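(* Let $p=p_n\ge1$, and let $X_1,\ldots,X_n$ be i.i.d. $\mathbb R^p$-valued random vectors with absolutely continuous distribution function $F$ and $Y_1,\ldots,Y_m$ i.i.d. $\mathbb R^p$-valued random vectors with absolutely continuous distribution function $G$, the two samples independent, with $c_0n\le m\le n$ for a fixed constant $0<c_0\le1$. Let $d\ge1$ and let $\psi_0\equiv1,\psi_1,\ldots,\psi_d$ be twice differentiable functions on $[0,1]$ that are orthonormal in $L^2([0,1])$; put $B_{\ell d}=\max_{1\le k\le d}\sup_{z\in[0,1]}|\psi_k^{(\ell)}(z)|$ for $\ell=0,1,2$. Assume there are constants $C_0,C_1>0$ and $c_1\in(0,1)$ such that $$d\le\min\{n,m,\exp(C_0p)\},\qquad \max\big(p^7B_{1d}^2,\;pB_{2d}^2\big)\le C_1n^{1-c_1}.$$ For $u\in\mathcal S^{p-1}=\{u\in\mathbb R^p:|u|_2=1\}$ let $F^u_n(x)=n^{-1}\sum_{i=1}^nI(u^\intercal X_i\le x)$, and define $$\hat\Psi_{\max}(d)=\sqrt{\tfrac{nm}{n+m}}\sup_{u\in\mathcal S^{p-1}}\max_{1\le k\le d}\Big|\frac1m\sum_{j=1}^m\psi_k\big(F^u_n(u^\intercal Y_j)\big)\Big|.$$ Let $e_1,\ldots,e_n$ be i.i.d. $N(0,1)$, independent of the data, and $$\hat\Psi^{\rm MB}_{\max}(d)=\sup_{(u,k)\in\mathcal S^{p-1}\times[d]}\Big|\frac1{\sqrt n}\sum_{i=1}^ne_i\psi_k\big(F^u_n(u^\intercal X_i)\big)\Big|.$$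 For $\alpha\in(0,1)$ let $\hat c^{\rm MB}_\alpha(d)=\inf\{t\in\mathbb R:P_e(\hat\Psi^{\rm MB}_{\max}(d)>t)\le\alpha\}$, where $P_e$ is the conditional probability given $X_1,\ldots,X_n$, and let $\Phi^{\rm MS}_\alpha(d)=I\{\hat\Psi_{\max}(d)\ge\hat c^{\rm MB}_\alpha(d)\}$. Then under $H_0:F=G$, as $n,m\to\infty$, $$\sup_{0<\alpha<1}\big|P_{H_0}\{\Phi^{\rm MS}_\alpha(d)=1\}-\alpha\big|\to0.$$
   Context: Here $[d]=\{1,\ldots,d\}$; $p$ and $d$ may depend on $n$. *)

theory Defs
  imports "HOL-Probability.Probability"
begin

(* Vectors in R^p are represented as functions nat => real, extensional on {..<p};
   Lebesgue measure on R^p is the product measure PiM {..<p} (%_. lborel). *)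

definition lebesgue_Rp :: "nat \<Rightarrow> (nat \<Rightarrow> real) measure" where
  "lebesgue_Rp p = (\<Pi>\<^sub>M i\<in>{..<p}. lborel)"

definition ip :: "nat \<Rightarrow> (nat \<Rightarrow> real) \<Rightarrow> (nat \<Rightarrow> real) \<Rightarrow> real" where
  "ip p u x = (\<Sum>i<p. u i * x i)"

definition unit_sphere :: "nat \<Rightarrow> (nat \<Rightarrow> real) set" where
  "unit_sphere p = {u \<in> {..<p} \<rightarrow>\<^sub>E (UNIV::real set). (\<Sum>i<p. (u i)^2) = 1}"

definition ecdf_u :: "nat \<Rightarrow> nat \<Rightarrow> (nat \<Rightarrow> nat \<Rightarrow> real) \<Rightarrow> (nat \<Rightarrow> real) \<Rightarrow> real \<Rightarrow> real" where
  "ecdf_u n p X u t = real (card {i. i < n \<and> ip p u (X i) \<le> t}) / real n"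

definition Psi_max :: "nat \<Rightarrow> nat \<Rightarrow> nat \<Rightarrow> nat \<Rightarrow> (nat \<Rightarrow> real \<Rightarrow> real)
    \<Rightarrow> (nat \<Rightarrow> nat \<Rightarrow> real) \<Rightarrow> (nat \<Rightarrow> nat \<Rightarrow> real) \<Rightarrow> real" where
  "Psi_max n m p d psi X Y =
     sqrt (real n * real m / (real n + real m)) *
     Sup {\<bar>(\<Sum>j<m. psi k (ecdf_u n p X u (ip p u (Y j)))) / real m\<bar> | u k.
            u \<in> unit_sphere p \<and> k \<in> {1..d}}"

definition Psi_MB :: "nat \<Rightarrow> nat \<Rightarrow> nat \<Rightarrow> (nat \<Rightarrow> real \<Rightarrow> real)
    \<Rightarrow> (nat \<Rightarrow> nat \<Rightarrow> real) \<Rightarrow> (nat \<Rightarrow> real) \<Rightarrow> real" where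
  "Psi_MB n p d psi X e =
     Sup {\<bar>(\<Sum>i<n. e i * psi k (ecdf_u n p X u (ip p u (X i)))) / sqrt (real n)\<bar> | u k.
            u \<in> unit_sphere p \<and> k \<in> {1..d}}"

definition gauss_mult :: "nat \<Rightarrow> (nat \<Rightarrow> real) measure" where
  "gauss_mult n = (\<Pi>\<^sub>M i\<in>{..<n}. density lborel std_normal_density)"

(* bootstrap critical value, a function of X only (P_e = conditional prob. given X) *)
definition c_MB :: "nat \<Rightarrow> nat \<Rightarrow> nat \<Rightarrow> (nat \<Rightarrow> real \<Rightarrow> real)
    \<Rightarrow> (nat \<Rightarrow> nat \<Rightarrow> real) \<Rightarrow> real \<Rightarrow> real" where
  "c_MB n p d psi X \<alpha> =
     Inf {t. measure (gauss_mult n) {e \<in> space (gauss_mult n). Psi_MB n p d psi X e > t} \<le> \<alpha>}"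

definition reject_prob :: "(nat \<Rightarrow> real) measure \<Rightarrow> (nat \<Rightarrow> real) measure \<Rightarrow> nat \<Rightarrow> nat \<Rightarrow> nat \<Rightarrow> nat
    \<Rightarrow> (nat \<Rightarrow> real \<Rightarrow> real) \<Rightarrow> real \<Rightarrow> real" where
  "reject_prob F G n m p d psi \<alpha> =
     (let M = (\<Pi>\<^sub>M i\<in>{..<n}. F) \<Otimes>\<^sub>M (\<Pi>\<^sub>M j\<in>{..<m}. G)
      in measure M {XY \<in> space M.
           Psi_max n m p d psi (fst XY) (snd XY) \<ge> c_MB n p d psi (fst XY) \<alpha>})"

end

theory Submission
  imports Defs "HOL-Real_Asymp.Real_Asymp" "HOL-Combinatorics.Permutations"
begin

text \<open>Under the null hypothesis the pooled sample of size \<open>N = n + m\<close> is exchangeable, so conditionally on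
  it the test is a permutation test: the second sample is a uniform \<open>m\<close>-subset. Only the order of the
  projections matters, and \<open>N\<close> points in dimension \<open>p\<close> have at most \<open>(N\<^sup>2 + 1)\<^sup>p\<close> order patterns, so the supremum
  over the sphere is a maximum over finitely many representatives; absolute continuity bounds
  the number of tied points by \<open>p\<close>. For each direction the statistic is, up to a martingale of smaller order,
  the linear rank statistic with scores \<open>psi k (rank / N)\<close>. Passing from the uniform subset to
  independent Bernoulli labels, a Lindeberg argument with a smoothed maximum compares its law with
  that of a Gaussian maximum depending on the pooled sample only. The multiplier bootstrap is a
  Gaussian maximum whose covariance is close to the same one, so Slepian interpolation
  applies. Anti-concentration of Gaussian maxima turns these comparisons into closeness of quantiles.\<close>

section \<open>Smooth approximation of the maximum\<close>

text \<open>The bootstrap critical value is a function of the same subset that determines the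
  statistic, so it cannot be treated as a constant. The remedy is the tail function of the Gaussian
  maximum, which the pool alone determines: for all but a small share of the subsets the bootstrap
  tail lies within a shift and an additive error of it, and this traps the critical value between
  two numbers fixed by the pool. The number of coordinates has a logarithm of order p ln N.
  Anti-concentration on the scale \<epsilon> costs \<epsilon> times the square root of that
  logarithm, so \<epsilon> must be small against (p ln N)^(-1/2). The soft maximum is accurate to
  \<epsilon> for an inverse temperature \<beta> of order p ln N / \<epsilon>, and the third
  derivatives of the smoothed indicator are then of order \<beta>^2 / \<epsilon>, that is p^(7/2) up
  to logarithms. Each summand is at most B / sqrt N, where B bounds the derivatives of the scores.
  The Lindeberg error is therefore p^(7/2) B / sqrt N up to logarithms: this is the origin of the
  condition on p^7 B^2.\<close>

definition logi :: "real \<Rightarrow> real" where "logi x = 1 / (1 + exp (- x))"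

lemma logi_bounds: "0 < logi x" "logi x < 1"
  by (auto simp: logi_def field_simps add_pos_pos)

lemma DERIV_logi:
  assumes "(f has_real_derivative f') (at s)"
  shows "((\<lambda>s. logi (f s)) has_real_derivative logi (f s) * (1 - logi (f s)) * f') (at s)"
proof -
  have pos: "1 + exp (- f s) \<noteq> 0" by (metis add_pos_pos exp_gt_zero less_numeral_extra(1) less_irrefl)
  show ?thesis
    unfolding logi_def using pos
    by (auto intro!: derivative_eq_intros assms simp: field_simps power2_eq_square)
qed

lemma logi_ge: "logi x \<ge> 1 - exp (- x)"
proof -
  have "(1 - exp (- x)) * (1 + exp (- x)) \<le> 1" by (simp add: algebra_simps)
  then show ?thesis unfolding logi_def by (subst pos_le_divide_eq) (auto simp: add_pos_pos)
qed

lemma logi_le: "logi x \<le> exp x"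
proof -
  have "1 \<le> exp x * (1 + exp (- x))" by (simp add: algebra_simps flip: exp_add)
  then show ?thesis unfolding logi_def by (subst pos_divide_le_eq) (auto simp: add_pos_pos)
qed

text \<open>Up to the factor 16 the derivative of the logistic function dominates the indicator of
  [-1, 1]. This turns a bound on an expected derivative into a bound on a small-ball probability.
  Since e <= 3, both \<open>logi x\<close> and \<open>1 - logi x\<close> are at least 1/4.\<close>

lemma logi_mult_ge:
  assumes "\<bar>x\<bar> \<le> 1" shows "logi x * (1 - logi x) \<ge> 1 / 16"
proof -
  have e: "exp 1 \<le> (3::real)" using exp_le by simp
  have "exp (- x) \<le> exp 1" "exp x \<le> exp 1" using assms by auto
  then have 1: "exp (- x) \<le> 3" "exp x \<le> 3" using e by linarith+
  have a: "logi x \<ge> 1 / 4" unfolding logi_def using 1 by (simp add: field_simps add_pos_pos)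
  have eq: "1 - logi x = logi (- x)"
    using exp_gt_zero[of x] unfolding logi_def exp_minus
    by (simp add: divide_simps) (smt (verit) exp_gt_zero)
  have b: "1 - logi x \<ge> 1 / 4" unfolding eq using 1 by (simp add: logi_def field_simps add_pos_pos)
  have "(1/4) * (1/4) \<le> logi x * (1 - logi x)" using a b by (intro mult_mono) auto
  then show ?thesis by simp
qed

text \<open>The three polynomials are the first three derivatives of the logistic function, written
  in terms of its value \<open>L\<close>. Each is the product of \<open>L * (1 - L)\<close>, which
  lies in [0, 1/4], with a factor of modulus at most 1.\<close>

lemma logi_deriv_bounds:
  assumes "0 \<le> L" "L \<le> (1::real)"
  shows "\<bar>L * (1 - L)\<bar> \<le> 1" "\<bar>L * (1 - L) * (1 - 2 * L)\<bar> \<le> 1"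
    "\<bar>L * (1 - L) * (1 - 6 * L + 6 * L\<^sup>2)\<bar> \<le> 1"
proof -
  have q: "0 \<le> L * (1 - L)" "L * (1 - L) \<le> 1/4" 
    using assms apply simp
    using zero_le_power2[of "L - 1/2"] by (simp add: power2_eq_square algebra_simps)
  show 1: "\<bar>L * (1 - L)\<bar> \<le> 1" using q by auto
  have "\<bar>1 - 2 * L\<bar> \<le> 1" using assms by auto
  then show "\<bar>L * (1 - L) * (1 - 2 * L)\<bar> \<le> 1"
    unfolding abs_mult[of "L * (1 - L)"] using 1 by (intro mult_le_one) auto
  have "1 - 6 * L + 6 * L\<^sup>2 = 1 - 6 * (L * (1 - L))" by (simp add: power2_eq_square algebra_simps)
  then have "\<bar>1 - 6 * L + 6 * L\<^sup>2\<bar> \<le> 1" using q by auto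
  then show "\<bar>L * (1 - L) * (1 - 6 * L + 6 * L\<^sup>2)\<bar> \<le> 1"
    unfolding abs_mult[of "L * (1 - L)"] using 1 by (intro mult_le_one) auto
qed

text \<open>Smoothing of a finite maximum: \<beta> is the inverse temperature of a log-sum-exp, and
  \<epsilon> the width of the logistic step that replaces the indicator of exceeding a
  threshold.\<close>

locale smax =
  fixes J :: "'a set" and \<beta> \<epsilon> :: real
  assumes finJ: "finite J" and neJ: "J \<noteq> {}" and \<beta>_pos: "\<beta> > 0" and \<epsilon>_pos: "\<epsilon> > 0"
begin

definition part_fun :: "('a \<Rightarrow> real) \<Rightarrow> real" where "part_fun z = (\<Sum>j\<in>J. exp (\<beta> * z j))"
definition soft_max :: "('a \<Rightarrow> real) \<Rightarrow> real" where "soft_max z = ln (part_fun z) / \<beta>"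
definition gibbs_avg :: "('a \<Rightarrow> real) \<Rightarrow> ('a \<Rightarrow> real) \<Rightarrow> real" where
  "gibbs_avg z c = (\<Sum>j\<in>J. exp (\<beta> * z j) * c j) / part_fun z"
definition soft_ind :: "real \<Rightarrow> ('a \<Rightarrow> real) \<Rightarrow> real" where "soft_ind t z = logi ((soft_max z - t) / \<epsilon>)"
text \<open>\<open>D1\<close>, \<open>D2\<close> and \<open>D3\<close> are the derivatives of orders
  one to three of \<open>soft_ind t\<close> at \<open>z\<close> along the direction
  \<open>a\<close>. Differentiating a Gibbs average produces \<beta> times a covariance, so the
  variance and the third cumulant of \<open>a\<close> under the Gibbs weights appear.\<close>

definition D1 :: "real \<Rightarrow> ('a \<Rightarrow> real) \<Rightarrow> ('a \<Rightarrow> real) \<Rightarrow> real" where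
  "D1 t z a = soft_ind t z * (1 - soft_ind t z) * (gibbs_avg z a / \<epsilon>)"
definition D2 :: "real \<Rightarrow> ('a \<Rightarrow> real) \<Rightarrow> ('a \<Rightarrow> real) \<Rightarrow> real" where
  "D2 t z a = soft_ind t z * (1 - soft_ind t z) * (1 - 2 * soft_ind t z) * (gibbs_avg z a)\<^sup>2 / \<epsilon>\<^sup>2
    + soft_ind t z * (1 - soft_ind t z) * \<beta> * (gibbs_avg z (\<lambda>j. (a j)\<^sup>2) - (gibbs_avg z a)\<^sup>2) / \<epsilon>"
definition D3 :: "real \<Rightarrow> ('a \<Rightarrow> real) \<Rightarrow> ('a \<Rightarrow> real) \<Rightarrow> real" where
  "D3 t z a = soft_ind t z * (1 - soft_ind t z) * (1 - 6 * soft_ind t z + 6 * (soft_ind t z)\<^sup>2) * (gibbs_avg z a)^3 / \<epsilon>^3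
    + 3 * (soft_ind t z * (1 - soft_ind t z) * (1 - 2 * soft_ind t z)) * \<beta> * gibbs_avg z a * (gibbs_avg z (\<lambda>j. (a j)\<^sup>2) - (gibbs_avg z a)\<^sup>2) / \<epsilon>\<^sup>2
    + soft_ind t z * (1 - soft_ind t z) * \<beta>\<^sup>2 * (gibbs_avg z (\<lambda>j. (a j)^3) - 3 * gibbs_avg z (\<lambda>j. (a j)\<^sup>2) * gibbs_avg z a + 2 * (gibbs_avg z a)^3) / \<epsilon>"

lemma part_fun_pos: "part_fun z > 0"
  unfolding part_fun_def using finJ neJ by (intro sum_pos) auto

lemma soft_ind_bounds: "0 < soft_ind t z" "soft_ind t z < 1" "0 \<le> soft_ind t z" "soft_ind t z \<le> 1"
  unfolding soft_ind_def using logi_bounds[of "(soft_max z - t) / \<epsilon>"] by auto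

lemma gibbs_avg_mono: assumes "\<And>j. j \<in> J \<Longrightarrow> c j \<le> d j" shows "gibbs_avg z c \<le> gibbs_avg z d"
  unfolding gibbs_avg_def using part_fun_pos[of z] assms by (intro divide_right_mono sum_mono mult_left_mono) auto

lemma gibbs_avg_const: "gibbs_avg z (\<lambda>_. c) = c"
  unfolding gibbs_avg_def using part_fun_pos[of z] by (simp add: part_fun_def flip: sum_distrib_right)

lemma gibbs_avg_cmult: "gibbs_avg z (\<lambda>j. k * c j) = k * gibbs_avg z c"
  unfolding gibbs_avg_def by (simp add: sum_distrib_left algebra_simps)

lemma gibbs_avg_multc: "gibbs_avg z (\<lambda>j. c j * k) = gibbs_avg z c * k"
  unfolding gibbs_avg_def by (simp add: sum_distrib_left sum_distrib_right algebra_simps)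

lemma gibbs_avg_add: "gibbs_avg z (\<lambda>j. c j + d j) = gibbs_avg z c + gibbs_avg z d"
  unfolding gibbs_avg_def by (simp add: sum.distrib algebra_simps add_divide_distrib)

lemma gibbs_avg_diff: "gibbs_avg z (\<lambda>j. c j - d j) = gibbs_avg z c - gibbs_avg z d"
  unfolding gibbs_avg_def by (simp add: sum_subtractf algebra_simps diff_divide_distrib)

lemma gibbs_avg_sum: "gibbs_avg z (\<lambda>j. \<Sum>i\<in>I. c i j) = (\<Sum>i\<in>I. gibbs_avg z (c i))"
  unfolding gibbs_avg_def by (simp add: sum_distrib_left sum.swap[of _ J] sum_divide_distrib)

lemma gibbs_avg_nonneg: assumes "\<And>j. j \<in> J \<Longrightarrow> 0 \<le> c j" shows "0 \<le> gibbs_avg z c"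
  using gibbs_avg_mono[of "\<lambda>_. 0" c] assms gibbs_avg_const by fastforce

lemma gibbs_avg_abs: "\<bar>gibbs_avg z c\<bar> \<le> gibbs_avg z (\<lambda>j. \<bar>c j\<bar>)"
proof -
  have "gibbs_avg z c \<le> gibbs_avg z (\<lambda>j. \<bar>c j\<bar>)" by (rule gibbs_avg_mono) auto
  moreover have "gibbs_avg z (\<lambda>j. (-1) * c j) \<le> gibbs_avg z (\<lambda>j. \<bar>c j\<bar>)" by (rule gibbs_avg_mono) auto
  ultimately show ?thesis unfolding gibbs_avg_cmult by auto
qed

lemma gibbs_avg_abs_le: assumes "\<And>j. j \<in> J \<Longrightarrow> \<bar>c j\<bar> \<le> C" shows "\<bar>gibbs_avg z c\<bar> \<le> C"
proof -
  have "gibbs_avg z (\<lambda>j. \<bar>c j\<bar>) \<le> gibbs_avg z (\<lambda>j. C)" by (rule gibbs_avg_mono) (use assms in auto)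
  then show ?thesis using gibbs_avg_abs[of z c] gibbs_avg_const[of z C] by linarith
qed

lemma gibbs_avg_square_le: "(gibbs_avg z a)\<^sup>2 \<le> gibbs_avg z (\<lambda>j. (a j)\<^sup>2)"
proof -
  define \<mu> where "\<mu> = gibbs_avg z a"
  have "0 \<le> gibbs_avg z (\<lambda>j. (a j - \<mu>)\<^sup>2)" by (rule gibbs_avg_nonneg) auto
  also have "(\<lambda>j. (a j - \<mu>)\<^sup>2) = (\<lambda>j. ((a j)\<^sup>2 - (2 * \<mu>) * a j) + \<mu>\<^sup>2)"
    by (auto simp: power2_eq_square algebra_simps)
  also have "gibbs_avg z \<dots> = gibbs_avg z (\<lambda>j. (a j)\<^sup>2) - 2 * \<mu> * \<mu> + \<mu>\<^sup>2"
    unfolding gibbs_avg_add gibbs_avg_diff gibbs_avg_cmult gibbs_avg_const \<mu>_def ..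
  finally show ?thesis by (simp add: \<mu>_def power2_eq_square)
qed

lemma DERIV_part_fun:
  assumes "\<And>j. j \<in> J \<Longrightarrow> ((\<lambda>s. z s j) has_real_derivative z' j) (at s)"
  shows "((\<lambda>s. part_fun (z s)) has_real_derivative \<beta> * (part_fun (z s) * gibbs_avg (z s) z')) (at s)"
proof -
  have "((\<lambda>s. \<Sum>j\<in>J. exp (\<beta> * z s j)) has_real_derivative (\<Sum>j\<in>J. exp (\<beta> * z s j) * (\<beta> * z' j))) (at s)"
    by (rule DERIV_sum) (auto intro!: derivative_eq_intros assms)
  also have "(\<Sum>j\<in>J. exp (\<beta> * z s j) * (\<beta> * z' j)) = \<beta> * (\<Sum>j\<in>J. exp (\<beta> * z s j) * z' j)"
    by (simp add: sum_distrib_left algebra_simps)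
  also have "\<dots> = \<beta> * (part_fun (z s) * gibbs_avg (z s) z')"
    unfolding gibbs_avg_def using part_fun_pos[of "z s"] by simp
  finally show ?thesis unfolding part_fun_def .
qed

lemma DERIV_soft_max:
  assumes "\<And>j. j \<in> J \<Longrightarrow> ((\<lambda>s. z s j) has_real_derivative z' j) (at s)"
  shows "((\<lambda>s. soft_max (z s)) has_real_derivative gibbs_avg (z s) z') (at s)"
proof -
  have "((\<lambda>s. ln (part_fun (z s)) / \<beta>) has_real_derivative (1 / part_fun (z s) * (\<beta> * (part_fun (z s) * gibbs_avg (z s) z'))) / \<beta>) (at s)"
    using part_fun_pos[of "z s"] by (auto intro!: derivative_eq_intros DERIV_part_fun assms)
  moreover have "(1 / part_fun (z s) * (\<beta> * (part_fun (z s) * gibbs_avg (z s) z'))) / \<beta> = gibbs_avg (z s) z'"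
    using part_fun_pos[of "z s"] \<beta>_pos by simp
  ultimately show ?thesis unfolding soft_max_def by simp
qed

lemma DERIV_gibbs_avg:
  assumes "\<And>j. j \<in> J \<Longrightarrow> ((\<lambda>s. z s j) has_real_derivative z' j) (at s)"
  shows "((\<lambda>s. gibbs_avg (z s) c) has_real_derivative \<beta> * (gibbs_avg (z s) (\<lambda>j. c j * z' j) - gibbs_avg (z s) c * gibbs_avg (z s) z')) (at s)"
proof -
  have num: "((\<lambda>s. \<Sum>j\<in>J. exp (\<beta> * z s j) * c j) has_real_derivative
      (\<Sum>j\<in>J. exp (\<beta> * z s j) * (\<beta> * z' j) * c j)) (at s)"
    by (rule DERIV_sum) (auto intro!: derivative_eq_intros assms)
  have eq: "(\<Sum>j\<in>J. exp (\<beta> * z s j) * (\<beta> * z' j) * c j) = \<beta> * (part_fun (z s) * gibbs_avg (z s) (\<lambda>j. c j * z' j))"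
  proof -
    have "(\<Sum>j\<in>J. exp (\<beta> * z s j) * (\<beta> * z' j) * c j) = \<beta> * (\<Sum>j\<in>J. exp (\<beta> * z s j) * (c j * z' j))"
      by (simp add: sum_distrib_left algebra_simps)
    then show ?thesis unfolding gibbs_avg_def using part_fun_pos[of "z s"] by simp
  qed
  have numv: "(\<Sum>j\<in>J. exp (\<beta> * z s j) * c j) = part_fun (z s) * gibbs_avg (z s) c"
    unfolding gibbs_avg_def using part_fun_pos[of "z s"] by simp
  have "((\<lambda>s. (\<Sum>j\<in>J. exp (\<beta> * z s j) * c j) / part_fun (z s)) has_real_derivative
     (\<beta> * (part_fun (z s) * gibbs_avg (z s) (\<lambda>j. c j * z' j)) * part_fun (z s) - (part_fun (z s) * gibbs_avg (z s) c) * (\<beta> * (part_fun (z s) * gibbs_avg (z s) z')))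
       / (part_fun (z s) * part_fun (z s))) (at s)"
    using DERIV_divide[OF num DERIV_part_fun[OF assms]] part_fun_pos[of "z s"] unfolding eq numv by auto
  moreover have "(\<beta> * (part_fun (z s) * gibbs_avg (z s) (\<lambda>j. c j * z' j)) * part_fun (z s) - (part_fun (z s) * gibbs_avg (z s) c) * (\<beta> * (part_fun (z s) * gibbs_avg (z s) z')))
       / (part_fun (z s) * part_fun (z s)) = \<beta> * (gibbs_avg (z s) (\<lambda>j. c j * z' j) - gibbs_avg (z s) c * gibbs_avg (z s) z')"
    using part_fun_pos[of "z s"] by (simp add: field_simps)
  ultimately show ?thesis unfolding gibbs_avg_def[of "z _" c] by simp
qed

lemma DERIV_soft_ind:
  assumes "\<And>j. j \<in> J \<Longrightarrow> ((\<lambda>s. z s j) has_real_derivative z' j) (at s)"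
  shows "((\<lambda>s. soft_ind t (z s)) has_real_derivative D1 t (z s) z') (at s)"
proof -
  have "((\<lambda>s. (soft_max (z s) - t) / \<epsilon>) has_real_derivative gibbs_avg (z s) z' / \<epsilon>) (at s)"
    using \<epsilon>_pos by (auto intro!: derivative_eq_intros DERIV_soft_max assms)
  from DERIV_logi[OF this] show ?thesis unfolding soft_ind_def D1_def by simp
qed

lemma DERIV_D1_aux:
  assumes "(f has_real_derivative f') (at s)" "(g has_real_derivative g') (at s)"
  shows "((\<lambda>s. f s * (1 - f s) * (g s / \<epsilon>)) has_real_derivative
     f' * (1 - 2 * f s) * (g s / \<epsilon>) + f s * (1 - f s) * (g' / \<epsilon>)) (at s)"
  using assms \<epsilon>_pos by (auto intro!: derivative_eq_intros simp: field_simps)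

lemma DERIV_D2_aux:
  assumes f: "(f has_real_derivative f') (at s)" and g: "(g has_real_derivative g') (at s)"
    and k: "(k has_real_derivative k') (at s)"
  shows "((\<lambda>s. f s * (1 - f s) * (1 - 2 * f s) * (g s)\<^sup>2 / \<epsilon>\<^sup>2 + f s * (1 - f s) * \<beta> * (k s - (g s)\<^sup>2) / \<epsilon>) has_real_derivative
     (f' * (1 - 6 * f s + 6 * (f s)\<^sup>2) * (g s)\<^sup>2 + f s * (1 - f s) * (1 - 2 * f s) * (2 * g s * g')) / \<epsilon>\<^sup>2
     + (f' * (1 - 2 * f s) * \<beta> * (k s - (g s)\<^sup>2) + f s * (1 - f s) * \<beta> * (k' - 2 * g s * g')) / \<epsilon>) (at s)"
proof -
  have p: "((\<lambda>s. f s * (1 - f s) * (1 - 2 * f s)) has_real_derivative f' * (1 - 6 * f s + 6 * (f s)\<^sup>2)) (at s)"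
    using f by (auto intro!: derivative_eq_intros simp: algebra_simps power2_eq_square)
  have p': "((\<lambda>s. f s * (1 - f s)) has_real_derivative f' * (1 - 2 * f s)) (at s)"
    using f by (auto intro!: derivative_eq_intros simp: algebra_simps)
  have g2: "((\<lambda>s. (g s)\<^sup>2) has_real_derivative 2 * g s * g') (at s)"
    using g by (auto intro!: derivative_eq_intros)
  have k2: "((\<lambda>s. k s - (g s)\<^sup>2) has_real_derivative k' - 2 * g s * g') (at s)"
    by (rule DERIV_diff[OF k g2])
  have a: "((\<lambda>s. f s * (1 - f s) * (1 - 2 * f s) * (g s)\<^sup>2) has_real_derivative
     f' * (1 - 6 * f s + 6 * (f s)\<^sup>2) * (g s)\<^sup>2 + f s * (1 - f s) * (1 - 2 * f s) * (2 * g s * g')) (at s)"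
    using DERIV_mult[OF p g2] by (simp add: algebra_simps)
  have b: "((\<lambda>s. f s * (1 - f s) * \<beta> * (k s - (g s)\<^sup>2)) has_real_derivative
     f' * (1 - 2 * f s) * \<beta> * (k s - (g s)\<^sup>2) + f s * (1 - f s) * \<beta> * (k' - 2 * g s * g')) (at s)"
    using DERIV_mult[OF DERIV_cmult_right[OF p', of \<beta>] k2] by (simp add: algebra_simps)
  show ?thesis by (rule DERIV_add[OF DERIV_cdivide[OF a] DERIV_cdivide[OF b]])
qed

lemma line_deriv: "((\<lambda>s. z j + s * a j) has_real_derivative a j) (at s)"
  by (auto intro!: derivative_eq_intros)

lemma DERIV_D1:
  "((\<lambda>s. D1 t (\<lambda>j. z j + s * (k * a j)) a) has_real_derivative k * D2 t (\<lambda>j. z j + s * (k * a j)) a) (at s)"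
proof -
  let ?z = "\<lambda>s j. z j + s * (k * a j)"
  let ?L = "soft_ind t (?z s)"
  have h: "((\<lambda>s. soft_ind t (?z s)) has_real_derivative D1 t (?z s) (\<lambda>j. k * a j)) (at s)"
    by (rule DERIV_soft_ind) (rule line_deriv)
  have A: "((\<lambda>s. gibbs_avg (?z s) a) has_real_derivative \<beta> * (gibbs_avg (?z s) (\<lambda>j. a j * (k * a j)) - gibbs_avg (?z s) a * gibbs_avg (?z s) (\<lambda>j. k * a j))) (at s)"
    by (rule DERIV_gibbs_avg) (rule line_deriv)
  have e: "(\<lambda>j. a j * (k * a j)) = (\<lambda>j. k * (a j)\<^sup>2)" by (auto simp: power2_eq_square)
  show ?thesis
    unfolding D1_def[of t _ a]
    apply (rule DERIV_cong[OF DERIV_D1_aux[OF h A]])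
    unfolding e gibbs_avg_cmult D1_def D2_def using \<epsilon>_pos
    apply (simp add: divide_simps)
    apply algebra
    done
qed

lemma DERIV_D2:
  "((\<lambda>s. D2 t (\<lambda>j. z j + s * a j) a) has_real_derivative D3 t (\<lambda>j. z j + s * a j) a) (at s)"
proof -
  let ?z = "\<lambda>s j. z j + s * a j"
  have h: "((\<lambda>s. soft_ind t (?z s)) has_real_derivative D1 t (?z s) a) (at s)"
    by (rule DERIV_soft_ind) (rule line_deriv)
  have A: "((\<lambda>s. gibbs_avg (?z s) a) has_real_derivative \<beta> * (gibbs_avg (?z s) (\<lambda>j. a j * a j) - gibbs_avg (?z s) a * gibbs_avg (?z s) a)) (at s)"
    by (rule DERIV_gibbs_avg) (rule line_deriv)
  have A2: "((\<lambda>s. gibbs_avg (?z s) (\<lambda>j. (a j)\<^sup>2)) has_real_derivative \<beta> * (gibbs_avg (?z s) (\<lambda>j. (a j)\<^sup>2 * a j) - gibbs_avg (?z s) (\<lambda>j. (a j)\<^sup>2) * gibbs_avg (?z s) a)) (at s)"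
    by (rule DERIV_gibbs_avg) (rule line_deriv)
  have e: "(\<lambda>j. a j * a j) = (\<lambda>j. (a j)\<^sup>2)" "(\<lambda>j. (a j)\<^sup>2 * a j) = (\<lambda>j. (a j)^3)"
    by (auto simp: power2_eq_square power3_eq_cube)
  show ?thesis
    unfolding D2_def
    apply (rule DERIV_cong[OF DERIV_D2_aux[OF h A A2]])
    unfolding e D1_def D3_def using \<epsilon>_pos
    apply (simp add: divide_simps)
    apply algebra
    done
qed

lemma DERIV_soft_ind_line:
  "((\<lambda>s. soft_ind t (\<lambda>j. z j + s * a j)) has_real_derivative D1 t (\<lambda>j. z j + s * a j) a) (at s)"
  by (rule DERIV_soft_ind) (rule line_deriv)

lemma D1_bound:
  assumes "\<And>j. j \<in> J \<Longrightarrow> \<bar>a j\<bar> \<le> c"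
  shows "\<bar>D1 t z a\<bar> \<le> c / \<epsilon>"
proof -
  have "\<bar>soft_ind t z * (1 - soft_ind t z)\<bar> * \<bar>gibbs_avg z a / \<epsilon>\<bar> \<le> 1 * (c / \<epsilon>)"
    using logi_deriv_bounds(1)[OF soft_ind_bounds(3,4), of t z] gibbs_avg_abs_le[of a c z] assms \<epsilon>_pos
    by (intro mult_mono) (auto simp: divide_right_mono)
  then show ?thesis unfolding D1_def by (simp add: abs_mult)
qed

text \<open>The three terms match those of \<open>D3\<close>. The last coefficient 6 is 1 + 3 + 2,
  from the expression of the third cumulant by moments.\<close>

definition K3 :: real where "K3 = 1/\<epsilon>^3 + 3 * \<beta> / \<epsilon>\<^sup>2 + 6 * \<beta>\<^sup>2 / \<epsilon>"

lemma K3_pos: "K3 > 0" unfolding K3_def using \<beta>_pos \<epsilon>_pos by (simp add: add_pos_pos)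

text \<open>Only one factor \<open>a\<close> is bounded by its maximum; the other two remain as a
  second moment under the Gibbs weights. Summed over the coordinates of a linear statistic, these
  second moments make up a bounded variance.\<close>

lemma D3_bound:
  assumes c: "\<And>j. j \<in> J \<Longrightarrow> \<bar>a j\<bar> \<le> c"
  shows "\<bar>D3 t z a\<bar> \<le> K3 * c * gibbs_avg z (\<lambda>j. (a j)\<^sup>2)"
proof -
  have c0: "c \<ge> 0" using neJ c by (metis abs_ge_zero all_not_in_conv order_trans)
  define S where "S = gibbs_avg z (\<lambda>j. (a j)\<^sup>2)"
  define m where "m = gibbs_avg z a"
  define L where "L = soft_ind t z"
  have S0: "S \<ge> 0" unfolding S_def by (rule gibbs_avg_nonneg) auto
  have m: "\<bar>m\<bar> \<le> c" unfolding m_def by (rule gibbs_avg_abs_le) (use c in auto)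
  have mS: "m\<^sup>2 \<le> S" unfolding m_def S_def by (rule gibbs_avg_square_le)
  have T: "\<bar>gibbs_avg z (\<lambda>j. (a j)^3)\<bar> \<le> c * S"
  proof -
    have "\<bar>gibbs_avg z (\<lambda>j. (a j)^3)\<bar> \<le> gibbs_avg z (\<lambda>j. \<bar>(a j)^3\<bar>)" by (rule gibbs_avg_abs)
    also have "\<dots> \<le> gibbs_avg z (\<lambda>j. c * (a j)\<^sup>2)"
    proof (rule gibbs_avg_mono)
      fix j assume "j \<in> J"
      have "\<bar>(a j)^3\<bar> = \<bar>a j\<bar> * (a j)\<^sup>2" by (simp add: power3_eq_cube power2_eq_square abs_mult)
      also have "\<dots> \<le> c * (a j)\<^sup>2" using c[OF \<open>j \<in> J\<close>] by (intro mult_right_mono) auto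
      finally show "\<bar>(a j)^3\<bar> \<le> c * (a j)\<^sup>2" .
    qed
    finally show ?thesis by (simp add: gibbs_avg_cmult S_def)
  qed
  have L: "0 \<le> L" "L \<le> 1" unfolding L_def using soft_ind_bounds[of t z] by auto
  note Lb = logi_deriv_bounds[OF L]
  have m3: "\<bar>m^3\<bar> \<le> c * S"
  proof -
    have "\<bar>m^3\<bar> = \<bar>m\<bar> * m\<^sup>2" by (simp add: power3_eq_cube power2_eq_square abs_mult)
    also have "\<dots> \<le> c * S" using m mS c0 by (intro mult_mono) auto
    finally show ?thesis .
  qed
  have mV: "\<bar>m * (S - m\<^sup>2)\<bar> \<le> c * S"
    unfolding abs_mult using m mS S0 c0 by (intro mult_mono) auto
  have mS': "\<bar>S * m\<bar> \<le> c * S" unfolding abs_mult using m S0 by (simp add: mult.commute[of c] mult_left_mono)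
  have kap: "\<bar>gibbs_avg z (\<lambda>j. (a j)^3) - 3 * S * m + 2 * m^3\<bar> \<le> 6 * (c * S)"
    using T mS' m3 by linarith
  have t1: "\<bar>L * (1 - L) * (1 - 6 * L + 6 * L\<^sup>2) * m^3 / \<epsilon>^3\<bar> \<le> 1 / \<epsilon>^3 * (c * S)"
  proof -
    have "\<bar>L * (1 - L) * (1 - 6 * L + 6 * L\<^sup>2)\<bar> * \<bar>m^3\<bar> \<le> 1 * (c * S)"
      using Lb(3) m3 by (intro mult_mono) auto
    then show ?thesis using \<epsilon>_pos by (simp add: abs_mult divide_right_mono)
  qed
  have t2: "\<bar>3 * (L * (1 - L) * (1 - 2 * L)) * \<beta> * m * (S - m\<^sup>2) / \<epsilon>\<^sup>2\<bar> \<le> 3 * \<beta> / \<epsilon>\<^sup>2 * (c * S)"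
  proof -
    have "\<bar>L * (1 - L) * (1 - 2 * L)\<bar> * \<bar>m * (S - m\<^sup>2)\<bar> \<le> 1 * (c * S)"
      using Lb(2) mV by (intro mult_mono) auto
    then have "(3 * \<beta> / \<epsilon>\<^sup>2) * (\<bar>L * (1 - L) * (1 - 2 * L)\<bar> * \<bar>m * (S - m\<^sup>2)\<bar>) \<le> (3 * \<beta> / \<epsilon>\<^sup>2) * (c * S)"
      using \<beta>_pos by (intro mult_left_mono) auto
    moreover have "\<bar>3 * (L * (1 - L) * (1 - 2 * L)) * \<beta> * m * (S - m\<^sup>2) / \<epsilon>\<^sup>2\<bar> = (3 * \<beta> / \<epsilon>\<^sup>2) * (\<bar>L * (1 - L) * (1 - 2 * L)\<bar> * \<bar>m * (S - m\<^sup>2)\<bar>)"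
      using \<beta>_pos by (simp add: abs_mult)
    ultimately show ?thesis by (simp only:)
  qed
  have t3: "\<bar>L * (1 - L) * \<beta>\<^sup>2 * (gibbs_avg z (\<lambda>j. (a j)^3) - 3 * S * m + 2 * m^3) / \<epsilon>\<bar> \<le> 6 * \<beta>\<^sup>2 / \<epsilon> * (c * S)"
  proof -
    have "\<bar>L * (1 - L)\<bar> * \<bar>gibbs_avg z (\<lambda>j. (a j)^3) - 3 * S * m + 2 * m^3\<bar> \<le> 1 * (6 * (c * S))"
      using Lb(1) kap by (intro mult_mono) auto
    then have "(\<beta>\<^sup>2 / \<epsilon>) * (\<bar>L * (1 - L)\<bar> * \<bar>gibbs_avg z (\<lambda>j. (a j)^3) - 3 * S * m + 2 * m^3\<bar>) \<le> (\<beta>\<^sup>2 / \<epsilon>) * (6 * (c * S))"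
      using \<epsilon>_pos by (intro mult_left_mono) auto
    moreover have "\<bar>L * (1 - L) * \<beta>\<^sup>2 * (gibbs_avg z (\<lambda>j. (a j)^3) - 3 * S * m + 2 * m^3) / \<epsilon>\<bar> = (\<beta>\<^sup>2 / \<epsilon>) * (\<bar>L * (1 - L)\<bar> * \<bar>gibbs_avg z (\<lambda>j. (a j)^3) - 3 * S * m + 2 * m^3\<bar>)"
      using \<epsilon>_pos by (simp add: abs_mult)
    ultimately have "\<bar>L * (1 - L) * \<beta>\<^sup>2 * (gibbs_avg z (\<lambda>j. (a j)^3) - 3 * S * m + 2 * m^3) / \<epsilon>\<bar> \<le> (\<beta>\<^sup>2 / \<epsilon>) * (6 * (c * S))"
      by (simp only:)
    also have "\<dots> = 6 * \<beta>\<^sup>2 / \<epsilon> * (c * S)" by simp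
    finally show ?thesis .
  qed
  have "\<bar>D3 t z a\<bar> \<le> 1 / \<epsilon>^3 * (c * S) + 3 * \<beta> / \<epsilon>\<^sup>2 * (c * S) + 6 * \<beta>\<^sup>2 / \<epsilon> * (c * S)"
    unfolding D3_def L_def[symmetric] S_def[symmetric] m_def[symmetric]
    by (rule order_trans[OF abs_triangle_ineq] add_mono order_trans[OF abs_triangle_ineq] t1 t2 t3)+
  also have "\<dots> = K3 * c * S" unfolding K3_def by (simp add: algebra_simps)
  finally show ?thesis unfolding S_def .
qed

text \<open>The shift changes every unnormalised weight by a factor at most exp (\<beta> c |s|), and
  the normalisation by the same factor at most; hence the 2 in the exponent.\<close>

lemma gibbs_avg_stable:
  assumes "\<And>j. j \<in> J \<Longrightarrow> \<bar>a j\<bar> \<le> c" and c: "\<And>j. j \<in> J \<Longrightarrow> 0 \<le> q j"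
  shows "gibbs_avg (\<lambda>j. z j + s * a j) q \<le> exp (2 * \<beta> * c * \<bar>s\<bar>) * gibbs_avg z q"
proof -
  let ?e = "exp (\<beta> * c * \<bar>s\<bar>)"
  have b: "\<bar>s * a j\<bar> \<le> \<bar>s\<bar> * c" if "j \<in> J" for j unfolding abs_mult using assms(1)[OF that] by (simp add: mult_left_mono)
  have up: "exp (\<beta> * (z j + s * a j)) \<le> ?e * exp (\<beta> * z j)" if "j \<in> J" for j
  proof -
    have "\<beta> * (s * a j) \<le> \<beta> * (\<bar>s\<bar> * c)" using b[OF that] \<beta>_pos by (intro mult_left_mono) auto
    then show ?thesis unfolding exp_add[symmetric] by (simp add: algebra_simps)
  qed
  have low: "exp (\<beta> * z j) \<le> ?e * exp (\<beta> * (z j + s * a j))" if "j \<in> J" for j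
  proof -
    have "\<beta> * (- (s * a j)) \<le> \<beta> * (\<bar>s\<bar> * c)" using b[OF that] \<beta>_pos by (intro mult_left_mono) auto
    then show ?thesis unfolding exp_add[symmetric] by (simp add: algebra_simps)
  qed
  have Z: "part_fun z \<le> ?e * part_fun (\<lambda>j. z j + s * a j)"
    unfolding part_fun_def sum_distrib_left by (intro sum_mono low) 
  have num: "(\<Sum>j\<in>J. exp (\<beta> * (z j + s * a j)) * q j) \<le> ?e * (\<Sum>j\<in>J. exp (\<beta> * z j) * q j)"
    unfolding sum_distrib_left mult.assoc[symmetric] using c by (intro sum_mono mult_right_mono up) auto
  have n0: "0 \<le> (\<Sum>j\<in>J. exp (\<beta> * z j) * q j)" using c by (intro sum_nonneg) auto
  have "gibbs_avg (\<lambda>j. z j + s * a j) q \<le> ?e * (\<Sum>j\<in>J. exp (\<beta> * z j) * q j) / part_fun (\<lambda>j. z j + s * a j)"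
    unfolding gibbs_avg_def using num part_fun_pos[of "\<lambda>j. z j + s * a j"] by (intro divide_right_mono) auto
  also have "\<dots> \<le> ?e * (\<Sum>j\<in>J. exp (\<beta> * z j) * q j) / (part_fun z / ?e)"
    using Z part_fun_pos[of z] n0 part_fun_pos[of "\<lambda>j. z j + s * a j"] by (intro divide_left_mono) (auto simp: field_simps)
  also have "\<dots> = (?e * ?e) * gibbs_avg z q" unfolding gibbs_avg_def by simp
  also have "?e * ?e = exp (2 * \<beta> * c * \<bar>s\<bar>)" by (simp flip: exp_add)
  finally show ?thesis .
qed

lemma soft_max_ge: assumes "j \<in> J" shows "z j \<le> soft_max z"
proof -
  have "exp (\<beta> * z j) \<le> part_fun z" unfolding part_fun_def using finJ assms by (intro member_le_sum) auto
  then have "\<beta> * z j \<le> ln (part_fun z)" using part_fun_pos[of z] by (simp add: ln_ge_iff)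
  then show ?thesis unfolding soft_max_def using \<beta>_pos by (simp add: field_simps)
qed

text \<open>Together with \<open>soft_max_ge\<close>: the overshoot over the maximum is at most ln
  (card J) / \<beta>, so \<beta> has to be of the order of the logarithm of the number of
  coordinates divided by the tolerated error.\<close>

lemma soft_max_le: assumes "\<And>j. j \<in> J \<Longrightarrow> z j \<le> x" shows "soft_max z \<le> x + ln (card J) / \<beta>"
proof -
  have cJ: "card J > 0" using finJ neJ by (simp add: card_gt_0_iff)
  have "part_fun z \<le> (\<Sum>j\<in>J. exp (\<beta> * x))" unfolding part_fun_def using assms \<beta>_pos by (intro sum_mono) auto
  then have "part_fun z \<le> card J * exp (\<beta> * x)" by simp
  then have "ln (part_fun z) \<le> ln (card J * exp (\<beta> * x))" using part_fun_pos[of z] cJ by (intro ln_mono) auto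
  also have "\<dots> = ln (card J) + \<beta> * x" using cJ by (simp add: ln_mult)
  finally show ?thesis unfolding soft_max_def using \<beta>_pos by (simp add: field_simps)
qed

end

section \<open>Gaussian maxima\<close>

abbreviation gP :: "'i set \<Rightarrow> ('i \<Rightarrow> real) measure" where
  "gP I \<equiv> PiM I (\<lambda>_. std_normal_distribution)"

lemma prob_space_std_normal: "prob_space std_normal_distribution"
  by (rule prob_space_normal_density) simp

interpretation gauss: product_sigma_finite "\<lambda>_. std_normal_distribution"
  by (simp add: product_sigma_finite_def prob_space_std_normal prob_space_imp_sigma_finite)

lemma prob_space_gP: "prob_space (gP I)"
  by (intro prob_space_PiM prob_space_std_normal)

lemma std_normal_mgf:
  "integrable std_normal_distribution (\<lambda>x. exp (c * x))"
  "(\<integral>x. exp (c * x) \<partial>std_normal_distribution) = exp (c\<^sup>2 / 2)"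
proof -
  have eq: "std_normal_density x * exp (c * x) = exp (c\<^sup>2/2) * normal_density c 1 x" for x
  proof -
    have "-x\<^sup>2/2 + c * x = c\<^sup>2/2 + -(x - c)\<^sup>2/2" by (simp add: power2_eq_square field_simps)
    then show ?thesis unfolding std_normal_density_def normal_density_def
      by (simp add: field_simps flip: exp_add)
  qed
  have i: "integrable lborel (\<lambda>x. exp (c\<^sup>2/2) * normal_density c 1 x)"
    by (intro integrable_mult_right integrable_normal_density) simp
  show "integrable std_normal_distribution (\<lambda>x. exp (c * x))"
    by (subst integrable_density) (auto simp: eq i normal_density_nonneg)
  show "(\<integral>x. exp (c * x) \<partial>std_normal_distribution) = exp (c\<^sup>2 / 2)"
    by (subst integral_density) (auto simp: eq normal_density_nonneg)
qed

lemma integrable_std_normal_pow: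
  "integrable std_normal_distribution (\<lambda>x. \<bar>x\<bar> ^ k)"
  by (subst integrable_density) (auto simp: normal_density_nonneg integrable_std_normal_moment_abs)

text \<open>Stein's identity. The Gaussian density p satisfies p' = -x p, so f p has the derivative
  (f' - x f) p; its integral over the line vanishes because f is bounded and p tends to 0 at both
  ends.\<close>

lemma gauss_ibp:
  fixes f f' :: "real \<Rightarrow> real"
  assumes D: "\<And>x. (f has_real_derivative f' x) (at x)" and c: "continuous_on UNIV f'"
    and b: "\<And>x. \<bar>f x\<bar> \<le> C" and b': "\<And>x. \<bar>f' x\<bar> \<le> C"
  shows "(\<integral>x. x * f x \<partial>std_normal_distribution) = (\<integral>x. f' x \<partial>std_normal_distribution)"
proof -
  let ?p = "std_normal_density"
  have cf: "continuous_on UNIV f" using D DERIV_continuous_on by (metis DERIV_isCont continuous_at_imp_continuous_on)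
  have mf[measurable]: "f \<in> borel_measurable borel" "f' \<in> borel_measurable borel"
    using cf c by (auto intro: borel_measurable_continuous_onI)
  have Dp: "(?p has_real_derivative - x * ?p x) (at x)" for x
    unfolding std_normal_density_def by (auto intro!: derivative_eq_intros simp: field_simps power2_eq_square)
  have DF: "((\<lambda>x. f x * ?p x) has_real_derivative f' x * ?p x - x * f x * ?p x) (at x)" for x
    by (rule DERIV_cong[OF DERIV_mult[OF D Dp]]) (simp add: algebra_simps)
  have C0: "C \<ge> 0" using b[of 0] by linarith
  have i1: "integrable lborel (\<lambda>x. ?p x * f' x)"
    by (rule Bochner_Integration.integrable_bound[OF integrable_mult_right[of C, OF integrable_std_normal_moment_abs[of 0]]])
       (auto simp: abs_mult normal_density_nonneg b' C0 intro!: mult_mono simp: mult.commute[of C] )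
  have i2: "integrable lborel (\<lambda>x. ?p x * (x * f x))"
  proof (rule Bochner_Integration.integrable_bound[OF integrable_mult_right[of C, OF integrable_std_normal_moment_abs[of 1]]])
    show "AE x in lborel. norm (?p x * (x * f x)) \<le> norm (C * (?p x * \<bar>x\<bar> ^ 1))"
    proof (intro AE_I2)
      fix x
      have "?p x * \<bar>x\<bar> * \<bar>f x\<bar> \<le> ?p x * \<bar>x\<bar> * C" using b by (intro mult_left_mono) (auto simp: normal_density_nonneg)
      then show "norm (?p x * (x * f x)) \<le> norm (C * (?p x * \<bar>x\<bar> ^ 1))"
        by (simp add: abs_mult normal_density_nonneg C0 algebra_simps)
    qed
  qed auto
  let ?g = "\<lambda>x. f' x * ?p x - x * f x * ?p x"
  have i3: "integrable lborel ?g"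
    using Bochner_Integration.integrable_diff[OF i1 i2] by (simp add: algebra_simps)
  have pc: "continuous_on UNIV ?p" using Dp by (metis DERIV_isCont continuous_at_imp_continuous_on)
  have lim: "((\<lambda>x. f x * ?p x) \<longlongrightarrow> 0) F" if "(?p \<longlongrightarrow> 0) F" for F
  proof (rule Lim_null_comparison[of _ "\<lambda>x. C * ?p x"])
    show "\<forall>\<^sub>F x in F. norm (f x * ?p x) \<le> C * ?p x"
      by (intro always_eventually allI) (auto simp: abs_mult normal_density_nonneg intro!: mult_right_mono b)
    show "((\<lambda>x. C * ?p x) \<longlongrightarrow> 0) F" using tendsto_mult_right_zero[OF that] by simp
  qed
  have l1: "(?p \<longlongrightarrow> 0) at_top" unfolding std_normal_density_def by real_asymp
  have l2: "(?p \<longlongrightarrow> 0) at_bot" unfolding std_normal_density_def by real_asymp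
  have "(LBINT x=-\<infinity>..\<infinity>. ?g x) = 0 - 0"
  proof (rule interval_integral_FTC_integrable[where F="\<lambda>x. f x * ?p x"])
    show "((\<lambda>x. f x * ?p x) has_vector_derivative ?g x) (at x)" for x
      using DF[of x] by (simp add: has_real_derivative_iff_has_vector_derivative)
    have "continuous_on UNIV ?g" by (intro continuous_intros c cf pc)
    then show "isCont ?g x" for x by (simp add: continuous_on_eq_continuous_at)
    show "set_integrable lborel (einterval (- \<infinity>) \<infinity>) ?g" using i3 by (simp add: set_integrable_def)
    show "(((\<lambda>x. f x * ?p x) \<circ> real_of_ereal) \<longlongrightarrow> 0) (at_right (- \<infinity>))"
      using lim[OF l2] by (simp only: ereal_tendsto_simps)
    show "(((\<lambda>x. f x * ?p x) \<circ> real_of_ereal) \<longlongrightarrow> 0) (at_left \<infinity>)"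
      using lim[OF l1] by (simp only: ereal_tendsto_simps)
  qed auto
  then have "(\<integral>x. ?g x \<partial>lborel) = 0" by (simp add: interval_lebesgue_integral_def set_lebesgue_integral_def)
  then have "(\<integral>x. ?p x * f' x \<partial>lborel) = (\<integral>x. ?p x * (x * f x) \<partial>lborel)"
    using Bochner_Integration.integral_diff[OF i1 i2] by (simp add: algebra_simps)
  then show ?thesis by (simp add: integral_density normal_density_nonneg)
qed

lemma integrable_gP_component:
  fixes g :: "real \<Rightarrow> real"
  assumes "i \<in> I" "integrable std_normal_distribution g"
  shows "integrable (gP I) (\<lambda>e. g (e i))"
proof -
  interpret product_prob_space "\<lambda>_. std_normal_distribution" I
    by (simp add: product_prob_space_def product_prob_space_axioms_def product_sigma_finite_def
      prob_space_std_normal prob_space_imp_sigma_finite)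
  have "integrable (distr (gP I) std_normal_distribution (\<lambda>e. e i)) g"
    using PiM_component[of i] assms by simp
  then show ?thesis by (rule integrable_distr[rotated]) (use assms in measurable)
qed

text \<open>Fubini isolates coordinate \<open>i\<close>, and the one-dimensional Stein identity
  applies with the other coordinates frozen.\<close>

lemma gauss_ibp_gP:
  fixes G G' :: "('i \<Rightarrow> real) \<Rightarrow> real"
  assumes I: "finite I" "i \<in> I"
    and m: "G \<in> borel_measurable (gP I)" "G' \<in> borel_measurable (gP I)"
    and D: "\<And>e x. ((\<lambda>x. G (e(i := x))) has_real_derivative G' (e(i := x))) (at x)"
    and c: "\<And>e. continuous_on UNIV (\<lambda>x. G' (e(i := x)))"
    and b: "\<And>e. \<bar>G e\<bar> \<le> C" and b': "\<And>e. \<bar>G' e\<bar> \<le> C"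
  shows "(\<integral>e. e i * G e \<partial>gP I) = (\<integral>e. G' e \<partial>gP I)"
proof -
  interpret P: prob_space "gP I" by (rule prob_space_gP)
  have II: "I = insert i (I - {i})" using I by auto
  have fin: "finite (I - {i})" "i \<notin> I - {i}" using I by auto
  have mi[measurable]: "(\<lambda>e. e i) \<in> borel_measurable (gP I)" using I by measurable
  note [measurable] = m
  have C0: "C \<ge> 0" using b[of undefined] by linarith
  have i1: "integrable (gP I) (\<lambda>e. e i * G e)"
  proof (rule Bochner_Integration.integrable_bound[OF integrable_mult_right[of C, OF integrable_gP_component[OF I(2) integrable_std_normal_pow[of 1]]]])
    show "AE e in gP I. norm (e i * G e) \<le> norm (C * \<bar>e i\<bar> ^ 1)"
      using b by (intro AE_I2) (auto simp: abs_mult C0 mult.commute[of C] intro!: mult_left_mono)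
  qed measurable
  have i2: "integrable (gP I) G'" by (rule P.integrable_const_bound[where B=C]) (auto simp: b')
  have "(\<integral>e. e i * G e \<partial>gP I) = (\<integral>e. (\<integral>x. x * G (e(i := x)) \<partial>std_normal_distribution) \<partial>gP (I - {i}))"
    using gauss.product_integral_insert[OF fin, of "\<lambda>e. e i * G e"] i1 II by simp
  also have "\<dots> = (\<integral>e. (\<integral>x. G' (e(i := x)) \<partial>std_normal_distribution) \<partial>gP (I - {i}))"
    by (intro Bochner_Integration.integral_cong refl gauss_ibp[OF D c b b'])
  also have "\<dots> = (\<integral>e. G' e \<partial>gP I)"
    using gauss.product_integral_insert[OF fin, of G'] i2 II by simp
  finally show ?thesis .
qed

text \<open>Common shape of all processes of the proof: noise \<open>e\<close> with coefficient
  functions \<open>a i\<close>. Standard Gaussian noise gives a centred Gaussian vector whose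
  covariance is the sum over \<open>i\<close> of \<open>a i j * a i k\<close>; standardised
  Bernoulli noise gives linear rank statistics.\<close>

definition lin :: "'i set \<Rightarrow> ('i \<Rightarrow> real) \<Rightarrow> ('i \<Rightarrow> 'a \<Rightarrow> real) \<Rightarrow> 'a \<Rightarrow> real" where
  "lin I e a = (\<lambda>j. \<Sum>i\<in>I. e i * a i j)"

lemma lin_upd:
  assumes "finite I" "i \<in> I"
  shows "lin I (e(i := x)) a = (\<lambda>j. lin (I - {i}) e a j + x * a i j)"
  unfolding lin_def using assms by (subst sum.remove[of I i]) (auto simp: fun_eq_iff intro!: sum.cong)

lemma lin_measurable[measurable]:
  "(\<lambda>e. lin I e a j) \<in> borel_measurable (PiM I (\<lambda>_. borel))"
  "(\<lambda>e. lin I e a j) \<in> borel_measurable (gP I)"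
  unfolding lin_def by measurable

lemma lin_mgf:
  assumes "finite I"
  shows "integrable (gP I) (\<lambda>e. exp (b * lin I e a j))"
    "(\<integral>e. exp (b * lin I e a j) \<partial>gP I) = exp (b\<^sup>2 * (\<Sum>i\<in>I. (a i j)\<^sup>2) / 2)"
proof -
  have eq: "exp (b * lin I e a j) = (\<Prod>i\<in>I. exp ((b * a i j) * e i))" for e
    unfolding lin_def sum_distrib_left exp_sum[OF assms, symmetric] by (simp add: algebra_simps)
  show "integrable (gP I) (\<lambda>e. exp (b * lin I e a j))"
    unfolding eq by (rule gauss.product_integrable_prod[OF assms std_normal_mgf(1)])
  have "(\<integral>e. exp (b * lin I e a j) \<partial>gP I) = (\<Prod>i\<in>I. exp ((b * a i j)\<^sup>2 / 2))"
    unfolding eq by (subst gauss.product_integral_prod[OF assms std_normal_mgf(1)]) (simp add: std_normal_mgf(2))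
  also have "\<dots> = exp (b\<^sup>2 * (\<Sum>i\<in>I. (a i j)\<^sup>2) / 2)"
    unfolding exp_sum[OF assms, symmetric]
    by (simp add: sum_distrib_left sum_divide_distrib algebra_simps power_mult_distrib)
  finally show "(\<integral>e. exp (b * lin I e a j) \<partial>gP I) = exp (b\<^sup>2 * (\<Sum>i\<in>I. (a i j)\<^sup>2) / 2)" .
qed

section \<open>Anti-concentration of Gaussian maxima\<close>

context smax begin

lemma smax_measurable:
  assumes [measurable]: "\<And>j. j \<in> J \<Longrightarrow> (\<lambda>e. z e j) \<in> borel_measurable M"
  shows "(\<lambda>e. soft_max (z e)) \<in> borel_measurable M" "(\<lambda>e. soft_ind t (z e)) \<in> borel_measurable M"
    "(\<lambda>e. gibbs_avg (z e) c) \<in> borel_measurable M" "(\<lambda>e. D1 t (z e) c) \<in> borel_measurable M"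
    "(\<lambda>e. D2 t (z e) c) \<in> borel_measurable M"
  unfolding D1_def D2_def soft_ind_def soft_max_def gibbs_avg_def logi_def part_fun_def by measurable

lemma D1_linear: "D1 t z (\<lambda>j. \<Sum>i\<in>I. k i * c i j) = (\<Sum>i\<in>I. k i * D1 t z (c i))"
proof -
  have "gibbs_avg z (\<lambda>j. \<Sum>i\<in>I. k i * c i j) = (\<Sum>i\<in>I. k i * gibbs_avg z (c i))" by (simp add: gibbs_avg_sum gibbs_avg_cmult)
  moreover have "D1 t z b = (soft_ind t z * (1 - soft_ind t z) / \<epsilon>) * gibbs_avg z b" for b unfolding D1_def by simp
  ultimately show ?thesis by (simp only: sum_distrib_left mult.left_commute)
qed

lemma cont_line:
  "continuous_on UNIV (\<lambda>x. gibbs_avg (\<lambda>j. z j + x * a j) c)" "continuous_on UNIV (\<lambda>x. soft_ind t (\<lambda>j. z j + x * a j))"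
proof -
  show "continuous_on UNIV (\<lambda>x. gibbs_avg (\<lambda>j. z j + x * a j) c)"
    by (intro continuous_at_imp_continuous_on ballI DERIV_isCont[OF DERIV_gibbs_avg[where z="\<lambda>x j. z j + x * a j"]]) (rule line_deriv)
  show "continuous_on UNIV (\<lambda>x. soft_ind t (\<lambda>j. z j + x * a j))"
    by (intro continuous_at_imp_continuous_on ballI DERIV_isCont[OF DERIV_soft_ind_line])
qed

text \<open>For any x and b > 0, each coordinate V j is at most x plus 1/b times the sum of all exp
  (b (V j - x)). With b = sqrt \<Lambda> and x = 2 sqrt \<Lambda>, a coordinate of variance at most
  2 contributes at most exp (- 2 \<Lambda> + \<Lambda>) in mean, which cancels the number of
  coordinates.\<close>

lemma expected_max_bound:
  assumes I: "finite I" and var: "\<And>j. j \<in> J \<Longrightarrow> (\<Sum>i\<in>I. (a i j)\<^sup>2) \<le> 2"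
    and L: "\<Lambda> \<ge> 1" "real (card J) \<le> exp \<Lambda>"
  shows "(\<integral>e. soft_ind t (lin I e a) * gibbs_avg (lin I e a) (lin I e a) \<partial>gP I) \<le> 3 * sqrt \<Lambda>"
proof -
  interpret P: prob_space "gP I" by (rule prob_space_gP)
  let ?b = "sqrt \<Lambda>" and ?x = "2 * sqrt \<Lambda>"
  have b: "?b \<ge> 1" using L by simp
  let ?R = "\<lambda>e. ?x + (1 / ?b) * (\<Sum>j\<in>J. exp (- ?b * ?x) * exp (?b * lin I e a j))"
  have iR: "integrable (gP I) ?R"
    by (intro Bochner_Integration.integrable_add integrable_mult_right Bochner_Integration.integrable_sum lin_mgf(1) I) simp
  have le: "soft_ind t (lin I e a) * gibbs_avg (lin I e a) (lin I e a) \<le> ?R e" for e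
  proof -
    let ?V = "lin I e a"
    have s: "?V j \<le> ?R e" if "j \<in> J" for j
    proof -
      have "?b * (?V j - ?x) \<le> exp (?b * (?V j - ?x))" using exp_ge_add_one_self[of "?b * (?V j - ?x)"] by linarith
      also have "\<dots> = exp (- ?b * ?x) * exp (?b * ?V j)" by (simp add: algebra_simps flip: exp_add)
      also have "\<dots> \<le> (\<Sum>j\<in>J. exp (- ?b * ?x) * exp (?b * ?V j))" using finJ that by (intro member_le_sum) auto
      finally have "?V j - ?x \<le> (1 / ?b) * (\<Sum>j\<in>J. exp (- ?b * ?x) * exp (?b * ?V j))"
        using b by (simp add: field_simps)
      then show ?thesis by linarith
    qed
    have R0: "0 \<le> ?R e" using b by (intro add_nonneg_nonneg mult_nonneg_nonneg sum_nonneg) auto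
    have "gibbs_avg ?V ?V \<le> ?R e" using gibbs_avg_mono[of ?V "\<lambda>_. ?R e"] s by (simp add: gibbs_avg_const)
    then have "soft_ind t ?V * gibbs_avg ?V ?V \<le> soft_ind t ?V * ?R e" using soft_ind_bounds by (intro mult_left_mono) auto
    also have "\<dots> \<le> 1 * ?R e" using soft_ind_bounds R0 by (intro mult_right_mono) auto
    finally show ?thesis by simp
  qed
  have b2: "?b\<^sup>2 = \<Lambda>" using L by simp
  have "(\<integral>e. soft_ind t (lin I e a) * gibbs_avg (lin I e a) (lin I e a) \<partial>gP I) \<le> (\<integral>e. ?R e \<partial>gP I)"
  \<comment> \<open>The Bochner integral of a non-integrable function is 0, so that case only needs
    a nonnegative right-hand side.\<close>
  proof (cases "integrable (gP I) (\<lambda>e. soft_ind t (lin I e a) * gibbs_avg (lin I e a) (lin I e a))")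
    case True then show ?thesis by (intro integral_mono iR le)
  next
    case False
    have "0 \<le> (\<integral>e. ?R e \<partial>gP I)" using b by (intro Bochner_Integration.integral_nonneg add_nonneg_nonneg mult_nonneg_nonneg sum_nonneg) auto
    then show ?thesis using False by (simp add: not_integrable_integral_eq)
  qed
  also have "(\<integral>e. ?R e \<partial>gP I) = ?x + (1 / ?b) * (\<Sum>j\<in>J. exp (- ?b * ?x) * exp (?b\<^sup>2 * (\<Sum>i\<in>I. (a i j)\<^sup>2) / 2))"
    by (subst Bochner_Integration.integral_add)
       (auto intro!: integrable_mult_right Bochner_Integration.integrable_sum lin_mgf(1) I simp: Bochner_Integration.integral_sum lin_mgf I P.prob_space simp del: real_sqrt_pow2)
  also have "\<dots> \<le> ?x + (1 / ?b) * (\<Sum>j\<in>J. exp (- ?b * ?x) * exp \<Lambda>)"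
    unfolding b2 using b var L
    by (intro add_left_mono mult_left_mono sum_mono) (auto intro!: mult_left_le)
  also have "(\<Sum>j\<in>J. exp (- ?b * ?x) * exp \<Lambda>) = real (card J) * exp (- \<Lambda>)"
    using b2 by (simp add: power2_eq_square algebra_simps flip: exp_add)
  also have "\<dots> \<le> exp \<Lambda> * exp (- \<Lambda>)" using L by (intro mult_right_mono) auto
  also have "\<dots> = 1" by (simp flip: exp_add)
  finally have "(\<integral>e. soft_ind t (lin I e a) * gibbs_avg (lin I e a) (lin I e a) \<partial>gP I) \<le> ?x + (1 / ?b) * 1"
    using b by (simp add: divide_right_mono)
  also have "\<dots> \<le> 3 * ?b" using b by (simp add: field_simps)
  finally show ?thesis .
qed

text \<open>Stein's identity is applied to h times the Gibbs average of \<open>a i\<close>, where h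
  is the smoothed indicator, and summed over \<open>i\<close>. One side becomes the mean of h times
  a Gibbs average of the process itself, at most 3 sqrt \<Lambda>. The other side is at least the
  mean of h (1 - h) / (2 \<epsilon>), because all variances are at least 1/2. With the factor 16 of
  \<open>logi_mult_ge\<close> this yields 16 * 2 * 3 = 96.\<close>

theorem anti_concentration:
  assumes I: "finite I" and var: "\<And>j. j \<in> J \<Longrightarrow> (\<Sum>i\<in>I. (a i j)\<^sup>2) \<le> 2"
    and var': "\<And>j. j \<in> J \<Longrightarrow> (\<Sum>i\<in>I. (a i j)\<^sup>2) \<ge> 1/2"
    and L: "\<Lambda> \<ge> 1" "real (card J) \<le> exp \<Lambda>" and eb: "\<epsilon> * \<beta> \<ge> 1"
  shows "measure (gP I) {e \<in> space (gP I). \<bar>soft_max (lin I e a) - t\<bar> \<le> \<epsilon>} \<le> 96 * \<epsilon> * sqrt \<Lambda>"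
proof -
  interpret P: prob_space "gP I" by (rule prob_space_gP)
  let ?V = "\<lambda>e. lin I e a"
  have mV[measurable]: "\<And>j. (\<lambda>e. lin I e a j) \<in> borel_measurable (gP I)" by (rule lin_measurable)
  have ms[measurable]: "(\<lambda>e. soft_max (?V e)) \<in> borel_measurable (gP I)" "\<And>t. (\<lambda>e. soft_ind t (?V e)) \<in> borel_measurable (gP I)"
    "\<And>c. (\<lambda>e. gibbs_avg (?V e) c) \<in> borel_measurable (gP I)" "\<And>c t. (\<lambda>e. D1 t (?V e) c) \<in> borel_measurable (gP I)"
    by (auto intro!: smax_measurable)
  let ?G = "\<lambda>i e. soft_ind t (?V e) * gibbs_avg (?V e) (a i)"
  let ?G' = "\<lambda>i e. D1 t (?V e) (a i) * gibbs_avg (?V e) (a i) + soft_ind t (?V e) * (\<beta> * (gibbs_avg (?V e) (\<lambda>j. a i j * a i j) - gibbs_avg (?V e) (a i) * gibbs_avg (?V e) (a i)))"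
  have bdd: "\<exists>C. (\<forall>e. \<bar>?G i e\<bar> \<le> C) \<and> (\<forall>e. \<bar>?G' i e\<bar> \<le> C)" for i
  proof -
    define c where "c = (\<Sum>j\<in>J. \<bar>a i j\<bar>)"
    have c: "\<bar>a i j\<bar> \<le> c" if "j \<in> J" for j unfolding c_def using finJ that by (intro member_le_sum) auto
    have c0: "c \<ge> 0" unfolding c_def by (intro sum_nonneg) auto
    have av1: "\<bar>gibbs_avg z (a i)\<bar> \<le> c" for z using c by (rule gibbs_avg_abs_le)
    have c2: "\<bar>a i j * a i j\<bar> \<le> c * c" if "j \<in> J" for j unfolding abs_mult using c[OF that] by (intro mult_mono) auto
    have av2: "\<bar>gibbs_avg z (\<lambda>j. a i j * a i j)\<bar> \<le> c * c" for z using c2 by (rule gibbs_avg_abs_le)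
    have h: "\<bar>soft_ind t z\<bar> \<le> 1" for z using soft_ind_bounds[of t z] by auto
    have g: "\<bar>?G i e\<bar> \<le> c" for e
      unfolding abs_mult using mult_mono[OF h[of "?V e"] av1[of "?V e"]] by simp
    have d1: "\<bar>D1 t z (a i)\<bar> \<le> c / \<epsilon>" for z using c by (rule D1_bound)
    have p1: "\<bar>D1 t z (a i) * gibbs_avg z (a i)\<bar> \<le> c / \<epsilon> * c" for z
      unfolding abs_mult using d1[of z] av1[of z] c0 \<epsilon>_pos by (intro mult_mono) auto
    have p2: "\<bar>gibbs_avg z (a i) * gibbs_avg z (a i)\<bar> \<le> c * c" for z
      unfolding abs_mult using av1[of z] c0 by (intro mult_mono) auto
    have p3: "\<bar>gibbs_avg z (\<lambda>j. a i j * a i j) - gibbs_avg z (a i) * gibbs_avg z (a i)\<bar> \<le> 2 * (c * c)" for z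
      using av2[of z] p2[of z] by linarith
    have p4: "\<bar>soft_ind t z * (\<beta> * (gibbs_avg z (\<lambda>j. a i j * a i j) - gibbs_avg z (a i) * gibbs_avg z (a i)))\<bar> \<le> 1 * (\<beta> * (2 * (c * c)))" for z
      unfolding abs_mult[of "soft_ind t z"] abs_mult[of \<beta>] using h[of z] p3[of z] \<beta>_pos
      by (intro mult_mono) auto
    have g': "\<bar>?G' i e\<bar> \<le> c / \<epsilon> * c + 1 * (\<beta> * (2 * (c * c)))" for e
      by (rule order_trans[OF abs_triangle_ineq add_mono[OF p1 p4]])
    show ?thesis
      by (rule exI[of _ "max c (c / \<epsilon> * c + 1 * (\<beta> * (2 * (c * c))))"], intro conjI allI)
         (rule order_trans[OF g max.cobounded1] order_trans[OF g' max.cobounded2])+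
  qed
  have ibp: "(\<integral>e. e i * ?G i e \<partial>gP I) = (\<integral>e. ?G' i e \<partial>gP I)" and iG': "integrable (gP I) (?G' i)"
    and iG: "integrable (gP I) (\<lambda>e. e i * ?G i e)"
    if i: "i \<in> I" for i
  proof -
    obtain C where C: "\<And>e. \<bar>?G i e\<bar> \<le> C" "\<And>e. \<bar>?G' i e\<bar> \<le> C" using bdd[of i] by blast
    have l: "((\<lambda>s. lin (I - {i}) e a j + s * a i j) has_real_derivative a i j) (at s)" for e j s
      by (rule line_deriv)
    show "(\<integral>e. e i * ?G i e \<partial>gP I) = (\<integral>e. ?G' i e \<partial>gP I)"
    proof (rule gauss_ibp_gP[where C=C, OF I i])
      show "((\<lambda>x. ?G i (e(i := x))) has_real_derivative ?G' i (e(i := x))) (at x)" for e x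
        unfolding lin_upd[OF I i]
        by (rule DERIV_cong[OF DERIV_mult[OF DERIV_soft_ind DERIV_gibbs_avg]], rule l, rule l) (simp add: algebra_simps)
      show "continuous_on UNIV (\<lambda>x. ?G' i (e(i := x)))" for e
        unfolding lin_upd[OF I i] D1_def using \<epsilon>_pos by (intro continuous_intros cont_line) auto
    qed (use C in measurable)
    show "integrable (gP I) (?G' i)"
      by (rule P.integrable_const_bound[where B=C]) (use C(2) in auto)
    have C0: "C \<ge> 0" using C(1)[of undefined] by linarith
    have [measurable]: "(\<lambda>e. e i) \<in> borel_measurable (gP I)" using i by measurable
    show "integrable (gP I) (\<lambda>e. e i * ?G i e)"
    proof (rule Bochner_Integration.integrable_bound[OF integrable_mult_right[of C, OF integrable_gP_component[OF i integrable_std_normal_pow[of 1]]]])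
      show "AE e in gP I. norm (e i * ?G i e) \<le> norm (C * \<bar>e i\<bar> ^ 1)"
        using C(1) by (intro AE_I2) (auto simp: abs_mult[of "_ i"] C0 mult.commute[of C] simp del: abs_mult intro!: mult_left_mono)
    qed measurable
  qed
  have sumeq: "soft_ind t (?V e) * gibbs_avg (?V e) (?V e) = (\<Sum>i\<in>I. e i * ?G i e)" for e
  proof -
    have "gibbs_avg (?V e) (?V e) = gibbs_avg (?V e) (\<lambda>j. \<Sum>i\<in>I. e i * a i j)" by (simp add: lin_def)
    also have "\<dots> = (\<Sum>i\<in>I. e i * gibbs_avg (?V e) (a i))" by (simp add: gibbs_avg_sum gibbs_avg_cmult)
    finally show ?thesis by (simp add: sum_distrib_left algebra_simps)
  qed
  have pt: "soft_ind t (?V e) * (1 - soft_ind t (?V e)) / (2 * \<epsilon>) \<le> (\<Sum>i\<in>I. ?G' i e)" for e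
  proof -
    let ?h = "soft_ind t (?V e)" and ?z = "?V e"
    \<comment> \<open>Here \<epsilon> \<beta> >= 1 enters: the derivative of the Gibbs average
      brings \<beta> times a Gibbs variance, large enough to complete the squared Gibbs average
      coming from \<open>D1\<close> to a full second moment.\<close>
    have "1 / \<epsilon> \<le> \<beta>" using eb \<epsilon>_pos by (simp add: field_simps)
    then have "?h * ((1 - ?h) / \<epsilon>) \<le> ?h * (1 * \<beta>)"
      unfolding divide_inverse using soft_ind_bounds[of t ?z] \<epsilon>_pos by (intro mult_left_mono mult_mono) (auto simp: field_simps)
    then have hb: "?h * (1 - ?h) / \<epsilon> \<le> ?h * \<beta>" by simp
    have "?h * (1 - ?h) / \<epsilon> * gibbs_avg ?z (\<lambda>j. (a i j)\<^sup>2) \<le> ?G' i e" for i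
    proof -
      let ?v = "gibbs_avg ?z (\<lambda>j. (a i j)\<^sup>2) - (gibbs_avg ?z (a i))\<^sup>2"
      have "?h * (1 - ?h) / \<epsilon> * ?v \<le> ?h * \<beta> * ?v" using hb gibbs_avg_square_le[of ?z "a i"] by (intro mult_right_mono) auto
      then show ?thesis unfolding D1_def by (simp add: power2_eq_square algebra_simps diff_divide_distrib add_divide_distrib)
    qed
    then have "(\<Sum>i\<in>I. ?h * (1 - ?h) / \<epsilon> * gibbs_avg ?z (\<lambda>j. (a i j)\<^sup>2)) \<le> (\<Sum>i\<in>I. ?G' i e)" by (rule sum_mono)
    also have "(\<Sum>i\<in>I. ?h * (1 - ?h) / \<epsilon> * gibbs_avg ?z (\<lambda>j. (a i j)\<^sup>2)) = ?h * (1 - ?h) / \<epsilon> * gibbs_avg ?z (\<lambda>j. \<Sum>i\<in>I. (a i j)\<^sup>2)"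
      by (simp add: gibbs_avg_sum sum_distrib_left)
    also have "\<dots> \<ge> ?h * (1 - ?h) / \<epsilon> * (1/2)"
      using gibbs_avg_mono[of "\<lambda>_. 1/2" "\<lambda>j. \<Sum>i\<in>I. (a i j)\<^sup>2" ?z] var' soft_ind_bounds[of t ?z] \<epsilon>_pos
      by (intro mult_left_mono) (auto simp: gibbs_avg_const)
    finally show ?thesis by simp
  qed
  have ih: "integrable (gP I) (\<lambda>e. soft_ind t (?V e) * (1 - soft_ind t (?V e)))"
    by (rule P.integrable_const_bound[where B=1])
      (use logi_deriv_bounds(1)[OF soft_ind_bounds(3,4)] in auto)
  have "measure (gP I) {e \<in> space (gP I). \<bar>soft_max (?V e) - t\<bar> \<le> \<epsilon>} / 16
     = (\<integral>e. indicator {e \<in> space (gP I). \<bar>soft_max (?V e) - t\<bar> \<le> \<epsilon>} e / 16 \<partial>gP I)"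
    by simp
  also have "\<dots> \<le> (\<integral>e. soft_ind t (?V e) * (1 - soft_ind t (?V e)) \<partial>gP I)"
  proof (rule integral_mono[OF _ ih])
    fix e assume "e \<in> space (gP I)"
    have "\<bar>soft_max (?V e) - t\<bar> \<le> \<epsilon> \<Longrightarrow> \<bar>(soft_max (?V e) - t) / \<epsilon>\<bar> \<le> 1" using \<epsilon>_pos by (simp add: field_simps)
    then show "indicator {e \<in> space (gP I). \<bar>soft_max (?V e) - t\<bar> \<le> \<epsilon>} e / 16 \<le> soft_ind t (?V e) * (1 - soft_ind t (?V e))"
      using logi_mult_ge[of "(soft_max (?V e) - t) / \<epsilon>"] soft_ind_bounds[of t "?V e"]
      by (auto simp: soft_ind_def[symmetric] indicator_def)
  qed (auto simp: less_top[symmetric] P.emeasure_eq_measure)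
  also have "\<dots> = 2 * \<epsilon> * (\<integral>e. soft_ind t (?V e) * (1 - soft_ind t (?V e)) / (2 * \<epsilon>) \<partial>gP I)"
    using \<epsilon>_pos by simp
  also have "\<dots> \<le> 2 * \<epsilon> * (\<integral>e. (\<Sum>i\<in>I. ?G' i e) \<partial>gP I)"
    using \<epsilon>_pos ih by (intro mult_left_mono integral_mono pt Bochner_Integration.integrable_sum iG') auto
  also have "(\<integral>e. (\<Sum>i\<in>I. ?G' i e) \<partial>gP I) = (\<Sum>i\<in>I. \<integral>e. ?G' i e \<partial>gP I)"
    by (rule Bochner_Integration.integral_sum) (rule iG')
  also have "\<dots> = (\<Sum>i\<in>I. \<integral>e. e i * ?G i e \<partial>gP I)"
    by (intro sum.cong refl ibp[symmetric])
  also have "\<dots> = (\<integral>e. (\<Sum>i\<in>I. e i * ?G i e) \<partial>gP I)"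
    by (rule Bochner_Integration.integral_sum[symmetric]) (rule iG)
  also have "\<dots> = (\<integral>e. soft_ind t (?V e) * gibbs_avg (?V e) (?V e) \<partial>gP I)" unfolding sumeq ..
  also have "2 * \<epsilon> * \<dots> \<le> 2 * \<epsilon> * (3 * sqrt \<Lambda>)"
    using \<epsilon>_pos by (intro mult_left_mono expected_max_bound I var L) auto
  finally show ?thesis by (simp add: algebra_simps)
qed

end

section \<open>Comparison of Gaussian maxima with close covariances\<close>

lemma DERIV_integral:
  fixes k k1 :: "real \<Rightarrow> 'e \<Rightarrow> real"
  assumes D: "\<And>x e. ((\<lambda>x. k x e) has_real_derivative k1 x e) (at x)"
    and ik: "\<And>x. integrable M (k x)" and mk: "\<And>x. k1 x \<in> borel_measurable M"
    and b: "\<And>x e. \<bar>k1 x e\<bar> \<le> C e" and iC: "integrable M C"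
  shows "((\<lambda>x. \<integral>e. k x e \<partial>M) has_real_derivative (\<integral>e. k1 x e \<partial>M)) (at x)"
  unfolding DERIV_def tendsto_at_iff_sequentially comp_def
proof (intro allI impI)
  fix h :: "nat \<Rightarrow> real" assume h: "\<forall>i. h i \<in> UNIV - {0}" "h \<longlonglongrightarrow> 0"
  have eq: "((\<integral>e. k (x + h i) e \<partial>M) - (\<integral>e. k x e \<partial>M)) / h i = (\<integral>e. (k (x + h i) e - k x e) / h i \<partial>M)" for i
    using ik by simp
  have "(\<lambda>i. \<integral>e. (k (x + h i) e - k x e) / h i \<partial>M) \<longlonglongrightarrow> (\<integral>e. k1 x e \<partial>M)"
  proof (rule integral_dominated_convergence[where w=C])
    show "AE e in M. (\<lambda>i. (k (x + h i) e - k x e) / h i) \<longlonglongrightarrow> k1 x e"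
      using D[where x=x] h unfolding DERIV_def tendsto_at_iff_sequentially comp_def by auto
    show "AE e in M. norm ((k (x + h i) e - k x e) / h i) \<le> C e" for i
    proof (rule AE_I2)
      fix e
      have h0: "h i \<noteq> 0" using h by auto
      have "\<exists>\<xi>. k (x + h i) e - k x e = h i * k1 \<xi> e"
      proof (cases "h i > 0")
        case True
        then show ?thesis using MVT2[of x "x + h i" "\<lambda>x. k x e" "\<lambda>x. k1 x e"] D by auto
      next
        case False
        then have "h i < 0" using h0 by auto
        then obtain \<xi> where "k x e - k (x + h i) e = - h i * k1 \<xi> e"
          using MVT2[of "x + h i" x "\<lambda>x. k x e" "\<lambda>x. k1 x e"] D by auto
        then have "k (x + h i) e - k x e = h i * k1 \<xi> e" by linarith
        then show ?thesis by blast
      qed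
      then obtain \<xi> where "k (x + h i) e - k x e = h i * k1 \<xi> e" by blast
      then have "(k (x + h i) e - k x e) / h i = k1 \<xi> e" using h0 by simp
      then show "norm ((k (x + h i) e - k x e) / h i) \<le> C e" using b by simp
    qed
    show "(\<lambda>e. (k (x + h i) e - k x e) / h i) \<in> borel_measurable M" for i
      using borel_measurable_integrable[OF ik] by measurable
  qed (use mk iC in auto)
  then show "(\<lambda>i. ((\<integral>e. k (x + h i) e \<partial>M) - (\<integral>e. k x e \<partial>M)) / h i) \<longlonglongrightarrow> (\<integral>e. k1 x e \<partial>M)"
    unfolding eq .
qed

lemma gP_reindex:
  fixes G :: "('i \<Rightarrow> real) \<Rightarrow> real"
  assumes "inj_on f I" "f ` I \<subseteq> K" and [measurable]: "G \<in> borel_measurable (gP I)"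
  shows "(\<integral>e. G (\<lambda>i\<in>I. e (f i)) \<partial>gP K) = (\<integral>e. G e \<partial>gP I)"
proof -
  have m: "(\<lambda>e. \<lambda>i\<in>I. e (f i)) \<in> measurable (gP K) (gP I)"
    using assms(2) by (intro measurable_restrict measurable_component_singleton) auto
  have "gP I = distr (gP K) (gP I) (\<lambda>e. \<lambda>i\<in>I. e (f i))"
    using distr_PiM_reindex[of K "\<lambda>_. std_normal_distribution" f I] assms prob_space_std_normal
    by (simp add: image_subset_iff_funcset)
  then have "(\<integral>e. G e \<partial>gP I) = (\<integral>e. G e \<partial>distr (gP K) (gP I) (\<lambda>e. \<lambda>i\<in>I. e (f i)))" by simp
  also have "\<dots> = (\<integral>e. G (\<lambda>i\<in>I. e (f i)) \<partial>gP K)" by (rule integral_distr[OF m]) measurable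
  finally show ?thesis ..
qed

context smax begin

lemma D2_zero: "D2 t z (\<lambda>_. 0) = 0"
  by (simp add: D2_def gibbs_avg_const)

lemma D2_bound:
  assumes "\<And>j. j \<in> J \<Longrightarrow> \<bar>a j\<bar> \<le> c"
  shows "\<bar>D2 t z a\<bar> \<le> c\<^sup>2 / \<epsilon>\<^sup>2 + \<beta> * c\<^sup>2 / \<epsilon>"
proof -
  have c0: "c \<ge> 0" using neJ assms by (metis abs_ge_zero all_not_in_conv order_trans)
  let ?h = "soft_ind t z"
  note L = logi_deriv_bounds[OF soft_ind_bounds(3,4), of t z]
  have m: "\<bar>gibbs_avg z a\<bar> \<le> c" by (rule gibbs_avg_abs_le) (use assms in auto)
  then have m2: "\<bar>(gibbs_avg z a)\<^sup>2\<bar> \<le> c\<^sup>2" by (simp add: abs_le_square_iff[symmetric] c0)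
  have "\<bar>gibbs_avg z (\<lambda>j. (a j)\<^sup>2)\<bar> \<le> c\<^sup>2" 
    by (rule gibbs_avg_abs_le) (use assms c0 in \<open>auto simp: abs_le_square_iff[symmetric]\<close>)
  then have v: "\<bar>gibbs_avg z (\<lambda>j. (a j)\<^sup>2) - (gibbs_avg z a)\<^sup>2\<bar> \<le> c\<^sup>2" using gibbs_avg_square_le[of z a] zero_le_power2[of "gibbs_avg z a"] by linarith
  have 1: "\<bar>?h * (1 - ?h) * (1 - 2 * ?h) * (gibbs_avg z a)\<^sup>2 / \<epsilon>\<^sup>2\<bar> \<le> c\<^sup>2 / \<epsilon>\<^sup>2"
  proof -
    have "\<bar>?h * (1 - ?h) * (1 - 2 * ?h)\<bar> * \<bar>(gibbs_avg z a)\<^sup>2\<bar> \<le> 1 * c\<^sup>2" using L m2 by (intro mult_mono) auto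
    then show ?thesis by (simp add: abs_mult divide_right_mono)
  qed
  have 2: "\<bar>?h * (1 - ?h) * \<beta> * (gibbs_avg z (\<lambda>j. (a j)\<^sup>2) - (gibbs_avg z a)\<^sup>2) / \<epsilon>\<bar> \<le> \<beta> * c\<^sup>2 / \<epsilon>"
  proof -
    have "\<bar>?h * (1 - ?h)\<bar> * \<bar>gibbs_avg z (\<lambda>j. (a j)\<^sup>2) - (gibbs_avg z a)\<^sup>2\<bar> \<le> 1 * c\<^sup>2" using L v by (intro mult_mono) auto
    then have "\<beta> * (\<bar>?h * (1 - ?h)\<bar> * \<bar>gibbs_avg z (\<lambda>j. (a j)\<^sup>2) - (gibbs_avg z a)\<^sup>2\<bar>) / \<epsilon> \<le> \<beta> * (1 * c\<^sup>2) / \<epsilon>"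
      using \<beta>_pos \<epsilon>_pos by (intro divide_right_mono mult_left_mono) auto
    moreover have "\<bar>?h * (1 - ?h) * \<beta> * (gibbs_avg z (\<lambda>j. (a j)\<^sup>2) - (gibbs_avg z a)\<^sup>2) / \<epsilon>\<bar> =
        \<beta> * (\<bar>?h * (1 - ?h)\<bar> * \<bar>gibbs_avg z (\<lambda>j. (a j)\<^sup>2) - (gibbs_avg z a)\<^sup>2\<bar>) / \<epsilon>"
      using \<beta>_pos \<epsilon>_pos by (simp add: abs_mult)
    ultimately show ?thesis by (simp only: mult_1)
  qed
  show ?thesis unfolding D2_def by (rule order_trans[OF abs_triangle_ineq add_mono[OF 1 2]])
qed

text \<open>The square of a Gibbs average is a double average over two independent draws
  \<open>j\<close> and \<open>k\<close>; moving the sum over \<open>i\<close> inside leaves only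
  entries of the covariance matrix.\<close>

lemma sum_gibbs_avg_square: "(\<Sum>i\<in>I. (gibbs_avg z (a i))\<^sup>2) = gibbs_avg z (\<lambda>j. gibbs_avg z (\<lambda>k. \<Sum>i\<in>I. a i j * a i k))"
proof -
  have "(gibbs_avg z (a i))\<^sup>2 = gibbs_avg z (\<lambda>j. gibbs_avg z (\<lambda>k. a i j * a i k))" for i
    by (simp add: gibbs_avg_cmult gibbs_avg_multc power2_eq_square)
  then show ?thesis by (simp add: gibbs_avg_sum)
qed

text \<open>\<open>D2\<close> is a quadratic form in the direction, so its sum over all noise
  coordinates is a function of the covariance matrix. The 2 in front of \<beta> stems from the Gibbs
  variance, a difference of two averages that move by at most \<Delta> each.\<close>

lemma sum_D2_diff_bound:
  assumes \<Delta>: "\<And>j k. j \<in> J \<Longrightarrow> k \<in> J \<Longrightarrow> \<bar>(\<Sum>i\<in>K. a i j * a i k) - (\<Sum>i\<in>K. b i j * b i k)\<bar> \<le> \<Delta>"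
  shows "\<bar>(\<Sum>i\<in>K. D2 t z (a i) - D2 t z (b i))\<bar> \<le> \<Delta> * (1 / \<epsilon>\<^sup>2 + 2 * \<beta> / \<epsilon>)"
proof -
  have \<Delta>0: "\<Delta> \<ge> 0" using neJ \<Delta> by (metis abs_ge_zero all_not_in_conv order_trans)
  let ?h = "soft_ind t z"
  define S where "S = (\<Sum>i\<in>K. (gibbs_avg z (a i))\<^sup>2) - (\<Sum>i\<in>K. (gibbs_avg z (b i))\<^sup>2)"
  define T where "T = (\<Sum>i\<in>K. gibbs_avg z (\<lambda>j. (a i j)\<^sup>2)) - (\<Sum>i\<in>K. gibbs_avg z (\<lambda>j. (b i j)\<^sup>2))"
  have S: "\<bar>S\<bar> \<le> \<Delta>" unfolding S_def sum_gibbs_avg_square gibbs_avg_diff[symmetric]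
    by (intro gibbs_avg_abs_le) (use \<Delta> in auto)
  have T: "\<bar>T\<bar> \<le> \<Delta>" unfolding T_def gibbs_avg_sum[symmetric] gibbs_avg_diff[symmetric]
    by (intro gibbs_avg_abs_le) (use \<Delta> in \<open>auto simp: power2_eq_square\<close>)
  define p where "p = ?h * (1 - ?h) * (1 - 2 * ?h) / \<epsilon>\<^sup>2"
  define q where "q = ?h * (1 - ?h) * \<beta> / \<epsilon>"
  note L = logi_deriv_bounds[OF soft_ind_bounds(3,4), of t z]
  have p: "\<bar>p\<bar> \<le> 1 / \<epsilon>\<^sup>2" unfolding p_def using L(2) by (simp add: divide_right_mono)
  have q: "\<bar>q\<bar> \<le> \<beta> / \<epsilon>"
    unfolding q_def using L(1) \<beta>_pos \<epsilon>_pos by (simp add: abs_mult divide_right_mono mult_left_le_one_le)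
  have D2f: "D2 t z c = p * (gibbs_avg z c)\<^sup>2 + q * (gibbs_avg z (\<lambda>j. (c j)\<^sup>2) - (gibbs_avg z c)\<^sup>2)" for c
    unfolding D2_def p_def q_def by simp
  have "(\<Sum>i\<in>K. D2 t z (a i) - D2 t z (b i)) = p * S + q * (T - S)"
    unfolding S_def T_def D2f by (simp add: sum_subtractf sum.distrib sum_distrib_left algebra_simps)
  also have "\<bar>\<dots>\<bar> \<le> \<bar>p\<bar> * \<bar>S\<bar> + \<bar>q\<bar> * \<bar>T - S\<bar>" by (metis abs_mult abs_triangle_ineq)
  also have "\<dots> \<le> (1 / \<epsilon>\<^sup>2) * \<Delta> + (\<beta> / \<epsilon>) * (2 * \<Delta>)"
    using p q S T \<Delta>0 \<beta>_pos \<epsilon>_pos by (intro add_mono mult_mono) auto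
  finally show ?thesis by (simp add: algebra_simps)
qed

text \<open>The path cos x * b + sin x * a joins the two processes. The assumption \<open>ab\<close>
  says that they use disjoint noise coordinates and are thus independent. By Stein's identity the
  derivative at x is sin x cos x times the mean of the difference of the two sums of
  \<open>D2\<close>, which is small when the covariances are close. The length pi / 2 < 2 of the
  path gives the leading factor 2.\<close>

lemma slepian_interpolation:
  fixes a b :: "'i \<Rightarrow> 'a \<Rightarrow> real"
  assumes K: "finite K" and ab: "\<And>i. a i = (\<lambda>_. 0) \<or> b i = (\<lambda>_. 0)"
    and \<Delta>: "\<And>j k. j \<in> J \<Longrightarrow> k \<in> J \<Longrightarrow> \<bar>(\<Sum>i\<in>K. a i j * a i k) - (\<Sum>i\<in>K. b i j * b i k)\<bar> \<le> \<Delta>"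
  shows "\<bar>(\<integral>e. soft_ind t (lin K e a) \<partial>gP K) - (\<integral>e. soft_ind t (lin K e b) \<partial>gP K)\<bar> \<le> 2 * (\<Delta> * (1 / \<epsilon>\<^sup>2 + 2 * \<beta> / \<epsilon>))"
proof -
  interpret P: prob_space "gP K" by (rule prob_space_gP)
  have \<Delta>0: "\<Delta> \<ge> 0" using neJ \<Delta> by (metis abs_ge_zero all_not_in_conv order_trans)
  let ?\<kappa> = "\<Delta> * (1 / \<epsilon>\<^sup>2 + 2 * \<beta> / \<epsilon>)"
  have \<kappa>0: "?\<kappa> \<ge> 0" using \<Delta>0 \<beta>_pos \<epsilon>_pos by auto
  define v where "v x i j = cos x * b i j + sin x * a i j" for x i j
  define v' where "v' x i j = - sin x * b i j + cos x * a i j" for x i j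
  define k where "k x e = soft_ind t (lin K e (v x))" for x e
  define k1 where "k1 x e = (\<Sum>i\<in>K. e i * D1 t (lin K e (v x)) (v' x i))" for x e
  have ms[measurable]: "(\<lambda>e. soft_ind t (lin K e c)) \<in> borel_measurable (gP K)"
     "(\<lambda>e. D1 t (lin K e c) d) \<in> borel_measurable (gP K)" "(\<lambda>e. D2 t (lin K e c) d) \<in> borel_measurable (gP K)" for c d
    by (auto intro!: smax_measurable)
  \<comment> \<open>A crude finite bound; it serves integrability and domination and does not enter
    the estimate.\<close>
  define B where "B = (\<Sum>i\<in>K. \<Sum>j\<in>J. \<bar>a i j\<bar> + \<bar>b i j\<bar>)"
  have B: "\<bar>a i j\<bar> + \<bar>b i j\<bar> \<le> B" if "i \<in> K" "j \<in> J" for i j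
  proof -
    have "\<bar>a i j\<bar> + \<bar>b i j\<bar> \<le> (\<Sum>j\<in>J. \<bar>a i j\<bar> + \<bar>b i j\<bar>)" using that finJ by (intro member_le_sum[of j J "\<lambda>j. \<bar>a i j\<bar> + \<bar>b i j\<bar>"]) auto
    also have "\<dots> \<le> B" unfolding B_def using that K
      by (intro member_le_sum[of i K "\<lambda>i. \<Sum>j\<in>J. \<bar>a i j\<bar> + \<bar>b i j\<bar>"]) (auto intro: sum_nonneg)
    finally show ?thesis .
  qed
  have Bab: "\<bar>a i j\<bar> \<le> B" "\<bar>b i j\<bar> \<le> B" if "i \<in> K" "j \<in> J" for i j using B[OF that] by auto
  have v'B: "\<bar>v' x i j\<bar> \<le> B" if "i \<in> K" "j \<in> J" for x i j
  proof -
    have "\<bar>v' x i j\<bar> \<le> \<bar>sin x\<bar> * \<bar>b i j\<bar> + \<bar>cos x\<bar> * \<bar>a i j\<bar>" unfolding v'_def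
      by (rule order_trans[OF abs_triangle_ineq]) (simp add: abs_mult)
    also have "\<dots> \<le> 1 * \<bar>b i j\<bar> + 1 * \<bar>a i j\<bar>" by (intro add_mono mult_right_mono) auto
    also have "\<dots> \<le> B" using B[OF that] by simp
    finally show ?thesis .
  qed
  have Dk: "((\<lambda>x. k x e) has_real_derivative k1 x e) (at x)" for x e
  proof -
    have "((\<lambda>x. soft_ind t (lin K e (v x))) has_real_derivative D1 t (lin K e (v x)) (\<lambda>j. \<Sum>i\<in>K. e i * v' x i j)) (at x)"
      by (rule DERIV_soft_ind) (auto simp: lin_def v_def v'_def mult.commute intro!: derivative_eq_intros sum.cong)
    then show ?thesis unfolding k_def k1_def D1_linear .
  qed
  have ie: "integrable (gP K) (\<lambda>e. \<bar>e i\<bar>)" if "i \<in> K" for i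
    using integrable_gP_component[OF that integrable_std_normal_pow[of 1]] by simp
  have DH: "((\<lambda>x. \<integral>e. k x e \<partial>gP K) has_real_derivative (\<integral>e. k1 x e \<partial>gP K)) (at x)" for x
  proof (rule DERIV_integral[where C="\<lambda>e. \<Sum>i\<in>K. \<bar>e i\<bar> * (B / \<epsilon>)", OF Dk])
    show "integrable (gP K) (k x)" for x
      unfolding k_def by (rule P.integrable_const_bound[where B=1]) (auto simp: soft_ind_bounds)
    show "k1 x \<in> borel_measurable (gP K)" for x unfolding k1_def by measurable
    show "\<bar>k1 x e\<bar> \<le> (\<Sum>i\<in>K. \<bar>e i\<bar> * (B / \<epsilon>))" for x e
      unfolding k1_def
      by (rule order_trans[OF sum_abs], intro sum_mono, unfold abs_mult, intro mult_left_mono D1_bound v'B abs_ge_zero)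
    show "integrable (gP K) (\<lambda>e. \<Sum>i\<in>K. \<bar>e i\<bar> * (B / \<epsilon>))"
      by (intro Bochner_Integration.integrable_sum integrable_mult_left ie)
  qed
  \<comment> \<open>\<open>r\<close> will be sin x or cos x, according to which of the two processes
    coordinate \<open>i\<close> drives.\<close>
  have ibp: "(\<integral>e. e i * D1 t (lin K e (v x)) c \<partial>gP K) = r * (\<integral>e. D2 t (lin K e (v x)) c \<partial>gP K)"
    if i: "i \<in> K" and vc: "v x i = (\<lambda>j. r * c j)" and cB: "\<And>j. j \<in> J \<Longrightarrow> \<bar>c j\<bar> \<le> B" for x i r c
  proof -
    let ?C = "max (B / \<epsilon>) (\<bar>r\<bar> * (B\<^sup>2 / \<epsilon>\<^sup>2 + \<beta> * B\<^sup>2 / \<epsilon>))"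
    have "(\<integral>e. e i * D1 t (lin K e (v x)) c \<partial>gP K) = (\<integral>e. r * D2 t (lin K e (v x)) c \<partial>gP K)"
    proof (rule gauss_ibp_gP[where C="?C", OF K i])
      show "((\<lambda>y. D1 t (lin K (e(i := y)) (v x)) c) has_real_derivative r * D2 t (lin K (e(i := y)) (v x)) c) (at y)" for e y
        unfolding lin_upd[OF K i] vc by (rule DERIV_D1)
      show "continuous_on UNIV (\<lambda>y. r * D2 t (lin K (e(i := y)) (v x)) c)" for e
        unfolding lin_upd[OF K i] D2_def using \<epsilon>_pos by (intro continuous_intros cont_line) auto
      show "\<bar>D1 t (lin K e (v x)) c\<bar> \<le> ?C" for e
        by (rule max.coboundedI1[OF D1_bound[OF cB]])
      show "\<bar>r * D2 t (lin K e (v x)) c\<bar> \<le> ?C" for e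
        unfolding abs_mult by (intro max.coboundedI2 mult_left_mono D2_bound[OF cB] abs_ge_zero)
    qed measurable
    then show ?thesis by simp
  qed
  have iD2: "integrable (gP K) (\<lambda>e. D2 t (lin K e (v x)) c)" if "\<And>j. j \<in> J \<Longrightarrow> \<bar>c j\<bar> \<le> B" for x c
    by (rule P.integrable_const_bound[where B="B\<^sup>2 / \<epsilon>\<^sup>2 + \<beta> * B\<^sup>2 / \<epsilon>"]) (use D2_bound[OF that] in auto)
  have iD1: "integrable (gP K) (\<lambda>e. e i * D1 t (lin K e (v x)) (v' x i))" if i: "i \<in> K" for x i
  proof (rule Bochner_Integration.integrable_bound[OF integrable_mult_left[of "B / \<epsilon>", OF ie[OF i]]])
    have [measurable]: "(\<lambda>e. e i) \<in> borel_measurable (gP K)" using i by measurable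
    show "(\<lambda>e. e i * D1 t (lin K e (v x)) (v' x i)) \<in> borel_measurable (gP K)" by measurable
    show "AE e in gP K. norm (e i * D1 t (lin K e (v x)) (v' x i)) \<le> norm (\<bar>e i\<bar> * (B / \<epsilon>))"
    proof (rule AE_I2)
      fix e
      have "\<bar>D1 t (lin K e (v x)) (v' x i)\<bar> \<le> B / \<epsilon>" by (rule D1_bound) (rule v'B[OF i])
      then have "\<bar>D1 t (lin K e (v x)) (v' x i)\<bar> \<le> \<bar>B / \<epsilon>\<bar>" by linarith
      then show "norm (e i * D1 t (lin K e (v x)) (v' x i)) \<le> norm (\<bar>e i\<bar> * (B / \<epsilon>))"
        unfolding real_norm_def abs_mult[of "e i"] abs_mult[of "\<bar>e i\<bar>"] abs_idempotent by (rule mult_left_mono) simp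
    qed
  qed
  have step: "(\<integral>e. e i * D1 t (lin K e (v x)) (v' x i) \<partial>gP K)
      = sin x * cos x * ((\<integral>e. D2 t (lin K e (v x)) (a i) \<partial>gP K) - (\<integral>e. D2 t (lin K e (v x)) (b i) \<partial>gP K))"
    if i: "i \<in> K" for x i
  proof -
    have D1c: "D1 t z (\<lambda>j. r * c j) = r * D1 t z c" for z r c by (simp add: D1_def gibbs_avg_cmult)
    from ab[of i] show ?thesis
    proof
      assume a0: "a i = (\<lambda>_. 0)"
      have vi: "v x i = (\<lambda>j. cos x * b i j)" "v' x i = (\<lambda>j. - sin x * b i j)" by (auto simp: v_def v'_def a0 fun_eq_iff)
      have "(\<integral>e. e i * D1 t (lin K e (v x)) (v' x i) \<partial>gP K) = (\<integral>e. (- sin x) * (e i * D1 t (lin K e (v x)) (b i)) \<partial>gP K)"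
        unfolding vi(2) D1c by (intro Bochner_Integration.integral_cong refl) (simp add: mult_ac)
      also have "\<dots> = - sin x * (\<integral>e. e i * D1 t (lin K e (v x)) (b i) \<partial>gP K)" by (rule integral_mult_right_zero)
      also have "\<dots> = - sin x * (cos x * (\<integral>e. D2 t (lin K e (v x)) (b i) \<partial>gP K))"
        using ibp[OF i vi(1)] Bab[OF i] by simp
      finally show ?thesis by (simp add: a0 D2_zero)
    next
      assume b0: "b i = (\<lambda>_. 0)"
      have vi: "v x i = (\<lambda>j. sin x * a i j)" "v' x i = (\<lambda>j. cos x * a i j)" by (auto simp: v_def v'_def b0 fun_eq_iff)
      have "(\<integral>e. e i * D1 t (lin K e (v x)) (v' x i) \<partial>gP K) = (\<integral>e. cos x * (e i * D1 t (lin K e (v x)) (a i)) \<partial>gP K)"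
        unfolding vi(2) D1c by (intro Bochner_Integration.integral_cong refl) (simp add: mult_ac)
      also have "\<dots> = cos x * (\<integral>e. e i * D1 t (lin K e (v x)) (a i) \<partial>gP K)" by (rule integral_mult_right_zero)
      also have "\<dots> = cos x * (sin x * (\<integral>e. D2 t (lin K e (v x)) (a i) \<partial>gP K))"
        using ibp[OF i vi(1)] Bab[OF i] by simp
      finally show ?thesis by (simp add: b0 D2_zero)
    qed
  qed
  have k1b: "\<bar>\<integral>e. k1 x e \<partial>gP K\<bar> \<le> ?\<kappa>" for x
  proof -
    have "(\<integral>e. k1 x e \<partial>gP K) = (\<Sum>i\<in>K. sin x * cos x * ((\<integral>e. D2 t (lin K e (v x)) (a i) \<partial>gP K) - (\<integral>e. D2 t (lin K e (v x)) (b i) \<partial>gP K)))"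
      unfolding k1_def by (subst Bochner_Integration.integral_sum) (auto simp: iD1 step)
    also have "\<dots> = sin x * cos x * (\<integral>e. (\<Sum>i\<in>K. D2 t (lin K e (v x)) (a i) - D2 t (lin K e (v x)) (b i)) \<partial>gP K)"
      by (subst Bochner_Integration.integral_sum) (auto simp: iD2 Bab sum_distrib_left Bochner_Integration.integral_diff)
    finally have eq: "(\<integral>e. k1 x e \<partial>gP K) = sin x * cos x * (\<integral>e. (\<Sum>i\<in>K. D2 t (lin K e (v x)) (a i) - D2 t (lin K e (v x)) (b i)) \<partial>gP K)" .
    have i: "integrable (gP K) (\<lambda>e. (\<Sum>i\<in>K. D2 t (lin K e (v x)) (a i) - D2 t (lin K e (v x)) (b i)))"
      by (intro Bochner_Integration.integrable_sum Bochner_Integration.integrable_diff iD2 Bab)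
    have "\<bar>\<integral>e. (\<Sum>i\<in>K. D2 t (lin K e (v x)) (a i) - D2 t (lin K e (v x)) (b i)) \<partial>gP K\<bar> \<le> (\<integral>e. ?\<kappa> \<partial>gP K)"
      by (rule order_trans[OF integral_abs_bound]) (intro integral_mono integrable_abs i sum_D2_diff_bound \<Delta> P.integrable_const)
    then have 1: "\<bar>\<integral>e. (\<Sum>i\<in>K. D2 t (lin K e (v x)) (a i) - D2 t (lin K e (v x)) (b i)) \<partial>gP K\<bar> \<le> ?\<kappa>"
      by (simp add: P.prob_space)
    have "\<bar>sin x * cos x\<bar> \<le> 1" unfolding abs_mult by (intro mult_le_one) auto
    then have "\<bar>sin x * cos x\<bar> * \<bar>\<integral>e. (\<Sum>i\<in>K. D2 t (lin K e (v x)) (a i) - D2 t (lin K e (v x)) (b i)) \<partial>gP K\<bar> \<le> 1 * ?\<kappa>"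
      using 1 by (intro mult_mono) auto
    then show ?thesis unfolding eq abs_mult[of "sin x * cos x"] by simp
  qed
  obtain \<xi> where \<xi>: "(\<integral>e. k (pi/2) e \<partial>gP K) - (\<integral>e. k 0 e \<partial>gP K) = (pi/2 - 0) * (\<integral>e. k1 \<xi> e \<partial>gP K)"
    using MVT2[of 0 "pi/2" "\<lambda>x. \<integral>e. k x e \<partial>gP K" "\<lambda>x. \<integral>e. k1 x e \<partial>gP K"] DH by auto
  have e: "k (pi/2) = (\<lambda>e. soft_ind t (lin K e a))" "k 0 = (\<lambda>e. soft_ind t (lin K e b))"
    unfolding k_def v_def by (simp_all add: lin_def)
  have "\<bar>(pi/2 - 0) * (\<integral>e. k1 \<xi> e \<partial>gP K)\<bar> \<le> 2 * ?\<kappa>"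
    unfolding abs_mult using k1b[of \<xi>] pi_half_less_two by (intro mult_mono) auto
  then show ?thesis using \<xi> unfolding e by simp
qed

text \<open>The two noise families are placed side by side on the disjoint sum of their index sets
  and each coefficient family is continued by 0. This realises the two laws independently on one
  space, as the interpolation requires.\<close>

theorem gaussian_comparison:
  fixes a :: "'i \<Rightarrow> 'a \<Rightarrow> real" and b :: "'k \<Rightarrow> 'a \<Rightarrow> real"
  assumes I: "finite I" "finite I'"
    and \<Delta>: "\<And>j k. j \<in> J \<Longrightarrow> k \<in> J \<Longrightarrow> \<bar>(\<Sum>i\<in>I. a i j * a i k) - (\<Sum>i\<in>I'. b i j * b i k)\<bar> \<le> \<Delta>"
  shows "\<bar>(\<integral>e. soft_ind t (lin I e a) \<partial>gP I) - (\<integral>e. soft_ind t (lin I' e b) \<partial>gP I')\<bar> \<le> 2 * (\<Delta> * (1 / \<epsilon>\<^sup>2 + 2 * \<beta> / \<epsilon>))"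
proof -
  define K :: "('i + 'k) set" where "K = I <+> I'"
  define a' :: "'i + 'k \<Rightarrow> 'a \<Rightarrow> real" where "a' = case_sum a (\<lambda>_ _. 0)"
  define b' :: "'i + 'k \<Rightarrow> 'a \<Rightarrow> real" where "b' = case_sum (\<lambda>_ _. 0) b"
  have K: "finite K" unfolding K_def using I by simp
  have split: "sum g K = (\<Sum>i\<in>I. g (Inl i)) + (\<Sum>i\<in>I'. g (Inr i))" for g :: "_ \<Rightarrow> real"
    unfolding K_def using I by (subst sum.Plus) auto
  have m: "(\<lambda>e. soft_ind t (lin L e c)) \<in> borel_measurable (gP L)" for L :: "'x set" and c
    by (intro smax_measurable lin_measurable)
  have "(\<integral>e. soft_ind t (lin I e a) \<partial>gP I) = (\<integral>e. soft_ind t (lin I (\<lambda>i\<in>I. e (Inl i)) a) \<partial>gP K)"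
    by (rule gP_reindex[symmetric]) (auto simp: K_def intro!: smax_measurable lin_measurable)
  also have "\<dots> = (\<integral>e. soft_ind t (lin K e a') \<partial>gP K)"
    by (intro Bochner_Integration.integral_cong refl arg_cong[of _ _ "soft_ind t"]) (simp add: lin_def split a'_def)
  finally have 1: "(\<integral>e. soft_ind t (lin I e a) \<partial>gP I) = (\<integral>e. soft_ind t (lin K e a') \<partial>gP K)" .
  have "(\<integral>e. soft_ind t (lin I' e b) \<partial>gP I') = (\<integral>e. soft_ind t (lin I' (\<lambda>i\<in>I'. e (Inr i)) b) \<partial>gP K)"
    by (rule gP_reindex[symmetric]) (auto simp: K_def intro!: smax_measurable lin_measurable)
  also have "\<dots> = (\<integral>e. soft_ind t (lin K e b') \<partial>gP K)"
    by (intro Bochner_Integration.integral_cong refl arg_cong[of _ _ "soft_ind t"]) (simp add: lin_def split b'_def)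
  finally have 2: "(\<integral>e. soft_ind t (lin I' e b) \<partial>gP I') = (\<integral>e. soft_ind t (lin K e b') \<partial>gP K)" .
  show ?thesis unfolding 1 2
  proof (rule slepian_interpolation[OF K])
    show "a' i = (\<lambda>_. 0) \<or> b' i = (\<lambda>_. 0)" for i by (cases i) (auto simp: a'_def b'_def)
    show "\<bar>(\<Sum>i\<in>K. a' i j * a' i k) - (\<Sum>i\<in>K. b' i j * b' i k)\<bar> \<le> \<Delta>" if "j \<in> J" "k \<in> J" for j k
      using \<Delta>[OF that] by (simp add: split a'_def b'_def)
  qed
qed

end

lemma lin_measurable':
  assumes "\<And>i. i \<in> I \<Longrightarrow> sets (M i) = sets borel"
  shows "(\<lambda>e. lin I e a j) \<in> borel_measurable (PiM I M)"
proof -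
  have eq: "sets (PiM I M) = sets (PiM I (\<lambda>_. borel :: real measure))" using assms by (intro sets_PiM_cong) auto
  show ?thesis unfolding measurable_cong_sets[OF eq refl] by (rule lin_measurable(1))
qed

section \<open>Lindeberg replacement\<close>

text \<open>Moving one coordinate changes the soft-max weights by an exponential factor. The exponentially
  weighted third moment and \<open>lower\<close> pay for that change.\<close>

locale unit_law = prob_space \<mu> for \<mu> :: "real measure" +
  fixes C c\<^sub>1 :: real
  assumes sets_law: "sets \<mu> = sets borel"
    and int3: "integrable \<mu> (\<lambda>x. \<bar>x\<bar>^3 * exp \<bar>x\<bar>)"
    and mean: "integrable \<mu> (\<lambda>x. x)" "(\<integral>x. x \<partial>\<mu>) = 0"
    and variance: "integrable \<mu> (\<lambda>x. x\<^sup>2)" "(\<integral>x. x\<^sup>2 \<partial>\<mu>) = 1"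
    and bound3: "(\<integral>x. \<bar>x\<bar>^3 * exp \<bar>x\<bar> \<partial>\<mu>) \<le> C"
    and lower: "c\<^sub>1 \<le> (\<integral>x. exp (- \<bar>x\<bar>) \<partial>\<mu>)"

context smax begin

text \<open>The third-order remainder sits at an unknown intermediate point.
  \<open>gibbs_avg_stable\<close> moves its Gibbs average back to \<open>z\<close>, and
  \<open>bc\<close> keeps the price at exp |x|.\<close>

lemma taylor_soft_ind:
  assumes c: "\<And>j. j \<in> J \<Longrightarrow> \<bar>a j\<bar> \<le> c" and bc: "2 * \<beta> * c \<le> 1"
  shows "\<bar>soft_ind t (\<lambda>j. z j + x * a j) - (soft_ind t z + D1 t z a * x + D2 t z a / 2 * x\<^sup>2)\<bar>
     \<le> K3 * c * gibbs_avg z (\<lambda>j. (a j)\<^sup>2) / 6 * (\<bar>x\<bar>^3 * exp \<bar>x\<bar>)"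
proof -
  have c0: "c \<ge> 0" using neJ c by (metis abs_ge_zero all_not_in_conv order_trans)
  define diff where "diff m = (if m = 0 then (\<lambda>s. soft_ind t (\<lambda>j. z j + s * a j)) else if m = 1 then (\<lambda>s. D1 t (\<lambda>j. z j + s * a j) a)
     else if m = 2 then (\<lambda>s. D2 t (\<lambda>j. z j + s * a j) a) else (\<lambda>s. D3 t (\<lambda>j. z j + s * a j) a))" for m :: nat
  have D1': "((\<lambda>s. D1 t (\<lambda>j. z j + s * a j) a) has_real_derivative D2 t (\<lambda>j. z j + s * a j) a) (at s)" for s
    using DERIV_D1[of t z 1 a s] by simp
  have "\<forall>m s. m < 3 \<and> \<bar>s\<bar> \<le> \<bar>x\<bar> \<longrightarrow> DERIV (diff m) s :> diff (Suc m) s"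
  proof (intro allI impI)
    fix m :: nat and s assume "m < 3 \<and> \<bar>s\<bar> \<le> \<bar>x\<bar>"
    then consider "m = 0" | "m = 1" | "m = 2" by linarith
    then show "DERIV (diff m) s :> diff (Suc m) s"
      by cases (auto simp: diff_def DERIV_soft_ind_line D1' DERIV_D2)
  qed
  from Maclaurin_bi_le[of diff "\<lambda>s. soft_ind t (\<lambda>j. z j + s * a j)", OF _ this] obtain s where s: "\<bar>s\<bar> \<le> \<bar>x\<bar>"
    and eq: "soft_ind t (\<lambda>j. z j + x * a j) = (\<Sum>m<3. diff m 0 / fact m * x ^ m) + diff 3 s / fact 3 * x ^ 3"
    by (auto simp: diff_def)
  have E: "soft_ind t (\<lambda>j. z j + x * a j) - (soft_ind t z + D1 t z a * x + D2 t z a / 2 * x\<^sup>2) = D3 t (\<lambda>j. z j + s * a j) a / 6 * x^3"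
    unfolding eq by (simp add: eval_nat_numeral diff_def fact_numeral)
  have "\<bar>soft_ind t (\<lambda>j. z j + x * a j) - (soft_ind t z + D1 t z a * x + D2 t z a / 2 * x\<^sup>2)\<bar> = \<bar>D3 t (\<lambda>j. z j + s * a j) a\<bar> / 6 * \<bar>x\<bar>^3"
    unfolding E by (simp add: abs_mult power_abs)
  also have "\<dots> \<le> (K3 * c * gibbs_avg (\<lambda>j. z j + s * a j) (\<lambda>j. (a j)\<^sup>2)) / 6 * \<bar>x\<bar>^3"
    by (intro mult_right_mono divide_right_mono D3_bound c) auto
  also have "\<dots> \<le> (K3 * c * (exp (2 * \<beta> * c * \<bar>s\<bar>) * gibbs_avg z (\<lambda>j. (a j)\<^sup>2))) / 6 * \<bar>x\<bar>^3"
    using K3_pos c0 by (intro mult_right_mono divide_right_mono mult_left_mono gibbs_avg_stable c) auto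
  also have "\<dots> \<le> (K3 * c * (exp \<bar>x\<bar> * gibbs_avg z (\<lambda>j. (a j)\<^sup>2))) / 6 * \<bar>x\<bar>^3"
  proof -
    have "2 * \<beta> * c * \<bar>s\<bar> \<le> 1 * \<bar>x\<bar>" using bc s c0 \<beta>_pos by (intro mult_mono) auto
    then show ?thesis using K3_pos c0 by (intro mult_right_mono divide_right_mono mult_left_mono gibbs_avg_nonneg) auto
  qed
  finally show ?thesis by (simp add: algebra_simps)
qed

text \<open>Mean 0 and variance 1 determine the expectation of the Taylor polynomial. It is the same
  for every \<open>unit_law\<close> and cancels when two of them are exchanged.\<close>

lemma taylor_soft_ind_expectation:
  assumes u: "unit_law \<mu> C c\<^sub>1"
    and c: "\<And>j. j \<in> J \<Longrightarrow> \<bar>a j\<bar> \<le> c" and bc: "2 * \<beta> * c \<le> 1"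
  shows "\<bar>(\<integral>x. soft_ind t (\<lambda>j. z j + x * a j) \<partial>\<mu>) - (soft_ind t z + D2 t z a / 2)\<bar> \<le> K3 * c * gibbs_avg z (\<lambda>j. (a j)\<^sup>2) / 6 * C"
proof -
  interpret unit_law \<mu> C c\<^sub>1 by fact
  have c0: "c \<ge> 0" using neJ c by (metis abs_ge_zero all_not_in_conv order_trans)
  note [measurable_cong] = sets_law
  have m[measurable]: "(\<lambda>x. soft_ind t (\<lambda>j. z j + x * a j)) \<in> borel_measurable \<mu>" by (rule smax_measurable) measurable
  let ?p = "\<lambda>x. soft_ind t z + D1 t z a * x + D2 t z a / 2 * x\<^sup>2"
  have ih: "integrable \<mu> (\<lambda>x. soft_ind t (\<lambda>j. z j + x * a j))"
    by (rule integrable_const_bound[where B=1]) (auto simp: soft_ind_bounds)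
  have ip: "integrable \<mu> ?p"
    by (intro Bochner_Integration.integrable_add integrable_mult_right mean(1) variance(1)) simp
  have pv: "(\<integral>x. ?p x \<partial>\<mu>) = soft_ind t z + D2 t z a / 2"
    by (subst Bochner_Integration.integral_add, (intro Bochner_Integration.integrable_add integrable_mult_right mean(1) variance(1); simp)+)
      (subst Bochner_Integration.integral_add, auto simp: mean variance prob_space intro!: integrable_mult_right)
  have "\<bar>(\<integral>x. soft_ind t (\<lambda>j. z j + x * a j) \<partial>\<mu>) - (\<integral>x. ?p x \<partial>\<mu>)\<bar> = \<bar>\<integral>x. soft_ind t (\<lambda>j. z j + x * a j) - ?p x \<partial>\<mu>\<bar>"
    by (subst Bochner_Integration.integral_diff[OF ih ip]) simp
  also have "\<dots> \<le> (\<integral>x. \<bar>soft_ind t (\<lambda>j. z j + x * a j) - ?p x\<bar> \<partial>\<mu>)" by (rule integral_abs_bound)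
  also have "\<dots> \<le> (\<integral>x. K3 * c * gibbs_avg z (\<lambda>j. (a j)\<^sup>2) / 6 * (\<bar>x\<bar>^3 * exp \<bar>x\<bar>) \<partial>\<mu>)"
    by (intro integral_mono integrable_abs Bochner_Integration.integrable_diff ih ip integrable_mult_right int3 taylor_soft_ind c bc)
  also have "\<dots> = K3 * c * gibbs_avg z (\<lambda>j. (a j)\<^sup>2) / 6 * (\<integral>x. \<bar>x\<bar>^3 * exp \<bar>x\<bar> \<partial>\<mu>)" by simp
  also have "\<dots> \<le> K3 * c * gibbs_avg z (\<lambda>j. (a j)\<^sup>2) / 6 * C"
    using K3_pos c0 gibbs_avg_nonneg[of "\<lambda>j. (a j)\<^sup>2" z] bound3 by (intro mult_left_mono) auto
  finally show ?thesis unfolding pv .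
qed

text \<open>The Taylor error carries the Gibbs average at \<open>z\<close>, where the swapped
  coordinate is absent. \<open>lower\<close> bounds it by the expected Gibbs average at the full
  argument under the old law \<nu>. For different coordinates these expectations then refer to one
  and the same random vector and can be summed.\<close>

lemma lindeberg_swap:
  assumes u: "unit_law \<mu> C c\<^sub>1" and v: "unit_law \<nu> C c\<^sub>1" and c1: "c\<^sub>1 > 0"
    and c: "\<And>j. j \<in> J \<Longrightarrow> \<bar>a j\<bar> \<le> c" and bc: "2 * \<beta> * c \<le> 1"
  shows "\<bar>(\<integral>x. soft_ind t (\<lambda>j. z j + x * a j) \<partial>\<nu>) - (\<integral>x. soft_ind t (\<lambda>j. z j + x * a j) \<partial>\<mu>)\<bar>
     \<le> (K3 * c * C / (3 * c\<^sub>1)) * (\<integral>x. gibbs_avg (\<lambda>j. z j + x * a j) (\<lambda>j. (a j)\<^sup>2) \<partial>\<nu>)"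
proof -
  interpret \<nu>: unit_law \<nu> C c\<^sub>1 by fact
  have c0: "c \<ge> 0" using neJ c by (metis abs_ge_zero all_not_in_conv order_trans)
  note [measurable_cong] = \<nu>.sets_law
  let ?Q = "gibbs_avg z (\<lambda>j. (a j)\<^sup>2)"
  have Q0: "?Q \<ge> 0" by (rule gibbs_avg_nonneg) auto
  have C0: "C \<ge> 0" using \<nu>.bound3 by (rule order_trans[rotated]) (auto intro!: Bochner_Integration.integral_nonneg)
  have m[measurable]: "(\<lambda>x. gibbs_avg (\<lambda>j. z j + x * a j) (\<lambda>j. (a j)\<^sup>2)) \<in> borel_measurable \<nu>" by (rule smax_measurable) measurable
  have avb: "\<bar>gibbs_avg w (\<lambda>j. (a j)\<^sup>2)\<bar> \<le> c\<^sup>2" for w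
    by (rule gibbs_avg_abs_le) (use c c0 in \<open>auto simp: abs_le_square_iff[symmetric]\<close>)
  have low: "exp (- \<bar>x\<bar>) * ?Q \<le> gibbs_avg (\<lambda>j. z j + x * a j) (\<lambda>j. (a j)\<^sup>2)" for x
  proof -
    have "gibbs_avg (\<lambda>j. (z j + x * a j) + (- x) * a j) (\<lambda>j. (a j)\<^sup>2) \<le> exp (2 * \<beta> * c * \<bar>-x\<bar>) * gibbs_avg (\<lambda>j. z j + x * a j) (\<lambda>j. (a j)\<^sup>2)"
      by (rule gibbs_avg_stable) (use c in auto)
    also have "(\<lambda>j. (z j + x * a j) + (- x) * a j) = z" by auto
    also have "exp (2 * \<beta> * c * \<bar>-x\<bar>) * gibbs_avg (\<lambda>j. z j + x * a j) (\<lambda>j. (a j)\<^sup>2) \<le> exp \<bar>x\<bar> * gibbs_avg (\<lambda>j. z j + x * a j) (\<lambda>j. (a j)\<^sup>2)"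
    proof -
      have "2 * \<beta> * c * \<bar>-x\<bar> \<le> 1 * \<bar>x\<bar>" using bc c0 \<beta>_pos by (intro mult_mono) auto
      then show ?thesis by (intro mult_right_mono gibbs_avg_nonneg) auto
    qed
    finally have "exp (- \<bar>x\<bar>) * ?Q \<le> exp (- \<bar>x\<bar>) * (exp \<bar>x\<bar> * gibbs_avg (\<lambda>j. z j + x * a j) (\<lambda>j. (a j)\<^sup>2))"
      by (intro mult_left_mono) auto
    then show ?thesis by (simp add: mult.assoc[symmetric] flip: exp_add)
  qed
  have "c\<^sub>1 * ?Q \<le> (\<integral>x. exp (- \<bar>x\<bar>) \<partial>\<nu>) * ?Q" using \<nu>.lower Q0 by (rule mult_right_mono)
  also have "\<dots> = (\<integral>x. exp (- \<bar>x\<bar>) * ?Q \<partial>\<nu>)" by simp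
  also have "\<dots> \<le> (\<integral>x. gibbs_avg (\<lambda>j. z j + x * a j) (\<lambda>j. (a j)\<^sup>2) \<partial>\<nu>)"
  proof (intro integral_mono low)
    show "integrable \<nu> (\<lambda>x. exp (- \<bar>x\<bar>) * ?Q)"
      by (intro integrable_mult_left \<nu>.integrable_const_bound[where B=1]) auto
    show "integrable \<nu> (\<lambda>x. gibbs_avg (\<lambda>j. z j + x * a j) (\<lambda>j. (a j)\<^sup>2))"
      by (rule \<nu>.integrable_const_bound[where B="c\<^sup>2"]) (use avb in auto)
  qed
  finally have Q: "?Q \<le> (\<integral>x. gibbs_avg (\<lambda>j. z j + x * a j) (\<lambda>j. (a j)\<^sup>2) \<partial>\<nu>) / c\<^sub>1" using c1 by (simp add: field_simps)
  have "\<bar>(\<integral>x. soft_ind t (\<lambda>j. z j + x * a j) \<partial>\<nu>) - (\<integral>x. soft_ind t (\<lambda>j. z j + x * a j) \<partial>\<mu>)\<bar> \<le> 2 * (K3 * c * ?Q / 6 * C)"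
  proof -
    have "\<bar>(\<integral>x. soft_ind t (\<lambda>j. z j + x * a j) \<partial>\<nu>) - (soft_ind t z + D2 t z a / 2)\<bar> \<le> K3 * c * ?Q / 6 * C"
      by (rule taylor_soft_ind_expectation[OF v _ bc]) (rule c)
    moreover have "\<bar>(\<integral>x. soft_ind t (\<lambda>j. z j + x * a j) \<partial>\<mu>) - (soft_ind t z + D2 t z a / 2)\<bar> \<le> K3 * c * ?Q / 6 * C"
      by (rule taylor_soft_ind_expectation[OF u _ bc]) (rule c)
    ultimately show ?thesis by linarith
  qed
  also have "\<dots> = (K3 * c * C / 3) * ?Q" by simp
  also have "\<dots> \<le> (K3 * c * C / 3) * ((\<integral>x. gibbs_avg (\<lambda>j. z j + x * a j) (\<lambda>j. (a j)\<^sup>2) \<partial>\<nu>) / c\<^sub>1)"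
    using K3_pos c0 C0 by (intro mult_left_mono Q) auto
  finally show ?thesis by simp
qed

text \<open>Swapping the coordinates in a greedy order, the one with the smallest expected squared weight first,
  makes the errors sum to a harmonic number although the weights change with every swap.\<close>

theorem lindeberg:
  fixes a :: "'i \<Rightarrow> 'a \<Rightarrow> real"
  assumes u: "unit_law \<mu> C c\<^sub>1" and v: "unit_law \<nu> C c\<^sub>1" and c1: "c\<^sub>1 > 0" and I: "finite I"
    and c: "\<And>i j. i \<in> I \<Longrightarrow> j \<in> J \<Longrightarrow> \<bar>a i j\<bar> \<le> c" and c0: "c \<ge> 0" and bc: "2 * \<beta> * c \<le> 1"
    and var: "\<And>j. j \<in> J \<Longrightarrow> (\<Sum>i\<in>I. (a i j)\<^sup>2) \<le> 2"
  shows "\<bar>(\<integral>x. soft_ind t (lin I x a) \<partial>PiM I (\<lambda>_. \<nu>)) - (\<integral>x. soft_ind t (lin I x a) \<partial>PiM I (\<lambda>_. \<mu>))\<bar>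
      \<le> (K3 * c * C / (3 * c\<^sub>1)) * 2 * harm (card I)"
proof -
  interpret \<mu>: unit_law \<mu> C c\<^sub>1 by fact
  interpret \<nu>: unit_law \<nu> C c\<^sub>1 by fact
  let ?\<kappa> = "K3 * c * C / (3 * c\<^sub>1)"
  have C0: "C \<ge> 0" using \<nu>.bound3 by (rule order_trans[rotated]) (auto intro!: Bochner_Integration.integral_nonneg)
  have \<kappa>0: "?\<kappa> \<ge> 0" using K3_pos c0 C0 c1 by simp
  \<comment> \<open>\<open>R\<close> collects the coordinates that still carry \<nu>; every swap
    removes one element from it.\<close>
  define M where "M R i = (if i \<in> R then \<nu> else \<mu>)" for R and i :: 'i
  have Mp: "prob_space (M R i)" for R i unfolding M_def by (simp add: \<mu>.prob_space_axioms \<nu>.prob_space_axioms)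
  have Ms: "sets (M R i) = sets borel" for R i unfolding M_def by (simp add: \<mu>.sets_law \<nu>.sets_law)
  have PM: "prob_space (PiM L (M R))" for L R by (intro prob_space_PiM Mp)
  have product_sigma_finite_F: "product_sigma_finite (M R)" for R by (simp add: product_sigma_finite_def Mp prob_space_imp_sigma_finite)
  have lm: "(\<lambda>x. lin L x a j) \<in> borel_measurable (PiM L (M R))" for L R j by (rule lin_measurable'[OF Ms])
  have mh: "(\<lambda>x. soft_ind t (lin L x a)) \<in> borel_measurable (PiM L (M R))" "(\<lambda>x. gibbs_avg (lin L x a) d) \<in> borel_measurable (PiM L (M R))" for L R d
    by (intro smax_measurable lm)+
  have ih: "integrable (PiM I (M R)) (\<lambda>x. soft_ind t (lin I x a))" for R
    by (intro finite_measure.integrable_const_bound[where B=1] prob_space.finite_measure PM mh) (auto simp: soft_ind_bounds)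
  have avb: "\<bar>gibbs_avg w (\<lambda>j. (a i j)\<^sup>2)\<bar> \<le> c\<^sup>2" if "i \<in> I" for w i
    by (rule gibbs_avg_abs_le) (use c[OF that] c0 in \<open>auto simp: abs_le_square_iff[symmetric]\<close>)
  have ia: "integrable (PiM I (M R)) (\<lambda>x. gibbs_avg (lin I x a) (\<lambda>j. (a i j)\<^sup>2))" if "i \<in> I" for R i
    by (intro finite_measure.integrable_const_bound[where B="c\<^sup>2"] prob_space.finite_measure PM mh) (auto simp: avb[OF that])
  have swap: "\<bar>(\<integral>x. soft_ind t (lin I x a) \<partial>PiM I (M R)) - (\<integral>x. soft_ind t (lin I x a) \<partial>PiM I (M (R - {i})))\<bar>
      \<le> ?\<kappa> * (\<integral>x. gibbs_avg (lin I x a) (\<lambda>j. (a i j)\<^sup>2) \<partial>PiM I (M R))" if i: "i \<in> I" "i \<in> R" for i R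
  proof -
    have II: "I = insert i (I - {i})" using i by auto
    have fin: "finite (I - {i})" "i \<notin> I - {i}" using I by auto
    have cong: "PiM (I - {i}) (M (R - {i})) = PiM (I - {i}) (M R)" by (intro PiM_cong) (auto simp: M_def)
    let ?P = "PiM (I - {i}) (M R)"
    interpret P: prob_space ?P by (rule PM)
    let ?z = "\<lambda>x. lin (I - {i}) x a"
    let ?f = "\<lambda>x. \<integral>y. soft_ind t (\<lambda>j. ?z x j + y * a i j) \<partial>\<nu>" and ?g = "\<lambda>x. \<integral>y. soft_ind t (\<lambda>j. ?z x j + y * a i j) \<partial>\<mu>"
    let ?q = "\<lambda>x. \<integral>y. gibbs_avg (\<lambda>j. ?z x j + y * a i j) (\<lambda>j. (a i j)\<^sup>2) \<partial>\<nu>"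
    have e1: "(\<integral>x. soft_ind t (lin I x a) \<partial>PiM I (M R)) = (\<integral>x. ?f x \<partial>?P)"
      using product_sigma_finite.product_integral_insert[OF product_sigma_finite_F fin, of R "\<lambda>x. soft_ind t (lin I x a)"] ih[of R] II i
      by (simp add: lin_upd[OF I i(1)] M_def)
    have e2: "(\<integral>x. soft_ind t (lin I x a) \<partial>PiM I (M (R - {i}))) = (\<integral>x. ?g x \<partial>?P)"
      using product_sigma_finite.product_integral_insert[OF product_sigma_finite_F fin, of "R - {i}" "\<lambda>x. soft_ind t (lin I x a)"] ih[of "R - {i}"] II i
      by (simp add: lin_upd[OF I i(1)] M_def cong)
    have e3: "(\<integral>x. gibbs_avg (lin I x a) (\<lambda>j. (a i j)\<^sup>2) \<partial>PiM I (M R)) = (\<integral>x. ?q x \<partial>?P)"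
      using product_sigma_finite.product_integral_insert[OF product_sigma_finite_F fin, of R "\<lambda>x. gibbs_avg (lin I x a) (\<lambda>j. (a i j)\<^sup>2)"] ia[of i R] II i
      by (simp add: lin_upd[OF I i(1)] M_def)
    have mz: "(\<lambda>x. ?z (fst x) j + snd x * a i j) \<in> borel_measurable (?P \<Otimes>\<^sub>M \<rho>)" if "sets \<rho> = sets borel" for j \<rho>
    proof -
      note [measurable_cong] = that
      note [measurable] = lm
      show ?thesis by measurable
    qed
    have mm: "(\<lambda>x. \<integral>y. soft_ind t (\<lambda>j. ?z x j + y * a i j) \<partial>\<rho>) \<in> borel_measurable ?P" 
             "(\<lambda>x. \<integral>y. gibbs_avg (\<lambda>j. ?z x j + y * a i j) d \<partial>\<rho>) \<in> borel_measurable ?P" if s: "sets \<rho> = sets borel" and p: "prob_space \<rho>" for \<rho> d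
    proof -
      interpret \<rho>: prob_space \<rho> by fact
      have "(\<lambda>(x, y). soft_ind t (\<lambda>j. ?z x j + y * a i j)) \<in> borel_measurable (?P \<Otimes>\<^sub>M \<rho>)"
        "(\<lambda>(x, y). gibbs_avg (\<lambda>j. ?z x j + y * a i j) d) \<in> borel_measurable (?P \<Otimes>\<^sub>M \<rho>)"
        unfolding split_beta by (intro smax_measurable mz s)+
      then show "(\<lambda>x. \<integral>y. soft_ind t (\<lambda>j. ?z x j + y * a i j) \<partial>\<rho>) \<in> borel_measurable ?P" 
             "(\<lambda>x. \<integral>y. gibbs_avg (\<lambda>j. ?z x j + y * a i j) d \<partial>\<rho>) \<in> borel_measurable ?P"
        by (auto intro: \<rho>.borel_measurable_lebesgue_integral)
    qed
    have b1: "\<bar>\<integral>y. soft_ind t (\<lambda>j. ?z x j + y * a i j) \<partial>\<rho>\<bar> \<le> 1" if p: "prob_space \<rho>" for \<rho> x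
    proof -
      interpret \<rho>: prob_space \<rho> by fact
      have "norm (\<integral>y. soft_ind t (\<lambda>j. ?z x j + y * a i j) \<partial>\<rho>) \<le> (\<integral>y. 1 \<partial>\<rho>)"
      proof (cases "integrable \<rho> (\<lambda>y. soft_ind t (\<lambda>j. ?z x j + y * a i j))")
        case True
        show ?thesis using True
          by (intro order_trans[OF integral_norm_bound integral_mono]) (auto simp: soft_ind_bounds)
      qed (simp add: not_integrable_integral_eq)
      then show ?thesis by (simp add: \<rho>.prob_space)
    qed
    have b2: "\<bar>?q x\<bar> \<le> c\<^sup>2" for x
    proof -
      have "norm (?q x) \<le> (\<integral>y. c\<^sup>2 \<partial>\<nu>)"
      proof (cases "integrable \<nu> (\<lambda>y. gibbs_avg (\<lambda>j. ?z x j + y * a i j) (\<lambda>j. (a i j)\<^sup>2))")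
        case True
        then show ?thesis
          by (intro order_trans[OF integral_norm_bound integral_mono]) (auto simp: avb[OF i(1)])
      qed (simp add: not_integrable_integral_eq)
      then show ?thesis by (simp add: \<nu>.prob_space)
    qed
    have i1: "integrable ?P ?f" "integrable ?P ?g" "integrable ?P ?q"
    proof -
      show "integrable ?P ?f"
        by (rule P.integrable_const_bound[where B=1]) (use mm(1) b1 \<nu>.sets_law \<nu>.prob_space_axioms in auto)
      show "integrable ?P ?g"
        by (rule P.integrable_const_bound[where B=1]) (use mm(1) b1 \<mu>.sets_law \<mu>.prob_space_axioms in auto)
      show "integrable ?P ?q"
        by (rule P.integrable_const_bound[where B="c\<^sup>2"]) (use mm(2) b2 \<nu>.sets_law \<nu>.prob_space_axioms in auto)
    qed
    have "\<bar>(\<integral>x. ?f x \<partial>?P) - (\<integral>x. ?g x \<partial>?P)\<bar> = \<bar>\<integral>x. ?f x - ?g x \<partial>?P\<bar>"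
      using i1 by simp
    also have "\<dots> \<le> (\<integral>x. \<bar>?f x - ?g x\<bar> \<partial>?P)" by (rule integral_abs_bound)
    also have "\<dots> \<le> (\<integral>x. ?\<kappa> * ?q x \<partial>?P)"
      by (intro integral_mono integrable_abs Bochner_Integration.integrable_diff i1 integrable_mult_right lindeberg_swap[OF u v c1 _ bc] c i)
    also have "\<dots> = ?\<kappa> * (\<integral>x. ?q x \<partial>?P)" by simp
    finally show ?thesis unfolding e1 e2 e3 .
  qed
  have main: "\<bar>(\<integral>x. soft_ind t (lin I x a) \<partial>PiM I (M R)) - (\<integral>x. soft_ind t (lin I x a) \<partial>PiM I (M {}))\<bar> \<le> ?\<kappa> * 2 * harm (card R)"
    if "R \<subseteq> I" for R
    using that
  proof (induction "card R" arbitrary: R)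
    case 0
    then have "R = {}" using I finite_subset by fastforce
    then show ?case by (simp add: harm_def)
  next
    case (Suc n)
    have fR: "finite R" using Suc.prems I finite_subset by blast
    let ?w = "\<lambda>i. \<integral>x. gibbs_avg (lin I x a) (\<lambda>j. (a i j)\<^sup>2) \<partial>PiM I (M R)"
    interpret P: prob_space "PiM I (M R)" by (rule PM)
    have tot: "(\<Sum>i\<in>R. ?w i) \<le> 2"
    proof -
      have "(\<Sum>i\<in>R. ?w i) = (\<integral>x. (\<Sum>i\<in>R. gibbs_avg (lin I x a) (\<lambda>j. (a i j)\<^sup>2)) \<partial>PiM I (M R))"
        using Suc.prems by (subst Bochner_Integration.integral_sum) (auto intro!: ia)
      also have "\<dots> \<le> (\<integral>x. 2 \<partial>PiM I (M R))"
      proof (intro integral_mono Bochner_Integration.integrable_sum ia)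
        fix x
        have "(\<Sum>i\<in>R. gibbs_avg (lin I x a) (\<lambda>j. (a i j)\<^sup>2)) = gibbs_avg (lin I x a) (\<lambda>j. \<Sum>i\<in>R. (a i j)\<^sup>2)" by (simp add: gibbs_avg_sum)
        also have "\<dots> \<le> gibbs_avg (lin I x a) (\<lambda>_. 2)"
        proof (rule gibbs_avg_mono)
          fix j assume "j \<in> J"
          have "(\<Sum>i\<in>R. (a i j)\<^sup>2) \<le> (\<Sum>i\<in>I. (a i j)\<^sup>2)" using Suc.prems I by (intro sum_mono2) auto
          then show "(\<Sum>i\<in>R. (a i j)\<^sup>2) \<le> 2" using var[OF \<open>j \<in> J\<close>] by linarith
        qed
        finally show "(\<Sum>i\<in>R. gibbs_avg (lin I x a) (\<lambda>j. (a i j)\<^sup>2)) \<le> 2" by (simp add: gibbs_avg_const)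
      qed (use Suc.prems in auto)
      finally show ?thesis by (simp add: P.prob_space)
    qed
    \<comment> \<open>Pigeonhole on the total weight 2. Swapping such an \<open>i\<close> costs at
      most a constant times 2 / card R, and these costs add up to the harmonic number.\<close>
    have "\<exists>i\<in>R. ?w i \<le> 2 / real (card R)"
    proof (rule ccontr)
      assume "\<not> ?thesis"
      then have "(\<Sum>i\<in>R. 2 / real (card R)) < (\<Sum>i\<in>R. ?w i)" using fR Suc.hyps(2) by (intro sum_strict_mono) auto
      moreover have "(\<Sum>i\<in>R. 2 / real (card R)) = 2" 
      proof -
        have "card R \<noteq> 0" using Suc.hyps(2) by simp
        then show ?thesis by simp
      qed
      ultimately show False using tot by linarith
    qed
    then obtain i where i: "i \<in> R" "?w i \<le> 2 / real (card R)" by blast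
    have iI: "i \<in> I" using i Suc.prems by auto
    have cR: "card (R - {i}) = n" using Suc.hyps(2) i fR by simp
    have IH: "\<bar>(\<integral>x. soft_ind t (lin I x a) \<partial>PiM I (M (R - {i}))) - (\<integral>x. soft_ind t (lin I x a) \<partial>PiM I (M {}))\<bar> \<le> ?\<kappa> * 2 * harm n"
      using Suc.hyps(1)[of "R - {i}"] cR Suc.prems by auto
    have "\<bar>(\<integral>x. soft_ind t (lin I x a) \<partial>PiM I (M R)) - (\<integral>x. soft_ind t (lin I x a) \<partial>PiM I (M (R - {i})))\<bar> \<le> ?\<kappa> * (2 / real (card R))"
      using swap[OF iI i(1)] mult_left_mono[OF i(2) \<kappa>0] by linarith
    moreover have "harm (card R) = harm n + 1 / real (card R)"
      using Suc.hyps(2) by (simp add: harm_Suc inverse_eq_divide flip: Suc.hyps(2))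
    then have "?\<kappa> * 2 * harm (card R) = ?\<kappa> * 2 * harm n + ?\<kappa> * (2 / real (card R))"
      by (simp add: distrib_left)
    ultimately show ?case using IH by linarith
  qed
  have "PiM I (M I) = PiM I (\<lambda>_. \<nu>)" "PiM I (M {}) = PiM I (\<lambda>_. \<mu>)"
    by (auto intro!: PiM_cong simp: M_def)
  then show ?thesis using main[of I] by simp
qed

end

section \<open>Random subsets\<close>

text \<open>For negative y the bound comes from exp (-y) >= 1 - y and (1 + y + y^2) (1 - y) = 1 -
  y^3 >= 1.\<close>

lemma exp_le_quadratic: assumes "y \<le> (1::real)" shows "exp y \<le> 1 + y + y\<^sup>2"
proof (cases "0 \<le> y")
  case True then show ?thesis using exp_bound assms by simp
next
  case False
  have "1 \<le> (1 + y + y\<^sup>2) * (1 - y)"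
  proof -
    have "(1 + y + y\<^sup>2) * (1 - y) = 1 - y^3" by (simp add: algebra_simps power2_eq_square power3_eq_cube)
    moreover have "y^3 \<le> 0" using False by (simp add: power_le_zero_eq)
    ultimately show ?thesis by simp
  qed
  also have "\<dots> \<le> (1 + y + y\<^sup>2) * exp (- y)"
  proof (rule mult_left_mono)
    show "1 - y \<le> exp (- y)" using exp_ge_add_one_self[of "-y"] by simp
    show "0 \<le> 1 + y + y\<^sup>2" using zero_le_power2[of "y + 1/2"] by (simp add: power2_eq_square algebra_simps)
  qed
  finally show ?thesis by (simp add: exp_minus field_simps)
qed

text \<open>Expectation over a random subset of \<open>{..<N}\<close> that contains each point
  independently with probability \<open>q\<close>, kept as a finite sum.\<close>

definition EB :: "nat \<Rightarrow> real \<Rightarrow> (nat set \<Rightarrow> real) \<Rightarrow> real" where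
  "EB N q F = (\<Sum>A\<in>Pow {..<N}. q ^ card A * (1 - q) ^ (N - card A) * F A)"

lemma EB_mono:
  assumes "0 \<le> q" "q \<le> 1" "\<And>A. A \<subseteq> {..<N} \<Longrightarrow> F A \<le> G A"
  shows "EB N q F \<le> EB N q G"
  unfolding EB_def using assms by (intro sum_mono mult_left_mono) auto

lemma EB_cong: "(\<And>A. A \<subseteq> {..<N} \<Longrightarrow> F A = G A) \<Longrightarrow> EB N q F = EB N q G"
  unfolding EB_def by (intro sum.cong) auto

lemma EB_cmult: "EB N q (\<lambda>A. c * F A) = c * EB N q F"
  unfolding EB_def by (simp add: sum_distrib_left algebra_simps)

lemma EB_add: "EB N q (\<lambda>A. F A + G A) = EB N q F + EB N q G"
  unfolding EB_def by (simp add: sum.distrib algebra_simps)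

lemma EB_Suc: "EB (Suc N) q F = EB N q (\<lambda>A. (1 - q) * F A + q * F (insert N A))"
proof -
  have fin: "finite A" if "A \<in> Pow {..<N}" for A using that finite_subset by auto
  have "EB (Suc N) q F = (\<Sum>A\<in>Pow {..<N}. q ^ card A * (1 - q) ^ (Suc N - card A) * F A)
      + (\<Sum>A\<in>insert N ` Pow {..<N}. q ^ card A * (1 - q) ^ (Suc N - card A) * F A)"
    unfolding EB_def lessThan_Suc Pow_insert by (subst sum.union_disjoint) auto
  also have "(\<Sum>A\<in>insert N ` Pow {..<N}. q ^ card A * (1 - q) ^ (Suc N - card A) * F A)
      = (\<Sum>A\<in>Pow {..<N}. q ^ card (insert N A) * (1 - q) ^ (Suc N - card (insert N A)) * F (insert N A))"
    by (subst sum.reindex) (auto simp: inj_on_def)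
  also have "\<dots> = (\<Sum>A\<in>Pow {..<N}. q ^ card A * (1 - q) ^ (N - card A) * (q * F (insert N A)))"
  proof (intro sum.cong refl)
    fix A assume A: "A \<in> Pow {..<N}"
    then have "card (insert N A) = Suc (card A)" using fin[OF A] by (subst card_insert_disjoint) auto
    then show "q ^ card (insert N A) * (1 - q) ^ (Suc N - card (insert N A)) * F (insert N A)
       = q ^ card A * (1 - q) ^ (N - card A) * (q * F (insert N A))" by simp
  qed
  also have "(\<Sum>A\<in>Pow {..<N}. q ^ card A * (1 - q) ^ (Suc N - card A) * F A)
      = (\<Sum>A\<in>Pow {..<N}. q ^ card A * (1 - q) ^ (N - card A) * ((1 - q) * F A))"
  proof (intro sum.cong refl)
    fix A assume A: "A \<in> Pow {..<N}"
    then have "card A \<le> N" using card_mono[of "{..<N}" A] by auto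
    then show "q ^ card A * (1 - q) ^ (Suc N - card A) * F A = q ^ card A * (1 - q) ^ (N - card A) * ((1 - q) * F A)"
      by (simp add: Suc_diff_le)
  qed
  finally show ?thesis unfolding EB_def by (simp add: distrib_left sum.distrib)
qed

lemma EB_const: "EB N q (\<lambda>_. c) = c"
proof (induction N)
  case 0 then show ?case by (simp add: EB_def)
next
  case (Suc N) then show ?case unfolding EB_Suc by (simp add: algebra_simps)
qed

lemma bernoulli_mgf:
  assumes q: "0 \<le> q" "q \<le> 1" and x: "\<bar>x\<bar> \<le> (1::real)"
  shows "(1 - q) * exp (- q * x) + q * exp ((1 - q) * x) \<le> exp (q * x\<^sup>2)"
proof -
  have "\<bar>q * x\<bar> \<le> 1" "\<bar>(1 - q) * x\<bar> \<le> 1" unfolding abs_mult using q x by (auto intro!: mult_le_one)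
  then have y: "- q * x \<le> 1" "(1 - q) * x \<le> 1" by auto
  have "(1 - q) * exp (- q * x) + q * exp ((1 - q) * x)
     \<le> (1 - q) * (1 + - q * x + (- q * x)\<^sup>2) + q * (1 + (1 - q) * x + ((1 - q) * x)\<^sup>2)"
    using q y by (intro add_mono mult_left_mono exp_le_quadratic) auto
  also have "\<dots> = 1 + q * x\<^sup>2 - q\<^sup>2 * x\<^sup>2" by (simp add: power2_eq_square algebra_simps)
  also have "\<dots> \<le> 1 + q * x\<^sup>2" by simp
  also have "\<dots> \<le> exp (q * x\<^sup>2)" by (rule exp_ge_add_one_self)
  finally show ?thesis .
qed

text \<open>The weight at \<open>r\<close> sees only the part of \<open>A\<close> below
  \<open>r\<close>. Under \<open>EB\<close> the summands are therefore martingale differences along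
  the indices.\<close>

definition msum :: "real \<Rightarrow> nat \<Rightarrow> (nat \<Rightarrow> nat set \<Rightarrow> real) \<Rightarrow> nat set \<Rightarrow> real" where
  "msum q N c A = (\<Sum>r<N. (of_bool (r \<in> A) - q) * c r (A \<inter> {..<r}))"

text \<open>Induction peels off the last index: given the rest of the subset its weight is fixed,
  and \<open>bernoulli_mgf\<close> bounds the conditional exponential moment.\<close>

lemma EB_msum_mgf:
  assumes q: "0 \<le> q" "q \<le> 1" and c: "\<And>r A. r < N \<Longrightarrow> \<bar>l * c r A\<bar> \<le> 1" and v: "\<And>r A. r < N \<Longrightarrow> (c r A)\<^sup>2 \<le> v r"
  shows "EB N q (\<lambda>A. exp (l * msum q N c A)) \<le> exp (l\<^sup>2 * q * (\<Sum>r<N. v r))"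
  using c v
proof (induction N)
  case 0 then show ?case by (simp add: EB_def msum_def)
next
  case (Suc N)
  have "EB (Suc N) q (\<lambda>A. exp (l * msum q (Suc N) c A)) \<le>
      EB N q (\<lambda>A. exp (l\<^sup>2 * q * v N) * exp (l * msum q N c A))"
    unfolding EB_Suc
  proof (rule EB_mono[OF q])
    fix A :: "nat set" assume A: "A \<subseteq> {..<N}"
    have m1: "msum q (Suc N) c A = msum q N c A + (- q) * c N A"
      unfolding msum_def using A by (auto simp: Int_absorb2)
    have ins: "insert N A \<inter> {..<r} = A \<inter> {..<r}" if "r \<le> N" for r using that by auto
    have m2: "msum q (Suc N) c (insert N A) = msum q N c A + (1 - q) * c N A"
      unfolding msum_def using A by (auto simp: ins Int_absorb2 intro!: sum.cong)
    let ?x = "l * c N A"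
    have "(1 - q) * exp (l * msum q (Suc N) c A) + q * exp (l * msum q (Suc N) c (insert N A))
       = exp (l * msum q N c A) * ((1 - q) * exp (- q * ?x) + q * exp ((1 - q) * ?x))"
    proof -
      have "exp (l * (msum q N c A + (- q) * c N A)) = exp (l * msum q N c A) * exp (- q * ?x)"
        "exp (l * (msum q N c A + (1 - q) * c N A)) = exp (l * msum q N c A) * exp ((1 - q) * ?x)"
        unfolding exp_add[symmetric] by (simp_all add: algebra_simps)
      then show ?thesis unfolding m1 m2 by (simp only: distrib_left mult_ac)
    qed
    also have "\<dots> \<le> exp (l * msum q N c A) * exp (q * ?x\<^sup>2)"
      using Suc.prems(1)[of N A] by (intro mult_left_mono bernoulli_mgf q) auto
    also have "\<dots> \<le> exp (l * msum q N c A) * exp (l\<^sup>2 * q * v N)"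
    proof -
      have "l\<^sup>2 * q * (c N A)\<^sup>2 \<le> l\<^sup>2 * q * v N" using Suc.prems(2)[of N A] q by (intro mult_left_mono) auto
      then show ?thesis by (simp add: power_mult_distrib mult_ac)
    qed
    finally show "(1 - q) * exp (l * msum q (Suc N) c A) + q * exp (l * msum q (Suc N) c (insert N A))
       \<le> exp (l\<^sup>2 * q * v N) * exp (l * msum q N c A)" by (simp add: mult_ac)
  qed
  also have "\<dots> \<le> exp (l\<^sup>2 * q * v N) * exp (l\<^sup>2 * q * (\<Sum>r<N. v r))"
    unfolding EB_cmult using Suc by (intro mult_left_mono) auto
  finally show ?case unfolding exp_add[symmetric] by (simp add: algebra_simps)
qed

text \<open>Chernoff's bound for the sum and for its negative. The parameter \<open>l\<close> stays
  free so that each application can balance the range of the weights against their variance.\<close>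

lemma EB_tail:
  assumes q: "0 \<le> q" "q \<le> 1" and c: "\<And>r A. r < N \<Longrightarrow> \<bar>c r A\<bar> \<le> b" and v: "\<And>r A. r < N \<Longrightarrow> (c r A)\<^sup>2 \<le> v r"
    and l: "l > 0" "l * b \<le> 1"
  shows "EB N q (\<lambda>A. of_bool (\<bar>msum q N c A\<bar> \<ge> \<tau>)) \<le> 2 * exp (- l * \<tau> + l\<^sup>2 * q * (\<Sum>r<N. v r))"
proof -
  have lc: "\<bar>l * c r A\<bar> \<le> 1" if "r < N" for r A
  proof -
    have "\<bar>l * c r A\<bar> \<le> l * b" unfolding abs_mult using l c[OF that] by (auto intro!: mult_mono)
    then show ?thesis using l by linarith
  qed
  have neg: "msum q N (\<lambda>r A. - c r A) A = - msum q N c A" for A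
    unfolding msum_def by (simp add: sum_negf)
  have "EB N q (\<lambda>A. of_bool (\<bar>msum q N c A\<bar> \<ge> \<tau>)) \<le>
     EB N q (\<lambda>A. exp (- l * \<tau>) * (exp (l * msum q N c A) + exp (l * msum q N (\<lambda>r A. - c r A) A)))"
  proof (rule EB_mono[OF q])
    fix A
    have "1 \<le> exp (l * (x - \<tau>))" if "x \<ge> \<tau>" for x using that l by simp
    moreover have "exp (l * (x - \<tau>)) = exp (- l * \<tau>) * exp (l * x)" for x unfolding exp_add[symmetric] by (simp add: algebra_simps)
    ultimately have *: "1 \<le> exp (- l * \<tau>) * exp (l * x)" if "x \<ge> \<tau>" for x using that by metis
    show "of_bool (\<bar>msum q N c A\<bar> \<ge> \<tau>) \<le> exp (- l * \<tau>) * (exp (l * msum q N c A) + exp (l * msum q N (\<lambda>r A. - c r A) A))"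
      unfolding neg distrib_left using *[of "msum q N c A"] *[of "- msum q N c A"]
      by (cases "msum q N c A \<ge> 0") (auto simp: add_increasing add_increasing2)
  qed
  also have "\<dots> = exp (- l * \<tau>) * (EB N q (\<lambda>A. exp (l * msum q N c A)) + EB N q (\<lambda>A. exp (l * msum q N (\<lambda>r A. - c r A) A)))"
    unfolding EB_cmult EB_add ..
  also have "\<dots> \<le> exp (- l * \<tau>) * (exp (l\<^sup>2 * q * (\<Sum>r<N. v r)) + exp (l\<^sup>2 * q * (\<Sum>r<N. v r)))"
    using lc v by (intro mult_left_mono add_mono EB_msum_mgf q) auto
  also have "\<dots> = 2 * exp (- l * \<tau> + l\<^sup>2 * q * (\<Sum>r<N. v r))" unfolding exp_add by simp
  finally show ?thesis .
qed

section \<open>Uniform subsets as images under random permutations\<close>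

definition EP :: "nat \<Rightarrow> ((nat \<Rightarrow> nat) \<Rightarrow> real) \<Rightarrow> real" where
  "EP N f = (\<Sum>\<pi> | \<pi> permutes {..<N}. f \<pi>) / fact N"

lemma EP_mono: "(\<And>\<pi>. \<pi> permutes {..<N} \<Longrightarrow> f \<pi> \<le> g \<pi>) \<Longrightarrow> EP N f \<le> EP N g"
  unfolding EP_def by (intro divide_right_mono sum_mono) auto

lemma EP_cong: "(\<And>\<pi>. \<pi> permutes {..<N} \<Longrightarrow> f \<pi> = g \<pi>) \<Longrightarrow> EP N f = EP N g"
  unfolding EP_def by (intro arg_cong2[of _ _ _ _ "(/)"] sum.cong) auto

lemma EP_add: "EP N (\<lambda>\<pi>. f \<pi> + g \<pi>) = EP N f + EP N g"
  unfolding EP_def by (simp add: sum.distrib add_divide_distrib)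

lemma EP_cmult: "EP N (\<lambda>\<pi>. c * f \<pi>) = c * EP N f"
  unfolding EP_def by (simp add: sum_distrib_left)

lemma EP_sum: "EP N (\<lambda>\<pi>. \<Sum>i\<in>I. f i \<pi>) = (\<Sum>i\<in>I. EP N (f i))"
  unfolding EP_def by (simp add: sum.swap[of _ I] sum_divide_distrib)

lemma EP_const: "EP N (\<lambda>_. c) = c"
  unfolding EP_def by (simp add: card_permutations[OF refl finite_lessThan])

lemma EP_nonneg: "(\<And>\<pi>. \<pi> permutes {..<N} \<Longrightarrow> 0 \<le> f \<pi>) \<Longrightarrow> 0 \<le> EP N f"
  unfolding EP_def by (intro divide_nonneg_nonneg sum_nonneg) auto

lemma EP_compose_left: assumes "\<sigma> permutes {..<N}" shows "EP N (\<lambda>\<pi>. f (\<sigma> \<circ> \<pi>)) = EP N f"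
  unfolding EP_def using setum_permutations_compose_left[OF assms, of f] by simp

lemma EP_compose_right: assumes "\<sigma> permutes {..<N}" shows "EP N (\<lambda>\<pi>. f (\<pi> \<circ> \<sigma>)) = EP N f"
  unfolding EP_def using sum_permutations_compose_right[OF assms, of f] by simp

lemma ex_permutes_image:
  assumes "finite S" "A \<subseteq> S" "B \<subseteq> S" "card A = card B"
  obtains \<sigma> where "\<sigma> permutes S" "\<sigma> ` A = B"
proof -
  have fA: "finite A" "finite B" using assms finite_subset by auto
  obtain f where f: "bij_betw f A B" using finite_same_card_bij[OF fA assms(4)] by blast
  have "card (S - A) = card (S - B)" using assms fA by (simp add: card_Diff_subset)
  then obtain g where g: "bij_betw g (S - A) (S - B)" using finite_same_card_bij[of "S - A" "S - B"] assms(1) by auto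
  define \<sigma> where "\<sigma> x = (if x \<in> A then f x else if x \<in> S then g x else x)" for x
  have "bij_betw \<sigma> A B" using f by (rule bij_betw_cong[THEN iffD1, rotated]) (auto simp: \<sigma>_def)
  moreover have "bij_betw \<sigma> (S - A) (S - B)" using g by (rule bij_betw_cong[THEN iffD1, rotated]) (auto simp: \<sigma>_def)
  ultimately have "bij_betw \<sigma> (A \<union> (S - A)) (B \<union> (S - B))" by (rule bij_betw_combine) auto
  then have "bij_betw \<sigma> S S" using assms by (simp add: Un_absorb1)
  then have "\<sigma> permutes S" by (rule bij_imp_permutes) (use assms in \<open>auto simp: \<sigma>_def\<close>)
  moreover have "\<sigma> ` A = B" using \<open>bij_betw \<sigma> A B\<close> by (simp add: bij_betw_def)
  ultimately show ?thesis using that by blast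
qed

text \<open>Two sets of equal size differ by a permutation, which the average over all permutations
  absorbs.\<close>

lemma EP_image:
  assumes "A \<subseteq> {..<N}" "B \<subseteq> {..<N}" "card A = card B"
  shows "EP N (\<lambda>\<pi>. F (\<pi> ` A)) = EP N (\<lambda>\<pi>. F (\<pi> ` B))"
proof -
  obtain \<sigma> where \<sigma>: "\<sigma> permutes {..<N}" "\<sigma> ` A = B" using ex_permutes_image[OF _ assms] by auto
  have "EP N (\<lambda>\<pi>. F ((\<pi> \<circ> \<sigma>) ` A)) = EP N (\<lambda>\<pi>. F (\<pi> ` A))" by (rule EP_compose_right[OF \<sigma>(1), of "\<lambda>\<pi>. F (\<pi> ` A)"])
  then show ?thesis by (simp only: image_comp[symmetric] \<sigma>(2))
qed

lemma EB_perm: assumes "\<pi> permutes {..<N}" shows "EB N q (\<lambda>A. F (\<pi> ` A)) = EB N q F"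
proof -
  have inj: "inj \<pi>" using assms permutes_inj by blast
  have "bij_betw ((`) \<pi>) (Pow {..<N}) (Pow {..<N})"
    using assms by (intro bij_betw_Pow) (rule permutes_imp_bij)
  moreover have "card (\<pi> ` A) = card A" for A using inj card_image inj_on_subset by blast
  ultimately show ?thesis unfolding EB_def
    by (subst sum.reindex_bij_betw[symmetric, where h="(`) \<pi>" and S="Pow {..<N}"]) auto
qed

text \<open>Independent inclusion is invariant under permutations, so \<open>F\<close> may be
  averaged over all of them. Grouping the subsets by size then exhibits the Bernoulli law as a
  binomial mixture of uniform laws.\<close>

lemma EB_eq_EP:
  "EB N q F = (\<Sum>s\<le>N. real (N choose s) * q ^ s * (1 - q) ^ (N - s) * EP N (\<lambda>\<pi>. F (\<pi> ` {..<s})))"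
proof -
  have cl: "card A \<le> N" if "A \<in> Pow {..<N}" for A using that card_mono[of "{..<N}" A] by auto
  have "EB N q F = EP N (\<lambda>\<pi>. EB N q (\<lambda>A. F (\<pi> ` A)))"
    using EP_cong[of N "\<lambda>\<pi>. EB N q (\<lambda>A. F (\<pi> ` A))" "\<lambda>_. EB N q F"] EB_perm by (simp add: EP_const)
  also have "\<dots> = (\<Sum>A\<in>Pow {..<N}. q ^ card A * (1 - q) ^ (N - card A) * EP N (\<lambda>\<pi>. F (\<pi> ` A)))"
    unfolding EB_def EP_sum EP_cmult ..
  also have "\<dots> = (\<Sum>A\<in>Pow {..<N}. q ^ card A * (1 - q) ^ (N - card A) * EP N (\<lambda>\<pi>. F (\<pi> ` {..<card A})))"
    using cl by (intro sum.cong refl arg_cong2[of _ _ _ _ "(*)"] EP_image) auto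
  also have "\<dots> = (\<Sum>s\<le>N. \<Sum>A\<in>{A\<in>Pow {..<N}. card A = s}. q ^ card A * (1 - q) ^ (N - card A) * EP N (\<lambda>\<pi>. F (\<pi> ` {..<card A})))"
    using cl by (subst sum.group) auto
  also have "\<dots> = (\<Sum>s\<le>N. real (N choose s) * q ^ s * (1 - q) ^ (N - s) * EP N (\<lambda>\<pi>. F (\<pi> ` {..<s})))"
  proof (intro sum.cong refl)
    fix s
    have "card {A\<in>Pow {..<N}. card A = s} = (N choose s)" using n_subsets[of "{..<N}" s] by simp
    then show "(\<Sum>A\<in>{A\<in>Pow {..<N}. card A = s}. q ^ card A * (1 - q) ^ (N - card A) * EP N (\<lambda>\<pi>. F (\<pi> ` {..<card A})))
       = real (N choose s) * q ^ s * (1 - q) ^ (N - s) * EP N (\<lambda>\<pi>. F (\<pi> ` {..<s}))" by simp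
  qed
  finally show ?thesis .
qed

text \<open>Ratios of consecutive binomial weights show that they increase up to m and decrease
  afterwards. The weight at m is thus the largest of N + 1 numbers with sum 1.\<close>

lemma binomial_mode:
  assumes m: "m \<le> N" "N > 0"
  shows "1 / (real N + 1) \<le> real (N choose m) * (real m / real N) ^ m * (1 - real m / real N) ^ (N - m)"
proof -
  define q where "q = real m / real N"
  define b where "b j = real (N choose j) * q ^ j * (1 - q) ^ (N - j)" for j
  have q: "0 \<le> q" "q \<le> 1" unfolding q_def using m by auto
  have qN: "q * real N = real m" unfolding q_def using m by simp
  have b0: "b j \<ge> 0" for j unfolding b_def using q by auto
  have step: "real (Suc j) * (1 - q) * b (Suc j) = real (N - j) * q * b j" if "j < N" for j
  proof -
    have "real (Suc j) * real (N choose Suc j) = real (N - j) * real (N choose j)"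
    proof -
      have "Suc j * (N choose Suc j) = (N - j) * (N choose j)" by (simp only: binomial_absorb_comp binomial_absorption)
      then show ?thesis by (metis of_nat_mult)
    qed
    moreover have "(1 - q) ^ (N - j) = (1 - q) * (1 - q) ^ (N - Suc j)" using that by (simp add: Suc_diff_Suc flip: power_Suc)
    moreover have "real (Suc j) * (1 - q) * b (Suc j) = (real (Suc j) * real (N choose Suc j)) * (q * q ^ j) * ((1 - q) * (1 - q) ^ (N - Suc j))"
      unfolding b_def by (simp only: power_Suc mult_ac)
    ultimately show ?thesis unfolding b_def by (simp only: mult_ac)
  qed
  have up: "b j \<le> b (Suc j)" if "j < m" for j
  proof -
    have jN: "j < N" using that m by simp
    have "real (Suc j) * (1 - q) \<le> real (N - j) * q"
    proof -
      have "real (Suc j) \<le> real m" using that by simp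
      then have "real (Suc j) \<le> q * real N" using qN by simp
      moreover have "q \<ge> 0" by (rule q)
      ultimately show ?thesis using jN by (simp add: of_nat_diff algebra_simps)
    qed
    then have "real (Suc j) * (1 - q) * b j \<le> real (Suc j) * (1 - q) * b (Suc j)"
      unfolding step[OF jN] using b0 by (intro mult_right_mono) auto
    then show ?thesis
    \<comment> \<open>For q = 1 the recursion cannot be divided through; then m = N and all weights
      below N vanish.\<close>
    proof (cases "q = 1")
      case True
      then have "m = N" using m by (simp add: q_def field_simps)
      then have "b j = 0" using True jN by (simp add: b_def)
      then show ?thesis using b0[of "Suc j"] by simp
    next
      case False
      then have pos: "real (Suc j) * (1 - q) > 0" using q by simp
      then show ?thesis using \<open>real (Suc j) * (1 - q) * b j \<le> real (Suc j) * (1 - q) * b (Suc j)\<close>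
        by (simp only: mult_le_cancel_left_pos[OF pos])
    qed
  qed
  have down: "b (Suc j) \<le> b j" if "m \<le> j" "j < N" for j
  proof -
    have le: "real (N - j) * q \<le> real (Suc j) * (1 - q)"
    proof -
      have "q * real N \<le> real j" using that qN by simp
      then show ?thesis using that q by (simp add: of_nat_diff algebra_simps)
    qed
    have pos: "real (Suc j) * (1 - q) > 0" using that m by (simp add: q_def)
    have "real (Suc j) * (1 - q) * b (Suc j) \<le> real (Suc j) * (1 - q) * b j"
      unfolding step[OF that(2)] using b0 le by (intro mult_right_mono) auto
    then show ?thesis by (simp only: mult_le_cancel_left_pos[OF pos])
  qed
  have "b j \<le> b m" if "j \<le> N" for j
  proof (cases "j \<le> m")
    case True
    then show ?thesis
    proof (induct rule: inc_induct)
      case (step i) then show ?case using up[of i] by linarith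
    qed simp
  next
    case False
    then have "m \<le> j" by simp
    then have "j \<le> N \<longrightarrow> b j \<le> b m"
    proof (induct rule: dec_induct)
      case (step i) then show ?case using down[of i] by auto
    qed simp
    then show ?thesis using that by simp
  qed
  then have "(\<Sum>j\<le>N. b j) \<le> (\<Sum>j\<le>N. b m)" by (intro sum_mono) auto
  moreover have "(\<Sum>j\<le>N. b j) = 1" unfolding b_def using binomial_ring[of q "1 - q" N] by simp
  ultimately have "1 \<le> (real N + 1) * b m" by (simp add: algebra_simps)
  then show ?thesis unfolding b_def q_def by (simp add: field_simps)
qed

text \<open>Keeping only the term of size m in the binomial mixture costs a factor N + 1. This is
  affordable for exponentially small tails; for comparing laws a coupling takes its place.\<close>

lemma EP_le_EB:
  assumes m: "m \<le> N" "N > 0" and F: "\<And>A. 0 \<le> F A"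
  shows "EP N (\<lambda>\<pi>. F (\<pi> ` {..<m})) \<le> (real N + 1) * EB N (real m / real N) F"
proof -
  let ?q = "real m / real N"
  have q: "0 \<le> ?q" "?q \<le> 1" using m by auto
  have E0: "0 \<le> EP N (\<lambda>\<pi>. F (\<pi> ` {..<m}))" using F by (rule EP_nonneg)
  have "1 / (real N + 1) * EP N (\<lambda>\<pi>. F (\<pi> ` {..<m})) \<le> real (N choose m) * ?q ^ m * (1 - ?q) ^ (N - m) * EP N (\<lambda>\<pi>. F (\<pi> ` {..<m}))"
    by (intro mult_right_mono binomial_mode m E0)
  also have "\<dots> \<le> EB N ?q F"
    unfolding EB_eq_EP using m q F
    by (intro member_le_sum[where f="\<lambda>s. real (N choose s) * ?q ^ s * (1 - ?q) ^ (N - s) * EP N (\<lambda>\<pi>. F (\<pi> ` {..<s}))"])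
       (auto intro!: mult_nonneg_nonneg EP_nonneg)
  finally show ?thesis by (simp add: field_simps)
qed

lemma EP_perm_image: assumes "\<sigma> permutes {..<N}" shows "EP N (\<lambda>\<pi>. F (\<sigma> ` (\<pi> ` A))) = EP N (\<lambda>\<pi>. F (\<pi> ` A))"
  using EP_compose_left[OF assms, of "\<lambda>\<pi>. F (\<pi> ` A)"] by (simp only: image_comp[symmetric])

text \<open>The permutation \<sigma> will be the ranking in a direction: it lets the martingale run
  along the ranks instead of the labels.\<close>

lemma EP_tail:
  assumes m: "m \<le> N" "N > 0" and \<sigma>: "\<sigma> permutes {..<N}"
    and c: "\<And>r A. r < N \<Longrightarrow> \<bar>c r A\<bar> \<le> b" and v: "\<And>r A. r < N \<Longrightarrow> (c r A)\<^sup>2 \<le> v r"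
    and l: "l > 0" "l * b \<le> 1"
    and e: "- l * \<tau> + l\<^sup>2 * (real m / real N) * (\<Sum>r<N. v r) \<le> - L"
  shows "EP N (\<lambda>\<pi>. of_bool (\<bar>msum (real m / real N) N c (\<sigma> ` (\<pi> ` {..<m}))\<bar> \<ge> \<tau>)) \<le> 2 * (real N + 1) * exp (- L)"
proof -
  let ?q = "real m / real N"
  have q: "0 \<le> ?q" "?q \<le> 1" using m by auto
  have "EP N (\<lambda>\<pi>. of_bool (\<bar>msum ?q N c (\<sigma> ` (\<pi> ` {..<m}))\<bar> \<ge> \<tau>)) = EP N (\<lambda>\<pi>. of_bool (\<bar>msum ?q N c (\<pi> ` {..<m})\<bar> \<ge> \<tau>))"
    by (rule EP_perm_image[OF \<sigma>, of "\<lambda>A. of_bool (\<bar>msum ?q N c A\<bar> \<ge> \<tau>)"])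
  also have "\<dots> \<le> (real N + 1) * EB N ?q (\<lambda>A. of_bool (\<bar>msum ?q N c A\<bar> \<ge> \<tau>))"
    by (rule EP_le_EB[OF m]) simp
  also have "\<dots> \<le> (real N + 1) * (2 * exp (- l * \<tau> + l\<^sup>2 * ?q * (\<Sum>r<N. v r)))"
    by (intro mult_left_mono EB_tail[OF q c v l]) auto
  also have "\<dots> \<le> (real N + 1) * (2 * exp (- L))" using e by (intro mult_left_mono) auto
  finally show ?thesis by (simp only: mult_ac)
qed

lemma msum_reindex:
  assumes "\<sigma> permutes {..<N}" "A \<subseteq> {..<N}"
  shows "msum q N c (\<sigma> ` A) = (\<Sum>i<N. (of_bool (i \<in> A) - q) * c (\<sigma> i) (\<sigma> ` A \<inter> {..<\<sigma> i}))"
proof -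
  have inj: "inj \<sigma>" using assms permutes_inj by blast
  have bij: "bij_betw \<sigma> {..<N} {..<N}" using assms permutes_imp_bij by blast
  show ?thesis unfolding msum_def
    by (subst sum.reindex_bij_betw[OF bij, symmetric]) (simp add: inj_image_mem_iff[OF inj])
qed

section \<open>Rank statistics\<close>

text \<open>\<open>A\<close> is the index set of the second sample inside the pooled sample, \<open>rho u i\<close> the rank of point \<open>i\<close> in
  direction \<open>u\<close> with ties broken arbitrarily, and \<open>cnt u A i\<close> the number of first-sample points that
  do not exceed point \<open>i\<close>. Ties make it differ from the count by ranks, by at most \<open>p\<close>.\<close>

locale rank_config =
  fixes n m N p d :: nat and U :: "'u set" and rho :: "'u \<Rightarrow> nat \<Rightarrow> nat" and psi :: "nat \<Rightarrow> real \<Rightarrow> real" and B \<Lambda> :: real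
    and cnt :: "'u \<Rightarrow> nat set \<Rightarrow> nat \<Rightarrow> nat"
  assumes N: "N = n + m" and m: "0 < m" "m \<le> n" and p: "1 \<le> p" and d: "1 \<le> d"
    and U: "finite U" "U \<noteq> {}" and rho: "\<And>u. u \<in> U \<Longrightarrow> rho u permutes {..<N}"
    and B1: "B \<ge> 1"
    and lip: "\<And>k x y. k \<in> {1..d} \<Longrightarrow> x \<in> {0..1} \<Longrightarrow> y \<in> {0..1} \<Longrightarrow> \<bar>psi k x - psi k y\<bar> \<le> B * \<bar>x - y\<bar>"
    and psiB: "\<And>k x. k \<in> {1..d} \<Longrightarrow> x \<in> {0..1} \<Longrightarrow> \<bar>psi k x\<bar> \<le> B"
    and rie1: "\<And>k M. k \<in> {1..d} \<Longrightarrow> M > 0 \<Longrightarrow> \<bar>\<Sum>i<M. psi k (real i / real M)\<bar> \<le> B"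
    and rie2: "\<And>k. k \<in> {1..d} \<Longrightarrow> \<bar>(\<Sum>i<N. (psi k (real i / real N))\<^sup>2) / real N - 1\<bar> \<le> 1 / 2"
    and \<Lambda>: "real p + 1 \<le> \<Lambda>" "\<Lambda> \<le> real N" "real (card U) * real d \<le> exp (\<Lambda> / 2)" "exp (- \<Lambda> / 2) \<le> 1 / real N ^ 5"
      "B * sqrt (\<Lambda> / real N) \<le> 1"
begin

definition q :: real where "q = real m / real N"
text \<open>Deviation allowed between the empirical distribution function of the first sample and
  the pooled rank. The 4 is 2 * 2: a centred count may deviate by 2 sqrt (\<Lambda> N), and n is at
  least N / 2.\<close>

definition \<delta> :: real where "\<delta> = 4 * sqrt (\<Lambda> / real N)"
definition xc :: "'u \<Rightarrow> nat set \<Rightarrow> nat \<Rightarrow> nat" where "xc u A r = card {i \<in> {..<N} - A. rho u i < r}"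

definition cnt_ok :: "nat set \<Rightarrow> bool" where
  "cnt_ok A \<longleftrightarrow> (\<forall>u\<in>U. \<forall>i<N. xc u A (rho u i) \<le> cnt u A i \<and> cnt u A i \<le> xc u A (rho u i) + p \<and> cnt u A i \<le> n)"

definition Ts :: "'u \<Rightarrow> nat \<Rightarrow> nat set \<Rightarrow> real" where
  "Ts u k A = sqrt (real n * real m / real N) * \<bar>(\<Sum>j\<in>A. psi k (real (cnt u A j) / real n)) / real m\<bar>"

definition Sl :: "'u \<Rightarrow> nat \<Rightarrow> nat set \<Rightarrow> real" where
  "Sl u k A = (\<Sum>i<N. (of_bool (i \<in> A) - q) * psi k (real (rho u i) / real N))"

lemma Npos: "0 < N" "real N > 0" "m \<le> N" "n > 0" "real n > 0" "real m > 0"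
  using N m by auto

lemma q01: "0 \<le> q" "q \<le> 1" "1 - q = real n / real N" "q > 0"
  unfolding q_def using N m by (auto simp: field_simps)

lemma \<Lambda>1: "\<Lambda> \<ge> 1" "\<Lambda> > 0" using \<Lambda>(1) p by auto

lemma Bpos: "B > 0" using B1 by simp

text \<open>The right-hand side depends on \<open>A\<close> only through the ranks below
  \<open>r\<close>. This makes the weights of the martingale predictable along the ranks.\<close>

lemma xc_eq: assumes u: "u \<in> U" and A: "A \<subseteq> {..<N}" and r: "r \<le> N"
  shows "real (xc u A r) = real r - real (card (rho u ` A \<inter> {..<r}))"
proof -
  have inj: "inj (rho u)" using rho[OF u] permutes_inj by blast
  have bij: "bij_betw (rho u) {..<N} {..<N}" using rho[OF u] permutes_imp_bij by blast
  have im: "rho u ` {..<N} = {..<N}" by (rule bij_betw_imp_surj_on[OF bij])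
  have "rho u ` {i \<in> {..<N} - A. rho u i < r} = {..<r} - rho u ` A"
  proof (intro equalityI subsetI)
    fix x assume "x \<in> {..<r} - rho u ` A"
    then have x: "x < r" "x \<notin> rho u ` A" "x \<in> rho u ` {..<N}" using r im by auto
    then obtain i where i: "i < N" "x = rho u i" by auto
    then have "i \<notin> A" using x by blast
    then show "x \<in> rho u ` {i \<in> {..<N} - A. rho u i < r}" using x i by auto
  next
    fix x assume "x \<in> rho u ` {i \<in> {..<N} - A. rho u i < r}"
    then show "x \<in> {..<r} - rho u ` A" by (auto simp: inj_eq[OF inj] dest: injD[OF inj])
  qed
  moreover have "card (rho u ` {i \<in> {..<N} - A. rho u i < r}) = xc u A r"
    unfolding xc_def by (intro card_image inj_on_subset[OF inj]) auto
  ultimately have "xc u A r = card ({..<r} - rho u ` A)" by simp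
  also have "\<dots> = r - card (rho u ` A \<inter> {..<r})"
    by (subst card_Diff_subset_Int) (auto simp: Int_commute)
  finally show ?thesis
    using card_mono[of "{..<r}" "rho u ` A \<inter> {..<r}"] by (simp add: of_nat_diff)
qed

lemma xc_le: assumes "A \<subseteq> {..<N}" "card A = m" shows "xc u A r \<le> n"
proof -
  have "finite A" using assms finite_subset by auto
  then have "card ({..<N} - A) = n" using assms N by (simp add: card_Diff_subset)
  then show ?thesis unfolding xc_def using card_mono[of "{..<N} - A" "{i \<in> {..<N} - A. rho u i < r}"] by auto
qed

text \<open>In rank order the points of the first sample have 0, 1, ..., n - 1 predecessors within
  that sample, whatever \<open>A\<close> is.\<close>

lemma xc_enumerates:
  assumes u: "u \<in> U" and A: "A \<subseteq> {..<N}" "card A = m"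
  shows "bij_betw (\<lambda>i. xc u A (rho u i)) ({..<N} - A) {..<n}"
proof -
  have inj: "inj (rho u)" using rho[OF u] permutes_inj by blast
  have finA: "finite A" using A finite_subset by auto
  have cn: "card ({..<N} - A) = n" using A finA N by (simp add: card_Diff_subset)
  have strict: "xc u A (rho u i) < xc u A (rho u j)" if "i \<in> {..<N} - A" "rho u i < rho u j" for i j
    unfolding xc_def using that by (intro psubset_card_mono) auto
  have i: "inj_on (\<lambda>i. xc u A (rho u i)) ({..<N} - A)"
  proof (rule inj_onI)
    fix i j assume ij: "i \<in> {..<N} - A" "j \<in> {..<N} - A" "xc u A (rho u i) = xc u A (rho u j)"
    then have "rho u i = rho u j" using strict[of i j] strict[of j i] by (cases "rho u i" "rho u j" rule: linorder_cases) auto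
    then show "i = j" using inj by (simp add: inj_eq)
  qed
  have sub: "(\<lambda>i. xc u A (rho u i)) ` ({..<N} - A) \<subseteq> {..<n}"
  proof
    fix x assume "x \<in> (\<lambda>i. xc u A (rho u i)) ` ({..<N} - A)"
    then obtain i where i: "i \<in> {..<N} - A" "x = xc u A (rho u i)" by auto
    have "card {i' \<in> {..<N} - A. rho u i' < rho u i} < card ({..<N} - A)"
      using i by (intro psubset_card_mono) auto
    then show "x \<in> {..<n}" using i cn by (simp add: xc_def)
  qed
  have "(\<lambda>i. xc u A (rho u i)) ` ({..<N} - A) = {..<n}"
    using sub card_image[OF i] cn by (intro card_subset_eq) auto
  then show ?thesis using i by (simp add: bij_betw_def)
qed

text \<open>By \<open>xc_enumerates\<close> the first sample contributes a fixed sum. A rescaled sum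
  over the second sample is therefore a centred sum over the whole pool plus a nonrandom
  term.\<close>

lemma rank_sum_identity:
  assumes u: "u \<in> U" and A: "A \<subseteq> {..<N}" "card A = m"
  shows "(\<Sum>i<N. (of_bool (i \<in> A) - q) * g (xc u A (rho u i))) = (real n / real N) * (\<Sum>i\<in>A. g (xc u A (rho u i))) - q * (\<Sum>i<n. g i)"
proof -
  let ?g = "\<lambda>i. g (xc u A (rho u i)) :: real"
  have sp: "{..<N} = A \<union> ({..<N} - A)" using A by auto
  have fin: "finite A" using A finite_subset by auto
  have "(\<Sum>i<N. (of_bool (i \<in> A) - q) * ?g i) = (\<Sum>i\<in>A. (of_bool (i \<in> A) - q) * ?g i) + (\<Sum>i\<in>{..<N} - A. (of_bool (i \<in> A) - q) * ?g i)"
    by (subst sp, subst sum.union_disjoint) (use fin in auto)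
  also have "\<dots> = (\<Sum>i\<in>A. (1 - q) * ?g i) + (\<Sum>i\<in>{..<N} - A. (- q) * ?g i)"
    by (intro arg_cong2[of _ _ _ _ "(+)"] sum.cong) auto
  also have "\<dots> = (1 - q) * (\<Sum>i\<in>A. ?g i) - q * (\<Sum>i\<in>{..<N} - A. ?g i)"
    by (simp add: sum_distrib_left sum_negf)
  also have "(\<Sum>i\<in>{..<N} - A. ?g i) = (\<Sum>i<n. g i)"
    by (rule sum.reindex_bij_betw[OF xc_enumerates[OF u A]])
  finally show ?thesis by (simp add: q01)
qed

definition rank_good :: "'u \<Rightarrow> nat set \<Rightarrow> bool" where
  "rank_good u A \<longleftrightarrow> (\<forall>r<N. \<bar>real (xc u A r) / real n - real r / real N\<bar> \<le> \<delta>)"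

text \<open>Read along the ranks, the error of replacing the empirical distribution function of the first sample
  by the pooled rank is a sum with predictable weights \<open>mc\<close>. Clipping makes these weights small surely,
  so that a martingale Bernstein bound applies.\<close>

definition clip :: "nat \<Rightarrow> real \<Rightarrow> real" where
  "clip r x = max (max 0 (real r / real N - \<delta>)) (min (min 1 (real r / real N + \<delta>)) x)"

definition mc :: "nat \<Rightarrow> nat \<Rightarrow> nat set \<Rightarrow> real" where
  "mc k r S = psi k (clip r ((real r - real (card S)) / real n)) - psi k (real r / real N)"

lemma \<delta>0: "\<delta> > 0" unfolding \<delta>_def using \<Lambda>1 Npos by simp

lemma clip: assumes "r < N" shows "clip r x \<in> {0..1}" "\<bar>clip r x - real r / real N\<bar> \<le> \<delta>"
proof -
  have r: "0 \<le> real r / real N" "real r / real N \<le> 1" using assms by auto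
  show "clip r x \<in> {0..1}" using r \<delta>0 unfolding clip_def by auto
  have "\<bar>max (max 0 (t - \<delta>)) (min (min 1 (t + \<delta>)) x) - t\<bar> \<le> \<delta>" if "0 \<le> t" "t \<le> 1" for t
    using that \<delta>0 by (auto simp: max_def min_def abs_le_iff)
  then show "\<bar>clip r x - real r / real N\<bar> \<le> \<delta>" using r unfolding clip_def by blast
qed

lemma clip_id: assumes "r < N" "0 \<le> x" "x \<le> 1" "\<bar>x - real r / real N\<bar> \<le> \<delta>" shows "clip r x = x"
  using assms unfolding clip_def by auto

lemma mc_bound: assumes "k \<in> {1..d}" "r < N" shows "\<bar>mc k r S\<bar> \<le> B * \<delta>"
proof -
  have "\<bar>mc k r S\<bar> \<le> B * \<bar>clip r ((real r - real (card S)) / real n) - real r / real N\<bar>"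
    unfolding mc_def using clip[OF assms(2)] assms by (intro lip) auto
  also have "\<dots> \<le> B * \<delta>" using clip[OF assms(2)] Bpos by (intro mult_left_mono) auto
  finally show ?thesis .
qed

text \<open>On a \<open>rank_good\<close> subset the clipping is inactive, and the martingale is
  exactly the error of replacing counts by pooled ranks.\<close>

lemma msum_mc:
  assumes u: "u \<in> U" and A: "A \<subseteq> {..<N}" "card A = m" and g: "rank_good u A"
  shows "msum q N (mc k) (rho u ` A) = (\<Sum>i<N. (of_bool (i \<in> A) - q) * psi k (real (xc u A (rho u i)) / real n)) - Sl u k A"
proof -
  have lt: "rho u i < N" if "i < N" for i using permutes_in_image[OF rho[OF u]] that by auto
  have "mc k (rho u i) (rho u ` A \<inter> {..<rho u i}) = psi k (real (xc u A (rho u i)) / real n) - psi k (real (rho u i) / real N)" if "i < N" for i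
  proof -
    have x: "real (rho u i) - real (card (rho u ` A \<inter> {..<rho u i})) = real (xc u A (rho u i))"
      using xc_eq[OF u A(1), of "rho u i"] lt[OF that] by simp
    have "clip (rho u i) (real (xc u A (rho u i)) / real n) = real (xc u A (rho u i)) / real n"
      using lt[OF that] g xc_le[OF A, of u "rho u i"] Npos by (intro clip_id) (auto simp: rank_good_def field_simps)
    then show ?thesis unfolding mc_def x by simp
  qed
  then have "msum q N (mc k) (rho u ` A) = (\<Sum>i<N. (of_bool (i \<in> A) - q) * (psi k (real (xc u A (rho u i)) / real n) - psi k (real (rho u i) / real N)))"
    unfolding msum_reindex[OF rho[OF u] A(1)] by (intro sum.cong) auto
  then show ?thesis unfolding Sl_def by (simp add: right_diff_distrib sum_subtractf)
qed

text \<open>The budget 10 \<Lambda> B covers 8 \<Lambda> B for the martingale, B p for ties and B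
  for the Riemann sum of the nonrandom term; the last two stay below \<Lambda> B because p + 1 <=
  \<Lambda>.\<close>

lemma T_close:
  assumes u: "u \<in> U" and k: "k \<in> {1..d}" and A: "A \<subseteq> {..<N}" "card A = m" and g: "rank_good u A" and c: "cnt_ok A"
    and t: "\<bar>msum q N (mc k) (rho u ` A)\<bar> \<le> 8 * \<Lambda> * B"
  shows "\<bar>Ts u k A - sqrt (real N / (real n * real m)) * \<bar>Sl u k A\<bar>\<bar> \<le> sqrt (real N / (real n * real m)) * (10 * \<Lambda> * B)"
proof -
  let ?s = "sqrt (real N / (real n * real m))"
  let ?X = "\<Sum>i\<in>A. psi k (real (xc u A (rho u i)) / real n)"
  let ?C = "\<Sum>i\<in>A. psi k (real (cnt u A i) / real n)"
  let ?E = "\<Sum>i<n. psi k (real i / real n)"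
  have id: "(real n / real N) * ?X - q * ?E = msum q N (mc k) (rho u ` A) + Sl u k A"
    using rank_sum_identity[OF u A, of "\<lambda>x. psi k (real x / real n)"] msum_mc[OF u A g, of k] by simp
  have CX: "\<bar>?C - ?X\<bar> \<le> B * real p"
  proof -
    have "\<bar>psi k (real (cnt u A i) / real n) - psi k (real (xc u A (rho u i)) / real n)\<bar> \<le> B * (real p / real n)" if i: "i \<in> A" for i
    proof -
      have c': "xc u A (rho u i) \<le> cnt u A i" "cnt u A i \<le> xc u A (rho u i) + p" "cnt u A i \<le> n"
        using c u i A unfolding cnt_ok_def by auto
      have "\<bar>psi k (real (cnt u A i) / real n) - psi k (real (xc u A (rho u i)) / real n)\<bar>
         \<le> B * \<bar>real (cnt u A i) / real n - real (xc u A (rho u i)) / real n\<bar>"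
        using k c' Npos by (intro lip) auto
      also have "\<dots> \<le> B * (real p / real n)"
        using c' Npos Bpos by (intro mult_left_mono) (auto simp: abs_le_iff diff_divide_distrib[symmetric] divide_le_cancel)
      finally show ?thesis .
    qed
    then have "(\<Sum>i\<in>A. \<bar>psi k (real (cnt u A i) / real n) - psi k (real (xc u A (rho u i)) / real n)\<bar>) \<le> (\<Sum>i\<in>A. B * (real p / real n))"
      by (rule sum_mono)
    also have "\<dots> = B * real p * (real m / real n)" using A by simp
    also have "\<dots> \<le> B * real p * 1" using m Bpos by (intro mult_left_mono) auto
    finally show ?thesis unfolding sum_subtractf[symmetric] mult_1_right by (rule order_trans[OF sum_abs])
  qed
  have sq: "sqrt (real n * real m / real N) * (x / real m) = ?s * ((real n / real N) * x)" for x
  proof -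
    have "sqrt (real n * real m / real N) = ?s * (real n * real m / real N)"
    proof (rule real_sqrt_unique)
      show "(?s * (real n * real m / real N))\<^sup>2 = real n * real m / real N" unfolding power_mult_distrib
        using Npos by (subst real_sqrt_pow2) (auto simp: power2_eq_square)
    qed (use Npos in auto)
    then show ?thesis using Npos by simp
  qed
  have "Ts u k A = \<bar>sqrt (real n * real m / real N) * (?C / real m)\<bar>" unfolding Ts_def by (simp add: abs_mult)
  also have "\<dots> = ?s * \<bar>(real n / real N) * ?C\<bar>" unfolding sq abs_mult[of ?s] by simp
  finally have Teq: "Ts u k A = ?s * \<bar>(real n / real N) * ?C\<bar>" .
  have nN: "real n / real N \<le> 1" "real n / real N \<ge> 0" using N Npos by (auto simp: divide_le_eq)
  have e1: "\<bar>(real n / real N) * (?C - ?X)\<bar> \<le> B * real p"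
    unfolding abs_mult using mult_mono[OF nN(1) CX] nN by simp
  have e2: "\<bar>q * ?E\<bar> \<le> B"
    unfolding abs_mult using mult_mono[OF q01(2) rie1[OF k Npos(4)]] q01 by simp
  have "\<bar>(real n / real N) * ?C - Sl u k A\<bar> \<le> B * real p + B + 8 * \<Lambda> * B"
    using id e1 e2 t by (simp add: right_diff_distrib abs_le_iff)
  also have "\<dots> \<le> 10 * \<Lambda> * B"
  proof -
    have "B * (real p + 1) \<le> B * \<Lambda>" using \<Lambda>(1) Bpos by (intro mult_left_mono) auto
    moreover have "0 \<le> B * \<Lambda>" using \<Lambda>1 Bpos by simp
    ultimately show ?thesis by (simp add: algebra_simps)
  qed
  finally have f: "\<bar>\<bar>(real n / real N) * ?C\<bar> - \<bar>Sl u k A\<bar>\<bar> \<le> 10 * \<Lambda> * B" by linarith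
  have "\<bar>Ts u k A - ?s * \<bar>Sl u k A\<bar>\<bar> = ?s * \<bar>\<bar>(real n / real N) * ?C\<bar> - \<bar>Sl u k A\<bar>\<bar>"
    unfolding Teq right_diff_distrib[symmetric] abs_mult by simp
  also have "\<dots> \<le> ?s * (10 * \<Lambda> * B)" using f by (intro mult_left_mono) auto
  finally show ?thesis .
qed

section \<open>Typical subsets and their probability\<close>

definition cov_good :: "'u \<Rightarrow> nat \<Rightarrow> 'u \<Rightarrow> nat \<Rightarrow> nat set \<Rightarrow> bool" where
  "cov_good u k u' k' A \<longleftrightarrow> \<bar>\<Sum>i<N. (of_bool (i \<in> A) - q) * (psi k (real (rho u i) / real N) * psi k' (real (rho u' i) / real N))\<bar> \<le> 4 * B * sqrt (\<Lambda> * real N)"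

definition mart_good :: "'u \<Rightarrow> nat \<Rightarrow> nat set \<Rightarrow> bool" where
  "mart_good u k A \<longleftrightarrow> \<bar>msum q N (mc k) (rho u ` A)\<bar> \<le> 8 * \<Lambda> * B"

lemma sqL: "sqrt (\<Lambda> / real N) * sqrt (\<Lambda> * real N) = \<Lambda>" "(sqrt (\<Lambda> / real N))\<^sup>2 * real N = \<Lambda>" "sqrt (\<Lambda> / real N) \<le> 1" "sqrt (\<Lambda> / real N) > 0"
  "sqrt (\<Lambda> * real N) > 0"
proof -
  have "sqrt (\<Lambda> / real N) * sqrt (\<Lambda> * real N) = sqrt (\<Lambda> * \<Lambda>)" unfolding real_sqrt_mult[symmetric] using Npos by simp
  then show "sqrt (\<Lambda> / real N) * sqrt (\<Lambda> * real N) = \<Lambda>" using \<Lambda>1 by simp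
  show "(sqrt (\<Lambda> / real N))\<^sup>2 * real N = \<Lambda>" using \<Lambda>1 Npos by simp
  show "sqrt (\<Lambda> / real N) \<le> 1" using \<Lambda> Npos by simp
  show "sqrt (\<Lambda> / real N) > 0" "sqrt (\<Lambda> * real N) > 0" using \<Lambda>1 Npos by auto
qed

lemma rho_le1: assumes "u \<in> U" "i < N" shows "real (rho u i) / real N \<in> {0..1}"
  using permutes_in_image[OF rho[OF assms(1)], of i] assms by auto

lemma sum_psi_sq: assumes u: "u \<in> U" and k: "k \<in> {1..d}"
  shows "(\<Sum>i<N. (psi k (real (rho u i) / real N))\<^sup>2) \<le> 2 * real N" "(\<Sum>i<N. (psi k (real (rho u i) / real N))\<^sup>2) \<ge> real N / 2"
proof -
  have eq: "(\<Sum>i<N. (psi k (real (rho u i) / real N))\<^sup>2) = (\<Sum>i<N. (psi k (real i / real N))\<^sup>2)"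
    by (rule sum.reindex_bij_betw[OF permutes_imp_bij[OF rho[OF u]]])
  have r: "(\<Sum>i<N. (psi k (real i / real N))\<^sup>2) / real N \<le> 3/2" "(\<Sum>i<N. (psi k (real i / real N))\<^sup>2) / real N \<ge> 1/2"
    using rie2[OF k] by linarith+
  show "(\<Sum>i<N. (psi k (real (rho u i) / real N))\<^sup>2) \<le> 2 * real N" "(\<Sum>i<N. (psi k (real (rho u i) / real N))\<^sup>2) \<ge> real N / 2"
    using r Npos unfolding eq by (auto simp: field_simps)
qed

lemma sum_psi: assumes u: "u \<in> U" and k: "k \<in> {1..d}"
  shows "\<bar>\<Sum>i<N. psi k (real (rho u i) / real N)\<bar> \<le> B"
proof -
  have eq: "(\<Sum>i<N. psi k (real (rho u i) / real N)) = (\<Sum>i<N. psi k (real i / real N))"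
    by (rule sum.reindex_bij_betw[OF permutes_imp_bij[OF rho[OF u]]])
  show ?thesis unfolding eq by (rule rie1[OF k Npos(1)])
qed

text \<open>For fixed \<open>r\<close> the number of points of the second sample among the first
  \<open>r\<close> ranks is, after centring, a martingale sum with weights 0 and 1. With l = sqrt
  (\<Lambda> / N) the exponent is at most - 2 \<Lambda> + \<Lambda>, and a union bound pays for the
  N values of \<open>r\<close>.\<close>

lemma prob_rank_bad: assumes u: "u \<in> U"
  shows "EP N (\<lambda>\<pi>. of_bool (\<not> rank_good u (\<pi> ` {..<m}))) \<le> real N * (2 * (real N + 1) * exp (- \<Lambda>))"
proof -
  let ?c = "\<lambda>r i (S::nat set). of_bool (i < r) :: real"
  let ?\<tau> = "2 * sqrt (\<Lambda> * real N)"
  have bad: "of_bool (\<not> rank_good u (\<pi> ` {..<m})) \<le> (\<Sum>r<N. of_bool (\<bar>msum q N (?c r) (rho u ` (\<pi> ` {..<m}))\<bar> \<ge> ?\<tau>) :: real)"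
    if pi: "\<pi> permutes {..<N}" for \<pi>
  proof (cases "rank_good u (\<pi> ` {..<m})")
    case False
    let ?A = "\<pi> ` {..<m}"
    have A: "?A \<subseteq> {..<N}" using permutes_image[OF pi] Npos(3) by (metis image_mono lessThan_subset_iff)
    obtain r where r: "r < N" "\<bar>real (xc u ?A r) / real n - real r / real N\<bar> > \<delta>" using False unfolding rank_good_def by (auto simp: not_le)
    have "msum q N (?c r) (rho u ` ?A) = (\<Sum>i<N. (of_bool (i \<in> rho u ` ?A) - q) * of_bool (i < r))" unfolding msum_def ..
    also have "\<dots> = (\<Sum>i<r. (of_bool (i \<in> rho u ` ?A) - q))"
      using r by (intro sum.mono_neutral_cong_right) auto
    also have "\<dots> = real (card (rho u ` ?A \<inter> {..<r})) - q * real r"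
      by (simp add: sum_subtractf sum.If_cases of_bool_def Int_commute Int_def mult.commute)
    finally have ms: "msum q N (?c r) (rho u ` ?A) = real r * (1 - q) - real (xc u ?A r)"
      using xc_eq[OF u A, of r] r by (simp add: algebra_simps)
    have "real (xc u ?A r) / real n - real r / real N = - msum q N (?c r) (rho u ` ?A) / real n"
      unfolding ms q01 using Npos by (simp add: field_simps)
    then have "\<bar>msum q N (?c r) (rho u ` ?A)\<bar> / real n > \<delta>" using r by simp
    then have "\<bar>msum q N (?c r) (rho u ` ?A)\<bar> > \<delta> * real n" using Npos by (simp add: field_simps)
    moreover have "\<delta> * real n \<ge> ?\<tau>"
    proof -
      have "sqrt (\<Lambda> * real N) = sqrt (\<Lambda> / real N) * real N"
        using \<Lambda>1 Npos by (intro real_sqrt_unique) (auto simp: power_mult_distrib power2_eq_square[of "real N"])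
      then have "?\<tau> = 2 * sqrt (\<Lambda> / real N) * real N" by simp
      also have "\<dots> \<le> 2 * sqrt (\<Lambda> / real N) * (2 * real n)" using N m sqL by (intro mult_left_mono) auto
      finally show ?thesis unfolding \<delta>_def by simp
    qed
    ultimately have "of_bool (\<bar>msum q N (?c r) (rho u ` ?A)\<bar> \<ge> ?\<tau>) = (1::real)" by simp
    moreover have "of_bool (\<bar>msum q N (?c r) (rho u ` ?A)\<bar> \<ge> ?\<tau>) \<le> (\<Sum>r<N. of_bool (\<bar>msum q N (?c r) (rho u ` ?A)\<bar> \<ge> ?\<tau>) :: real)"
      using r(1) by (intro member_le_sum[where f="\<lambda>r. of_bool (\<bar>msum q N (?c r) (rho u ` ?A)\<bar> \<ge> ?\<tau>)"]) auto
    ultimately show ?thesis using False by simp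
  qed (simp add: sum_nonneg)
  have "EP N (\<lambda>\<pi>. of_bool (\<not> rank_good u (\<pi> ` {..<m}))) \<le> EP N (\<lambda>\<pi>. \<Sum>r<N. of_bool (\<bar>msum q N (?c r) (rho u ` (\<pi> ` {..<m}))\<bar> \<ge> ?\<tau>))"
    by (rule EP_mono) (rule bad)
  also have "\<dots> = (\<Sum>r<N. EP N (\<lambda>\<pi>. of_bool (\<bar>msum q N (?c r) (rho u ` (\<pi> ` {..<m}))\<bar> \<ge> ?\<tau>)))" by (rule EP_sum)
  also have "\<dots> \<le> (\<Sum>r<N. 2 * (real N + 1) * exp (- \<Lambda>))"
  proof (rule sum_mono)
    fix r
    show "EP N (\<lambda>\<pi>. of_bool (\<bar>msum q N (?c r) (rho u ` (\<pi> ` {..<m}))\<bar> \<ge> ?\<tau>)) \<le> 2 * (real N + 1) * exp (- \<Lambda>)"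
      unfolding q_def
    proof (rule EP_tail[OF Npos(3,1) rho[OF u], where b=1 and v="\<lambda>_. 1" and l="sqrt (\<Lambda> / real N)"])
      have "(sqrt (\<Lambda> / real N))\<^sup>2 * q * real N \<le> \<Lambda>"
        using mult_right_mono[OF q01(2), of \<Lambda>] sqL(2) \<Lambda>1 by (simp add: mult_ac)
      then show "- sqrt (\<Lambda> / real N) * ?\<tau> + (sqrt (\<Lambda> / real N))\<^sup>2 * (real m / real N) * (\<Sum>r<N. 1) \<le> - \<Lambda>"
        using sqL(1) unfolding q_def by simp
    qed (use sqL in auto)
  qed
  also have "\<dots> = real N * (2 * (real N + 1) * exp (- \<Lambda>))" by simp
  finally show ?thesis .
qed

text \<open>The clipped weights are at most B \<delta>, of order B sqrt (\<Lambda> / N). Their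
  squares sum to the order of B^2 \<Lambda>, so already deviations of order \<Lambda> B are
  exponentially rare, without a factor sqrt N. The parameter \<open>l\<close> equals 1 / (4
  B).\<close>

lemma prob_mart_bad: assumes u: "u \<in> U" and k: "k \<in> {1..d}"
  shows "EP N (\<lambda>\<pi>. of_bool (\<not> mart_good u k (\<pi> ` {..<m}))) \<le> 2 * (real N + 1) * exp (- \<Lambda>)"
proof -
  have "EP N (\<lambda>\<pi>. of_bool (\<not> mart_good u k (\<pi> ` {..<m}))) \<le> EP N (\<lambda>\<pi>. of_bool (\<bar>msum q N (mc k) (rho u ` (\<pi> ` {..<m}))\<bar> \<ge> 8 * \<Lambda> * B))"
    by (rule EP_mono) (auto simp: mart_good_def)
  also have "\<dots> \<le> 2 * (real N + 1) * exp (- \<Lambda>)"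
    unfolding q_def
  proof (rule EP_tail[OF Npos(3,1) rho[OF u], where b="B * \<delta>" and v="\<lambda>_. (B * \<delta>)\<^sup>2" and l="sqrt (\<Lambda> / real N) / (B * \<delta>)"])
    have Bd: "B * \<delta> > 0" using Bpos \<delta>0 by simp
    show "\<bar>mc k r S\<bar> \<le> B * \<delta>" if "r < N" for r S by (rule mc_bound[OF k that])
    show "(mc k r S)\<^sup>2 \<le> (B * \<delta>)\<^sup>2" if "r < N" for r S using power_mono[OF mc_bound[OF k that, of S], of 2] by simp
    show "0 < sqrt (\<Lambda> / real N) / (B * \<delta>)" "sqrt (\<Lambda> / real N) / (B * \<delta>) * (B * \<delta>) \<le> 1" using Bd sqL by auto
    have a: "(sqrt (\<Lambda> / real N) / (B * \<delta>))\<^sup>2 * q * (\<Sum>r<N. (B * \<delta>)\<^sup>2) \<le> \<Lambda>"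
    proof -
      have "(sqrt (\<Lambda> / real N) / (B * \<delta>))\<^sup>2 * q * (\<Sum>r<N. (B * \<delta>)\<^sup>2) = q * ((sqrt (\<Lambda> / real N))\<^sup>2 * real N)"
        using Bpos \<delta>0 Npos \<Lambda>1 by (simp add: power_divide)
      also have "\<dots> \<le> \<Lambda>" unfolding sqL(2) using q01 \<Lambda>1 by simp
      finally show ?thesis .
    qed
    have b: "sqrt (\<Lambda> / real N) / (B * \<delta>) * (8 * \<Lambda> * B) = 2 * \<Lambda>"
      unfolding \<delta>_def using Bpos sqL(4) Npos by simp
    show "- (sqrt (\<Lambda> / real N) / (B * \<delta>)) * (8 * \<Lambda> * B) + (sqrt (\<Lambda> / real N) / (B * \<delta>))\<^sup>2 * (real m / real N) * (\<Sum>r<N. (B * \<delta>)\<^sup>2) \<le> - \<Lambda>"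
      using a b unfolding q_def by linarith
  qed
  finally show ?thesis .
qed

text \<open>The weights are nonrandom, so the identity takes the place of a ranking. Only one of the
  two scores is bounded by B; the other enters through its sum of squares, at most 2 N. The exponent
  2 \<Lambda> pays for a union bound over pairs of coordinates.\<close>

lemma prob_cov_bad: assumes u: "u \<in> U" "u' \<in> U" and k: "k \<in> {1..d}" "k' \<in> {1..d}"
  shows "EP N (\<lambda>\<pi>. of_bool (\<not> cov_good u k u' k' (\<pi> ` {..<m}))) \<le> 2 * (real N + 1) * exp (- (2 * \<Lambda>))"
proof -
  define f where "f i = psi k (real (rho u i) / real N) * psi k' (real (rho u' i) / real N)" for i
  have fb: "\<bar>psi k' (real (rho u' i) / real N)\<bar> \<le> B" "\<bar>psi k (real (rho u i) / real N)\<bar> \<le> B" if "i < N" for i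
    using psiB k rho_le1 u that by auto
  have "EP N (\<lambda>\<pi>. of_bool (\<not> cov_good u k u' k' (\<pi> ` {..<m}))) \<le> EP N (\<lambda>\<pi>. of_bool (\<bar>msum q N (\<lambda>i _. f i) (id ` (\<pi> ` {..<m}))\<bar> \<ge> 4 * B * sqrt (\<Lambda> * real N)))"
    by (rule EP_mono) (auto simp: cov_good_def msum_def f_def)
  also have "\<dots> \<le> 2 * (real N + 1) * exp (- (2 * \<Lambda>))"
    unfolding q_def
  proof (rule EP_tail[OF Npos(3,1) permutes_id, where b="B * B" and v="\<lambda>i. B\<^sup>2 * (psi k (real (rho u i) / real N))\<^sup>2" and l="sqrt (\<Lambda> / real N) / B"])
    show "\<bar>f i\<bar> \<le> B * B" if "i < N" for i unfolding f_def abs_mult using fb[OF that] Bpos by (intro mult_mono) auto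
    show "(f i)\<^sup>2 \<le> B\<^sup>2 * (psi k (real (rho u i) / real N))\<^sup>2" if "i < N" for i
    proof -
      have "(psi k' (real (rho u' i) / real N))\<^sup>2 \<le> B\<^sup>2" using power_mono[OF fb(1)[OF that], of 2] by simp
      then have "(psi k (real (rho u i) / real N))\<^sup>2 * (psi k' (real (rho u' i) / real N))\<^sup>2 \<le> (psi k (real (rho u i) / real N))\<^sup>2 * B\<^sup>2" by (intro mult_left_mono) auto
      then show ?thesis unfolding f_def power_mult_distrib by (simp add: mult.commute)
    qed
    show "0 < sqrt (\<Lambda> / real N) / B" using sqL Bpos by simp
    show "sqrt (\<Lambda> / real N) / B * (B * B) \<le> 1" using \<Lambda>(5) Bpos by (simp add: mult.commute)
    have a: "(sqrt (\<Lambda> / real N) / B)\<^sup>2 * q * (\<Sum>i<N. B\<^sup>2 * (psi k (real (rho u i) / real N))\<^sup>2) \<le> 2 * \<Lambda>"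
    proof -
      have "(sqrt (\<Lambda> / real N) / B)\<^sup>2 * q * (\<Sum>i<N. B\<^sup>2 * (psi k (real (rho u i) / real N))\<^sup>2) = q * ((sqrt (\<Lambda> / real N))\<^sup>2 * (\<Sum>i<N. (psi k (real (rho u i) / real N))\<^sup>2))"
        unfolding sum_distrib_left[symmetric] power_divide using Bpos by simp
      also have "\<dots> \<le> 1 * ((sqrt (\<Lambda> / real N))\<^sup>2 * (2 * real N))"
        using q01 sum_psi_sq[OF u(1) k(1)] by (intro mult_mono mult_nonneg_nonneg sum_nonneg) auto
      also have "\<dots> = 2 * \<Lambda>" using sqL(2) by simp
      finally show ?thesis .
    qed
    have b: "sqrt (\<Lambda> / real N) / B * (4 * B * sqrt (\<Lambda> * real N)) = 4 * \<Lambda>" using sqL(1) Bpos by simp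
    show "- (sqrt (\<Lambda> / real N) / B) * (4 * B * sqrt (\<Lambda> * real N)) + (sqrt (\<Lambda> / real N) / B)\<^sup>2 * (real m / real N) * (\<Sum>r<N. B\<^sup>2 * (psi k (real (rho u r) / real N))\<^sup>2) \<le> - (2 * \<Lambda>)"
      using a b unfolding q_def by linarith
  qed
  finally show ?thesis .
qed

end

lemma one_le_sum_of_bool:
  assumes "finite X" "x \<in> X" "P x" shows "1 \<le> (\<Sum>x\<in>X. of_bool (P x) :: real)"
  using member_le_sum[of x X "\<lambda>x. of_bool (P x) :: real"] assms by simp

context rank_config begin

definition good :: "nat set \<Rightarrow> bool" where
  "good A \<longleftrightarrow> (\<forall>u\<in>U. rank_good u A) \<and> (\<forall>u\<in>U. \<forall>k\<in>{1..d}. mart_good u k A)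
     \<and> (\<forall>u\<in>U. \<forall>k\<in>{1..d}. \<forall>u'\<in>U. \<forall>k'\<in>{1..d}. cov_good u k u' k' A)"

text \<open>After the union bounds a factor exp (- \<Lambda> / 2) is left; being at most 1 / N^5 it
  absorbs the powers of N collected on the way.\<close>

lemma prob_bad: "EP N (\<lambda>\<pi>. of_bool (\<not> good (\<pi> ` {..<m}))) \<le> 12 / real N"
proof -
  let ?J = "U \<times> {1..d}"
  let ?A = "\<lambda>\<pi>. \<pi> ` {..<m}"
  have fJ: "finite ?J" using U by simp
  have cJ: "real (card ?J) \<le> exp (\<Lambda> / 2)" using \<Lambda>(3) by (simp add: card_cartesian_product)
  have cU: "real (card U) \<le> exp (\<Lambda> / 2)"
  proof -
    have "real (card U) * 1 \<le> real (card U) * real d" using d by (intro mult_left_mono) auto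
    then show ?thesis using \<Lambda>(3) by linarith
  qed
  have pt: "of_bool (\<not> good A) \<le> (\<Sum>u\<in>U. of_bool (\<not> rank_good u A)) + (\<Sum>j\<in>?J. of_bool (\<not> mart_good (fst j) (snd j) A))
     + (\<Sum>j\<in>?J \<times> ?J. of_bool (\<not> cov_good (fst (fst j)) (snd (fst j)) (fst (snd j)) (snd (snd j)) A) :: real)" for A
  proof (cases "good A")
    case True then show ?thesis by (simp add: sum_nonneg)
  next
    case False
    then consider u where "u \<in> U" "\<not> rank_good u A" | u k where "u \<in> U" "k \<in> {1..d}" "\<not> mart_good u k A"
      | u k u' k' where "u \<in> U" "k \<in> {1..d}" "u' \<in> U" "k' \<in> {1..d}" "\<not> cov_good u k u' k' A"
      unfolding good_def by blast
    then have "1 \<le> (\<Sum>u\<in>U. of_bool (\<not> rank_good u A) :: real) \<or> 1 \<le> (\<Sum>j\<in>?J. of_bool (\<not> mart_good (fst j) (snd j) A) :: real)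
      \<or> 1 \<le> (\<Sum>j\<in>?J \<times> ?J. of_bool (\<not> cov_good (fst (fst j)) (snd (fst j)) (fst (snd j)) (snd (snd j)) A) :: real)"
    proof cases
      case (1 u) then show ?thesis using one_le_sum_of_bool[OF U(1), of u "\<lambda>u. \<not> rank_good u A"] by simp
    next
      case (2 u k) then show ?thesis
        using one_le_sum_of_bool[OF fJ, of "(u, k)" "\<lambda>j. \<not> mart_good (fst j) (snd j) A"] by simp
    next
      case (3 u k u' k') then show ?thesis
        using one_le_sum_of_bool[OF finite_cartesian_product[OF fJ fJ], of "((u, k), (u', k'))"
          "\<lambda>j. \<not> cov_good (fst (fst j)) (snd (fst j)) (fst (snd j)) (snd (snd j)) A"] by simp
    qed
    moreover have "0 \<le> (\<Sum>u\<in>U. of_bool (\<not> rank_good u A) :: real)" "0 \<le> (\<Sum>j\<in>?J. of_bool (\<not> mart_good (fst j) (snd j) A) :: real)"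
      "0 \<le> (\<Sum>j\<in>?J \<times> ?J. of_bool (\<not> cov_good (fst (fst j)) (snd (fst j)) (fst (snd j)) (snd (snd j)) A) :: real)"
      by (intro sum_nonneg; simp)+
    ultimately show ?thesis using False by (elim disjE) simp_all
  qed
  let ?e = "exp (- \<Lambda> / 2)"
  have e1: "exp (- \<Lambda>) = ?e * ?e" "exp (\<Lambda> / 2) * ?e = 1" "exp (- (2 * \<Lambda>)) = ?e * ?e * (?e * ?e)" by (simp_all flip: exp_add)
  have e01: "0 < ?e" "?e \<le> 1" using \<Lambda>1 by auto
  have "EP N (\<lambda>\<pi>. of_bool (\<not> good (?A \<pi>))) \<le> EP N (\<lambda>\<pi>. (\<Sum>u\<in>U. of_bool (\<not> rank_good u (?A \<pi>))) + (\<Sum>j\<in>?J. of_bool (\<not> mart_good (fst j) (snd j) (?A \<pi>)))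
     + (\<Sum>j\<in>?J \<times> ?J. of_bool (\<not> cov_good (fst (fst j)) (snd (fst j)) (fst (snd j)) (snd (snd j)) (?A \<pi>))))"
    by (rule EP_mono) (rule pt)
  also have "\<dots> = (\<Sum>u\<in>U. EP N (\<lambda>\<pi>. of_bool (\<not> rank_good u (?A \<pi>)))) + (\<Sum>j\<in>?J. EP N (\<lambda>\<pi>. of_bool (\<not> mart_good (fst j) (snd j) (?A \<pi>))))
     + (\<Sum>j\<in>?J \<times> ?J. EP N (\<lambda>\<pi>. of_bool (\<not> cov_good (fst (fst j)) (snd (fst j)) (fst (snd j)) (snd (snd j)) (?A \<pi>))))"
    unfolding EP_add EP_sum ..
  also have "\<dots> \<le> (\<Sum>u\<in>U. real N * (2 * (real N + 1) * exp (- \<Lambda>))) + (\<Sum>j\<in>?J. 2 * (real N + 1) * exp (- \<Lambda>)) + (\<Sum>j\<in>?J \<times> ?J. 2 * (real N + 1) * exp (- (2 * \<Lambda>)))"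
    by (intro add_mono sum_mono prob_rank_bad prob_mart_bad prob_cov_bad) auto
  also have "\<dots> = 2 * (real N + 1) * (real N * (real (card U) * exp (- \<Lambda>)) + real (card ?J) * exp (- \<Lambda>) + real (card ?J) * real (card ?J) * exp (- (2 * \<Lambda>)))"
    by (simp add: algebra_simps card_cartesian_product)
  also have "\<dots> \<le> 2 * (real N + 1) * (real N * ?e + ?e + ?e)"
  proof (intro mult_left_mono add_mono)
    have A: "x * exp (- \<Lambda>) \<le> ?e" if "x \<le> exp (\<Lambda> / 2)" for x
    proof -
      have "x * exp (- \<Lambda>) \<le> exp (\<Lambda> / 2) * (?e * ?e)" unfolding e1(1) using that by (intro mult_right_mono) auto
      then show ?thesis using e1(2) by (simp flip: mult.assoc)
    qed
    show "real (card U) * exp (- \<Lambda>) \<le> ?e" "real (card ?J) * exp (- \<Lambda>) \<le> ?e" using A cU cJ by auto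
    have "real (card ?J) * real (card ?J) * exp (- (2 * \<Lambda>)) = (real (card ?J) * exp (- \<Lambda>)) * (real (card ?J) * exp (- \<Lambda>))"
      by (simp add: exp_add[symmetric])
    also have "\<dots> \<le> ?e * 1" using A[OF cJ] order_trans[OF A[OF cJ] e01(2)] e01 by (intro mult_mono) auto
    finally show "real (card ?J) * real (card ?J) * exp (- (2 * \<Lambda>)) \<le> ?e" by simp
  qed auto
  also have "\<dots> = 2 * (real N + 1) * (real N + 2) * ?e" by (simp add: algebra_simps)
  also have "\<dots> \<le> 2 * (2 * real N) * (3 * real N) * (1 / real N ^ 5)"
    using \<Lambda>(4) Npos by (intro mult_mono) auto
  also have "\<dots> = 12 / real N ^ 3" using Npos by (simp add: power_def eval_nat_numeral field_simps)
  also have "\<dots> \<le> 12 / real N ^ 1" using Npos by (intro divide_left_mono power_increasing) auto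
  finally show ?thesis by simp
qed

text \<open>The 128 splits into 120 for replacing pooled ranks by counts of the first sample in both
  scores and 8 for restricting the sum from the pool to the first sample, which
  \<open>cov_good\<close> controls.\<close>

lemma cov_close:
  assumes A: "A \<subseteq> {..<N}" "card A = m" and g: "good A" and c: "cnt_ok A"
    and u: "u \<in> U" "u' \<in> U" and k: "k \<in> {1..d}" "k' \<in> {1..d}"
  shows "\<bar>(\<Sum>i<N. psi k (real (rho u i) / real N) * psi k' (real (rho u' i) / real N)) / real N
      - (\<Sum>i\<in>{..<N} - A. psi k (real (cnt u A i) / real n) * psi k' (real (cnt u' A i) / real n)) / real n\<bar> \<le> 128 * B * sqrt (\<Lambda> / real N)"
proof -
  let ?s = "sqrt (\<Lambda> / real N)"
  define x where "x k u i = psi k (real (rho u i) / real N)" for k u i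
  define y where "y k u i = psi k (real (cnt u A i) / real n)" for k u i
  have s: "?s > 0" "?s \<le> 1" by (rule sqL)+
  have Bs: "B * ?s \<le> 1" by (rule \<Lambda>(5))
  \<comment> \<open>6 = 4 + 2: the deviation \<delta>, and the ties, since p / n is at most 2 sqrt
    (\<Lambda> / N).\<close>
  have close: "\<bar>y k u i - x k u i\<bar> \<le> 6 * (B * ?s)" if "u \<in> U" "k \<in> {1..d}" "i < N" for u k i
  proof -
    have ri: "rho u i < N" using permutes_in_image[OF rho[OF that(1)], of i] that by auto
    have r: "\<bar>real (xc u A (rho u i)) / real n - real (rho u i) / real N\<bar> \<le> \<delta>"
      using g that ri unfolding good_def rank_good_def by blast
    have c': "xc u A (rho u i) \<le> cnt u A i" "cnt u A i \<le> xc u A (rho u i) + p" "cnt u A i \<le> n"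
      using c that unfolding cnt_ok_def by auto
    have "\<bar>real (cnt u A i) / real n - real (xc u A (rho u i)) / real n\<bar> \<le> real p / real n"
      using c' Npos by (auto simp: abs_le_iff diff_divide_distrib[symmetric] divide_le_cancel)
    also have "real p / real n \<le> 2 * ?s"
    proof -
      have "real p / real n \<le> \<Lambda> / (real N / 2)" using \<Lambda> N m Npos by (intro frac_le) auto
      also have "\<dots> = 2 * (\<Lambda> / real N)" by simp
      also have "\<Lambda> / real N = ?s * ?s" using \<Lambda>1 Npos by simp
      also have "?s * ?s \<le> ?s * 1" using s by (intro mult_left_mono) auto
      finally show ?thesis by simp
    qed
    finally have "\<bar>real (cnt u A i) / real n - real (rho u i) / real N\<bar> \<le> 6 * ?s" using r unfolding \<delta>_def by linarith
    moreover have "\<bar>y k u i - x k u i\<bar> \<le> B * \<bar>real (cnt u A i) / real n - real (rho u i) / real N\<bar>"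
      unfolding x_def y_def using that c' Npos rho_le1[OF that(1,3)] by (intro lip) auto
    ultimately have "\<bar>y k u i - x k u i\<bar> \<le> B * (6 * ?s)"
      using Bpos by (meson mult_left_mono order_trans less_imp_le)
    then show ?thesis by simp
  qed
  \<comment> \<open>The scores are nearly normalised, so |x| <= (1 + x^2) / 2 bounds their absolute
    sum without a factor B. Bounding them by B would make the final error quadratic in B.\<close>
  have l1: "(\<Sum>i\<in>{..<N} - A. \<bar>x k u i\<bar>) \<le> 2 * real N" if "u \<in> U" "k \<in> {1..d}" for u k
  proof -
    have "(\<Sum>i\<in>{..<N} - A. \<bar>x k u i\<bar>) \<le> (\<Sum>i<N. \<bar>x k u i\<bar>)" by (rule sum_mono2) auto
    also have "\<dots> \<le> (\<Sum>i<N. (1 + (x k u i)\<^sup>2) / 2)"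
    proof (rule sum_mono)
      fix i
      have "0 \<le> (\<bar>x k u i\<bar> - 1)\<^sup>2" by simp
      then show "\<bar>x k u i\<bar> \<le> (1 + (x k u i)\<^sup>2) / 2" by (simp add: power2_eq_square algebra_simps abs_mult_self_eq)
    qed
    also have "\<dots> = (real N + (\<Sum>i<N. (x k u i)\<^sup>2)) / 2" by (simp add: sum.distrib flip: sum_divide_distrib)
    also have "\<dots> \<le> 2 * real N" using sum_psi_sq(1)[OF that] unfolding x_def by simp
    finally show ?thesis .
  qed
  let ?I = "{..<N} - A"
  let ?t = "6 * (B * ?s)"
  have t0: "?t \<ge> 0" "?t \<le> 6" using Bpos s Bs by auto
  have cI: "card ?I = n" using A N finite_subset[OF A(1)] by (simp add: card_Diff_subset)
  have "\<bar>(\<Sum>i\<in>?I. y k u i * y k' u' i) - (\<Sum>i\<in>?I. x k u i * x k' u' i)\<bar> \<le> (\<Sum>i\<in>?I. ?t * \<bar>x k' u' i\<bar> + ?t * \<bar>x k u i\<bar> + ?t * ?t)"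
    unfolding sum_subtractf[symmetric]
  proof (rule order_trans[OF sum_abs sum_mono])
    fix i assume i: "i \<in> ?I"
    let ?d = "y k u i - x k u i" and ?d' = "y k' u' i - x k' u' i"
    have d: "\<bar>?d\<bar> \<le> ?t" "\<bar>?d'\<bar> \<le> ?t" using i close u k by auto
    have "y k u i * y k' u' i - x k u i * x k' u' i = ?d * x k' u' i + x k u i * ?d' + ?d * ?d'" by (simp add: algebra_simps)
    then have "\<bar>y k u i * y k' u' i - x k u i * x k' u' i\<bar> \<le> \<bar>?d\<bar> * \<bar>x k' u' i\<bar> + \<bar>x k u i\<bar> * \<bar>?d'\<bar> + \<bar>?d\<bar> * \<bar>?d'\<bar>"
      unfolding abs_mult[symmetric] by linarith
    also have "\<dots> \<le> ?t * \<bar>x k' u' i\<bar> + \<bar>x k u i\<bar> * ?t + ?t * ?t"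
      using d t0 by (intro add_mono mult_mono) auto
    finally show "\<bar>y k u i * y k' u' i - x k u i * x k' u' i\<bar> \<le> ?t * \<bar>x k' u' i\<bar> + ?t * \<bar>x k u i\<bar> + ?t * ?t" by (simp add: mult.commute)
  qed
  also have "\<dots> = ?t * (\<Sum>i\<in>?I. \<bar>x k' u' i\<bar>) + ?t * (\<Sum>i\<in>?I. \<bar>x k u i\<bar>) + ?t * (?t * real n)"
    by (simp add: sum.distrib sum_distrib_left cI del: card_Diff_subset)
  also have "\<dots> \<le> ?t * (2 * real N) + ?t * (2 * real N) + ?t * (6 * real N)"
    using t0 l1 u k N by (intro add_mono mult_left_mono mult_mono) auto
  also have "\<dots> = 60 * (B * ?s) * real N" by simp
  also have "\<dots> \<le> 60 * (B * ?s) * (2 * real n)" using N m Bpos s by (intro mult_left_mono) auto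
  finally have e1: "\<bar>(\<Sum>i\<in>?I. y k u i * y k' u' i) - (\<Sum>i\<in>?I. x k u i * x k' u' i)\<bar> \<le> 120 * (B * ?s) * real n" by simp
  let ?c = "\<lambda>i. x k u i * x k' u' i"
  have M: "\<bar>\<Sum>i<N. (of_bool (i \<in> A) - q) * ?c i\<bar> \<le> 4 * B * sqrt (\<Lambda> * real N)"
    using g u k unfolding good_def cov_good_def x_def by blast
  have split: "(\<Sum>i<N. ?c i) = (\<Sum>i\<in>A. ?c i) + (\<Sum>i\<in>?I. ?c i)"
    using sum.subset_diff[OF A(1), of ?c] by simp
  have "(\<Sum>i<N. (of_bool (i \<in> A) - q) * ?c i) = (\<Sum>i\<in>A. ?c i) - q * (\<Sum>i<N. ?c i)"
  proof -
    have "(\<Sum>i<N. of_bool (i \<in> A) * ?c i) = (\<Sum>i\<in>A. ?c i)"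
      using A by (intro sum.mono_neutral_cong_right) auto
    then show ?thesis by (simp add: left_diff_distrib sum_subtractf sum_distrib_left)
  qed
  then have "(\<Sum>i\<in>?I. ?c i) = (1 - q) * (\<Sum>i<N. ?c i) - (\<Sum>i<N. (of_bool (i \<in> A) - q) * ?c i)"
    using split by (simp add: algebra_simps)
  then have e2: "(\<Sum>i\<in>?I. ?c i) / real n = (\<Sum>i<N. ?c i) / real N - (\<Sum>i<N. (of_bool (i \<in> A) - q) * ?c i) / real n"
    unfolding q01(3) using Npos by (simp add: diff_divide_distrib)
  have "sqrt (\<Lambda> * real N) = ?s * real N"
    using \<Lambda>1 Npos by (intro real_sqrt_unique) (auto simp: power_mult_distrib power2_eq_square[of "real N"])
  also have "\<dots> \<le> ?s * (2 * real n)" using N m s by (intro mult_left_mono) auto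
  finally have "4 * B * sqrt (\<Lambda> * real N) \<le> 4 * B * (?s * (2 * real n))" using Bpos by (intro mult_left_mono) auto
  then have M': "\<bar>\<Sum>i<N. (of_bool (i \<in> A) - q) * ?c i\<bar> / real n \<le> 8 * (B * ?s)"
    using M Npos by (simp add: field_simps)
  have e1': "\<bar>(\<Sum>i\<in>?I. y k u i * y k' u' i) / real n - (\<Sum>i\<in>?I. ?c i) / real n\<bar> \<le> 120 * (B * ?s)"
    using e1 Npos by (simp add: diff_divide_distrib[symmetric] field_simps)
  have "\<bar>(\<Sum>i<N. ?c i) / real N - (\<Sum>i\<in>?I. y k u i * y k' u' i) / real n\<bar> \<le> 128 * (B * ?s)"
  proof -
    have "\<bar>(\<Sum>i<N. (of_bool (i \<in> A) - q) * ?c i) / real n\<bar> \<le> 8 * (B * ?s)" using M' by simp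
    then show ?thesis using e1' e2 by linarith
  qed
  then show ?thesis unfolding x_def y_def by simp
qed

section \<open>Coupling of Bernoulli and uniform subsets\<close>

definition Ev :: "real \<Rightarrow> nat set \<Rightarrow> bool" where
  "Ev t A \<longleftrightarrow> (\<exists>u\<in>U. \<exists>k\<in>{1..d}. sqrt (real N / (real n * real m)) * \<bar>Sl u k A\<bar> \<ge> t)"

text \<open>A Bernoulli subset has size within \<open>Kd\<close> of \<open>m\<close> with high probability. Conditionally on its size it is
  coupled with a uniform \<open>m\<close>-subset by adding or deleting a random block.\<close>

definition Kd :: real where "Kd = sqrt (real N) * ln (real N)"

text \<open>Normalised bound on the change of a linear rank statistic when at most \<open>Kd\<close>
  random points join or leave the subset: sqrt (Kd \<Lambda>) is the Gaussian part of a Bernstein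
  bound, \<Lambda> B the part due to the range of the scores.\<close>

definition wc :: real where "wc = sqrt (real N / (real n * real m)) * (5 * \<Lambda> * B + 4 * sqrt (Kd * \<Lambda>))"

lemma Kd0: "Kd \<ge> 0" unfolding Kd_def using Npos by simp

definition Yb :: "'u \<Rightarrow> nat \<Rightarrow> nat set \<Rightarrow> real" where
  "Yb u k A = (\<Sum>i\<in>A. psi k (real (rho u i) / real N))"

lemma Sl_Yb: assumes "A \<subseteq> {..<N}" shows "Sl u k A = Yb u k A - q * Yb u k {..<N}"
proof -
  have "(\<Sum>i<N. of_bool (i \<in> A) * psi k (real (rho u i) / real N)) = Yb u k A"
    unfolding Yb_def using assms by (intro sum.mono_neutral_cong_right) auto
  then show ?thesis unfolding Sl_def by (simp add: left_diff_distrib sum_subtractf sum_distrib_left Yb_def)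
qed

text \<open>By \<open>EP_image\<close> the block may be taken to be an initial segment, so its image
  is a uniform subset of size hi - lo. The parameter l = 1 / (B + sqrt (Kd / \<Lambda>)) balances
  range and variance. Centring the block sum costs at most B, which is why 5 \<Lambda> B faces 4
  \<Lambda> B in \<tau>.\<close>

lemma prob_block_bad:
  assumes u: "u \<in> U" and k: "k \<in> {1..d}" and lh: "lo \<le> hi" "hi \<le> N" "real (hi - lo) \<le> Kd"
  shows "EP N (\<lambda>\<pi>. of_bool (\<bar>Yb u k (\<pi> ` {lo..<hi})\<bar> > 5 * \<Lambda> * B + 4 * sqrt (Kd * \<Lambda>))) \<le> 2 * (real N + 1) * exp (- (2 * \<Lambda>))"
proof (cases "Kd = 0")
  case True
  then have "hi - lo = 0" using lh by simp
  then have "lo = hi" using lh by simp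
  then have "EP N (\<lambda>\<pi>. of_bool (\<bar>Yb u k (\<pi> ` {lo..<hi})\<bar> > 5 * \<Lambda> * B + 4 * sqrt (Kd * \<Lambda>))) = 0"
    using Bpos \<Lambda>1 True by (simp add: Yb_def EP_const not_less)
  then show ?thesis by simp
next
  case False
  then have K: "Kd > 0" using Kd0 by simp
  let ?s = "hi - lo"
  define f where "f i = psi k (real (rho u i) / real N)" for i
  define \<tau> where "\<tau> = 4 * \<Lambda> * B + 4 * sqrt (Kd * \<Lambda>)"
  define l where "l = 1 / (B + sqrt (Kd / \<Lambda>))"
  have sN: "?s \<le> N" using lh by simp
  have sq: "\<Lambda> * sqrt (Kd / \<Lambda>) = sqrt (Kd * \<Lambda>)"
    using \<Lambda>1 K by (intro real_sqrt_unique[symmetric]) (auto simp: power_mult_distrib power2_eq_square[of \<Lambda>])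
  have den: "B + sqrt (Kd / \<Lambda>) > 0" using Bpos K \<Lambda>1 by (intro add_pos_pos) auto
  have fB: "\<bar>f i\<bar> \<le> B" if "i < N" for i unfolding f_def using psiB[OF k rho_le1[OF u that]] .
  have "EP N (\<lambda>\<pi>. of_bool (\<bar>Yb u k (\<pi> ` {lo..<hi})\<bar> > 5 * \<Lambda> * B + 4 * sqrt (Kd * \<Lambda>)))
     = EP N (\<lambda>\<pi>. of_bool (\<bar>Yb u k (\<pi> ` {..<?s})\<bar> > 5 * \<Lambda> * B + 4 * sqrt (Kd * \<Lambda>)))"
    by (rule EP_image[where F="\<lambda>A. of_bool (\<bar>Yb u k A\<bar> > 5 * \<Lambda> * B + 4 * sqrt (Kd * \<Lambda>))"]) (use lh in auto)
  also have "\<dots> \<le> EP N (\<lambda>\<pi>. of_bool (\<bar>msum (real ?s / real N) N (\<lambda>i _. f i) (id ` (\<pi> ` {..<?s}))\<bar> \<ge> \<tau>))"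
  proof (rule EP_mono)
    fix \<pi> assume pi: "\<pi> permutes {..<N}"
    let ?A = "\<pi> ` {..<?s}"
    have A: "?A \<subseteq> {..<N}" using permutes_image[OF pi] sN by (metis image_mono lessThan_subset_iff)
    have "(\<Sum>i<N. of_bool (i \<in> ?A) * f i) = Yb u k ?A"
      unfolding Yb_def f_def using A by (intro sum.mono_neutral_cong_right) auto
    then have ms: "msum (real ?s / real N) N (\<lambda>i _. f i) ?A = Yb u k ?A - real ?s / real N * (\<Sum>i<N. f i)"
      unfolding msum_def by (simp add: left_diff_distrib sum_subtractf sum_distrib_left)
    define X where "X = real ?s / real N * (\<Sum>i<N. f i)"
    have "\<bar>X\<bar> \<le> 1 * B"
      unfolding X_def abs_mult using sum_psi[OF u k] sN Npos by (intro mult_mono) (auto simp: f_def)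
    moreover have "B \<le> \<Lambda> * B" using \<Lambda>1 Bpos by simp
    ultimately have "\<bar>msum (real ?s / real N) N (\<lambda>i _. f i) ?A\<bar> \<ge> \<tau>" if "\<bar>Yb u k ?A\<bar> > 5 * \<Lambda> * B + 4 * sqrt (Kd * \<Lambda>)"
      using that unfolding ms X_def[symmetric] \<tau>_def mult.assoc by linarith
    then show "of_bool (\<bar>Yb u k ?A\<bar> > 5 * \<Lambda> * B + 4 * sqrt (Kd * \<Lambda>)) \<le> (of_bool (\<bar>msum (real ?s / real N) N (\<lambda>i _. f i) (id ` ?A)\<bar> \<ge> \<tau>) :: real)"
      by simp
  qed
  also have "\<dots> \<le> 2 * (real N + 1) * exp (- (2 * \<Lambda>))"
  proof (rule EP_tail[OF sN Npos(1) permutes_id, where b=B and v="\<lambda>i. (f i)\<^sup>2" and l=l])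
    show "0 < l" unfolding l_def using den by simp
    show "l * B \<le> 1" unfolding l_def using den K \<Lambda>1 by simp
    have "l * \<tau> = 4 * \<Lambda>"
    proof -
      have "\<tau> = 4 * \<Lambda> * (B + sqrt (Kd / \<Lambda>))" unfolding \<tau>_def by (simp add: algebra_simps sq)
      then show ?thesis unfolding l_def using den by simp
    qed
    moreover have "l\<^sup>2 * (real ?s / real N) * (\<Sum>i<N. (f i)\<^sup>2) \<le> 2 * \<Lambda>"
    proof -
      have "l\<^sup>2 \<le> (1 / sqrt (Kd / \<Lambda>))\<^sup>2"
        unfolding l_def using Bpos K \<Lambda>1 den by (intro power_mono divide_left_mono mult_pos_pos) auto
      then have l2: "l\<^sup>2 \<le> \<Lambda> / Kd" using K \<Lambda>1 by (simp add: power_divide)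
      have "l\<^sup>2 * (real ?s / real N) * (\<Sum>i<N. (f i)\<^sup>2) \<le> (\<Lambda> / Kd) * (Kd / real N) * (2 * real N)"
        using l2 lh(3) sum_psi_sq(1)[OF u k] K \<Lambda>1 unfolding f_def
        by (intro mult_mono divide_right_mono sum_nonneg) auto
      also have "\<dots> = 2 * \<Lambda>" using K Npos by simp
      finally show ?thesis .
    qed
    ultimately show "- l * \<tau> + l\<^sup>2 * (real ?s / real N) * (\<Sum>r<N. (f r)\<^sup>2) \<le> - (2 * \<Lambda>)" by linarith
  qed (use fB in auto)
  finally show ?thesis .
qed

text \<open>One permutation generates both subsets as images of nested initial segments, so they
  differ by the image of a block. The centring uses \<open>q\<close> for both sizes and
  cancels.\<close>

lemma block_coupling:
  assumes s: "s \<le> N" "s' \<le> N" "\<bar>real s - real s'\<bar> \<le> Kd"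
  shows "EP N (\<lambda>\<pi>. of_bool (Ev t (\<pi> ` {..<s}))) \<le> EP N (\<lambda>\<pi>. of_bool (Ev (t - wc) (\<pi> ` {..<s'}))) + 4 / real N"
proof -
  let ?J = "U \<times> {1..d}"
  let ?lo = "min s s'" and ?hi = "max s s'"
  let ?\<tau> = "5 * \<Lambda> * B + 4 * sqrt (Kd * \<Lambda>)"
  let ?r = "sqrt (real N / (real n * real m))"
  have lh: "?lo \<le> ?hi" "?hi \<le> N" "real (?hi - ?lo) \<le> Kd" using s by (auto simp: max_def min_def of_nat_diff)
  have pt: "of_bool (Ev t (\<pi> ` {..<s})) \<le> of_bool (Ev (t - wc) (\<pi> ` {..<s'})) + (\<Sum>j\<in>?J. of_bool (\<bar>Yb (fst j) (snd j) (\<pi> ` {?lo..<?hi})\<bar> > ?\<tau>) :: real)"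
    if pi: "\<pi> permutes {..<N}" for \<pi>
  proof (cases "Ev t (\<pi> ` {..<s})")
    case True
    then obtain u k where uk: "u \<in> U" "k \<in> {1..d}" "?r * \<bar>Sl u k (\<pi> ` {..<s})\<bar> \<ge> t" unfolding Ev_def by blast
    have inj: "inj \<pi>" using pi permutes_inj by blast
    have sub: "\<pi> ` {..<x} \<subseteq> {..<N}" if "x \<le> N" for x using permutes_image[OF pi] that by (metis image_mono lessThan_subset_iff)
    have Yd: "Yb u k (\<pi> ` {..<?hi}) = Yb u k (\<pi> ` {..<?lo}) + Yb u k (\<pi> ` {?lo..<?hi})"
    proof -
      have "{..<?hi} = {..<?lo} \<union> {?lo..<?hi}" by auto
      then have "\<pi> ` {..<?hi} = \<pi> ` {..<?lo} \<union> \<pi> ` {?lo..<?hi}" by (metis image_Un)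
      moreover have "\<pi> ` {..<?lo} \<inter> \<pi> ` {?lo..<?hi} = {}" using inj by (auto simp: inj_eq)
      ultimately show ?thesis unfolding Yb_def by (simp add: sum.union_disjoint)
    qed
    have dY: "\<bar>Sl u k (\<pi> ` {..<s}) - Sl u k (\<pi> ` {..<s'})\<bar> = \<bar>Yb u k (\<pi> ` {?lo..<?hi})\<bar>"
      unfolding Sl_Yb[OF sub[OF s(1)]] Sl_Yb[OF sub[OF s(2)]] using Yd by (cases "s \<le> s'") (auto simp: min_def max_def)
    show ?thesis
    proof (cases "\<bar>Yb u k (\<pi> ` {?lo..<?hi})\<bar> > ?\<tau>")
      case True
      have "of_bool (\<bar>Yb u k (\<pi> ` {?lo..<?hi})\<bar> > ?\<tau>) \<le> (\<Sum>j\<in>?J. of_bool (\<bar>Yb (fst j) (snd j) (\<pi> ` {?lo..<?hi})\<bar> > ?\<tau>) :: real)"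
        using member_le_sum[of "(u, k)" ?J "\<lambda>j. of_bool (\<bar>Yb (fst j) (snd j) (\<pi> ` {?lo..<?hi})\<bar> > ?\<tau>) :: real"] uk U by auto
      then show ?thesis using True by (auto simp: of_bool_def split: if_splits)
    next
      case False
      have "\<bar>Sl u k (\<pi> ` {..<s'})\<bar> \<ge> \<bar>Sl u k (\<pi> ` {..<s})\<bar> - ?\<tau>" using dY False by linarith
      then have "?r * \<bar>Sl u k (\<pi> ` {..<s'})\<bar> \<ge> ?r * (\<bar>Sl u k (\<pi> ` {..<s})\<bar> - ?\<tau>)" by (intro mult_left_mono) auto
      then have "?r * \<bar>Sl u k (\<pi> ` {..<s'})\<bar> \<ge> t - wc" using uk(3) unfolding wc_def by (simp add: right_diff_distrib)
      then have "Ev (t - wc) (\<pi> ` {..<s'})" unfolding Ev_def using uk by blast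
      then show ?thesis by (simp add: sum_nonneg)
    qed
  qed (simp add: sum_nonneg)
  have "EP N (\<lambda>\<pi>. of_bool (Ev t (\<pi> ` {..<s}))) \<le> EP N (\<lambda>\<pi>. of_bool (Ev (t - wc) (\<pi> ` {..<s'})) + (\<Sum>j\<in>?J. of_bool (\<bar>Yb (fst j) (snd j) (\<pi> ` {?lo..<?hi})\<bar> > ?\<tau>)))"
    by (rule EP_mono) (rule pt)
  also have "\<dots> = EP N (\<lambda>\<pi>. of_bool (Ev (t - wc) (\<pi> ` {..<s'}))) + (\<Sum>j\<in>?J. EP N (\<lambda>\<pi>. of_bool (\<bar>Yb (fst j) (snd j) (\<pi> ` {?lo..<?hi})\<bar> > ?\<tau>)))"
    unfolding EP_add EP_sum ..
  also have "(\<Sum>j\<in>?J. EP N (\<lambda>\<pi>. of_bool (\<bar>Yb (fst j) (snd j) (\<pi> ` {?lo..<?hi})\<bar> > ?\<tau>))) \<le> (\<Sum>j\<in>?J. 2 * (real N + 1) * exp (- (2 * \<Lambda>)))"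
    by (intro sum_mono prob_block_bad lh) auto
  also have "\<dots> = 2 * (real N + 1) * (real (card U) * real d * exp (- (2 * \<Lambda>)))" by (simp add: card_cartesian_product)
  also have "\<dots> \<le> 2 * (2 * real N) * (1 / real N ^ 5)"
  proof (intro mult_mono)
    have "real (card U) * real d * exp (- (2 * \<Lambda>)) \<le> exp (\<Lambda> / 2) * exp (- (2 * \<Lambda>))" using \<Lambda>(3) by (intro mult_right_mono) auto
    also have "\<dots> \<le> exp (- \<Lambda> / 2)" using \<Lambda>1 by (simp flip: exp_add)
    also have "\<dots> \<le> 1 / real N ^ 5" by (rule \<Lambda>(4))
    finally show "real (card U) * real d * exp (- (2 * \<Lambda>)) \<le> 1 / real N ^ 5" .
  qed (use Npos in auto)
  also have "\<dots> = 4 / real N ^ 4" using Npos by (simp add: power_def eval_nat_numeral field_simps)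
  also have "\<dots> \<le> 4 / real N ^ 1" using Npos by (intro divide_left_mono power_increasing) auto
  finally show ?thesis by simp
qed

text \<open>The deviation of the size is the martingale sum with unit weights. With l = 1 / sqrt N
  the exponent becomes q - ln N, and 2 exp q is at most 6.\<close>

lemma prob_size_bad: "EB N q (\<lambda>A. of_bool (\<bar>real (card A) - real m\<bar> > Kd)) \<le> 6 / real N"
proof -
  let ?l = "1 / sqrt (real N)"
  have N1: "real N \<ge> 1" using Npos by linarith
  have "EB N q (\<lambda>A. of_bool (\<bar>real (card A) - real m\<bar> > Kd)) \<le> EB N q (\<lambda>A. of_bool (\<bar>msum q N (\<lambda>_ _. 1) A\<bar> \<ge> Kd))"
  proof (rule EB_mono[OF q01(1,2)])
    fix A assume A: "A \<subseteq> {..<N}"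
    have "msum q N (\<lambda>_ _. 1) A = (\<Sum>i<N. of_bool (i \<in> A)) - q * real N" unfolding msum_def by (simp add: sum_subtractf mult.commute)
    also have "(\<Sum>i<N. of_bool (i \<in> A) :: real) = real (card A)" using A by (simp add: sum.If_cases of_bool_def Int_absorb1)
    also have "q * real N = real m" unfolding q_def using Npos by simp
    finally show "of_bool (\<bar>real (card A) - real m\<bar> > Kd) \<le> (of_bool (\<bar>msum q N (\<lambda>_ _. 1) A\<bar> \<ge> Kd) :: real)" by simp
  qed
  also have "\<dots> \<le> 2 * exp (- ?l * Kd + ?l\<^sup>2 * q * (\<Sum>r<N. 1))"
    by (rule EB_tail[OF q01(1,2), where b=1]) (use N1 in auto)
  also have "- ?l * Kd + ?l\<^sup>2 * q * (\<Sum>r<N. 1) = q - ln (real N)" unfolding Kd_def using Npos by (simp add: power_divide)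
  also have "exp (q - ln (real N)) = exp q / real N" using Npos by (simp add: exp_diff)
  also have "exp q \<le> 3"
  proof -
    have "exp q \<le> exp 1" using q01 by simp
    then show ?thesis using exp_le by linarith
  qed
  finally show ?thesis using Npos by (simp add: divide_right_mono)
qed

lemma binom_sum1: "(\<Sum>s\<le>N. real (N choose s) * q ^ s * (1 - q) ^ (N - s)) = 1"
  using binomial_ring[of q "1 - q" N] by simp

text \<open>Both directions average \<open>block_coupling\<close> over the binomial size: 4 / N
  comes from the block, 6 / N from sizes further than \<open>Kd\<close> from m.\<close>

lemma EP_le_EB_coupled: "EP N (\<lambda>\<pi>. of_bool (Ev t (\<pi> ` {..<m}))) \<le> EB N q (\<lambda>A. of_bool (Ev (t - wc) A)) + 10 / real N"
  and EB_le_EP_coupled: "EB N q (\<lambda>A. of_bool (Ev t A)) \<le> EP N (\<lambda>\<pi>. of_bool (Ev (t - wc) (\<pi> ` {..<m}))) + 10 / real N"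
proof -
  let ?b = "\<lambda>s. real (N choose s) * q ^ s * (1 - q) ^ (N - s)"
  have b0: "?b s \<ge> 0" for s using q01 by simp
  have EP1: "0 \<le> EP N (\<lambda>\<pi>. of_bool (P \<pi>))" "EP N (\<lambda>\<pi>. of_bool (P \<pi>)) \<le> 1" for P
    using EP_nonneg[of N "\<lambda>\<pi>. of_bool (P \<pi>)"] EP_mono[of N "\<lambda>\<pi>. of_bool (P \<pi>)" "\<lambda>_. 1"] by (auto simp: EP_const)
  have size: "(\<Sum>s\<le>N. ?b s * of_bool (\<bar>real s - real m\<bar> > Kd)) \<le> 6 / real N"
  proof -
    have "EB N q (\<lambda>A. of_bool (\<bar>real (card A) - real m\<bar> > Kd)) = (\<Sum>s\<le>N. ?b s * of_bool (\<bar>real s - real m\<bar> > Kd))"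
      unfolding EB_eq_EP
    proof (intro sum.cong refl arg_cong2[of _ _ _ _ "(*)"])
      fix s assume "s \<in> {..N}"
      have "EP N (\<lambda>\<pi>. of_bool (Kd < \<bar>real (card (\<pi> ` {..<s})) - real m\<bar>)) = EP N (\<lambda>\<pi>. of_bool (Kd < \<bar>real s - real m\<bar>))"
      proof (rule EP_cong)
        fix \<pi> assume "\<pi> permutes {..<N}"
        then have "inj_on \<pi> {..<s}" using permutes_inj inj_on_subset by blast
        then show "of_bool (Kd < \<bar>real (card (\<pi> ` {..<s})) - real m\<bar>) = (of_bool (Kd < \<bar>real s - real m\<bar>) :: real)" by (simp add: card_image)
      qed
      then show "EP N (\<lambda>\<pi>. of_bool (Kd < \<bar>real (card (\<pi> ` {..<s})) - real m\<bar>)) = of_bool (Kd < \<bar>real s - real m\<bar>)" by (simp add: EP_const)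
    qed
    then show ?thesis using prob_size_bad by simp
  qed
  have "EP N (\<lambda>\<pi>. of_bool (Ev t (\<pi> ` {..<m}))) = (\<Sum>s\<le>N. ?b s * EP N (\<lambda>\<pi>. of_bool (Ev t (\<pi> ` {..<m}))))"
    unfolding sum_distrib_right[symmetric] binom_sum1 by simp
  also have "\<dots> \<le> (\<Sum>s\<le>N. ?b s * EP N (\<lambda>\<pi>. of_bool (Ev (t - wc) (\<pi> ` {..<s}))) + ?b s * (4 / real N) + ?b s * of_bool (\<bar>real s - real m\<bar> > Kd))"
  proof (rule sum_mono)
    fix s assume "s \<in> {..N}"
    then have "EP N (\<lambda>\<pi>. of_bool (Ev t (\<pi> ` {..<m}))) \<le> EP N (\<lambda>\<pi>. of_bool (Ev (t - wc) (\<pi> ` {..<s}))) + 4 / real N + of_bool (\<bar>real s - real m\<bar> > Kd)"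
      using block_coupling[of m s t] Npos(3) EP1[of "\<lambda>\<pi>. Ev (t - wc) (\<pi> ` {..<s})"] EP1[of "\<lambda>\<pi>. Ev t (\<pi> ` {..<m})"]
      by (cases "\<bar>real s - real m\<bar> \<le> Kd") (auto simp: abs_minus_commute intro: add_increasing order_trans[of _ 1])
    from mult_left_mono[OF this b0[of s]]
    show "?b s * EP N (\<lambda>\<pi>. of_bool (Ev t (\<pi> ` {..<m}))) \<le> ?b s * EP N (\<lambda>\<pi>. of_bool (Ev (t - wc) (\<pi> ` {..<s}))) + ?b s * (4 / real N) + ?b s * of_bool (\<bar>real s - real m\<bar> > Kd)"
      by (simp only: distrib_left)
  qed
  also have "\<dots> = EB N q (\<lambda>A. of_bool (Ev (t - wc) A)) + 4 / real N + (\<Sum>s\<le>N. ?b s * of_bool (\<bar>real s - real m\<bar> > Kd))"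
    unfolding sum.distrib EB_eq_EP sum_distrib_right[symmetric, of _ "4 / real N"] binom_sum1 by simp
  finally show "EP N (\<lambda>\<pi>. of_bool (Ev t (\<pi> ` {..<m}))) \<le> EB N q (\<lambda>A. of_bool (Ev (t - wc) A)) + 10 / real N"
    using size by linarith
  have "EB N q (\<lambda>A. of_bool (Ev t A)) = (\<Sum>s\<le>N. ?b s * EP N (\<lambda>\<pi>. of_bool (Ev t (\<pi> ` {..<s}))))" by (rule EB_eq_EP)
  also have "\<dots> \<le> (\<Sum>s\<le>N. ?b s * EP N (\<lambda>\<pi>. of_bool (Ev (t - wc) (\<pi> ` {..<m}))) + ?b s * (4 / real N) + ?b s * of_bool (\<bar>real s - real m\<bar> > Kd))"
  proof (rule sum_mono)
    fix s assume "s \<in> {..N}"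
    then have "EP N (\<lambda>\<pi>. of_bool (Ev t (\<pi> ` {..<s}))) \<le> EP N (\<lambda>\<pi>. of_bool (Ev (t - wc) (\<pi> ` {..<m}))) + 4 / real N + of_bool (\<bar>real s - real m\<bar> > Kd)"
      using block_coupling[of s m t] Npos(3) EP1[of "\<lambda>\<pi>. Ev (t - wc) (\<pi> ` {..<m})"] EP1[of "\<lambda>\<pi>. Ev t (\<pi> ` {..<s})"]
      by (cases "\<bar>real s - real m\<bar> \<le> Kd") (auto intro: add_increasing order_trans[of _ 1])
    from mult_left_mono[OF this b0[of s]]
    show "?b s * EP N (\<lambda>\<pi>. of_bool (Ev t (\<pi> ` {..<s}))) \<le> ?b s * EP N (\<lambda>\<pi>. of_bool (Ev (t - wc) (\<pi> ` {..<m}))) + ?b s * (4 / real N) + ?b s * of_bool (\<bar>real s - real m\<bar> > Kd)"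
      by (simp only: distrib_left)
  qed
  also have "\<dots> = EP N (\<lambda>\<pi>. of_bool (Ev (t - wc) (\<pi> ` {..<m}))) + 4 / real N + (\<Sum>s\<le>N. ?b s * of_bool (\<bar>real s - real m\<bar> > Kd))"
    unfolding sum.distrib sum_distrib_right[symmetric] binom_sum1 by simp
  finally show "EB N q (\<lambda>A. of_bool (Ev t A)) \<le> EP N (\<lambda>\<pi>. of_bool (Ev (t - wc) (\<pi> ` {..<m}))) + 10 / real N"
    using size by linarith
qed

end

section \<open>Gaussian approximation of the permutation distribution\<close>

definition two_point :: "real \<Rightarrow> real measure" where
  "two_point q = distr (measure_pmf (bernoulli_pmf q)) borel (\<lambda>b. (of_bool b - q) / sqrt (q * (1 - q)))"

lemma two_point_integral:
  fixes f :: "real \<Rightarrow> real"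
  assumes q: "0 \<le> q" "q \<le> 1" and [measurable]: "f \<in> borel_measurable borel"
  shows "integrable (two_point q) f"
    "(\<integral>x. f x \<partial>two_point q) = (1 - q) * f ((0 - q) / sqrt (q * (1 - q))) + q * f ((1 - q) / sqrt (q * (1 - q)))"
proof -
  have "integrable (measure_pmf (bernoulli_pmf q)) (\<lambda>b. f ((of_bool b - q) / sqrt (q * (1 - q))))"
    by (rule integrable_measure_pmf_finite) simp
  then show "integrable (two_point q) f" unfolding two_point_def by (subst integrable_distr_eq) auto
  show "(\<integral>x. f x \<partial>two_point q) = (1 - q) * f ((0 - q) / sqrt (q * (1 - q))) + q * f ((1 - q) / sqrt (q * (1 - q)))"
    unfolding two_point_def using q by (subst integral_distr) (auto simp: integral_bernoulli_pmf algebra_simps)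
qed

lemma prob_space_two_point: "prob_space (two_point q)"
  unfolding two_point_def by (rule prob_space.prob_space_distr[OF measure_pmf.prob_space_axioms]) simp

lemma sets_two_point: "sets (two_point q) = sets borel" unfolding two_point_def by simp

text \<open>\<open>R\<close> bounds the support. The constants depend on q only through
  \<open>R\<close>, so they can be chosen once for a whole range of sampling fractions.\<close>

lemma unit_law_two_point:
  assumes q: "0 < q" "q < 1" and R: "1 / sqrt (q * (1 - q)) \<le> R" and C: "R^3 * exp R \<le> C" and c: "c \<le> exp (- R)"
  shows "unit_law (two_point q) C c"
proof -
  let ?s = "sqrt (q * (1 - q))"
  have s: "?s > 0" using q by simp
  have s2: "?s\<^sup>2 = q * (1 - q)" using q by simp
  note I = two_point_integral[OF less_imp_le[OF q(1)] less_imp_le[OF q(2)]]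
  have R1: "q / ?s \<le> R" "(1 - q) / ?s \<le> R"
    using R q s order_trans[OF divide_right_mono[of q 1 ?s] R] order_trans[OF divide_right_mono[of "1 - q" 1 ?s] R] by auto
  have R0: "R \<ge> 0" using R s by (metis divide_nonneg_pos less_eq_real_def order_trans zero_le_one)
  have b: "\<bar>(0 - q) / ?s\<bar> \<le> R" "\<bar>(1 - q) / ?s\<bar> \<le> R" using R1 q s by auto
  interpret prob_space "two_point q" by (rule prob_space_two_point)
  show ?thesis
  proof
    show "sets (two_point q) = sets borel" by (rule sets_two_point)
    show "integrable (two_point q) (\<lambda>x. \<bar>x\<bar>^3 * exp \<bar>x\<bar>)" by (rule I) measurable
    show "integrable (two_point q) (\<lambda>x. x)" by (rule I) measurable
    show "integrable (two_point q) (\<lambda>x. x\<^sup>2)" by (rule I) measurable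
    show "(\<integral>x. x \<partial>two_point q) = 0" by (subst I(2)) auto
    have "(\<integral>x. x\<^sup>2 \<partial>two_point q) = ((1 - q) * q\<^sup>2 + q * (1 - q)\<^sup>2) / ?s\<^sup>2"
      by (subst I(2)) (auto simp: power_divide add_divide_distrib simp del: real_sqrt_pow2_iff)
    also have "(1 - q) * q\<^sup>2 + q * (1 - q)\<^sup>2 = q * (1 - q)" by (simp add: power2_eq_square algebra_simps)
    finally show "(\<integral>x. x\<^sup>2 \<partial>two_point q) = 1" unfolding s2 using q by simp
    have m: "\<bar>y\<bar>^3 * exp \<bar>y\<bar> \<le> C" if "\<bar>y\<bar> \<le> R" for y
    proof -
      have "\<bar>y\<bar>^3 * exp \<bar>y\<bar> \<le> R^3 * exp R" using that R0 by (intro mult_mono power_mono) auto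
      then show ?thesis using C by linarith
    qed
    have "(\<integral>x. \<bar>x\<bar>^3 * exp \<bar>x\<bar> \<partial>two_point q) \<le> (1 - q) * C + q * C"
      using q m[OF b(1)] m[OF b(2)] by (subst I(2)) (auto intro!: add_mono mult_left_mono)
    then show "(\<integral>x. \<bar>x\<bar>^3 * exp \<bar>x\<bar> \<partial>two_point q) \<le> C" by (simp add: algebra_simps)
    have m': "c \<le> exp (- \<bar>y\<bar>)" if "\<bar>y\<bar> \<le> R" for y using c that by (meson exp_le_cancel_iff neg_le_iff_le order_trans)
    have "(1 - q) * c + q * c \<le> (\<integral>x. exp (- \<bar>x\<bar>) \<partial>two_point q)"
      using q m'[OF b(1)] m'[OF b(2)] by (subst I(2)) (auto intro!: add_mono mult_left_mono)
    then show "c \<le> (\<integral>x. exp (- \<bar>x\<bar>) \<partial>two_point q)" by (simp add: algebra_simps)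
  qed
qed

lemma unit_law_std_normal:
  obtains C\<^sub>0 where "\<And>C c. C\<^sub>0 \<le> C \<Longrightarrow> c \<le> exp (-1) \<Longrightarrow> unit_law std_normal_distribution C c"
proof -
  interpret prob_space std_normal_distribution by (rule prob_space_std_normal)
  have e: "\<bar>x\<bar>^3 * exp \<bar>x\<bar> \<le> 27 * (exp (2 * x) + exp ((-2) * x))" for x :: real
  proof -
    have "\<bar>x\<bar> / 3 \<le> exp (\<bar>x\<bar> / 3)" using exp_ge_add_one_self[of "\<bar>x\<bar> / 3"] by linarith
    then have "(\<bar>x\<bar> / 3)^3 \<le> (exp (\<bar>x\<bar> / 3))^3" by (intro power_mono) auto
    also have "\<dots> = exp \<bar>x\<bar>" by (simp flip: exp_of_nat_mult)
    finally have "\<bar>x\<bar>^3 \<le> 27 * exp \<bar>x\<bar>" by (simp add: power_divide)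
    then have "\<bar>x\<bar>^3 * exp \<bar>x\<bar> \<le> 27 * exp \<bar>x\<bar> * exp \<bar>x\<bar>" by (intro mult_right_mono) auto
    also have "\<dots> = 27 * exp (2 * \<bar>x\<bar>)" by (simp flip: exp_add)
    also have "\<dots> \<le> 27 * (exp (2 * x) + exp ((-2) * x))" by (cases "x \<ge> 0") auto
    finally show ?thesis .
  qed
  have i3: "integrable std_normal_distribution (\<lambda>x. \<bar>x\<bar>^3 * exp \<bar>x\<bar>)"
  proof (rule Bochner_Integration.integrable_bound)
    show "integrable std_normal_distribution (\<lambda>x. 27 * (exp (2 * x) + exp ((-2) * x)))"
      by (intro integrable_mult_right Bochner_Integration.integrable_add std_normal_mgf)
    show "AE x in std_normal_distribution. norm (\<bar>x\<bar>^3 * exp \<bar>x\<bar>) \<le> norm (27 * (exp (2 * x) + exp ((-2) * x)))"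
    proof (rule AE_I2)
      fix x :: real
      have "0 \<le> 27 * (exp (2 * x) + exp ((-2) * x))" by (simp add: add_nonneg_nonneg)
      then show "norm (\<bar>x\<bar>^3 * exp \<bar>x\<bar>) \<le> norm (27 * (exp (2 * x) + exp ((-2) * x)))" using e[of x] by simp
    qed
  qed measurable
  have i1: "integrable std_normal_distribution (\<lambda>x. x)"
    using integrable_std_normal_pow[of 1] by (simp add: integrable_abs_iff)
  have i2: "integrable std_normal_distribution (\<lambda>x. x\<^sup>2)" using integrable_std_normal_pow[of 2] by simp
  have m1: "(\<integral>x. x \<partial>std_normal_distribution) = 0"
    using gauss_ibp[of "\<lambda>_. 1" "\<lambda>_. 0" 1] by simp
  have m2: "(\<integral>x. x\<^sup>2 \<partial>std_normal_distribution) = 1"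
    using integral_std_normal_moment_even[of 1] by (simp add: integral_density normal_density_nonneg fact_2)
  have low: "exp (-1) \<le> (\<integral>x. exp (- \<bar>x\<bar>) \<partial>std_normal_distribution)"
  proof -
    \<comment> \<open>The tangent of exp at -1 gives exp (- |x|) >= exp (-1) (2 - |x|), and |x| <=
      (1 + x^2) / 2 makes the bound quadratic in x. Its mean under unit variance is exactly exp
      (-1).\<close>
    have pt: "exp (-1) * (3/2 - x\<^sup>2/2) \<le> exp (- \<bar>x\<bar>)" for x :: real
    proof -
      have "exp (- \<bar>x\<bar>) = exp (-1) * exp (1 - \<bar>x\<bar>)" by (simp flip: exp_add)
      also have "\<dots> \<ge> exp (-1) * (2 - \<bar>x\<bar>)" using exp_ge_add_one_self[of "1 - \<bar>x\<bar>"] by (intro mult_left_mono) auto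
      finally have 1: "exp (-1) * (2 - \<bar>x\<bar>) \<le> exp (- \<bar>x\<bar>)" .
      have "0 \<le> (\<bar>x\<bar> - 1)\<^sup>2" by simp
      then have "3/2 - x\<^sup>2/2 \<le> 2 - \<bar>x\<bar>" by (simp add: power2_eq_square algebra_simps)
      then have "exp (-1) * (3/2 - x\<^sup>2/2) \<le> exp (-1) * (2 - \<bar>x\<bar>)" by (intro mult_left_mono) auto
      then show ?thesis using 1 by linarith
    qed
    have "(\<integral>x. exp (-1) * (3/2 - x\<^sup>2/2) \<partial>std_normal_distribution) \<le> (\<integral>x. exp (- \<bar>x\<bar>) \<partial>std_normal_distribution)"
    proof (intro integral_mono pt)
      show "integrable std_normal_distribution (\<lambda>x. exp (-1) * (3/2 - x\<^sup>2/2))"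
        using i2 by (intro integrable_mult_right Bochner_Integration.integrable_diff) auto
      show "integrable std_normal_distribution (\<lambda>x. exp (- \<bar>x\<bar>))"
        by (rule integrable_const_bound[where B=1]) auto
    qed
    moreover have "(\<integral>x. exp (-1) * (3/2 - x\<^sup>2/2) \<partial>std_normal_distribution) = exp (-1)"
      using i2 m2 prob_space by (simp add: Bochner_Integration.integral_diff)
    ultimately show ?thesis by simp
  qed
  show ?thesis
  proof (rule that)
    fix C c assume "(\<integral>x. \<bar>x\<bar>^3 * exp \<bar>x\<bar> \<partial>std_normal_distribution) \<le> C" "c \<le> exp (-1 :: real)"
    then show "unit_law std_normal_distribution C c"
      using i3 i1 i2 m1 m2 low by unfold_locales auto
  qed
qed

text \<open>Bridge between the Lindeberg theorem, which speaks of product measures, and the finite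
  sums \<open>EB\<close>: the noise at \<open>i\<close> is the standardised membership
  indicator.\<close>

lemma integral_two_point_PiM:
  fixes G :: "(nat \<Rightarrow> real) \<Rightarrow> real"
  assumes q: "0 \<le> q" "q \<le> 1" and G: "G \<in> borel_measurable (PiM {..<N} (\<lambda>_. two_point q))" and b: "\<And>x. \<bar>G x\<bar> \<le> C"
  shows "(\<integral>x. G x \<partial>PiM {..<N} (\<lambda>_. two_point q)) = EB N q (\<lambda>A. G (\<lambda>i\<in>{..<N}. (of_bool (i \<in> A) - q) / sqrt (q * (1 - q))))"
  using G b
proof (induction N arbitrary: G)
  case 0
  interpret prob_space "PiM {} (\<lambda>_::nat. two_point q)" by (intro prob_space_PiM prob_space_two_point)
  have "(\<integral>x. G x \<partial>PiM {} (\<lambda>_. two_point q)) = (\<integral>x. G (\<lambda>_. undefined) \<partial>PiM {} (\<lambda>_::nat. two_point q))"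
    by (rule Bochner_Integration.integral_cong[OF refl]) (simp add: space_PiM_empty)
  then show ?case by (simp add: EB_def prob_space restrict_def)
next
  case (Suc N)
  let ?T = "\<lambda>_::nat. two_point q"
  let ?s = "sqrt (q * (1 - q))"
  let ?lo = "(0 - q) / ?s" and ?hi = "(1 - q) / ?s"
  interpret product_sigma_finite_F: product_sigma_finite ?T
    by (simp add: product_sigma_finite_def prob_space_two_point prob_space_imp_sigma_finite)
  interpret P: prob_space "PiM {..<Suc N} ?T" by (intro prob_space_PiM prob_space_two_point)
  have ins: "{..<Suc N} = insert N {..<N}" by auto
  have sp: "space (two_point q) = UNIV" using sets_eq_imp_space_eq[OF sets_two_point] by simp
  have iG: "integrable (PiM {..<Suc N} ?T) G"
    by (rule P.integrable_const_bound[where B=C]) (use Suc.prems in auto)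
  have mu: "(\<lambda>x. x(N := y)) \<in> measurable (PiM {..<N} ?T) (PiM {..<Suc N} ?T)" for y
    unfolding ins using measurable_fun_upd[where J="{..<N}" and I="insert N {..<N}" and i=N and M="?T" and f="\<lambda>x. x" and h="\<lambda>_. y"]
    by (auto simp: sp)
  have my: "(\<lambda>y. G (x(N := y))) \<in> borel_measurable borel" if "x \<in> space (PiM {..<N} ?T)" for x
  proof -
    have "(\<lambda>y. x(N := y)) \<in> measurable (two_point q) (PiM {..<Suc N} ?T)"
      unfolding ins using measurable_component_update[OF that, of N] by simp
    then have "(\<lambda>y. G (x(N := y))) \<in> borel_measurable (two_point q)" using Suc.prems(1) by (rule measurable_compose)
    then show ?thesis by (simp add: measurable_cong_sets[OF sets_two_point refl])
  qed
  have "(\<integral>x. G x \<partial>PiM {..<Suc N} ?T) = (\<integral>x. (\<integral>y. G (x(N := y)) \<partial>two_point q) \<partial>PiM {..<N} ?T)"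
    unfolding ins by (rule product_sigma_finite_F.product_integral_insert) (use iG ins in auto)
  also have "\<dots> = (\<integral>x. (1 - q) * G (x(N := ?lo)) + q * G (x(N := ?hi)) \<partial>PiM {..<N} ?T)"
    by (intro Bochner_Integration.integral_cong refl) (rule two_point_integral(2)[OF q my])
  also have "\<dots> = EB N q (\<lambda>A. (1 - q) * G ((\<lambda>i\<in>{..<N}. (of_bool (i \<in> A) - q) / ?s)(N := ?lo)) + q * G ((\<lambda>i\<in>{..<N}. (of_bool (i \<in> A) - q) / ?s)(N := ?hi)))"
  proof (rule Suc.IH)
    show "(\<lambda>x. (1 - q) * G (x(N := ?lo)) + q * G (x(N := ?hi))) \<in> borel_measurable (PiM {..<N} ?T)"
      using measurable_compose[OF mu Suc.prems(1)] by measurable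
    show "\<bar>(1 - q) * G (x(N := ?lo)) + q * G (x(N := ?hi))\<bar> \<le> C" for x
    proof -
      have "\<bar>(1 - q) * G (x(N := ?lo)) + q * G (x(N := ?hi))\<bar> \<le> (1 - q) * \<bar>G (x(N := ?lo))\<bar> + q * \<bar>G (x(N := ?hi))\<bar>"
        using q by (intro order_trans[OF abs_triangle_ineq]) (simp add: abs_mult)
      also have "\<dots> \<le> (1 - q) * C + q * C" using q Suc.prems(2) by (intro add_mono mult_left_mono) auto
      finally show ?thesis by (simp add: algebra_simps)
    qed
  qed
  also have "\<dots> = EB (Suc N) q (\<lambda>A. G (\<lambda>i\<in>{..<Suc N}. (of_bool (i \<in> A) - q) / ?s))"
    unfolding EB_Suc
  proof (rule EB_cong)
    fix A assume A: "A \<subseteq> {..<N}"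
    have 1: "(\<lambda>i\<in>{..<N}. (of_bool (i \<in> A) - q) / ?s)(N := ?lo) = (\<lambda>i\<in>{..<Suc N}. (of_bool (i \<in> A) - q) / ?s)"
      using A by (auto simp: fun_eq_iff less_Suc_eq restrict_def)
    have 2: "(\<lambda>i\<in>{..<N}. (of_bool (i \<in> A) - q) / ?s)(N := ?hi) = (\<lambda>i\<in>{..<Suc N}. (of_bool (i \<in> insert N A) - q) / ?s)"
      using A by (auto simp: fun_eq_iff less_Suc_eq restrict_def)
    show "(1 - q) * G ((\<lambda>i\<in>{..<N}. (of_bool (i \<in> A) - q) / ?s)(N := ?lo)) + q * G ((\<lambda>i\<in>{..<N}. (of_bool (i \<in> A) - q) / ?s)(N := ?hi))
      = (1 - q) * G (\<lambda>i\<in>{..<Suc N}. (of_bool (i \<in> A) - q) / ?s) + q * G (\<lambda>i\<in>{..<Suc N}. (of_bool (i \<in> insert N A) - q) / ?s)"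
      unfolding 1 2 ..
  qed
  finally show ?case .
qed

section \<open>Smoothing errors of tail probabilities\<close>

context smax begin

lemma soft_ind_ge: assumes "j \<in> J" "z j \<ge> t" shows "1 \<le> soft_ind (t - w) z + exp (- w / \<epsilon>)"
proof -
  have "soft_max z \<ge> t" using soft_max_ge[OF assms(1), of z] assms by linarith
  then have "- ((soft_max z - (t - w)) / \<epsilon>) \<le> - w / \<epsilon>" using \<epsilon>_pos by (simp add: divide_simps)
  then have "exp (- ((soft_max z - (t - w)) / \<epsilon>)) \<le> exp (- w / \<epsilon>)" by simp
  then show ?thesis using logi_ge[of "(soft_max z - (t - w)) / \<epsilon>"] unfolding soft_ind_def by linarith
qed

text \<open>The 1 in the exponent is the overshoot of the soft maximum, at most one unit of
  \<epsilon> by assumption \<open>b\<close>.\<close>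

lemma soft_ind_le: assumes "\<And>j. j \<in> J \<Longrightarrow> z j \<le> t - w" and b: "ln (card J) / \<beta> \<le> \<epsilon>" shows "soft_ind t z \<le> exp (1 - w / \<epsilon>)"
proof -
  have "soft_max z \<le> t - w + \<epsilon>" using soft_max_le[of z "t - w"] assms by fastforce
  then have "(soft_max z - t) / \<epsilon> \<le> 1 - w / \<epsilon>" using \<epsilon>_pos by (simp add: divide_simps)
  then show ?thesis using logi_le[of "(soft_max z - t) / \<epsilon>"] unfolding soft_ind_def by (meson exp_le_cancel_iff order_trans)
qed

end

definition gauss_tail :: "'i set \<Rightarrow> ('i \<Rightarrow> 'a \<Rightarrow> real) \<Rightarrow> 'a set \<Rightarrow> real \<Rightarrow> real" where
  "gauss_tail I a J t = measure (gP I) {e \<in> space (gP I). \<exists>j\<in>J. lin I e a j \<ge> t}"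

lemma gauss_tail_set_measurable:
  assumes "finite J" shows "{e \<in> space (gP I). \<exists>j\<in>J. lin I e a j \<ge> t} \<in> sets (gP I)"
proof -
  have "{e \<in> space (gP I). \<exists>j\<in>J. lin I e a j \<ge> t} = (\<Union>j\<in>J. {e \<in> space (gP I). lin I e a j \<ge> t})" by auto
  moreover have "{e \<in> space (gP I). lin I e a j \<ge> t} \<in> sets (gP I)" for j
    using lin_measurable(2)[of I a j] by measurable
  ultimately show ?thesis using assms by auto
qed

lemma gauss_tail_antimono: assumes "finite J" "s \<le> t" shows "gauss_tail I a J t \<le> gauss_tail I a J s"
proof -
  interpret prob_space "gP I" by (rule prob_space_gP)
  show ?thesis unfolding gauss_tail_def
    by (rule finite_measure_mono[OF _ gauss_tail_set_measurable[OF assms(1)]]) (use assms in \<open>auto intro: order_trans\<close>)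
qed

text \<open>A finite maximum is finite, so the exceedance events decrease to the empty set. Quantile
  sets are nonempty for this reason.\<close>

lemma gauss_tail_eventually_small:
  assumes J: "finite J" and x: "0 < x"
  shows "\<exists>t. gauss_tail I a J t \<le> x"
proof -
  interpret prob_space "gP I" by (rule prob_space_gP)
  let ?A = "\<lambda>i::nat. {e \<in> space (gP I). \<exists>j\<in>J. lin I e a j \<ge> real i}"
  have "(\<lambda>i. measure (gP I) (?A i)) \<longlonglongrightarrow> measure (gP I) (\<Inter>i. ?A i)"
  proof (rule finite_Lim_measure_decseq)
    show "range ?A \<subseteq> sets (gP I)" using gauss_tail_set_measurable[OF J] by auto
    show "decseq ?A" unfolding decseq_def by auto (meson of_nat_le_iff order_trans)
  qed
  moreover have "(\<Inter>i. ?A i) = {}"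
  proof -
    have False if "e \<in> (\<Inter>i. ?A i)" for e
    proof -
      let ?m = "\<Sum>j\<in>J. \<bar>lin I e a j\<bar>"
      obtain i :: nat where i: "?m < real i" using reals_Archimedean2 by blast
      have "e \<in> ?A i" using that by blast
      then obtain j where j: "j \<in> J" "lin I e a j \<ge> real i" by blast
      have "\<bar>lin I e a j\<bar> \<le> ?m" using j J by (intro member_le_sum[where f="\<lambda>j. \<bar>lin I e a j\<bar>"]) auto
      then show False using i j by linarith
    qed
    then show ?thesis by blast
  qed
  ultimately have "(\<lambda>i. measure (gP I) (?A i)) \<longlonglongrightarrow> 0" by simp
  then have "\<forall>\<^sub>F i in sequentially. measure (gP I) (?A i) < x" using x by (rule order_tendstoD(2))
  from eventually_happens[OF this] obtain i where "measure (gP I) (?A i) < x" by auto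
  then show ?thesis unfolding gauss_tail_def by (intro exI[of _ "real i"]) simp
qed

context smax begin

lemma gauss_tail_le_soft_ind: "gauss_tail I a J t \<le> (\<integral>e. soft_ind (t - w) (lin I e a) \<partial>gP I) + exp (- w / \<epsilon>)"
  and soft_ind_le_gauss_tail: "ln (card J) / \<beta> \<le> \<epsilon> \<Longrightarrow> (\<integral>e. soft_ind t (lin I e a) \<partial>gP I) \<le> gauss_tail I a J (t - w) + exp (1 - w / \<epsilon>)"
proof -
  interpret P: prob_space "gP I" by (rule prob_space_gP)
  let ?E = "\<lambda>t. {e \<in> space (gP I). \<exists>j\<in>J. lin I e a j \<ge> t}"
  have E: "?E t \<in> sets (gP I)" for t by (rule gauss_tail_set_measurable[OF finJ])
  have m: "(\<lambda>e. soft_ind t (lin I e a)) \<in> borel_measurable (gP I)" for t by (intro smax_measurable lin_measurable)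
  have ih: "integrable (gP I) (\<lambda>e. soft_ind t (lin I e a))" for t
    by (rule P.integrable_const_bound[where B=1]) (use m in \<open>auto simp: soft_ind_bounds\<close>)
  have ii: "integrable (gP I) (indicator (?E t) :: _ \<Rightarrow> real)" for t
    using E[of t] by (simp add: P.emeasure_eq_measure)
  have "gauss_tail I a J t = (\<integral>e. indicator (?E t) e \<partial>gP I)" unfolding gauss_tail_def using E[of t] by simp
  also have "\<dots> \<le> (\<integral>e. soft_ind (t - w) (lin I e a) + exp (- w / \<epsilon>) \<partial>gP I)"
  proof (rule integral_mono[OF ii])
    show "integrable (gP I) (\<lambda>e. soft_ind (t - w) (lin I e a) + exp (- w / \<epsilon>))" using ih by auto
    show "indicator (?E t) e \<le> soft_ind (t - w) (lin I e a) + exp (- w / \<epsilon>)" for e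
      using soft_ind_ge[of _ t "lin I e a" w] soft_ind_bounds[of "t - w" "lin I e a"] by (auto simp: indicator_def add_nonneg_nonneg)
  qed
  finally show "gauss_tail I a J t \<le> (\<integral>e. soft_ind (t - w) (lin I e a) \<partial>gP I) + exp (- w / \<epsilon>)"
    using ih by (simp add: P.prob_space)
  assume b: "ln (card J) / \<beta> \<le> \<epsilon>"
  have "(\<integral>e. soft_ind t (lin I e a) \<partial>gP I) \<le> (\<integral>e. indicator (?E (t - w)) e + exp (1 - w / \<epsilon>) \<partial>gP I)"
  proof (rule integral_mono[OF ih])
    show "integrable (gP I) (\<lambda>e. indicator (?E (t - w)) e + exp (1 - w / \<epsilon>))" using ii by auto
    show "soft_ind t (lin I e a) \<le> indicator (?E (t - w)) e + exp (1 - w / \<epsilon>)" if "e \<in> space (gP I)" for e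
    proof (cases "e \<in> ?E (t - w)")
      case True then show ?thesis using soft_ind_bounds[of t "lin I e a"] by (simp add: add_increasing2)
    next
      case False
      then have "\<And>j. j \<in> J \<Longrightarrow> lin I e a j \<le> t - w" using that by force
      then show ?thesis using soft_ind_le[of "lin I e a" t w] b False by simp
    qed
  qed
  also have "\<dots> = gauss_tail I a J (t - w) + exp (1 - w / \<epsilon>)"
    unfolding gauss_tail_def using ii E[of "t - w"] by (subst Bochner_Integration.integral_add) (auto simp: P.prob_space)
  finally show "(\<integral>e. soft_ind t (lin I e a) \<partial>gP I) \<le> gauss_tail I a J (t - w) + exp (1 - w / \<epsilon>)" .
qed

end

section \<open>Reference tail, permutation tail and bootstrap tail\<close>

locale boot_config = rank_config n m N p d U rho psi B \<Lambda> cnt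
  for n m N p d :: nat and U :: "'u set" and rho psi B \<Lambda> cnt +
  fixes \<epsilon> \<beta> C c\<^sub>1 :: real
  assumes eps: "\<epsilon> > 0" and bet: "\<beta> > 0" and eb: "\<epsilon> * \<beta> \<ge> 1" and c1: "c\<^sub>1 > 0"
    and ul1: "unit_law (two_point (real m / real N)) C c\<^sub>1" and ul2: "unit_law std_normal_distribution C c\<^sub>1"
    and lnJ: "ln (2 * (real (card U) * real d)) / \<beta> \<le> \<epsilon>" and bc: "2 * \<beta> * (B / sqrt (real N)) \<le> 1"
    and cntok: "\<And>A. A \<subseteq> {..<N} \<Longrightarrow> card A = m \<Longrightarrow> cnt_ok A"
begin

text \<open>The boolean component carries a sign: the maximum of the absolute values is the maximum over \<open>Jp\<close>.\<close>

definition Jp :: "(('u \<times> nat) \<times> bool) set" where "Jp = (U \<times> {1..d}) \<times> UNIV"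

definition sg :: "bool \<Rightarrow> real" where "sg b = (if b then 1 else -1)"

text \<open>Driven by standardised Bernoulli noise, these coefficients give the normalised linear
  rank statistics with a sign; driven by Gaussian noise, they give the reference maximum. They
  involve the pooled ranks but not the subset, in contrast to \<open>bb A\<close>.\<close>

definition aa :: "nat \<Rightarrow> (('u \<times> nat) \<times> bool) \<Rightarrow> real" where
  "aa i j = sg (snd j) * psi (snd (fst j)) (real (rho (fst (fst j)) i) / real N) / sqrt (real N)"

definition bb :: "nat set \<Rightarrow> nat \<Rightarrow> (('u \<times> nat) \<times> bool) \<Rightarrow> real" where
  "bb A i j = sg (snd j) * psi (snd (fst j)) (real (cnt (fst (fst j)) A i) / real n) / sqrt (real n)"

lemma Jp: "finite Jp" "Jp \<noteq> {}" "card Jp = 2 * (card U * d)"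
  unfolding Jp_def using U d by (auto simp: card_cartesian_product)

sublocale sx: smax Jp \<beta> \<epsilon>
  by unfold_locales (use Jp eps bet in auto)

definition s0 :: real where "s0 = sqrt (real N / (real n * real m))"
text \<open>Chosen so that the smoothing error exp (1 - w / \<epsilon>) equals 1 / N.\<close>

definition w :: real where "w = \<epsilon> * (ln (real N) + 1)"
definition \<eta>clt :: real where "\<eta>clt = sx.K3 * (B / sqrt (real N)) * C / (3 * c\<^sub>1) * 2 * harm N"
definition \<eta>g :: real where "\<eta>g = 2 * (128 * B * sqrt (\<Lambda> / real N) * (1 / \<epsilon>\<^sup>2 + 2 * \<beta> / \<epsilon>))"
text \<open>Total shift between permutation tail and reference tail: linearisation of the statistic,
  coupling of the sizes, and one \<open>w\<close> each for passing to the smoothed indicator and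
  back.\<close>

definition W :: real where "W = s0 * (10 * \<Lambda> * B) + wc + 2 * w"
text \<open>24 = 12 + 10 + 1 + 1: atypical subsets, size coupling, and two smoothing errors.\<close>

definition \<eta> :: real where "\<eta> = 24 / real N + \<eta>clt + \<eta>g"
definition an :: real where "an = 96 * (W + \<epsilon>) * sqrt \<Lambda>"
definition Sg :: "real \<Rightarrow> real" where "Sg = gauss_tail {..<N} aa Jp"
definition Sb :: "nat set \<Rightarrow> real \<Rightarrow> real" where "Sb A = gauss_tail ({..<N} - A) (bb A) Jp"
definition ET :: "real \<Rightarrow> nat set \<Rightarrow> bool" where "ET t A \<longleftrightarrow> (\<exists>u\<in>U. \<exists>k\<in>{1..d}. Ts u k A \<ge> t)"

lemma lnN: "ln (real N) \<ge> 0" using Npos by simp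

lemma w_pos: "w > 0" unfolding w_def using eps lnN by (simp add: add_nonneg_pos)

lemma expw: "exp (1 - w / \<epsilon>) = 1 / real N" "exp (- w / \<epsilon>) \<le> 1 / real N"
proof -
  have e: "w / \<epsilon> = ln (real N) + 1" unfolding w_def using eps by simp
  show 1: "exp (1 - w / \<epsilon>) = 1 / real N" unfolding e using Npos by (simp add: exp_minus inverse_eq_divide)
  have "exp (- w / \<epsilon>) \<le> exp (1 - w / \<epsilon>)" by simp
  then show "exp (- w / \<epsilon>) \<le> 1 / real N" using 1 by simp
qed

lemma s0_pos: "s0 > 0" unfolding s0_def using Npos by simp

lemma wc_nonneg: "wc \<ge> 0" unfolding wc_def using Npos \<Lambda>1 Bpos Kd0 by simp

lemma W_bounds: "W > 0" "2 * w \<le> W" "s0 * (10 * \<Lambda> * B) + wc + 2 * w = W"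
  unfolding W_def using s0_pos wc_nonneg w_pos \<Lambda>1 Bpos by (auto simp: add_nonneg_pos)

lemma lnJ': "ln (real (card Jp)) / \<beta> \<le> \<epsilon>" using lnJ by (simp add: Jp)

lemma aa_sum: assumes "j \<in> Jp" "j' \<in> Jp"
  shows "(\<Sum>i<N. aa i j * aa i j') = sg (snd j) * sg (snd j') *
    ((\<Sum>i<N. psi (snd (fst j)) (real (rho (fst (fst j)) i) / real N) * psi (snd (fst j')) (real (rho (fst (fst j')) i) / real N)) / real N)"
proof -
  have "aa i j * aa i j' = sg (snd j) * sg (snd j') * (psi (snd (fst j)) (real (rho (fst (fst j)) i) / real N) * psi (snd (fst j')) (real (rho (fst (fst j')) i) / real N)) / real N" for i
    unfolding aa_def using Npos by (simp add: mult_ac)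
  then show ?thesis by (simp add: sum_distrib_left sum_divide_distrib)
qed

lemma bb_sum: assumes "j \<in> Jp" "j' \<in> Jp"
  shows "(\<Sum>i\<in>I. bb A i j * bb A i j') = sg (snd j) * sg (snd j') *
    ((\<Sum>i\<in>I. psi (snd (fst j)) (real (cnt (fst (fst j)) A i) / real n) * psi (snd (fst j')) (real (cnt (fst (fst j')) A i) / real n)) / real n)"
proof -
  have "bb A i j * bb A i j' = sg (snd j) * sg (snd j') * (psi (snd (fst j)) (real (cnt (fst (fst j)) A i) / real n) * psi (snd (fst j')) (real (cnt (fst (fst j')) A i) / real n)) / real n" for i
    unfolding bb_def using Npos by (simp add: mult_ac)
  then show ?thesis by (simp add: sum_distrib_left sum_divide_distrib)
qed

lemma aa_var: assumes "j \<in> Jp" shows "(\<Sum>i<N. (aa i j)\<^sup>2) \<le> 2" "(\<Sum>i<N. (aa i j)\<^sup>2) \<ge> 1/2"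
proof -
  have sg2: "sg b * sg b = 1" for b by (simp add: sg_def)
  have "(\<Sum>i<N. (aa i j)\<^sup>2) = (\<Sum>i<N. (psi (snd (fst j)) (real (rho (fst (fst j)) i) / real N))\<^sup>2) / real N"
    using aa_sum[OF assms assms] by (simp add: power2_eq_square sg2)
  moreover have "fst (fst j) \<in> U" "snd (fst j) \<in> {1..d}" using assms unfolding Jp_def by auto
  ultimately show "(\<Sum>i<N. (aa i j)\<^sup>2) \<le> 2" "(\<Sum>i<N. (aa i j)\<^sup>2) \<ge> 1/2"
    using sum_psi_sq[of "fst (fst j)" "snd (fst j)"] Npos(2) by (auto simp: divide_le_eq le_divide_eq mult.commute)
qed

lemma aa_bound: assumes "i < N" "j \<in> Jp" shows "\<bar>aa i j\<bar> \<le> B / sqrt (real N)"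
proof -
  have "fst (fst j) \<in> U" "snd (fst j) \<in> {1..d}" using assms unfolding Jp_def by auto
  then have "\<bar>psi (snd (fst j)) (real (rho (fst (fst j)) i) / real N)\<bar> \<le> B" using psiB rho_le1 assms by blast
  moreover have "\<bar>sg b\<bar> = 1" for b by (simp add: sg_def)
  ultimately show ?thesis unfolding aa_def using Npos by (simp add: abs_mult divide_right_mono)
qed

lemma clt: "\<bar>(\<integral>e. sx.soft_ind t (lin {..<N} e aa) \<partial>gP {..<N}) - (\<integral>x. sx.soft_ind t (lin {..<N} x aa) \<partial>PiM {..<N} (\<lambda>_. two_point q))\<bar> \<le> \<eta>clt"
proof -
  have "\<bar>(\<integral>e. sx.soft_ind t (lin {..<N} e aa) \<partial>PiM {..<N} (\<lambda>_. std_normal_distribution)) - (\<integral>x. sx.soft_ind t (lin {..<N} x aa) \<partial>PiM {..<N} (\<lambda>_. two_point (real m / real N)))\<bar>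
    \<le> (sx.K3 * (B / sqrt (real N)) * C / (3 * c\<^sub>1)) * 2 * harm (card {..<N})"
    by (rule sx.lindeberg[OF ul1 ul2 c1 finite_lessThan]) (use aa_bound aa_var(1) Bpos bc in auto)
  then show ?thesis unfolding \<eta>clt_def q_def by simp
qed

lemma boot_compare:
  assumes A: "A \<subseteq> {..<N}" "card A = m" and g: "good A"
  shows "\<bar>(\<integral>e. sx.soft_ind t (lin {..<N} e aa) \<partial>gP {..<N}) - (\<integral>e. sx.soft_ind t (lin ({..<N} - A) e (bb A)) \<partial>gP ({..<N} - A))\<bar> \<le> \<eta>g"
  unfolding \<eta>g_def
proof (rule sx.gaussian_comparison)
  fix j j' assume j: "j \<in> Jp" "j' \<in> Jp"
  then have m: "fst (fst j) \<in> U" "snd (fst j) \<in> {1..d}" "fst (fst j') \<in> U" "snd (fst j') \<in> {1..d}" unfolding Jp_def by auto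
  have s: "\<bar>sg (snd j) * sg (snd j')\<bar> = 1" by (simp add: sg_def)
  show "\<bar>(\<Sum>i<N. aa i j * aa i j') - (\<Sum>i\<in>{..<N} - A. bb A i j * bb A i j')\<bar> \<le> 128 * B * sqrt (\<Lambda> / real N)"
    unfolding aa_sum[OF j] bb_sum[OF j] right_diff_distrib[symmetric] abs_mult[of "sg (snd j) * sg (snd j')"] s mult_1
    by (rule cov_close[OF A g cntok[OF A] m(1,3,2,4)])
qed auto

lemma lin_aa_xi:
  assumes A: "A \<subseteq> {..<N}"
  shows "lin {..<N} (\<lambda>i\<in>{..<N}. (of_bool (i \<in> A) - q) / sqrt (q * (1 - q))) aa ((u, k), b) = sg b * (s0 * Sl u k A)"
proof -
  have s: "s0 = 1 / (sqrt (q * (1 - q)) * sqrt (real N))"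
  proof -
    have "q * (1 - q) * real N = real n * real m / real N" using q01(3) Npos by (simp add: q_def)
    then have "sqrt (q * (1 - q)) * sqrt (real N) = sqrt (real n * real m / real N)" by (metis real_sqrt_mult)
    then show ?thesis unfolding s0_def by (simp add: real_sqrt_divide)
  qed
  have "lin {..<N} (\<lambda>i\<in>{..<N}. (of_bool (i \<in> A) - q) / sqrt (q * (1 - q))) aa ((u, k), b)
    = (\<Sum>i<N. sg b * (s0 * ((of_bool (i \<in> A) - q) * psi k (real (rho u i) / real N))))"
    unfolding lin_def s aa_def by (intro sum.cong refl) (simp add: mult_ac)
  then show ?thesis unfolding Sl_def by (simp add: sum_distrib_left)
qed

lemma Ev_iff: assumes A: "A \<subseteq> {..<N}"
  shows "Ev t A \<longleftrightarrow> (\<exists>j\<in>Jp. lin {..<N} (\<lambda>i\<in>{..<N}. (of_bool (i \<in> A) - q) / sqrt (q * (1 - q))) aa j \<ge> t)"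
proof -
  have "(\<exists>j\<in>Jp. lin {..<N} (\<lambda>i\<in>{..<N}. (of_bool (i \<in> A) - q) / sqrt (q * (1 - q))) aa j \<ge> t)
      \<longleftrightarrow> (\<exists>u\<in>U. \<exists>k\<in>{1..d}. \<exists>b. sg b * (s0 * Sl u k A) \<ge> t)"
    unfolding Jp_def using lin_aa_xi[OF A] by auto
  also have "\<dots> \<longleftrightarrow> (\<exists>u\<in>U. \<exists>k\<in>{1..d}. s0 * \<bar>Sl u k A\<bar> \<ge> t)"
  proof -
    have "(\<exists>b. sg b * x \<ge> t) \<longleftrightarrow> \<bar>x\<bar> \<ge> t" for x
      unfolding sg_def by (auto simp: ex_bool_eq abs_if split: if_splits)
    moreover have "\<bar>s0 * x\<bar> = s0 * \<bar>x\<bar>" for x using s0_pos by (simp add: abs_mult)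
    ultimately show ?thesis by simp
  qed
  finally show ?thesis unfolding Ev_def s0_def by simp
qed

lemma EB_Ev_le: "EB N q (\<lambda>A. of_bool (Ev t A)) \<le> (\<integral>x. sx.soft_ind (t - w) (lin {..<N} x aa) \<partial>PiM {..<N} (\<lambda>_. two_point q)) + 1 / real N"
  and soft_ind_le_EB_Ev: "(\<integral>x. sx.soft_ind t (lin {..<N} x aa) \<partial>PiM {..<N} (\<lambda>_. two_point q)) \<le> EB N q (\<lambda>A. of_bool (Ev (t - w) A)) + 1 / real N"
proof -
  let ?\<xi> = "\<lambda>A. \<lambda>i\<in>{..<N}. (of_bool (i \<in> A) - q) / sqrt (q * (1 - q))"
  have I: "(\<integral>x. sx.soft_ind t (lin {..<N} x aa) \<partial>PiM {..<N} (\<lambda>_. two_point q)) = EB N q (\<lambda>A. sx.soft_ind t (lin {..<N} (?\<xi> A) aa))" for t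
    by (rule integral_two_point_PiM[OF q01(1,2), where C=1])
       (auto intro!: sx.smax_measurable lin_measurable' simp: sets_two_point sx.soft_ind_bounds)
  have "EB N q (\<lambda>A. of_bool (Ev t A)) \<le> EB N q (\<lambda>A. sx.soft_ind (t - w) (lin {..<N} (?\<xi> A) aa) + 1 / real N)"
  proof (rule EB_mono[OF q01(1,2)])
    fix A assume A: "A \<subseteq> {..<N}"
    show "of_bool (Ev t A) \<le> sx.soft_ind (t - w) (lin {..<N} (?\<xi> A) aa) + 1 / real N"
    proof (cases "Ev t A")
      case True
      then obtain j where "j \<in> Jp" "lin {..<N} (?\<xi> A) aa j \<ge> t" unfolding Ev_iff[OF A] by blast
      then show ?thesis using sx.soft_ind_ge[of j t "lin {..<N} (?\<xi> A) aa" w] True expw(2) by simp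
    qed (use sx.soft_ind_bounds(1)[of "t - w" "lin {..<N} (?\<xi> A) aa"] in simp)
  qed
  then show "EB N q (\<lambda>A. of_bool (Ev t A)) \<le> (\<integral>x. sx.soft_ind (t - w) (lin {..<N} x aa) \<partial>PiM {..<N} (\<lambda>_. two_point q)) + 1 / real N"
    unfolding I EB_add EB_const .
  have "EB N q (\<lambda>A. sx.soft_ind t (lin {..<N} (?\<xi> A) aa)) \<le> EB N q (\<lambda>A. of_bool (Ev (t - w) A) + 1 / real N)"
  proof (rule EB_mono[OF q01(1,2)])
    fix A assume A: "A \<subseteq> {..<N}"
    show "sx.soft_ind t (lin {..<N} (?\<xi> A) aa) \<le> of_bool (Ev (t - w) A) + 1 / real N"
    proof (cases "Ev (t - w) A")
      case True then show ?thesis using sx.soft_ind_bounds(4)[of t "lin {..<N} (?\<xi> A) aa"] by (simp add: add_increasing2)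
    next
      case False
      then have "\<And>j. j \<in> Jp \<Longrightarrow> lin {..<N} (?\<xi> A) aa j \<le> t - w" unfolding Ev_iff[OF A] by force
      from sx.soft_ind_le[OF this lnJ'] show ?thesis using False expw(1) by simp
    qed
  qed
  then show "(\<integral>x. sx.soft_ind t (lin {..<N} x aa) \<partial>PiM {..<N} (\<lambda>_. two_point q)) \<le> EB N q (\<lambda>A. of_bool (Ev (t - w) A)) + 1 / real N"
    unfolding I EB_add EB_const .
qed

lemma error_terms_nonneg: "\<eta>clt \<ge> 0" "\<eta>g \<ge> 0"
proof -
  interpret ul: unit_law std_normal_distribution C c\<^sub>1 by (rule ul2)
  have C0: "C \<ge> 0" using ul.bound3 by (rule order_trans[rotated]) (auto intro!: Bochner_Integration.integral_nonneg)
  show "\<eta>clt \<ge> 0" unfolding \<eta>clt_def using sx.K3_pos Bpos C0 c1 by (simp add: harm_nonneg)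
  show "\<eta>g \<ge> 0" unfolding \<eta>g_def using Bpos \<Lambda>1 eps bet by simp
qed

lemma EP_good_transfer:
  assumes "\<And>A. A \<subseteq> {..<N} \<Longrightarrow> card A = m \<Longrightarrow> good A \<Longrightarrow> P A \<Longrightarrow> Q A"
  shows "EP N (\<lambda>\<pi>. of_bool (P (\<pi> ` {..<m}))) \<le> EP N (\<lambda>\<pi>. of_bool (Q (\<pi> ` {..<m}))) + 12 / real N"
proof -
  have "EP N (\<lambda>\<pi>. of_bool (P (\<pi> ` {..<m}))) \<le> EP N (\<lambda>\<pi>. of_bool (Q (\<pi> ` {..<m})) + of_bool (\<not> good (\<pi> ` {..<m})))"
  proof (rule EP_mono)
    fix \<pi> assume pi: "\<pi> permutes {..<N}"
    have A: "\<pi> ` {..<m} \<subseteq> {..<N}" using permutes_image[OF pi] Npos(3) by (metis image_mono lessThan_subset_iff)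
    have "inj_on \<pi> {..<m}" using permutes_inj[OF pi] inj_on_subset by blast
    then have "card (\<pi> ` {..<m}) = m" by (simp add: card_image)
    then show "of_bool (P (\<pi> ` {..<m})) \<le> (of_bool (Q (\<pi> ` {..<m})) + of_bool (\<not> good (\<pi> ` {..<m})) :: real)"
      using assms[OF A] by auto
  qed
  then show ?thesis unfolding EP_add using prob_bad by linarith
qed

lemma ET_Ev: assumes A: "A \<subseteq> {..<N}" "card A = m" and g: "good A"
  shows "ET t A \<Longrightarrow> Ev (t - s0 * (10 * \<Lambda> * B)) A" "Ev t A \<Longrightarrow> ET (t - s0 * (10 * \<Lambda> * B)) A"
proof -
  have cl: "\<bar>Ts u k A - s0 * \<bar>Sl u k A\<bar>\<bar> \<le> s0 * (10 * \<Lambda> * B)" if "u \<in> U" "k \<in> {1..d}" for u k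
    unfolding s0_def using that g by (intro T_close A cntok) (auto simp: good_def mart_good_def)
  show "ET t A \<Longrightarrow> Ev (t - s0 * (10 * \<Lambda> * B)) A"
    unfolding ET_def Ev_def s0_def[symmetric]
  proof (elim bexE)
    fix u k assume "u \<in> U" "k \<in> {1..d}" "t \<le> Ts u k A"
    then have "t - s0 * (10 * \<Lambda> * B) \<le> s0 * \<bar>Sl u k A\<bar>" using cl[of u k] by linarith
    then show "\<exists>u\<in>U. \<exists>k\<in>{1..d}. t - s0 * (10 * \<Lambda> * B) \<le> s0 * \<bar>Sl u k A\<bar>" using \<open>u \<in> U\<close> \<open>k \<in> {1..d}\<close> by blast
  qed
  show "Ev t A \<Longrightarrow> ET (t - s0 * (10 * \<Lambda> * B)) A"
    unfolding ET_def Ev_def s0_def[symmetric]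
  proof (elim bexE)
    fix u k assume "u \<in> U" "k \<in> {1..d}" "t \<le> s0 * \<bar>Sl u k A\<bar>"
    then have "t - s0 * (10 * \<Lambda> * B) \<le> Ts u k A" using cl[of u k] by linarith
    then show "\<exists>u\<in>U. \<exists>k\<in>{1..d}. t - s0 * (10 * \<Lambda> * B) \<le> Ts u k A" using \<open>u \<in> U\<close> \<open>k \<in> {1..d}\<close> by blast
  qed
qed

text \<open>The chain of laws is uniform subset, Bernoulli subset, two-point noise, Gaussian noise.
  The noise is exchanged under the smoothed indicator, hence \<open>w\<close> is spent twice.
  \<open>statistic_lower\<close> runs the chain backwards.\<close>

lemma statistic_upper: "EP N (\<lambda>\<pi>. of_bool (ET t (\<pi> ` {..<m}))) \<le> Sg (t - W) + \<eta>"
proof -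
  let ?t1 = "t - s0 * (10 * \<Lambda> * B)"
  have "EP N (\<lambda>\<pi>. of_bool (ET t (\<pi> ` {..<m}))) \<le> EP N (\<lambda>\<pi>. of_bool (Ev ?t1 (\<pi> ` {..<m}))) + 12 / real N"
    by (rule EP_good_transfer) (rule ET_Ev)
  also have "EP N (\<lambda>\<pi>. of_bool (Ev ?t1 (\<pi> ` {..<m}))) \<le> EB N q (\<lambda>A. of_bool (Ev (?t1 - wc) A)) + 10 / real N"
    by (rule EP_le_EB_coupled)
  also have "EB N q (\<lambda>A. of_bool (Ev (?t1 - wc) A)) \<le> (\<integral>x. sx.soft_ind (?t1 - wc - w) (lin {..<N} x aa) \<partial>PiM {..<N} (\<lambda>_. two_point q)) + 1 / real N"
    by (rule EB_Ev_le)
  also have "(\<integral>x. sx.soft_ind (?t1 - wc - w) (lin {..<N} x aa) \<partial>PiM {..<N} (\<lambda>_. two_point q)) \<le> (\<integral>e. sx.soft_ind (?t1 - wc - w) (lin {..<N} e aa) \<partial>gP {..<N}) + \<eta>clt"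
    using clt[of "?t1 - wc - w"] by linarith
  also have "(\<integral>e. sx.soft_ind (?t1 - wc - w) (lin {..<N} e aa) \<partial>gP {..<N}) \<le> Sg (?t1 - wc - w - w) + 1 / real N"
    unfolding Sg_def using sx.soft_ind_le_gauss_tail[OF lnJ', where t="?t1 - wc - w" and I="{..<N}" and a=aa and w=w] expw(1) by simp
  also have "?t1 - wc - w - w = t - W" unfolding W_def by simp
  finally show ?thesis unfolding \<eta>_def using error_terms_nonneg by simp
qed

lemma statistic_lower: "Sg t \<le> EP N (\<lambda>\<pi>. of_bool (ET (t - W) (\<pi> ` {..<m}))) + \<eta>"
proof -
  have "Sg t \<le> (\<integral>e. sx.soft_ind (t - w) (lin {..<N} e aa) \<partial>gP {..<N}) + 1 / real N"
    unfolding Sg_def using sx.gauss_tail_le_soft_ind[where t=t and I="{..<N}" and a=aa and w=w] expw(2) by linarith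
  also have "(\<integral>e. sx.soft_ind (t - w) (lin {..<N} e aa) \<partial>gP {..<N}) \<le> (\<integral>x. sx.soft_ind (t - w) (lin {..<N} x aa) \<partial>PiM {..<N} (\<lambda>_. two_point q)) + \<eta>clt"
    using clt[of "t - w"] by linarith
  also have "(\<integral>x. sx.soft_ind (t - w) (lin {..<N} x aa) \<partial>PiM {..<N} (\<lambda>_. two_point q)) \<le> EB N q (\<lambda>A. of_bool (Ev (t - w - w) A)) + 1 / real N"
    by (rule soft_ind_le_EB_Ev)
  also have "EB N q (\<lambda>A. of_bool (Ev (t - w - w) A)) \<le> EP N (\<lambda>\<pi>. of_bool (Ev (t - w - w - wc) (\<pi> ` {..<m}))) + 10 / real N"
    by (rule EB_le_EP_coupled)
  also have "EP N (\<lambda>\<pi>. of_bool (Ev (t - w - w - wc) (\<pi> ` {..<m}))) \<le> EP N (\<lambda>\<pi>. of_bool (ET (t - w - w - wc - s0 * (10 * \<Lambda> * B)) (\<pi> ` {..<m}))) + 12 / real N"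
    by (rule EP_good_transfer) (rule ET_Ev)
  also have "t - w - w - wc - s0 * (10 * \<Lambda> * B) = t - W" unfolding W_def by simp
  finally show ?thesis unfolding \<eta>_def using error_terms_nonneg by simp
qed

text \<open>Both sides are Gaussian, so one covariance comparison suffices and the shift 2 w would
  do. It is enlarged to \<open>W\<close> to work with a single shift everywhere.\<close>

lemma boot_tail:
  assumes A: "A \<subseteq> {..<N}" "card A = m" and g: "good A"
  shows "Sb A t \<le> Sg (t - W) + \<eta>" "Sg t \<le> Sb A (t - W) + \<eta>"
proof -
  have h: "\<bar>(\<integral>e. sx.soft_ind t (lin {..<N} e aa) \<partial>gP {..<N}) - (\<integral>e. sx.soft_ind t (lin ({..<N} - A) e (bb A)) \<partial>gP ({..<N} - A))\<bar> \<le> \<eta>g" for t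
    by (rule boot_compare[OF A g])
  have mono: "Sg (t - 2 * w) \<le> Sg (t - W)" "Sb A (t - 2 * w) \<le> Sb A (t - W)" for t
    unfolding Sg_def Sb_def using W_bounds(2) by (auto intro!: gauss_tail_antimono Jp)
  have N2: "2 / real N \<le> 24 / real N" by (simp add: divide_right_mono)
  have "Sb A t \<le> (\<integral>e. sx.soft_ind (t - w) (lin ({..<N} - A) e (bb A)) \<partial>gP ({..<N} - A)) + 1 / real N"
    unfolding Sb_def using sx.gauss_tail_le_soft_ind[where t=t and I="{..<N} - A" and a="bb A" and w=w] expw(2) by linarith
  also have "(\<integral>e. sx.soft_ind (t - w) (lin ({..<N} - A) e (bb A)) \<partial>gP ({..<N} - A)) \<le> (\<integral>e. sx.soft_ind (t - w) (lin {..<N} e aa) \<partial>gP {..<N}) + \<eta>g"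
    using h[of "t - w"] by linarith
  also have "(\<integral>e. sx.soft_ind (t - w) (lin {..<N} e aa) \<partial>gP {..<N}) \<le> Sg (t - w - w) + 1 / real N"
    unfolding Sg_def using sx.soft_ind_le_gauss_tail[OF lnJ', where t="t - w" and I="{..<N}" and a=aa and w=w] expw(1) by simp
  finally show "Sb A t \<le> Sg (t - W) + \<eta>" unfolding \<eta>_def using mono(1)[of t] error_terms_nonneg N2 by simp
  have "Sg t \<le> (\<integral>e. sx.soft_ind (t - w) (lin {..<N} e aa) \<partial>gP {..<N}) + 1 / real N"
    unfolding Sg_def using sx.gauss_tail_le_soft_ind[where t=t and I="{..<N}" and a=aa and w=w] expw(2) by linarith
  also have "(\<integral>e. sx.soft_ind (t - w) (lin {..<N} e aa) \<partial>gP {..<N}) \<le> (\<integral>e. sx.soft_ind (t - w) (lin ({..<N} - A) e (bb A)) \<partial>gP ({..<N} - A)) + \<eta>g"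
    using h[of "t - w"] by linarith
  also have "(\<integral>e. sx.soft_ind (t - w) (lin ({..<N} - A) e (bb A)) \<partial>gP ({..<N} - A)) \<le> Sb A (t - w - w) + 1 / real N"
    unfolding Sb_def using sx.soft_ind_le_gauss_tail[OF lnJ', where t="t - w" and I="{..<N} - A" and a="bb A" and w=w] expw(1) by simp
  finally show "Sg t \<le> Sb A (t - W) + \<eta>" unfolding \<eta>_def using mono(2)[of t] error_terms_nonneg N2 by simp
qed

text \<open>If the maximum lies between t and t + W, the soft maximum is within W + \<epsilon> of t
  + W, and anti-concentration bounds the probability of that.\<close>

lemma Sg_increment: "Sg t \<le> Sg (t + W) + an"
proof -
  interpret P: prob_space "gP {..<N}" by (rule prob_space_gP)
  \<comment> \<open>A second instance with width W + \<epsilon>. The soft maximum does not depend on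
    the width, so the small-ball bound on this larger scale concerns the same random
    variable.\<close>
  interpret sy: smax Jp \<beta> "W + \<epsilon>" by unfold_locales (use Jp eps bet W_bounds in auto)
  let ?E = "\<lambda>t. {e \<in> space (gP {..<N}). \<exists>j\<in>Jp. lin {..<N} e aa j \<ge> t}"
  let ?C = "{e \<in> space (gP {..<N}). \<bar>sx.soft_max (lin {..<N} e aa) - (t + W)\<bar> \<le> W + \<epsilon>}"
  have E: "?E t \<in> sets (gP {..<N})" for t by (rule gauss_tail_set_measurable[OF Jp(1)])
  have C: "?C \<in> sets (gP {..<N})"
  proof -
    have [measurable]: "(\<lambda>e. sx.soft_max (lin {..<N} e aa)) \<in> borel_measurable (gP {..<N})" by (intro sx.smax_measurable lin_measurable)
    show ?thesis by measurable
  qed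
  have "?E t \<subseteq> ?E (t + W) \<union> ?C"
  proof
    fix e assume e: "e \<in> ?E t"
    then obtain j where j: "j \<in> Jp" "lin {..<N} e aa j \<ge> t" by blast
    show "e \<in> ?E (t + W) \<union> ?C"
    proof (cases "e \<in> ?E (t + W)")
      case False
      then have "\<And>j. j \<in> Jp \<Longrightarrow> lin {..<N} e aa j \<le> t + W" using e by force
      then have "sx.soft_max (lin {..<N} e aa) \<le> t + W + ln (card Jp) / \<beta>" by (rule sx.soft_max_le)
      then have "sx.soft_max (lin {..<N} e aa) \<le> t + W + \<epsilon>" using lnJ' by linarith
      moreover have "t \<le> sx.soft_max (lin {..<N} e aa)" using sx.soft_max_ge[OF j(1), of "lin {..<N} e aa"] j(2) by linarith
      ultimately show ?thesis using e W_bounds(1) eps by auto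
    qed blast
  qed
  then have "measure (gP {..<N}) (?E t) \<le> measure (gP {..<N}) (?E (t + W) \<union> ?C)"
    using E C by (intro P.finite_measure_mono) auto
  also have "\<dots> \<le> measure (gP {..<N}) (?E (t + W)) + measure (gP {..<N}) ?C"
    using E C by (intro measure_Un_le)
  also have "measure (gP {..<N}) ?C \<le> 96 * (W + \<epsilon>) * sqrt \<Lambda>"
  proof (rule sy.anti_concentration[OF finite_lessThan _ _ \<Lambda>1(1)])
    show "(\<Sum>i<N. (aa i j)\<^sup>2) \<le> 2" "(\<Sum>i<N. (aa i j)\<^sup>2) \<ge> 1/2" if "j \<in> Jp" for j using aa_var[OF that] by auto
    have "2 \<le> exp (\<Lambda> / 2)"
    proof -
      have "real p + 1 \<ge> 2" using p by simp
      then have "\<Lambda> / 2 \<ge> 1" using \<Lambda>(1) by linarith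
      then have "exp (\<Lambda> / 2) \<ge> 1 + \<Lambda> / 2" using exp_ge_add_one_self by blast
      then show ?thesis using \<open>\<Lambda> / 2 \<ge> 1\<close> by linarith
    qed
    then have "2 * (real (card U) * real d) \<le> exp (\<Lambda> / 2) * exp (\<Lambda> / 2)" using \<Lambda>(3) by (intro mult_mono) auto
    also have "\<dots> = exp \<Lambda>" by (simp flip: exp_add)
    finally show "real (card Jp) \<le> exp \<Lambda>" by (simp add: Jp)
    have "1 \<le> \<epsilon> * \<beta>" by (rule eb)
    also have "\<dots> \<le> (W + \<epsilon>) * \<beta>" using W_bounds(1) bet by (intro mult_right_mono) auto
    finally show "1 \<le> (W + \<epsilon>) * \<beta>" .
  qed
  finally show ?thesis unfolding Sg_def gauss_tail_def an_def by simp
qed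

text \<open>Every coordinate occurs with both signs, so the maximum is never negative. This supplies
  the starting point 0 for locating quantiles.\<close>

lemma Sg_nonpos: assumes "t \<le> 0" shows "Sg t = 1"
proof -
  interpret P: prob_space "gP {..<N}" by (rule prob_space_gP)
  obtain u where u: "u \<in> U" using U by blast
  have k: "(1::nat) \<in> {1..d}" using d by simp
  have "\<exists>j\<in>Jp. lin {..<N} e aa j \<ge> t" for e
  proof -
    have j: "((u, 1), b) \<in> Jp" for b using u k unfolding Jp_def by auto
    have "lin {..<N} e aa ((u, 1), False) = - lin {..<N} e aa ((u, 1), True)"
      unfolding lin_def aa_def sg_def by (simp add: sum_negf)
    then have "lin {..<N} e aa ((u, 1), False) \<ge> t \<or> lin {..<N} e aa ((u, 1), True) \<ge> t" using assms by linarith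
    then show ?thesis using j by blast
  qed
  then have "{e \<in> space (gP {..<N}). \<exists>j\<in>Jp. lin {..<N} e aa j \<ge> t} = space (gP {..<N})" by auto
  then show ?thesis unfolding Sg_def gauss_tail_def by (simp add: P.prob_space)
qed

end

section \<open>Bootstrap quantiles and the size of the test\<close>

definition gauss_tail_strict :: "'i set \<Rightarrow> ('i \<Rightarrow> 'a \<Rightarrow> real) \<Rightarrow> 'a set \<Rightarrow> real \<Rightarrow> real" where
  "gauss_tail_strict I a J t = measure (gP I) {e \<in> space (gP I). \<exists>j\<in>J. lin I e a j > t}"

lemma gauss_tail_strict_set_measurable:
  assumes "finite J" shows "{e \<in> space (gP I). \<exists>j\<in>J. lin I e a j > t} \<in> sets (gP I)"
proof -
  have "{e \<in> space (gP I). \<exists>j\<in>J. lin I e a j > t} = (\<Union>j\<in>J. {e \<in> space (gP I). lin I e a j > t})" by auto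
  moreover have "{e \<in> space (gP I). lin I e a j > t} \<in> sets (gP I)" for j
    using lin_measurable(2)[of I a j] by measurable
  ultimately show ?thesis using assms by auto
qed

lemma gauss_tail_strict_le_gauss_tail: assumes "finite J" shows "gauss_tail_strict I a J t \<le> gauss_tail I a J t"
proof -
  interpret prob_space "gP I" by (rule prob_space_gP)
  show ?thesis unfolding gauss_tail_def gauss_tail_strict_def
    by (rule finite_measure_mono[OF _ gauss_tail_set_measurable[OF assms]]) (auto intro: less_imp_le)
qed

lemma gauss_tail_le_gauss_tail_strict: assumes "finite J" "s < t" shows "gauss_tail I a J t \<le> gauss_tail_strict I a J s"
proof -
  interpret prob_space "gP I" by (rule prob_space_gP)
  show ?thesis unfolding gauss_tail_def gauss_tail_strict_def
    by (rule finite_measure_mono[OF _ gauss_tail_strict_set_measurable[OF assms(1)]]) (use assms(2) in \<open>auto intro: less_le_trans\<close>)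
qed

text \<open>An approximate quantile, found as the last multiple of \<open>W\<close> before the tail
  drops to x or below. No continuity of the tail is required, and the resolution \<open>W\<close> is
  no worse than the shifts that occur anyway.\<close>

lemma antimono_crossing:
  fixes S :: "real \<Rightarrow> real"
  assumes anti: "\<And>s t. s \<le> t \<Longrightarrow> S t \<le> S s" and W: "W > 0" and x: "S 0 > x" and ex: "S t\<^sub>0 \<le> x"
  obtains t where "S t > x" "S (t + W) \<le> x"
proof -
  obtain k0 :: nat where "t\<^sub>0 / W < real k0" using reals_Archimedean2 by blast
  then have "t\<^sub>0 \<le> real k0 * W" using W by (simp add: field_simps)
  then have k0: "S (real k0 * W) \<le> x" using anti ex order_trans by blast
  define k where "k = (LEAST k. S (real k * W) \<le> x)"
  have k: "S (real k * W) \<le> x" unfolding k_def using k0 by (rule LeastI)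
  have "k \<noteq> 0" using k x by (intro notI) simp
  then obtain k' where k': "k = Suc k'" using not0_implies_Suc by blast
  have "\<not> S (real k' * W) \<le> x" using not_less_Least[of k' "\<lambda>k. S (real k * W) \<le> x"] k' unfolding k_def by simp
  moreover have "S (real k' * W + W) \<le> x" using k k' by (simp add: algebra_simps)
  ultimately show ?thesis using that by force
qed

context boot_config begin

text \<open>The critical value rests on the strict tail, rejection on a weak inequality. The weak
  tail at t is at most the strict tail at any s < t, and the strict tail at t is at most the weak
  one; \<open>cA_ge\<close> and \<open>cA_le\<close> follow from this interlacing.\<close>

definition cA :: "real \<Rightarrow> nat set \<Rightarrow> real" where
  "cA \<alpha> A = Inf {t. gauss_tail_strict ({..<N} - A) (bb A) Jp t \<le> \<alpha>}"

lemma Sb_nonpos: assumes "t \<le> 0" shows "Sb A t = 1"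
proof -
  let ?I = "{..<N} - A"
  interpret P: prob_space "gP ?I" by (rule prob_space_gP)
  obtain u where u: "u \<in> U" using U by blast
  have k: "(1::nat) \<in> {1..d}" using d by simp
  have "\<exists>j\<in>Jp. lin ?I e (bb A) j \<ge> t" for e
  proof -
    have j: "((u, 1), b) \<in> Jp" for b using u k unfolding Jp_def by auto
    have "lin ?I e (bb A) ((u, 1), False) = - lin ?I e (bb A) ((u, 1), True)"
      unfolding lin_def bb_def sg_def by (simp add: sum_negf)
    then have "lin ?I e (bb A) ((u, 1), False) \<ge> t \<or> lin ?I e (bb A) ((u, 1), True) \<ge> t" using assms by linarith
    then show ?thesis using j by blast
  qed
  then have "{e \<in> space (gP ?I). \<exists>j\<in>Jp. lin ?I e (bb A) j \<ge> t} = space (gP ?I)" by auto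
  then show ?thesis unfolding Sb_def gauss_tail_def by (simp add: P.prob_space)
qed

lemma cA_ge:
  assumes a: "0 < \<alpha>" and t: "Sb A t > \<alpha>" shows "cA \<alpha> A \<ge> t"
  unfolding cA_def
proof (rule cInf_greatest)
  obtain t' where "Sb A t' \<le> \<alpha>" using gauss_tail_eventually_small[OF Jp(1) a] unfolding Sb_def by blast
  then have "gauss_tail_strict ({..<N} - A) (bb A) Jp t' \<le> \<alpha>" using gauss_tail_strict_le_gauss_tail[OF Jp(1)] unfolding Sb_def using order_trans by blast
  then show "{t. gauss_tail_strict ({..<N} - A) (bb A) Jp t \<le> \<alpha>} \<noteq> {}" by blast
  fix s assume s: "s \<in> {t. gauss_tail_strict ({..<N} - A) (bb A) Jp t \<le> \<alpha>}"
  show "t \<le> s"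
  proof (rule ccontr)
    assume "\<not> t \<le> s"
    then have "Sb A t \<le> gauss_tail_strict ({..<N} - A) (bb A) Jp s" unfolding Sb_def by (intro gauss_tail_le_gauss_tail_strict Jp) auto
    then show False using s t by auto
  qed
qed

lemma cA_le:
  assumes a: "\<alpha> < 1" and t: "Sb A t \<le> \<alpha>" shows "cA \<alpha> A \<le> t"
  unfolding cA_def
proof (rule cInf_lower)
  have "gauss_tail_strict ({..<N} - A) (bb A) Jp t \<le> \<alpha>" using gauss_tail_strict_le_gauss_tail[OF Jp(1)] t unfolding Sb_def using order_trans by blast
  then show "t \<in> {t. gauss_tail_strict ({..<N} - A) (bb A) Jp t \<le> \<alpha>}" by simp
  show "bdd_below {t. gauss_tail_strict ({..<N} - A) (bb A) Jp t \<le> \<alpha>}"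
  proof (rule bdd_belowI)
    fix s assume s: "s \<in> {t. gauss_tail_strict ({..<N} - A) (bb A) Jp t \<le> \<alpha>}"
    show "0 \<le> s"
    proof (rule ccontr)
      assume "\<not> 0 \<le> s"
      \<comment> \<open>For negative s the weak tail at s / 2 > s is at most the strict tail at s,
        and it equals 1. Hence no negative s has tail at most \<alpha> < 1, and the set is bounded
        below.\<close>
      then have "Sb A (s / 2) \<le> gauss_tail_strict ({..<N} - A) (bb A) Jp s" unfolding Sb_def by (intro gauss_tail_le_gauss_tail_strict Jp) auto
      moreover have "Sb A (s / 2) = 1" using \<open>\<not> 0 \<le> s\<close> by (intro Sb_nonpos) auto
      ultimately show False using s a by auto
    qed
  qed
qed

lemma ET_mono: "s \<le> t \<Longrightarrow> ET t A \<Longrightarrow> ET s A"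
  unfolding ET_def using order_trans by blast

text \<open>For the upper bound, the reference tail crosses \<alpha> + \<eta> between t and t + W,
  so on typical subsets the critical value is at least t - W. The statistic reaches t - W with
  probability at most Sg (t - 2 W) + \<eta>, and three increments \<open>an\<close> lead from t - 2
  W to t + W. The three \<eta> come from the level, from the statistic and from the atypical
  subsets. The lower bound mirrors this with \<alpha> - \<eta>.\<close>

theorem size_error:
  assumes a: "0 < \<alpha>" "\<alpha> < 1"
  shows "\<bar>EP N (\<lambda>\<pi>. of_bool (ET (cA \<alpha> (\<pi> ` {..<m})) (\<pi> ` {..<m}))) - \<alpha>\<bar> \<le> 3 * an + 3 * \<eta>"
proof -
  have \<eta>12: "12 / real N \<le> \<eta>" unfolding \<eta>_def using error_terms_nonneg
    by (smt (verit) divide_right_mono of_nat_0_le_iff)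
  have \<eta>0: "\<eta> \<ge> 0" using \<eta>12 by (rule order_trans[rotated]) simp
  have an0: "an \<ge> 0" unfolding an_def using W_bounds(1) eps \<Lambda>1 by simp
  have anti: "s \<le> t \<Longrightarrow> Sg t \<le> Sg s" for s t unfolding Sg_def by (rule gauss_tail_antimono[OF Jp(1)])
  have S0: "Sg 0 = 1" by (rule Sg_nonpos) simp
  let ?R = "EP N (\<lambda>\<pi>. of_bool (ET (cA \<alpha> (\<pi> ` {..<m})) (\<pi> ` {..<m})))"
  have R01: "0 \<le> ?R" "?R \<le> 1"
    using EP_nonneg[of N "\<lambda>\<pi>. of_bool (ET (cA \<alpha> (\<pi> ` {..<m})) (\<pi> ` {..<m}))"]
      EP_mono[of N "\<lambda>\<pi>. of_bool (ET (cA \<alpha> (\<pi> ` {..<m})) (\<pi> ` {..<m}))" "\<lambda>_. 1"] by (auto simp: EP_const)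
  have upper: "?R \<le> \<alpha> + 3 * an + 3 * \<eta>"
  \<comment> \<open>Otherwise the claimed bound is at least 1 and there is nothing to show.\<close>
  proof (cases "\<alpha> + \<eta> < 1")
    case False then show ?thesis using R01 \<eta>0 an0 by linarith
  next
    case True
    obtain t0 where "Sg t0 \<le> \<alpha> + \<eta>" using gauss_tail_eventually_small[OF Jp(1), of "\<alpha> + \<eta>"] a \<eta>0 unfolding Sg_def by fastforce
    then obtain t where t: "Sg t > \<alpha> + \<eta>" "Sg (t + W) \<le> \<alpha> + \<eta>"
      using antimono_crossing[of Sg W "\<alpha> + \<eta>" t0] anti W_bounds(1) S0 True by auto
    have "?R \<le> EP N (\<lambda>\<pi>. of_bool (ET (t - W) (\<pi> ` {..<m}))) + 12 / real N"
    proof (rule EP_good_transfer)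
      fix A assume A: "A \<subseteq> {..<N}" "card A = m" "good A" "ET (cA \<alpha> A) A"
      have "Sb A (t - W) > \<alpha>" using boot_tail(2)[OF A(1-3), of t] t by linarith
      then have "t - W \<le> cA \<alpha> A" by (rule cA_ge[OF a(1)])
      then show "ET (t - W) A" using A(4) by (rule ET_mono)
    qed
    also have "EP N (\<lambda>\<pi>. of_bool (ET (t - W) (\<pi> ` {..<m}))) \<le> Sg (t - W - W) + \<eta>" by (rule statistic_upper)
    also have "Sg (t - W - W) \<le> Sg (t + W) + 3 * an"
      using Sg_increment[of "t - W - W"] Sg_increment[of "t - W"] Sg_increment[of t] by simp
    finally show ?thesis using t \<eta>12 by linarith
  qed
  have lower: "\<alpha> \<le> ?R + 3 * an + 3 * \<eta>"
  proof (cases "\<alpha> - \<eta> > 0")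
    case False then show ?thesis using R01 \<eta>0 an0 by linarith
  next
    case True
    obtain t0 where "Sg t0 \<le> \<alpha> - \<eta>" using gauss_tail_eventually_small[OF Jp(1) True] unfolding Sg_def by blast
    then obtain t where t: "Sg t > \<alpha> - \<eta>" "Sg (t + W) \<le> \<alpha> - \<eta>"
      using antimono_crossing[of Sg W "\<alpha> - \<eta>" t0] anti W_bounds(1) S0 a \<eta>0 by auto
    have "Sg (t + W + W + W) \<le> EP N (\<lambda>\<pi>. of_bool (ET (t + W + W) (\<pi> ` {..<m}))) + \<eta>"
      using statistic_lower[of "t + W + W + W"] by simp
    also have "EP N (\<lambda>\<pi>. of_bool (ET (t + W + W) (\<pi> ` {..<m}))) \<le> ?R + 12 / real N"
    proof (rule EP_good_transfer)
      fix A assume A: "A \<subseteq> {..<N}" "card A = m" "good A" "ET (t + W + W) A"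
      have "Sb A (t + W + W) \<le> \<alpha>" using boot_tail(1)[OF A(1-3), of "t + W + W"] t(2) by (simp only: add_diff_cancel_right')
      then have "cA \<alpha> A \<le> t + W + W" by (rule cA_le[OF a(2)])
      then show "ET (cA \<alpha> A) A" using A(4) by (rule ET_mono)
    qed
    finally have "Sg (t + W + W + W) \<le> ?R + 12 / real N + \<eta>" by simp
    then show ?thesis using Sg_increment[of t] Sg_increment[of "t + W"] Sg_increment[of "t + W + W"] t \<eta>12 by linarith
  qed
  show ?thesis using upper lower by linarith
qed

end

section \<open>Order patterns of projections\<close>

definition sign_pattern :: "'c set \<Rightarrow> 'l set \<Rightarrow> ('l \<Rightarrow> 'c \<Rightarrow> real) \<Rightarrow> ('c \<Rightarrow> real) \<Rightarrow> 'l set" where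
  "sign_pattern I L w u = {l \<in> L. (\<Sum>i\<in>I. u i * w l i) \<le> 0}"

text \<open>Deleting \<open>l\<close> maps \<open>P'\<close> into \<open>P\<close>, and a set has
  two preimages exactly when it occurs both with and without \<open>l\<close>; all such sets lie in
  \<open>D\<close>.\<close>

lemma card_le_by_deletion:
  assumes P: "finite P" and P': "\<And>S. S \<in> P' \<Longrightarrow> S - {l} \<in> P" and D: "finite D"
    and dbl: "\<And>S. l \<notin> S \<Longrightarrow> S \<in> P' \<Longrightarrow> insert l S \<in> P' \<Longrightarrow> S \<in> D"
  shows "finite P'" "card P' \<le> card P + card D"
proof -
  define A0 where "A0 = {S \<in> P'. l \<notin> S}"
  define A1 where "A1 = {S \<in> P'. l \<in> S}"
  define A2 where "A2 = (\<lambda>S. S - {l}) ` A1"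
  have A0P: "A0 \<subseteq> P" using P' unfolding A0_def by fastforce
  have A2P: "A2 \<subseteq> P" using P' unfolding A2_def A1_def by auto
  have inj: "inj_on (\<lambda>S. S - {l}) A1" unfolding A1_def inj_on_def by blast
  have f: "finite A0" "finite A2" using A0P A2P P finite_subset by auto
  then have f1: "finite A1" unfolding A2_def using inj finite_imageD by blast
  have PP: "P' = A0 \<union> A1" unfolding A0_def A1_def by auto
  then show "finite P'" using f f1 by simp
  have "card P' = card A0 + card A2"
  proof -
    have "card P' = card A0 + card A1" unfolding PP by (rule card_Un_disjoint[OF f(1) f1]) (auto simp: A0_def A1_def)
    then show ?thesis unfolding A2_def using card_image[OF inj] by simp
  qed
  also have "\<dots> = card (A0 \<union> A2) + card (A0 \<inter> A2)" using card_Un_Int[OF f] .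
  also have "\<dots> \<le> card P + card D"
  proof (intro add_mono card_mono P D)
    show "A0 \<union> A2 \<subseteq> P" using A0P A2P by auto
    show "A0 \<inter> A2 \<subseteq> D"
    proof
      fix S assume S: "S \<in> A0 \<inter> A2"
      then obtain S' where S': "S' \<in> P'" "l \<in> S'" "S = S' - {l}" unfolding A2_def A1_def by auto
      then have "insert l S = S'" by auto
      then show "S \<in> D" using dbl[of S] S S' unfolding A0_def by auto
    qed
  qed
  finally show "card P' \<le> card P + card D" .
qed

text \<open>Deletion and restriction for hyperplane arrangements. A pattern that occurs on both
  sides of the hyperplane of \<open>l\<close> is realised on that hyperplane, a space of one
  dimension less; the resulting recursion is of Pascal type.\<close>

lemma card_sign_patterns:
  assumes "finite L" "finite I"
  shows "finite (range (sign_pattern I L w)) \<and> card (range (sign_pattern I L w)) \<le> (card L + 1) ^ card I"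
  using assms
proof (induction L arbitrary: I w rule: finite_induct)
  case empty
  have "range (sign_pattern I {} w) = {{}}" unfolding sign_pattern_def by auto
  then show ?case by simp
next
  case (insert l L)
  let ?dot = "\<lambda>u v. \<Sum>i\<in>I. u i * v i"
  have IH: "finite (range (sign_pattern I L w))" "card (range (sign_pattern I L w)) \<le> (card L + 1) ^ card I" using insert.IH[OF insert.prems] by auto
  have del: "S - {l} \<in> range (sign_pattern I L w)" if S: "S \<in> range (sign_pattern I (insert l L) w)" for S
  proof -
    obtain u where u: "S = sign_pattern I (insert l L) w u" using S by auto
    then have "S - {l} = sign_pattern I L w u" using insert.hyps(2) unfolding sign_pattern_def by auto
    then show ?thesis by simp
  qed
  have seg: "\<exists>v. ?dot v (w l) = 0 \<and> S = sign_pattern I L w v \<and> (\<exists>i\<in>I. w l i \<noteq> 0)"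
    if S: "l \<notin> S" "S \<in> range (sign_pattern I (insert l L) w)" "insert l S \<in> range (sign_pattern I (insert l L) w)" for S
  proof -
    obtain u where u: "S = sign_pattern I (insert l L) w u" using S by auto
    obtain u' where u': "insert l S = sign_pattern I (insert l L) w u'" using S by auto
    have a: "?dot u (w l) > 0" using u S(1) unfolding sign_pattern_def by auto
    have b: "?dot u' (w l) \<le> 0" using u' unfolding sign_pattern_def by auto
    have Su: "S = sign_pattern I L w u" using u S(1) unfolding sign_pattern_def by auto
    have Su': "S = sign_pattern I L w u'" using u' S(1) insert.hyps(2) unfolding sign_pattern_def by auto
    define x where "x = ?dot u (w l)"
    define y where "y = - ?dot u' (w l)"
    have xy: "x > 0" "y \<ge> 0" using a b unfolding x_def y_def by auto
    \<comment> \<open>The combination of \<open>u\<close> and \<open>u'\<close> with weights y >= 0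
      and x > 0 that is orthogonal to \<open>w l\<close>. Signs on which both vectors agree are
      kept; x > 0 preserves the strict ones.\<close>
    define v where "v i = y * u i + x * u' i" for i
    have dv: "?dot v z = y * ?dot u z + x * ?dot u' z" for z
      unfolding v_def by (simp add: sum_distrib_left sum.distrib algebra_simps)
    have "?dot v (w l) = 0" unfolding dv x_def y_def by simp
    moreover have "S = sign_pattern I L w v"
    proof -
      have "(?dot v (w k) \<le> 0) = (k \<in> S)" if k: "k \<in> L" for k
      proof (cases "k \<in> S")
        case True
        have "k \<in> sign_pattern I L w u" using True Su by simp
        moreover have "k \<in> sign_pattern I L w u'" using True Su' by simp
        ultimately have "?dot u (w k) \<le> 0" "?dot u' (w k) \<le> 0" unfolding sign_pattern_def by auto
        then have "?dot v (w k) \<le> 0" unfolding dv using xy by (intro add_nonpos_nonpos mult_nonneg_nonpos) auto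
        then show ?thesis using True by simp
      next
        case False
        have "k \<notin> sign_pattern I L w u" using False Su by simp
        moreover have "k \<notin> sign_pattern I L w u'" using False Su' by simp
        ultimately have "?dot u (w k) > 0" "?dot u' (w k) > 0" using k unfolding sign_pattern_def by auto
        then have "?dot v (w k) > 0" unfolding dv using xy by (intro add_nonneg_pos mult_nonneg_nonneg mult_pos_pos) auto
        then show ?thesis using False by simp
      qed
      moreover have "S \<subseteq> L" using Su unfolding sign_pattern_def by auto
      ultimately show ?thesis unfolding sign_pattern_def by auto
    qed
    moreover have "\<exists>i\<in>I. w l i \<noteq> 0"
    proof (rule ccontr)
      assume "\<not> ?thesis"
      then have "?dot u (w l) = 0" by (intro sum.neutral) auto
      then show False using a by simp
    qed
    ultimately show ?thesis by blast
  qed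
  show ?case
  proof (cases "\<exists>i\<in>I. w l i \<noteq> 0")
    case False
    have "finite (range (sign_pattern I (insert l L) w)) \<and> card (range (sign_pattern I (insert l L) w)) \<le> card (range (sign_pattern I L w)) + card ({} :: 'a set set)"
    proof -
      have nd: "S \<in> ({} :: 'a set set)" if S: "l \<notin> S" "S \<in> range (sign_pattern I (insert l L) w)" "insert l S \<in> range (sign_pattern I (insert l L) w)" for S
        using seg[OF S] False by blast
      show ?thesis using card_le_by_deletion[OF IH(1) del finite.emptyI nd] by simp
    qed
    moreover have "(card L + 1) ^ card I \<le> (card (insert l L) + 1) ^ card I"
      using insert.hyps by (intro power_mono) auto
    ultimately show ?thesis using IH(2) by simp
  next
    case True
    then obtain c where c: "c \<in> I" "w l c \<noteq> 0" by blast
    \<comment> \<open>On the hyperplane coordinate \<open>c\<close> is determined by the others.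
      Eliminating it leaves sign patterns in the remaining coordinates.\<close>
    define w' where "w' k i = w k i - w k c * w l i / w l c" for k i
    let ?D = "range (sign_pattern (I - {c}) L w')"
    have D: "finite ?D" "card ?D \<le> (card L + 1) ^ card (I - {c})" using insert.IH[of "I - {c}" w'] insert.prems by auto
    have inD: "S \<in> ?D" if S: "l \<notin> S" "S \<in> range (sign_pattern I (insert l L) w)" "insert l S \<in> range (sign_pattern I (insert l L) w)" for S
    proof -
      obtain v where v: "?dot v (w l) = 0" "S = sign_pattern I L w v" using seg[OF S] by blast
      have split: "?dot v z = v c * z c + (\<Sum>i\<in>I - {c}. v i * z i)" for z
        using sum.remove[OF insert.prems c(1)] by simp
      have vc: "v c = - (\<Sum>i\<in>I - {c}. v i * w l i) / w l c" using v(1) c(2) unfolding split by (simp add: field_simps)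
      have "?dot v (w k) = (\<Sum>i\<in>I - {c}. v i * w' k i)" for k
        unfolding split vc w'_def by (simp add: right_diff_distrib sum_subtractf sum_distrib_left sum_divide_distrib algebra_simps)
      then have "sign_pattern I L w v = sign_pattern (I - {c}) L w' v" unfolding sign_pattern_def by simp
      then show ?thesis using v by auto
    qed
    have fin: "finite (range (sign_pattern I (insert l L) w))" and le: "card (range (sign_pattern I (insert l L) w)) \<le> card (range (sign_pattern I L w)) + card ?D"
      using card_le_by_deletion[OF IH(1) del D(1) inD] by simp_all
    have cI: "card I = Suc (card (I - {c}))" using c insert.prems by (metis card_Suc_Diff1)
    have cL: "card (insert l L) = Suc (card L)" using insert.hyps by simp
    have "card (range (sign_pattern I (insert l L) w)) \<le> (card L + 1) ^ card I + (card L + 1) ^ card (I - {c})"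
      using le IH(2) D(2) by linarith
    also have "\<dots> = (card L + 2) * (card L + 1) ^ card (I - {c})" unfolding cI by simp
    also have "\<dots> \<le> (card L + 2) * (card L + 2) ^ card (I - {c})" by (intro mult_left_mono power_mono) auto
    also have "\<dots> = (card (insert l L) + 1) ^ card I" unfolding cI cL by simp
    finally show ?thesis using fin by blast
  qed
qed

lemma ranking_exists:
  fixes f :: "nat \<Rightarrow> real"
  obtains \<rho> where "\<rho> permutes {..<N}" "\<And>i j. i < N \<Longrightarrow> j < N \<Longrightarrow> f i < f j \<Longrightarrow> \<rho> i < \<rho> j"
proof -
  define lt where "lt i j \<longleftrightarrow> f i < f j \<or> (f i = f j \<and> i < j)" for i j
  define \<rho> where "\<rho> i = (if i < N then card {j \<in> {..<N}. lt j i} else i)" for i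
  have tr: "lt i j \<Longrightarrow> lt j k \<Longrightarrow> lt i k" for i j k unfolding lt_def by auto
  have irr: "\<not> lt i i" for i unfolding lt_def by auto
  have tot: "i \<noteq> j \<Longrightarrow> lt i j \<or> lt j i" for i j unfolding lt_def by auto
  have mono: "\<rho> i < \<rho> j" if "i < N" "j < N" "lt i j" for i j
  proof -
    have "{k \<in> {..<N}. lt k i} \<subset> {k \<in> {..<N}. lt k j}" using that tr irr by blast
    then show ?thesis unfolding \<rho>_def using that by (simp add: psubset_card_mono)
  qed
  have inj: "inj_on \<rho> {..<N}"
  proof (rule inj_onI)
    fix i j assume "i \<in> {..<N}" "j \<in> {..<N}" "\<rho> i = \<rho> j"
    then show "i = j" using mono[of i j] mono[of j i] tot[of i j] by auto
  qed
  have sub: "\<rho> ` {..<N} \<subseteq> {..<N}"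
  proof
    fix x assume "x \<in> \<rho> ` {..<N}"
    then obtain i where i: "i < N" "x = \<rho> i" by auto
    have "{j \<in> {..<N}. lt j i} \<subset> {..<N}" using i irr by blast
    then have "card {j \<in> {..<N}. lt j i} < card {..<N}" by (intro psubset_card_mono) auto
    then show "x \<in> {..<N}" using i by (simp add: \<rho>_def)
  qed
  have "\<rho> ` {..<N} = {..<N}" using inj sub by (simp add: endo_inj_surj)
  then have "bij_betw \<rho> {..<N} {..<N}" using inj by (simp add: bij_betw_def)
  then have "\<rho> permutes {..<N}" by (rule bij_imp_permutes) (simp add: \<rho>_def)
  moreover have "\<rho> i < \<rho> j" if "i < N" "j < N" "f i < f j" for i j using mono[OF that(1,2)] that(3) unfolding lt_def by simp
  ultimately show ?thesis using that by blast
qed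

text \<open>A weak order: tied points appear as pairs in both directions. Only signs of differences
  of projections matter, so counting order patterns reduces to counting sign patterns of
  half-spaces.\<close>

definition order_pattern :: "nat \<Rightarrow> nat \<Rightarrow> (nat \<Rightarrow> nat \<Rightarrow> real) \<Rightarrow> (nat \<Rightarrow> real) \<Rightarrow> (nat \<times> nat) set" where
  "order_pattern p N Z u = {(i, j). i < N \<and> j < N \<and> ip p u (Z i) \<le> ip p u (Z j)}"

definition count_le :: "nat \<Rightarrow> nat \<Rightarrow> (nat \<Rightarrow> nat \<Rightarrow> real) \<Rightarrow> (nat \<Rightarrow> real) \<Rightarrow> nat set \<Rightarrow> nat \<Rightarrow> nat" where
  "count_le p N Z u A i = card {x \<in> {..<N} - A. ip p u (Z x) \<le> ip p u (Z i)}"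

text \<open>General position of the pool: no affine hyperplane carries more than \<open>p\<close> of
  its points.\<close>

definition ties_ok :: "nat \<Rightarrow> nat \<Rightarrow> (nat \<Rightarrow> nat \<Rightarrow> real) \<Rightarrow> bool" where
  "ties_ok p N Z \<longleftrightarrow> (\<forall>u\<in>unit_sphere p. \<forall>i<N. card {x \<in> {..<N}. ip p u (Z x) = ip p u (Z i)} \<le> p)"

lemma order_pattern_eq_sign_pattern: "order_pattern p N Z u = sign_pattern {..<p} ({..<N} \<times> {..<N}) (\<lambda>(i, j) c. Z i c - Z j c) u"
proof -
  have "(ip p u (Z i) \<le> ip p u (Z j)) \<longleftrightarrow> (\<Sum>c<p. u c * (Z i c - Z j c)) \<le> 0" for i j
    unfolding ip_def by (simp add: right_diff_distrib sum_subtractf)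
  then show ?thesis unfolding order_pattern_def sign_pattern_def by auto
qed

lemma unit_sphere_nonempty: assumes "1 \<le> p" shows "unit_sphere p \<noteq> {}"
proof -
  have "(\<Sum>i<p. ((\<lambda>i\<in>{..<p}. of_bool (i = 0) :: real) i)\<^sup>2) = (\<Sum>i<p. of_bool (i = 0))" by (intro sum.cong) auto
  also have "\<dots> = 1" using assms by (subst sum.remove[of _ 0]) auto
  finally have "(\<lambda>i\<in>{..<p}. of_bool (i = 0)) \<in> unit_sphere p" unfolding unit_sphere_def by auto
  then show ?thesis by blast
qed

lemma direction_representatives:
  assumes p: "1 \<le> p"
  obtains U where "finite U" "U \<noteq> {}" "U \<subseteq> unit_sphere p" "\<And>u. u \<in> unit_sphere p \<Longrightarrow> \<exists>u'\<in>U. order_pattern p N Z u = order_pattern p N Z u'"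
    "card U \<le> (N * N + 1) ^ p"
proof -
  let ?O = "order_pattern p N Z ` unit_sphere p"
  define g where "g P = (SOME u. u \<in> unit_sphere p \<and> order_pattern p N Z u = P)" for P
  have g: "g P \<in> unit_sphere p \<and> order_pattern p N Z (g P) = P" if "P \<in> ?O" for P
    unfolding g_def by (rule someI_ex[of "\<lambda>u. u \<in> unit_sphere p \<and> order_pattern p N Z u = P"]) (use that in blast)
  have sub: "?O \<subseteq> range (sign_pattern {..<p} ({..<N} \<times> {..<N}) (\<lambda>(i, j) c. Z i c - Z j c))" unfolding order_pattern_eq_sign_pattern by auto
  have r: "finite (range (sign_pattern {..<p} ({..<N} \<times> {..<N}) (\<lambda>(i, j) c. Z i c - Z j c)))"
    "card (range (sign_pattern {..<p} ({..<N} \<times> {..<N}) (\<lambda>(i, j) c. Z i c - Z j c))) \<le> (N * N + 1) ^ p"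
    using card_sign_patterns[of "{..<N} \<times> {..<N}" "{..<p}" "\<lambda>(i, j) c. Z i c - Z j c"] by auto
  have fO: "finite ?O" using sub r(1) finite_subset by blast
  have cO: "card ?O \<le> (N * N + 1) ^ p" using card_mono[OF r(1) sub] r(2) by linarith
  show ?thesis
  proof (rule that[of "g ` ?O"])
    show "finite (g ` ?O)" using fO by simp
    show "g ` ?O \<noteq> {}" using unit_sphere_nonempty[OF p] by simp
    show "g ` ?O \<subseteq> unit_sphere p" using g by blast
    show "\<exists>u'\<in>g ` ?O. order_pattern p N Z u = order_pattern p N Z u'" if u: "u \<in> unit_sphere p" for u
      using g[of "order_pattern p N Z u"] u by (intro bexI[of _ "g (order_pattern p N Z u)"]) simp_all
    show "card (g ` ?O) \<le> (N * N + 1) ^ p" using card_image_le[OF fO, of g] cO by linarith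
  qed
qed

lemma count_le_order_pattern: assumes "i < N" shows "count_le p N Z u A i = card {x \<in> {..<N} - A. (x, i) \<in> order_pattern p N Z u}"
  unfolding count_le_def order_pattern_def using assms by (intro arg_cong[of _ _ card]) auto

text \<open>The bound of \<open>size_error\<close> written out in numbers alone. It does not mention
  the pool, so it can be averaged over pools and estimated separately.\<close>

definition err :: "nat \<Rightarrow> nat \<Rightarrow> real \<Rightarrow> real \<Rightarrow> real \<Rightarrow> real \<Rightarrow> real \<Rightarrow> real \<Rightarrow> real" where
  "err n m B \<Lambda> \<epsilon> \<beta> C c = (let N = real (n + m); s = sqrt (N / (real n * real m)) in
     3 * (96 * ((s * (10 * \<Lambda> * B) + s * (5 * \<Lambda> * B + 4 * sqrt (sqrt N * ln N * \<Lambda>)) + 2 * (\<epsilon> * (ln N + 1))) + \<epsilon>) * sqrt \<Lambda>)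
     + 3 * (24 / N + (1 / \<epsilon>^3 + 3 * \<beta> / \<epsilon>\<^sup>2 + 6 * \<beta>\<^sup>2 / \<epsilon>) * (B / sqrt N) * C / (3 * c) * 2 * harm (n + m)
        + 2 * (128 * B * sqrt (\<Lambda> / N) * (1 / \<epsilon>\<^sup>2 + 2 * \<beta> / \<epsilon>))))"

context boot_config begin

lemma err_eq: "3 * an + 3 * \<eta> = err n m B \<Lambda> \<epsilon> \<beta> C c\<^sub>1"
  unfolding an_def \<eta>_def W_def \<eta>clt_def \<eta>g_def sx.K3_def w_def wc_def s0_def Kd_def err_def Let_def N[symmetric] ..

end

section \<open>From data to a rank configuration\<close>

locale rank_data =
  fixes n m N p d :: nat and Z :: "nat \<Rightarrow> nat \<Rightarrow> real" and psi :: "nat \<Rightarrow> real \<Rightarrow> real" and \<pi> :: "nat \<Rightarrow> nat"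
    and U :: "(nat \<Rightarrow> real) set"
  assumes N: "N = n + m" and m: "0 < m" "m \<le> n" and p: "1 \<le> p" and d: "1 \<le> d"
    and pi: "\<pi> permutes {..<N}"
    and U: "finite U" "U \<noteq> {}" "U \<subseteq> unit_sphere p" "\<And>u. u \<in> unit_sphere p \<Longrightarrow> \<exists>u'\<in>U. order_pattern p N Z u = order_pattern p N Z u'"
begin

definition A :: "nat set" where "A = \<pi> ` {..<m}"
definition X :: "nat \<Rightarrow> nat \<Rightarrow> real" where "X = (\<lambda>i. Z (\<pi> (m + i)))"
definition Y :: "nat \<Rightarrow> nat \<Rightarrow> real" where "Y = (\<lambda>j. Z (\<pi> j))"

lemma inj: "inj \<pi>" using permutes_inj[OF pi] .

lemma bij_X: "bij_betw (\<lambda>i. \<pi> (m + i)) {..<n} ({..<N} - A)"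
proof -
  have "(\<lambda>i. \<pi> (m + i)) ` {..<n} = \<pi> ` {m..<N}"
  proof -
    have "{m..<N} = (\<lambda>i. m + i) ` {..<n}"
    proof (intro equalityI subsetI)
      fix x assume "x \<in> {m..<N}"
      then have "x = m + (x - m)" "x - m < n" using N by auto
      then show "x \<in> (\<lambda>i. m + i) ` {..<n}" by blast
    qed (use N in auto)
    then show ?thesis by (auto simp: image_image)
  qed
  also have "\<dots> = {..<N} - A"
  proof -
    have "{m..<N} = {..<N} - {..<m}" by auto
    then have "\<pi> ` {m..<N} = \<pi> ` {..<N} - \<pi> ` {..<m}" using image_set_diff[OF inj, of "{..<N}" "{..<m}"] by (simp only:)
    then show ?thesis unfolding A_def permutes_image[OF pi] .
  qed
  finally have im: "(\<lambda>i. \<pi> (m + i)) ` {..<n} = {..<N} - A" .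
  have "inj_on (\<lambda>i. \<pi> (m + i)) {..<n}" by (rule inj_onI) (simp add: inj_eq[OF inj])
  then show ?thesis unfolding bij_betw_def using im by (rule conjI)
qed

lemma A_sub: "A \<subseteq> {..<N}" unfolding A_def using permutes_image[OF pi] N by (metis image_mono lessThan_subset_iff le_add2)

lemma ecdf_eq: "ecdf_u n p X u (ip p u (Z i)) = real (count_le p N Z u A i) / real n"
proof -
  have "bij_betw (\<lambda>i. \<pi> (m + i)) {x. x < n \<and> ip p u (X x) \<le> ip p u (Z i)} {x \<in> {..<N} - A. ip p u (Z x) \<le> ip p u (Z i)}"
    unfolding bij_betw_def
  proof
    show "inj_on (\<lambda>i. \<pi> (m + i)) {x. x < n \<and> ip p u (X x) \<le> ip p u (Z i)}"
      using bij_X unfolding bij_betw_def by (rule inj_on_subset[OF conjunct1]) auto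
    have im: "(\<lambda>i. \<pi> (m + i)) ` {..<n} = {..<N} - A" using bij_X unfolding bij_betw_def by blast
    show "(\<lambda>i. \<pi> (m + i)) ` {x. x < n \<and> ip p u (X x) \<le> ip p u (Z i)} = {x \<in> {..<N} - A. ip p u (Z x) \<le> ip p u (Z i)}"
    proof (intro equalityI subsetI)
      fix x assume "x \<in> (\<lambda>i. \<pi> (m + i)) ` {x. x < n \<and> ip p u (X x) \<le> ip p u (Z i)}"
      then obtain y where y: "y < n" "ip p u (Z (\<pi> (m + y))) \<le> ip p u (Z i)" "x = \<pi> (m + y)" unfolding X_def by blast
      then have "x \<in> {..<N} - A" unfolding im[symmetric] by blast
      then show "x \<in> {x \<in> {..<N} - A. ip p u (Z x) \<le> ip p u (Z i)}" using y by blast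
    next
      fix x assume x: "x \<in> {x \<in> {..<N} - A. ip p u (Z x) \<le> ip p u (Z i)}"
      then have "x \<in> (\<lambda>i. \<pi> (m + i)) ` {..<n}" unfolding im by blast
      then show "x \<in> (\<lambda>i. \<pi> (m + i)) ` {x. x < n \<and> ip p u (X x) \<le> ip p u (Z i)}" using x unfolding X_def by blast
    qed
  qed
  then show ?thesis unfolding ecdf_u_def count_le_def by (simp add: bij_betw_same_card)
qed

lemma psi_cnt_rep: assumes "u \<in> unit_sphere p" obtains u' where "u' \<in> U" "\<And>i. i < N \<Longrightarrow> count_le p N Z u A i = count_le p N Z u' A i"
proof -
  obtain u' where "u' \<in> U" "order_pattern p N Z u = order_pattern p N Z u'" using U(4)[OF assms] by blast
  then show ?thesis using that[of u'] by (simp add: count_le_order_pattern)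
qed

text \<open>The supremum over the sphere is attained at one of finitely many representatives, so
  weak and strict inequalities can both be read off coordinate by coordinate.\<close>

lemma Sup_image_ge:
  fixes f :: "(nat \<Rightarrow> real) \<Rightarrow> nat \<Rightarrow> real"
  assumes rep: "\<And>u. u \<in> unit_sphere p \<Longrightarrow> \<exists>u'\<in>U. \<forall>k\<in>{1..d}. f u k = f u' k"
  shows "Sup {f u k | u k. u \<in> unit_sphere p \<and> k \<in> {1..d}} = Max ((\<lambda>(u, k). f u k) ` (U \<times> {1..d}))"
    "finite ((\<lambda>(u, k). f u k) ` (U \<times> {1..d}))" "(\<lambda>(u, k). f u k) ` (U \<times> {1..d}) \<noteq> {}"
proof -
  let ?V = "(\<lambda>(u, k). f u k) ` (U \<times> {1..d})"
  show fin: "finite ?V" using U by simp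
  show ne: "?V \<noteq> {}" using U d by auto
  have "{f u k | u k. u \<in> unit_sphere p \<and> k \<in> {1..d}} = ?V"
  proof (intro equalityI subsetI)
    fix x assume "x \<in> {f u k | u k. u \<in> unit_sphere p \<and> k \<in> {1..d}}"
    then obtain u k where "u \<in> unit_sphere p" "k \<in> {1..d}" "x = f u k" by blast
    then show "x \<in> ?V" using rep[of u] by force
  next
    fix x assume "x \<in> ?V"
    then obtain u k where "u \<in> U" "k \<in> {1..d}" "x = f u k" by auto
    then show "x \<in> {f u k | u k. u \<in> unit_sphere p \<and> k \<in> {1..d}}" using U(3) by blast
  qed
  then show "Sup {f u k | u k. u \<in> unit_sphere p \<and> k \<in> {1..d}} = Max ?V" using cSup_eq_Max[OF fin ne] by simp
qed

lemma Psi_max_ge_iff: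
  "Psi_max n m p d psi X Y \<ge> c \<longleftrightarrow>
     (\<exists>u\<in>U. \<exists>k\<in>{1..d}. sqrt (real n * real m / real N) * \<bar>(\<Sum>j\<in>A. psi k (real (count_le p N Z u A j) / real n)) / real m\<bar> \<ge> c)"
proof -
  define f where "f u k = \<bar>(\<Sum>j<m. psi k (ecdf_u n p X u (ip p u (Y j)))) / real m\<bar>" for u k
  let ?s = "sqrt (real n * real m / real N)"
  have s: "?s \<ge> 0" by simp
  have fA: "f u k = \<bar>(\<Sum>j\<in>A. psi k (real (count_le p N Z u A j) / real n)) / real m\<bar>" for u k
    unfolding f_def Y_def ecdf_eq A_def by (subst sum.reindex) (auto intro: inj_on_subset[OF inj])
  have rep: "\<exists>u'\<in>U. \<forall>k\<in>{1..d}. f u k = f u' k" if u: "u \<in> unit_sphere p" for u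
  proof -
    obtain u' where u': "u' \<in> U" "\<And>i. i < N \<Longrightarrow> count_le p N Z u A i = count_le p N Z u' A i" using psi_cnt_rep[OF u] by blast
    have "f u k = f u' k" for k unfolding fA using u'(2) A_sub by (intro arg_cong[of _ _ abs] arg_cong2[of _ _ _ _ "(/)"] sum.cong) auto
    then show ?thesis using u' by blast
  qed
  note S = Sup_image_ge[of f, OF rep]
  let ?V = "(\<lambda>(u, k). f u k) ` (U \<times> {1..d})"
  have "Psi_max n m p d psi X Y = ?s * Max ?V"
    unfolding Psi_max_def f_def[symmetric] by (simp only: S(1) N of_nat_add)
  moreover have "?s * Max ?V \<ge> c \<longleftrightarrow> (\<exists>v\<in>?V. ?s * v \<ge> c)"
  proof
    assume "?s * Max ?V \<ge> c" then show "\<exists>v\<in>?V. ?s * v \<ge> c" using Max_in[OF S(2,3)] by blast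
  next
    assume "\<exists>v\<in>?V. ?s * v \<ge> c"
    then obtain v where v: "v \<in> ?V" "?s * v \<ge> c" by blast
    then show "?s * Max ?V \<ge> c" using mult_left_mono[OF Max_ge[OF S(2) v(1)] s] by linarith
  qed
  ultimately show ?thesis unfolding fA by auto
qed

lemma Psi_MB_gt_iff:
  "Psi_MB n p d psi X e > t \<longleftrightarrow>
     (\<exists>u\<in>U. \<exists>k\<in>{1..d}. \<bar>(\<Sum>i<n. e i * psi k (real (count_le p N Z u A (\<pi> (m + i))) / real n)) / sqrt (real n)\<bar> > t)"
proof -
  define f where "f u k = \<bar>(\<Sum>i<n. e i * psi k (ecdf_u n p X u (ip p u (X i)))) / sqrt (real n)\<bar>" for u k
  have lt: "\<pi> (m + i) < N" if "i < n" for i using bij_betwE[OF bij_X] that by auto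
  have fA: "f u k = \<bar>(\<Sum>i<n. e i * psi k (real (count_le p N Z u A (\<pi> (m + i))) / real n)) / sqrt (real n)\<bar>" for u k
    unfolding f_def X_def[of] ecdf_eq[unfolded X_def] ..
  have rep: "\<exists>u'\<in>U. \<forall>k\<in>{1..d}. f u k = f u' k" if u: "u \<in> unit_sphere p" for u
  proof -
    obtain u' where u': "u' \<in> U" "\<And>i. i < N \<Longrightarrow> count_le p N Z u A i = count_le p N Z u' A i" using psi_cnt_rep[OF u] by blast
    have "f u k = f u' k" for k unfolding fA using u'(2) lt by (intro arg_cong[of _ _ abs] arg_cong2[of _ _ _ _ "(/)"] sum.cong) auto
    then show ?thesis using u' by blast
  qed
  note S = Sup_image_ge[of f, OF rep]
  have "Psi_MB n p d psi X e = Max ((\<lambda>(u, k). f u k) ` (U \<times> {1..d}))"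
    unfolding Psi_MB_def f_def[symmetric] by (rule S(1))
  then show ?thesis using Max_gr_iff[OF S(2,3)] unfolding fA by auto
qed

end

text \<open>The number (N^2 + 1)^p stands in for the number of representatives, so that the
  numerical assumptions are free of the pool; of the pool itself only \<open>ties_ok\<close> is
  asked.\<close>

lemma permutation_size_error:
  assumes N: "N = n + m" and m: "0 < m" "m \<le> n" and p: "1 \<le> p" and d: "1 \<le> d"
    and B1: "B \<ge> 1"
    and lip: "\<And>k x y. k \<in> {1..d} \<Longrightarrow> x \<in> {0..1} \<Longrightarrow> y \<in> {0..1} \<Longrightarrow> \<bar>psi k x - psi k y\<bar> \<le> B * \<bar>x - y\<bar>"
    and psiB: "\<And>k x. k \<in> {1..d} \<Longrightarrow> x \<in> {0..1} \<Longrightarrow> \<bar>psi k x\<bar> \<le> B"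
    and rie1: "\<And>k M. k \<in> {1..d} \<Longrightarrow> M > 0 \<Longrightarrow> \<bar>\<Sum>i<M. psi k (real i / real M)\<bar> \<le> B"
    and rie2: "\<And>k. k \<in> {1..d} \<Longrightarrow> \<bar>(\<Sum>i<N. (psi k (real i / real N))\<^sup>2) / real N - 1\<bar> \<le> 1 / 2"
    and \<Lambda>: "real p + 1 \<le> \<Lambda>" "\<Lambda> \<le> real N" "real ((N * N + 1) ^ p) * real d \<le> exp (\<Lambda> / 2)" "exp (- \<Lambda> / 2) \<le> 1 / real N ^ 5"
      "B * sqrt (\<Lambda> / real N) \<le> 1"
    and eps: "\<epsilon> > 0" and bet: "\<beta> > 0" and eb: "\<epsilon> * \<beta> \<ge> 1" and c1: "c\<^sub>1 > 0"
    and ul1: "unit_law (two_point (real m / real N)) C c\<^sub>1" and ul2: "unit_law std_normal_distribution C c\<^sub>1"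
    and lnJ: "\<Lambda> / \<beta> \<le> \<epsilon>" and bc: "2 * \<beta> * (B / sqrt (real N)) \<le> 1"
    and ties: "ties_ok p N Z" and \<alpha>: "0 < \<alpha>" "\<alpha> < 1"
  shows "\<bar>EP N (\<lambda>\<pi>. of_bool (Psi_max n m p d psi (\<lambda>i. Z (\<pi> (m + i))) (\<lambda>j. Z (\<pi> j)) \<ge> c_MB n p d psi (\<lambda>i. Z (\<pi> (m + i))) \<alpha>)) - \<alpha>\<bar>
    \<le> err n m B \<Lambda> \<epsilon> \<beta> C c\<^sub>1"
proof -
  obtain U where U: "finite U" "U \<noteq> {}" "U \<subseteq> unit_sphere p" "\<And>u. u \<in> unit_sphere p \<Longrightarrow> \<exists>u'\<in>U. order_pattern p N Z u = order_pattern p N Z u'"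
    "card U \<le> (N * N + 1) ^ p" using direction_representatives[OF p, of N Z] by blast
  have "\<exists>\<rho>. \<rho> permutes {..<N} \<and> (\<forall>i j. i < N \<longrightarrow> j < N \<longrightarrow> ip p u (Z i) < ip p u (Z j) \<longrightarrow> \<rho> i < \<rho> j)" for u
  proof -
    obtain \<rho> where "\<rho> permutes {..<N}" "\<And>i j. i < N \<Longrightarrow> j < N \<Longrightarrow> ip p u (Z i) < ip p u (Z j) \<Longrightarrow> \<rho> i < \<rho> j"
      by (rule ranking_exists[of N "\<lambda>i. ip p u (Z i)"]) auto
    then show ?thesis by blast
  qed
  then obtain rho where rho: "\<And>u. rho u permutes {..<N}" "\<And>u i j. i < N \<Longrightarrow> j < N \<Longrightarrow> ip p u (Z i) < ip p u (Z j) \<Longrightarrow> rho u i < rho u j" by metis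
  have cU: "real (card U) * real d \<le> exp (\<Lambda> / 2)"
  proof -
    have "real (card U) \<le> real ((N * N + 1) ^ p)" using U(5) of_nat_mono by blast
    then have "real (card U) * real d \<le> real ((N * N + 1) ^ p) * real d" by (intro mult_right_mono) auto
    then show ?thesis using \<Lambda>(3) by linarith
  qed
  interpret R: rank_config n m N p d U rho psi B \<Lambda> "count_le p N Z"
    by unfold_locales (use N m p d U rho B1 lip psiB rie1 rie2 \<Lambda> cU in auto)
  interpret R: boot_config n m N p d U rho psi B \<Lambda> "count_le p N Z" \<epsilon> \<beta> C c\<^sub>1
  proof (intro boot_config.intro boot_config_axioms.intro R.rank_config_axioms)
    show "ln (2 * (real (card U) * real d)) / \<beta> \<le> \<epsilon>"
    proof -
      have "card U > 0" using U by (simp add: card_gt_0_iff)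
      then have pos: "2 * (real (card U) * real d) > 0" using d by simp
      have "\<Lambda> / 2 \<ge> 1" using \<Lambda>(1) p by linarith
      then have "2 \<le> exp (\<Lambda> / 2)" using exp_ge_add_one_self[of "\<Lambda> / 2"] by linarith
      then have "2 * (real (card U) * real d) \<le> exp (\<Lambda> / 2) * exp (\<Lambda> / 2)" using cU by (intro mult_mono) auto
      also have "\<dots> = exp \<Lambda>" by (simp flip: exp_add)
      finally have "ln (2 * (real (card U) * real d)) \<le> \<Lambda>" using pos ln_mono[of "2 * (real (card U) * real d)" "exp \<Lambda>"] by simp
      then show ?thesis using lnJ bet by (intro order_trans[OF divide_right_mono lnJ]) auto
    qed
    show "R.cnt_ok A" if A: "A \<subseteq> {..<N}" "card A = m" for A
      unfolding R.cnt_ok_def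
    proof (intro ballI allI impI conjI)
      fix u i assume u: "u \<in> U" and i: "i < N"
      have xsub: "{x \<in> {..<N} - A. rho u x < rho u i} \<subseteq> {x \<in> {..<N} - A. ip p u (Z x) \<le> ip p u (Z i)}"
        using rho(2)[OF i, of _ u] by (force simp: not_le[symmetric])
      show "R.xc u A (rho u i) \<le> count_le p N Z u A i" unfolding R.xc_def count_le_def by (rule card_mono[OF _ xsub]) simp
      \<comment> \<open>A point that does not exceed point \<open>i\<close> has a smaller rank or is
        tied with it. The ties number at most p, point \<open>i\<close> itself included.\<close>
      have "{x \<in> {..<N} - A. ip p u (Z x) \<le> ip p u (Z i)} \<subseteq> {x \<in> {..<N} - A. rho u x < rho u i} \<union> {x \<in> {..<N}. ip p u (Z x) = ip p u (Z i)}"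
        using rho(2)[OF _ i, of _ u] by (force simp: le_less)
      then have "count_le p N Z u A i \<le> card ({x \<in> {..<N} - A. rho u x < rho u i} \<union> {x \<in> {..<N}. ip p u (Z x) = ip p u (Z i)})"
        unfolding count_le_def by (intro card_mono) auto
      also have "\<dots> \<le> R.xc u A (rho u i) + card {x \<in> {..<N}. ip p u (Z x) = ip p u (Z i)}" unfolding R.xc_def by (rule card_Un_le)
      also have "card {x \<in> {..<N}. ip p u (Z x) = ip p u (Z i)} \<le> p" using ties u i U(3) unfolding ties_ok_def by blast
      finally show "count_le p N Z u A i \<le> R.xc u A (rho u i) + p" by simp
      have "count_le p N Z u A i \<le> card ({..<N} - A)" unfolding count_le_def by (intro card_mono) auto
      also have "card ({..<N} - A) = n" using A N finite_subset[OF A(1)] by (simp add: card_Diff_subset)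
      finally show "count_le p N Z u A i \<le> n" .
    qed
  qed (fact eps bet eb c1 ul1 ul2 bc)+
  have ev: "Psi_max n m p d psi (\<lambda>i. Z (\<pi> (m + i))) (\<lambda>j. Z (\<pi> j)) \<ge> c_MB n p d psi (\<lambda>i. Z (\<pi> (m + i))) \<alpha> \<longleftrightarrow> R.ET (R.cA \<alpha> (\<pi> ` {..<m})) (\<pi> ` {..<m})"
    if pi: "\<pi> permutes {..<N}" for \<pi>
  proof -
    interpret D: rank_data n m N p d Z psi \<pi> U
      by unfold_locales (use N m p d pi U in auto)
    let ?I = "{..<N} - D.A" and ?f = "\<lambda>i. \<pi> (m + i)"
    \<comment> \<open>The multipliers are indexed by positions in the first sample on one side and
      by the complement of \<open>A\<close> in the pool on the other; relabelling preserves the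
      Gaussian product measure.\<close>
    have tail: "measure (gauss_mult n) {e \<in> space (gauss_mult n). Psi_MB n p d psi D.X e > t} = gauss_tail_strict ?I (R.bb D.A) R.Jp t" for t
    proof -
      have fm: "(\<lambda>e. \<lambda>i\<in>{..<n}. e (?f i)) \<in> measurable (gP ?I) (gP {..<n})"
        using bij_betwE[OF D.bij_X] by (intro measurable_restrict measurable_component_singleton) auto
      have dist: "distr (gP ?I) (gP {..<n}) (\<lambda>e. \<lambda>i\<in>{..<n}. e (?f i)) = gP {..<n}"
        using distr_PiM_reindex[of ?I "\<lambda>_. std_normal_distribution" ?f "{..<n}"] prob_space_std_normal bij_betwE[OF D.bij_X] bij_betw_imp_inj_on[OF D.bij_X]
        by (simp add: Pi_iff)
      have lin: "lin {..<n} (\<lambda>i\<in>{..<n}. e (?f i)) (\<lambda>i. R.bb D.A (?f i)) j = lin ?I e (R.bb D.A) j" for e j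
        unfolding lin_def by (subst sum.reindex_bij_betw[OF D.bij_X, symmetric]) (auto intro!: sum.cong)
      have iff: "Psi_MB n p d psi D.X e > t \<longleftrightarrow> (\<exists>j\<in>R.Jp. lin {..<n} e (\<lambda>i. R.bb D.A (?f i)) j > t)" for e
      proof -
        have "lin {..<n} e (\<lambda>i. R.bb D.A (?f i)) ((u, k), b) = R.sg b * ((\<Sum>i<n. e i * psi k (real (count_le p N Z u D.A (?f i)) / real n)) / sqrt (real n))" for u k b
          unfolding lin_def R.bb_def by (simp add: sum_distrib_left sum_divide_distrib mult_ac)
        then have "(\<exists>j\<in>R.Jp. lin {..<n} e (\<lambda>i. R.bb D.A (?f i)) j > t) \<longleftrightarrow>
           (\<exists>u\<in>U. \<exists>k\<in>{1..d}. \<exists>b. R.sg b * ((\<Sum>i<n. e i * psi k (real (count_le p N Z u D.A (?f i)) / real n)) / sqrt (real n)) > t)"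
          unfolding R.Jp_def by auto
        moreover have "(\<exists>b. R.sg b * x > t) \<longleftrightarrow> \<bar>x\<bar> > t" for x
          unfolding R.sg_def by (auto simp: ex_bool_eq abs_if split: if_splits)
        ultimately show ?thesis unfolding D.Psi_MB_gt_iff by (simp only:)
      qed
      have gm: "gauss_mult n = gP {..<n}" unfolding gauss_mult_def ..
      let ?E = "{e \<in> space (gP {..<n}). \<exists>j\<in>R.Jp. lin {..<n} e (\<lambda>i. R.bb D.A (?f i)) j > t}"
      have E: "?E \<in> sets (gP {..<n})" by (rule gauss_tail_strict_set_measurable[OF R.Jp(1)])
      have "measure (gauss_mult n) {e \<in> space (gauss_mult n). Psi_MB n p d psi D.X e > t} = measure (gP {..<n}) ?E" unfolding gm iff ..
      also have "\<dots> = measure (distr (gP ?I) (gP {..<n}) (\<lambda>e. \<lambda>i\<in>{..<n}. e (?f i))) ?E" unfolding dist ..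
      also have "\<dots> = measure (gP ?I) ((\<lambda>e. \<lambda>i\<in>{..<n}. e (?f i)) -` ?E \<inter> space (gP ?I))" by (rule measure_distr[OF fm E])
      also have "(\<lambda>e. \<lambda>i\<in>{..<n}. e (?f i)) -` ?E \<inter> space (gP ?I) = {e \<in> space (gP ?I). \<exists>j\<in>R.Jp. lin ?I e (R.bb D.A) j > t}"
        using measurable_space[OF fm] lin by auto
      finally show ?thesis unfolding gauss_tail_strict_def .
    qed
    have "c_MB n p d psi D.X \<alpha> = R.cA \<alpha> D.A" unfolding c_MB_def tail R.cA_def ..
    moreover have "Psi_max n m p d psi D.X D.Y \<ge> c \<longleftrightarrow> R.ET c D.A" for c
      unfolding D.Psi_max_ge_iff R.ET_def R.Ts_def ..
    ultimately show ?thesis unfolding D.X_def D.Y_def D.A_def by simp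
  qed
  have "EP N (\<lambda>\<pi>. of_bool (Psi_max n m p d psi (\<lambda>i. Z (\<pi> (m + i))) (\<lambda>j. Z (\<pi> j)) \<ge> c_MB n p d psi (\<lambda>i. Z (\<pi> (m + i))) \<alpha>))
     = EP N (\<lambda>\<pi>. of_bool (R.ET (R.cA \<alpha> (\<pi> ` {..<m})) (\<pi> ` {..<m})))"
    by (rule EP_cong) (simp only: ev)
  then show ?thesis using R.size_error[OF \<alpha>] unfolding R.err_eq by simp
qed

text \<open>The determinant of the leading \<open>k \<times> k\<close> block, computed by Schur complements at the top left
  pivot; it is only meaningful when no pivot vanishes, and a vanishing pivot makes it \<open>0\<close>.\<close>

fun schur_det :: "nat \<Rightarrow> (nat \<Rightarrow> nat \<Rightarrow> real) \<Rightarrow> real" where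
  "schur_det 0 M = 1"
| "schur_det (Suc k) M = M 0 0 * schur_det k (\<lambda>r c. M (Suc r) (Suc c) - M (Suc r) 0 * M 0 (Suc c) / M 0 0)"

lemma schur_det_cong: assumes "\<And>r c. r < k \<Longrightarrow> c < k \<Longrightarrow> M r c = M' r c" shows "schur_det k M = schur_det k M'"
  using assms
proof (induction k arbitrary: M M')
  case (Suc k)
  have "schur_det k (\<lambda>r c. M (Suc r) (Suc c) - M (Suc r) 0 * M 0 (Suc c) / M 0 0) = schur_det k (\<lambda>r c. M' (Suc r) (Suc c) - M' (Suc r) 0 * M' 0 (Suc c) / M' 0 0)"
    by (rule Suc.IH) (simp add: Suc.prems)
  then show ?case using Suc.prems[of 0 0] by simp
qed simp

text \<open>A nonzero value means that no pivot vanished. Eliminating the first unknown turns the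
  kernel equations into those of the Schur complement, and back substitution finishes.\<close>

lemma schur_det_kernel:
  assumes "schur_det k M \<noteq> 0" "\<And>r. r < k \<Longrightarrow> (\<Sum>c<k. M r c * v c) = 0" "c < k"
  shows "v c = 0"
  using assms
proof (induction k arbitrary: M v c)
  case (Suc k)
  let ?M = "\<lambda>r c. M (Suc r) (Suc c) - M (Suc r) 0 * M 0 (Suc c) / M 0 0"
  have p: "M 0 0 \<noteq> 0" "schur_det k ?M \<noteq> 0" using Suc.prems(1) by auto
  have row: "M r 0 * v 0 + (\<Sum>c<k. M r (Suc c) * v (Suc c)) = 0" if "r < Suc k" for r
    using Suc.prems(2)[OF that] by (simp add: sum.lessThan_Suc_shift del: sum.lessThan_Suc)
  have v0: "v 0 = - (\<Sum>c<k. M 0 (Suc c) * v (Suc c)) / M 0 0" using row[of 0] p(1) by (simp add: field_simps)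
  have "(\<Sum>c<k. ?M r c * v (Suc c)) = 0" if "r < k" for r
  proof -
    have "(\<Sum>c<k. ?M r c * v (Suc c)) = (\<Sum>c<k. M (Suc r) (Suc c) * v (Suc c)) - M (Suc r) 0 / M 0 0 * (\<Sum>c<k. M 0 (Suc c) * v (Suc c))"
    proof -
      have "?M r c * v (Suc c) = M (Suc r) (Suc c) * v (Suc c) - M (Suc r) 0 / M 0 0 * (M 0 (Suc c) * v (Suc c))" for c
        by (simp add: algebra_simps)
      then show ?thesis by (simp only: sum_subtractf sum_distrib_left)
    qed
    also have "\<dots> = M (Suc r) 0 * v 0 + (\<Sum>c<k. M (Suc r) (Suc c) * v (Suc c))" unfolding v0 by simp
    finally show ?thesis using row[of "Suc r"] that by simp
  qed
  then have rest: "v (Suc c) = 0" if "c < k" for c using Suc.IH[OF p(2), of "\<lambda>c. v (Suc c)"] that by blast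
  then have "v 0 = 0" unfolding v0 by simp
  then show ?case using rest Suc.prems(3) by (cases c) auto
qed simp

text \<open>Each elimination step changes the last diagonal entry only by an additive constant, so
  the value is affine in that entry, with the leading minor as slope.\<close>

lemma schur_det_last:
  "\<exists>e. \<forall>x. schur_det (Suc k) (\<lambda>r c. if r = k \<and> c = k then x else M r c) = x * schur_det k M + e"
proof (induction k arbitrary: M)
  case 0 then show ?case by (intro exI[of _ 0]) simp
next
  case (Suc k)
  let ?M = "\<lambda>r c. M (Suc r) (Suc c) - M (Suc r) 0 * M 0 (Suc c) / M 0 0"
  let ?s = "M (Suc k) 0 * M 0 (Suc k) / M 0 0"
  obtain e where e: "\<And>x. schur_det (Suc k) (\<lambda>r c. if r = k \<and> c = k then x else ?M r c) = x * schur_det k ?M + e" using Suc.IH[of ?M] by blast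
  show ?case
  proof (intro exI allI)
    fix x
    let ?N = "\<lambda>r c. if r = Suc k \<and> c = Suc k then x else M r c"
    have "(\<lambda>r c. ?N (Suc r) (Suc c) - ?N (Suc r) 0 * ?N 0 (Suc c) / ?N 0 0) = (\<lambda>r c. if r = k \<and> c = k then x - ?s else ?M r c)"
      by (auto simp: fun_eq_iff)
    then have "schur_det (Suc (Suc k)) ?N = M 0 0 * schur_det (Suc k) (\<lambda>r c. if r = k \<and> c = k then x - ?s else ?M r c)"
      by (simp only: schur_det.simps(2)[of "Suc k"]) simp
    also have "\<dots> = M 0 0 * ((x - ?s) * schur_det k ?M + e)" unfolding e ..
    also have "\<dots> = x * schur_det (Suc k) M + M 0 0 * (e - ?s * schur_det k ?M)" by (simp add: algebra_simps)
    finally show "schur_det (Suc (Suc k)) ?N = x * schur_det (Suc k) M + M 0 0 * (e - ?s * schur_det k ?M)" .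
  qed
qed

lemma schur_det_measurable:
  assumes "\<And>r c. r < k \<Longrightarrow> c < k \<Longrightarrow> (\<lambda>\<omega>. M \<omega> r c) \<in> borel_measurable \<Omega>"
  shows "(\<lambda>\<omega>. schur_det k (M \<omega>)) \<in> borel_measurable \<Omega>"
  using assms
proof (induction k arbitrary: M)
  case (Suc k)
  have [measurable]: "(\<lambda>\<omega>. M \<omega> r c) \<in> borel_measurable \<Omega>" if "r < Suc k" "c < Suc k" for r c using Suc.prems that by blast
  have "(\<lambda>\<omega>. schur_det k (\<lambda>r c. M \<omega> (Suc r) (Suc c) - M \<omega> (Suc r) 0 * M \<omega> 0 (Suc c) / M \<omega> 0 0)) \<in> borel_measurable \<Omega>"
    by (rule Suc.IH) measurable
  then show ?case by simp
qed simp

text \<open>The rows are (1, z) for the selected points z. A hyperplane with normal u and offset t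
  through all of them amounts to the kernel vector (-t, u).\<close>

definition affine_matrix :: "(nat \<Rightarrow> nat) \<Rightarrow> (nat \<Rightarrow> nat \<Rightarrow> real) \<Rightarrow> nat \<Rightarrow> nat \<Rightarrow> real" where
  "affine_matrix idx Z r c = (if c = 0 then 1 else Z (idx r) (c - 1))"

section \<open>Absolutely continuous samples\<close>

locale ac_law = prob_space F for F :: "(nat \<Rightarrow> real) measure" +
  fixes p :: nat
  assumes sets_F: "sets F = sets (lebesgue_Rp p)" and ac: "absolutely_continuous (lebesgue_Rp p) F"
begin

lemma coord_measurable: "c < p \<Longrightarrow> (\<lambda>z. z c) \<in> borel_measurable F"
proof -
  assume "c < p"
  then have "(\<lambda>z. z c) \<in> measurable (lebesgue_Rp p) lborel"
    unfolding lebesgue_Rp_def by (intro measurable_component_singleton) simp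
  then have "(\<lambda>z. z c) \<in> borel_measurable (lebesgue_Rp p)" by simp
  then show ?thesis unfolding measurable_cong_sets[OF sets_F refl] .
qed

lemma product_sigma_finite_F: "product_sigma_finite (\<lambda>_. F)"
  by (simp add: product_sigma_finite_def prob_space_imp_sigma_finite prob_space_axioms)

lemma coord2_measurable: assumes "i \<in> K" "c < p" shows "(\<lambda>Z. Z i c) \<in> borel_measurable (PiM K (\<lambda>_. F))"
  using measurable_compose[OF measurable_component_singleton[OF assms(1)] coord_measurable[OF assms(2)]] .

text \<open>Lines parallel to axis \<open>c\<close> meet \<open>S\<close> in at most one point, so
  \<open>S\<close> is Lebesgue null by Fubini and null for \<open>F\<close> by absolute
  continuity.\<close>

lemma null_affine:
  assumes c: "c < p" and S: "S \<in> sets F"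
    and uniq: "\<And>z. \<exists>y0. \<forall>y. z(c := y) \<in> S \<longrightarrow> y = y0"
  shows "emeasure F S = 0"
proof -
  interpret L: product_sigma_finite "\<lambda>_::nat. lborel :: real measure" by unfold_locales
  let ?I = "{..<p} - {c}"
  have ins: "{..<p} = insert c ?I" using c by auto
  have S': "S \<in> sets (PiM (insert c ?I) (\<lambda>_. lborel))" using S sets_F ins unfolding lebesgue_Rp_def by simp
  have "emeasure (lebesgue_Rp p) S = (\<integral>\<^sup>+z. indicator S z \<partial>PiM (insert c ?I) (\<lambda>_. lborel))"
    unfolding lebesgue_Rp_def using S' ins by simp
  also have "\<dots> = (\<integral>\<^sup>+z. (\<integral>\<^sup>+y. indicator S (z(c := y)) \<partial>lborel) \<partial>PiM ?I (\<lambda>_. lborel))"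
    by (rule L.product_nn_integral_insert) (use S' in auto)
  also have "\<dots> = 0"
  proof -
    have "(\<integral>\<^sup>+y. indicator S (z(c := y)) \<partial>lborel) = 0" for z
    proof -
      obtain y0 where y0: "\<And>y. z(c := y) \<in> S \<Longrightarrow> y = y0" using uniq[of z] by blast
      have "(\<integral>\<^sup>+y. indicator S (z(c := y)) \<partial>lborel) \<le> (\<integral>\<^sup>+y. indicator {y0} y \<partial>lborel)"
        using y0 by (intro nn_integral_mono) (auto simp: indicator_def)
      also have "\<dots> = 0" by simp
      finally show ?thesis by simp
    qed
    then show ?thesis by simp
  qed
  finally have "S \<in> null_sets (lebesgue_Rp p)" using S sets_F by (auto simp: null_sets_def)
  then show ?thesis using ac unfolding absolutely_continuous_def by (auto simp: null_sets_def)
qed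

text \<open>Induction on the number of points. With the earlier points fixed, coordinate
  \<open>k\<close> of the new point is the last diagonal entry. The slope in this entry is nonzero
  by induction, so on each line parallel to that axis at most one value is exceptional and
  \<open>null_affine\<close> applies.\<close>

lemma generic_position:
  assumes "finite K" "inj_on idx {..k}" "idx ` {..k} \<subseteq> K" "k \<le> p"
  shows "AE Z in PiM K (\<lambda>_. F). schur_det (Suc k) (affine_matrix idx Z) \<noteq> 0"
  using assms
proof (induction k arbitrary: K)
  case 0 then show ?case by (simp add: affine_matrix_def)
next
  case (Suc k)
  interpret P: product_sigma_finite "\<lambda>_. F" by (rule product_sigma_finite_F)
  let ?i = "idx (Suc k)"
  let ?I = "K - {?i}"
  have ins: "K = insert ?i ?I" using Suc.prems by auto
  have finI: "finite ?I" "?i \<notin> ?I" using Suc.prems by auto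
  have ne: "idx r \<noteq> ?i" if "r \<le> k" for r using inj_onD[OF Suc.prems(2), of r "Suc k"] that by auto
  have sub: "idx ` {..k} \<subseteq> ?I" using Suc.prems(3) ne by auto
  have IH: "AE x in PiM ?I (\<lambda>_. F). schur_det (Suc k) (affine_matrix idx x) \<noteq> 0"
    by (rule Suc.IH) (use Suc.prems finI sub in \<open>auto intro: inj_on_subset\<close>)
  have mM: "(\<lambda>Z. affine_matrix idx Z r c) \<in> borel_measurable (PiM K (\<lambda>_. F))" if "r < Suc (Suc k)" "c < Suc (Suc k)" for r c
  proof (cases "c = 0")
    case False
    have "idx r \<in> K" using Suc.prems(3) that(1) by (auto simp: image_subset_iff)
    moreover have "c - 1 < p" using that(2) False Suc.prems(4) by linarith
    ultimately show ?thesis unfolding affine_matrix_def using coord2_measurable[of "idx r" K "c - 1"] False by simp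
  qed (simp add: affine_matrix_def)
  have md[measurable]: "(\<lambda>Z. schur_det (Suc (Suc k)) (affine_matrix idx Z)) \<in> borel_measurable (PiM K (\<lambda>_. F))" by (rule schur_det_measurable) (rule mM)
  let ?S = "{Z \<in> space (PiM K (\<lambda>_. F)). schur_det (Suc (Suc k)) (affine_matrix idx Z) = 0}"
  have S: "?S \<in> sets (PiM K (\<lambda>_. F))" by measurable
  have "emeasure (PiM K (\<lambda>_. F)) ?S = (\<integral>\<^sup>+Z. indicator ?S Z \<partial>PiM (insert ?i ?I) (\<lambda>_. F))"
    using S ins by simp
  also have "\<dots> = (\<integral>\<^sup>+x. (\<integral>\<^sup>+z. indicator ?S (x(?i := z)) \<partial>F) \<partial>PiM ?I (\<lambda>_. F))"
    by (rule P.product_nn_integral_insert[OF finI]) (use S ins in auto)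
  also have "\<dots> = (\<integral>\<^sup>+x. 0 \<partial>PiM ?I (\<lambda>_. F))"
  proof (rule nn_integral_cong_AE, use IH AE_space in eventually_elim)
    case (elim x)
    let ?T = "{z \<in> space F. x(?i := z) \<in> ?S}"
    show ?case
    proof -
      have up: "(\<lambda>z. x(?i := z)) \<in> measurable F (PiM K (\<lambda>_. F))"
        using measurable_component_update[OF elim(2) finI(2)] ins by simp
      have T: "?T \<in> sets F"
      proof -
        have "?T = (\<lambda>z. x(?i := z)) -` ?S \<inter> space F" by auto
        then show ?thesis using measurable_sets[OF up S] by simp
      qed
      have "(\<integral>\<^sup>+z. indicator ?S (x(?i := z)) \<partial>F) = (\<integral>\<^sup>+z. indicator ?T z \<partial>F)"
        by (intro nn_integral_cong) (auto simp: indicator_def)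
      also have "\<dots> = emeasure F ?T" using T by simp
      also have "\<dots> = 0"
      proof (rule null_affine[OF _ T])
        show "k < p" using Suc.prems by simp
        fix z
        define M where "M = affine_matrix idx (x(?i := z))"
        obtain e where e: "\<And>y. schur_det (Suc (Suc k)) (\<lambda>r c. if r = Suc k \<and> c = Suc k then y else M r c) = y * schur_det (Suc k) M + e"
          using schur_det_last[of "Suc k" M] by blast
        have M1: "schur_det (Suc k) M = schur_det (Suc k) (affine_matrix idx x)"
          unfolding M_def by (rule schur_det_cong) (use ne in \<open>auto simp: affine_matrix_def\<close>)
        have M2: "schur_det (Suc (Suc k)) (affine_matrix idx (x(?i := z(k := y)))) = y * schur_det (Suc k) (affine_matrix idx x) + e" for y
        proof -
          have "schur_det (Suc (Suc k)) (affine_matrix idx (x(?i := z(k := y)))) = schur_det (Suc (Suc k)) (\<lambda>r c. if r = Suc k \<and> c = Suc k then y else M r c)"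
          proof (rule schur_det_cong)
            fix r c assume rc: "r < Suc (Suc k)" "c < Suc (Suc k)"
            show "affine_matrix idx (x(?i := z(k := y))) r c = (if r = Suc k \<and> c = Suc k then y else M r c)"
            proof (cases "r = Suc k")
              case True then show ?thesis using rc by (auto simp: affine_matrix_def M_def)
            next
              case False then show ?thesis using ne[of r] rc by (auto simp: affine_matrix_def M_def)
            qed
          qed
          then show ?thesis unfolding e M1 .
        qed
        show "\<exists>y0. \<forall>y. z(k := y) \<in> ?T \<longrightarrow> y = y0"
        proof (intro exI[of _ "- e / schur_det (Suc k) (affine_matrix idx x)"] allI impI)
          fix y assume "z(k := y) \<in> ?T"
          then have 0: "y * schur_det (Suc k) (affine_matrix idx x) + e = 0" unfolding M2[symmetric] by simp
          show "y = - e / schur_det (Suc k) (affine_matrix idx x)" unfolding nonzero_eq_divide_eq[OF elim(1)] using 0 by linarith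
        qed
      qed
      finally show ?thesis .
    qed
  qed
  finally have "?S \<in> null_sets (PiM K (\<lambda>_. F))" using S by (auto simp: null_sets_def)
  then have "AE Z in PiM K (\<lambda>_. F). Z \<notin> ?S" by (rule AE_not_in)
  then show ?case using AE_space by eventually_elim auto
qed

end

context ac_law begin

text \<open>If p + 1 points had a common projection t in direction u, then (-t, u) would lie in the
  kernel of an affine matrix whose \<open>schur_det\<close> is nonzero, so u would vanish. Only
  finitely many selections of p + 1 indices have to be excluded.\<close>

lemma AE_ties_ok: "AE Z in PiM {..<N} (\<lambda>_. F). ties_ok p N Z"
proof -
  let ?G = "{idx \<in> {..p} \<rightarrow>\<^sub>E {..<N}. inj_on idx {..p}}"
  have "finite ?G" by (rule finite_subset[OF _ finite_PiE[of "{..p}" "\<lambda>_. {..<N}"]]) auto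
  then have "AE Z in PiM {..<N} (\<lambda>_. F). \<forall>idx\<in>?G. schur_det (Suc p) (affine_matrix idx Z) \<noteq> 0"
    by (rule AE_finite_allI) (rule generic_position, auto)
  then show ?thesis
  proof eventually_elim
    case (elim Z)
    show ?case unfolding ties_ok_def
    proof (intro ballI allI impI, rule ccontr)
      fix u i assume u: "u \<in> unit_sphere p" and i: "i < N" and big: "\<not> card {x \<in> {..<N}. ip p u (Z x) = ip p u (Z i)} \<le> p"
      let ?C = "{x \<in> {..<N}. ip p u (Z x) = ip p u (Z i)}" and ?t = "ip p u (Z i)"
      have "Suc p \<le> card ?C" using big by simp
      from obtain_subset_with_card_n[OF this] obtain C where C: "C \<subseteq> ?C" "card C = Suc p" "finite C" by blast
      have "card {..p} = card C" using C by simp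
      then obtain f where f: "bij_betw f {..p} C" using finite_same_card_bij[OF finite_atMost C(3)] by blast
      define idx where "idx = restrict f {..p}"
      have idxC: "idx r \<in> C" if "r \<le> p" for r using bij_betwE[OF f] that by (simp add: idx_def)
      have "inj_on idx {..p}" using bij_betw_imp_inj_on[OF f] by (simp add: idx_def inj_on_def)
      moreover have "idx \<in> {..p} \<rightarrow>\<^sub>E {..<N}" using idxC C(1) by (auto simp: idx_def)
      ultimately have d: "schur_det (Suc p) (affine_matrix idx Z) \<noteq> 0" using elim by blast
      define v where "v c = (if c = 0 then - ?t else u (c - 1))" for c
      have "(\<Sum>c<Suc p. affine_matrix idx Z r c * v c) = 0" if "r < Suc p" for r
      proof -
        have "(\<Sum>c<Suc p. affine_matrix idx Z r c * v c) = - ?t + (\<Sum>c<p. Z (idx r) c * u c)"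
          unfolding sum.lessThan_Suc_shift by (simp add: affine_matrix_def v_def)
        also have "(\<Sum>c<p. Z (idx r) c * u c) = ip p u (Z (idx r))" unfolding ip_def by (simp add: mult.commute)
        also have "\<dots> = ?t" using idxC[of r] that C(1) by auto
        finally show ?thesis by simp
      qed
      then have "v (Suc c) = 0" if "c < p" for c using schur_det_kernel[OF d, of v "Suc c"] that by simp
      then have "u c = 0" if "c < p" for c using that by (simp add: v_def)
      then have "(\<Sum>i<p. (u i)\<^sup>2) = 0" by simp
      then show False using u unfolding unit_sphere_def by simp
    qed
  qed
qed

end

section \<open>Measurability of the rejection event\<close>

lemma bounded_finite_coords_convergent_subseq:
  fixes u :: "nat \<Rightarrow> nat \<Rightarrow> real"
  assumes "\<And>l c. c < p \<Longrightarrow> \<bar>u l c\<bar> \<le> 2"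
  shows "\<exists>(r :: nat \<Rightarrow> nat) v. strict_mono r \<and> (\<forall>c<p. (\<lambda>l. u (r l) c) \<longlonglongrightarrow> v c)"
  using assms
proof (induction p)
  case 0 then show ?case by (intro exI[of _ id]) (auto simp: strict_mono_id)
next
  case (Suc p)
  obtain r v where r: "strict_mono (r :: nat \<Rightarrow> nat)" "\<And>c. c < p \<Longrightarrow> (\<lambda>l. u (r l) c) \<longlonglongrightarrow> v c" using Suc by fastforce
  have "seq_compact {-2..2::real}" using compact_imp_seq_compact[OF compact_Icc] .
  moreover have "\<forall>l. u (r l) p \<in> {-2..2}" using Suc.prems[of p] by (auto simp: abs_le_iff minus_le_iff)
  ultimately obtain y s where s: "strict_mono (s :: nat \<Rightarrow> nat)" "((\<lambda>l. u (r l) p) \<circ> s) \<longlonglongrightarrow> y" by (rule seq_compactE) blast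
  have "(\<lambda>l. u ((r \<circ> s) l) c) \<longlonglongrightarrow> (v(p := y)) c" if "c < Suc p" for c
  proof (cases "c = p")
    case True then show ?thesis using s(2) by (simp add: o_def)
  next
    case False
    then have "c < p" using that by simp
    from LIMSEQ_subseq_LIMSEQ[OF r(2)[OF this] s(1)] show ?thesis using False by (simp add: o_def)
  qed
  moreover have "strict_mono (r \<circ> s)" using strict_mono_o[OF r(1) s(1)] .
  ultimately show ?case by blast
qed

definition proj_diff :: "nat \<Rightarrow> (nat \<Rightarrow> nat \<Rightarrow> real) \<Rightarrow> (nat \<Rightarrow> real) \<Rightarrow> nat \<Rightarrow> nat \<Rightarrow> real" where
  "proj_diff p Z u i j = ip p u (Z i) - ip p u (Z j)"

text \<open>Rational vectors and rational slack express membership in the set of order patterns by countably many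
  measurable conditions, since the sphere is compact.\<close>

definition approx_pattern :: "nat \<Rightarrow> nat \<Rightarrow> (nat \<times> nat) set \<Rightarrow> nat \<Rightarrow> nat \<Rightarrow> (nat \<Rightarrow> real) \<Rightarrow> (nat \<Rightarrow> nat \<Rightarrow> real) \<Rightarrow> bool" where
  "approx_pattern p N P k l u Z \<longleftrightarrow> (\<forall>c\<in>{..<p}. \<bar>u c\<bar> \<le> 2) \<and> \<bar>(\<Sum>c<p. (u c)\<^sup>2) - 1\<bar> \<le> 1 / real (Suc l)
     \<and> (\<forall>i\<in>{..<N}. \<forall>j\<in>{..<N}. ((i, j) \<in> P \<longrightarrow> proj_diff p Z u i j \<le> 1 / real (Suc l))
        \<and> ((i, j) \<notin> P \<longrightarrow> proj_diff p Z u i j \<ge> 1 / real (Suc k) - 1 / real (Suc l)))"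

lemma proj_diff_tendsto:
  assumes "\<And>c. c < p \<Longrightarrow> (\<lambda>l. u l c) \<longlonglongrightarrow> v c"
  shows "(\<lambda>l. proj_diff p Z (u l) i j) \<longlonglongrightarrow> proj_diff p Z v i j" "(\<lambda>l. \<Sum>c<p. (u l c)\<^sup>2) \<longlonglongrightarrow> (\<Sum>c<p. (v c)\<^sup>2)"
  unfolding proj_diff_def ip_def using assms by (auto intro!: tendsto_intros)

text \<open>A direction satisfies finitely many strict inequalities, hence with a common gap 1 / (k
  + 1), and rational vectors close to it meet each relaxed condition. Conversely, relaxed solutions
  accumulate at a point of the sphere; \<open>k\<close> is fixed before \<open>l\<close>, so the gap
  keeps the strict inequalities strict in the limit.\<close>

lemma order_pattern_iff_approx:
  "P \<in> order_pattern p N Z ` unit_sphere p \<longleftrightarrow>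
     P \<subseteq> {..<N} \<times> {..<N} \<and> (\<exists>k. \<forall>l. \<exists>u\<in>{..<p} \<rightarrow>\<^sub>E \<rat>. approx_pattern p N P k l u Z)"
proof
  assume "P \<in> order_pattern p N Z ` unit_sphere p"
  then obtain u where u: "u \<in> unit_sphere p" and P: "P = order_pattern p N Z u" by blast
  have PN: "P \<subseteq> {..<N} \<times> {..<N}" unfolding P order_pattern_def by auto
  have inP: "(i, j) \<in> P \<longleftrightarrow> proj_diff p Z u i j \<le> 0" if "i < N" "j < N" for i j unfolding P order_pattern_def proj_diff_def using that by auto
  \<comment> \<open>The 1 keeps \<open>D\<close> nonempty when every pair belongs to
    \<open>P\<close>.\<close>
  define D where "D = insert 1 {proj_diff p Z u i j | i j. i < N \<and> j < N \<and> (i, j) \<notin> P}"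
  have finD: "finite D"
  proof -
    have "{proj_diff p Z u i j | i j. i < N \<and> j < N \<and> (i, j) \<notin> P} \<subseteq> (\<lambda>(i, j). proj_diff p Z u i j) ` ({..<N} \<times> {..<N})" by auto
    then show ?thesis unfolding D_def using finite_subset by fastforce
  qed
  have Dpos: "x > 0" if "x \<in> D" for x using that inP unfolding D_def by force
  have "Min D > 0" using Min_in[OF finD] Dpos unfolding D_def by blast
  from nat_approx_posE[OF this] obtain k where k: "1 / real (Suc k) < Min D" by blast
  have gap: "1 / real (Suc k) < proj_diff p Z u i j" if "i < N" "j < N" "(i, j) \<notin> P" for i j
    using k Min_le[OF finD, of "proj_diff p Z u i j"] that unfolding D_def by force
  have exq: "\<exists>q. q \<in> \<rat> \<and> \<bar>q - u c\<bar> < 1 / real (Suc l)" for l c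
    using Rats_dense_in_real[of "u c - 1 / real (Suc l)" "u c + 1 / real (Suc l)"] by (force simp: abs_less_iff)
  define q where "q l c = (SOME q. q \<in> \<rat> \<and> \<bar>q - u c\<bar> < 1 / real (Suc l))" for l c
  have q: "q l c \<in> \<rat>" "\<bar>q l c - u c\<bar> < 1 / real (Suc l)" for l c
    using someI_ex[OF exq[of c l]] unfolding q_def by auto
  define s where "s l = restrict (q l) {..<p}" for l
  have sQ: "s l \<in> {..<p} \<rightarrow>\<^sub>E \<rat>" for l unfolding s_def using q(1) by auto
  have lim: "(\<lambda>l. s l c) \<longlonglongrightarrow> u c" if "c < p" for c
  proof -
    have "(\<lambda>l. q l c - u c) \<longlonglongrightarrow> 0"
      by (rule Lim_null_comparison[OF _ LIMSEQ_inverse_real_of_nat])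
         (use q(2)[of _ c] in \<open>auto simp: inverse_eq_divide intro!: always_eventually less_imp_le\<close>)
    then have "(\<lambda>l. q l c) \<longlonglongrightarrow> u c" by (rule LIM_zero_cancel)
    then show ?thesis using that by (simp add: s_def)
  qed
  have u1: "(\<Sum>c<p. (u c)\<^sup>2) = 1" using u unfolding unit_sphere_def by simp
  have ub: "\<bar>u c\<bar> \<le> 1" if "c < p" for c
  proof -
    have "(u c)\<^sup>2 \<le> (\<Sum>c<p. (u c)\<^sup>2)" using that by (intro member_le_sum[where f="\<lambda>c. (u c)\<^sup>2"]) auto
    then show ?thesis unfolding u1 by (simp add: abs_square_le_1)
  qed
  have "\<exists>u\<in>{..<p} \<rightarrow>\<^sub>E \<rat>. approx_pattern p N P k l u Z" for l
  proof -
    have lpos: "0 < 1 / real (Suc l)" by simp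
    have e1: "\<forall>\<^sub>F x in sequentially. \<forall>c\<in>{..<p}. \<bar>s x c\<bar> \<le> 2"
    proof (intro eventually_ball_finite ballI)
      fix c assume "c \<in> {..<p}"
      then have "(\<lambda>l. \<bar>s l c\<bar>) \<longlonglongrightarrow> \<bar>u c\<bar>" using lim by (intro tendsto_rabs) auto
      moreover have "\<bar>u c\<bar> < 2" using ub[of c] \<open>c \<in> {..<p}\<close> by simp
      ultimately have "\<forall>\<^sub>F x in sequentially. \<bar>s x c\<bar> < 2" by (rule order_tendstoD(2))
      then show "\<forall>\<^sub>F x in sequentially. \<bar>s x c\<bar> \<le> 2" by eventually_elim simp
    qed simp
    have e2: "\<forall>\<^sub>F x in sequentially. \<bar>(\<Sum>c<p. (s x c)\<^sup>2) - 1\<bar> \<le> 1 / real (Suc l)"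
    proof -
      have "(\<lambda>x. \<bar>(\<Sum>c<p. (s x c)\<^sup>2) - 1\<bar>) \<longlonglongrightarrow> \<bar>(\<Sum>c<p. (u c)\<^sup>2) - 1\<bar>"
        by (intro tendsto_rabs tendsto_diff proj_diff_tendsto(2) lim tendsto_const)
      then have "\<forall>\<^sub>F x in sequentially. \<bar>(\<Sum>c<p. (s x c)\<^sup>2) - 1\<bar> < 1 / real (Suc l)"
        by (rule order_tendstoD(2)) (simp add: u1)
      then show ?thesis by eventually_elim simp
    qed
    have e3: "\<forall>\<^sub>F x in sequentially. \<forall>i\<in>{..<N}. \<forall>j\<in>{..<N}. ((i, j) \<in> P \<longrightarrow> proj_diff p Z (s x) i j \<le> 1 / real (Suc l))
        \<and> ((i, j) \<notin> P \<longrightarrow> proj_diff p Z (s x) i j \<ge> 1 / real (Suc k) - 1 / real (Suc l))"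
    proof (intro eventually_ball_finite ballI finite_lessThan)
      fix i j assume ij: "i \<in> {..<N}" "j \<in> {..<N}"
      have L: "(\<lambda>x. proj_diff p Z (s x) i j) \<longlonglongrightarrow> proj_diff p Z u i j" by (rule proj_diff_tendsto(1)) (rule lim)
      show "\<forall>\<^sub>F x in sequentially. ((i, j) \<in> P \<longrightarrow> proj_diff p Z (s x) i j \<le> 1 / real (Suc l))
        \<and> ((i, j) \<notin> P \<longrightarrow> proj_diff p Z (s x) i j \<ge> 1 / real (Suc k) - 1 / real (Suc l))"
      proof (cases "(i, j) \<in> P")
        case True
        then have "proj_diff p Z u i j \<le> 0" using inP[of i j] ij by simp
        then have "proj_diff p Z u i j < 1 / real (Suc l)" using lpos by linarith
        then have "\<forall>\<^sub>F x in sequentially. proj_diff p Z (s x) i j < 1 / real (Suc l)" by (rule order_tendstoD(2)[OF L])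
        then show ?thesis by (rule eventually_mono) (use True in auto)
      next
        case False
        then have "1 / real (Suc k) < proj_diff p Z u i j" using gap[of i j] ij by blast
        then have "1 / real (Suc k) - 1 / real (Suc l) < proj_diff p Z u i j" using lpos by linarith
        then have "\<forall>\<^sub>F x in sequentially. 1 / real (Suc k) - 1 / real (Suc l) < proj_diff p Z (s x) i j" by (rule order_tendstoD(1)[OF L])
        then show ?thesis by (rule eventually_mono) (use False in auto)
      qed
    qed
    have "\<forall>\<^sub>F x in sequentially. approx_pattern p N P k l (s x) Z"
      using e1 e2 e3 unfolding approx_pattern_def by eventually_elim blast
    from eventually_happens[OF this] obtain x where "approx_pattern p N P k l (s x) Z" by auto
    then show ?thesis using sQ by blast
  qed
  then show "P \<subseteq> {..<N} \<times> {..<N} \<and> (\<exists>k. \<forall>l. \<exists>u\<in>{..<p} \<rightarrow>\<^sub>E \<rat>. approx_pattern p N P k l u Z)" using PN by blast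
next
  assume "P \<subseteq> {..<N} \<times> {..<N} \<and> (\<exists>k. \<forall>l. \<exists>u\<in>{..<p} \<rightarrow>\<^sub>E \<rat>. approx_pattern p N P k l u Z)"
  then obtain k where PN: "P \<subseteq> {..<N} \<times> {..<N}" and "\<And>l. \<exists>u. approx_pattern p N P k l u Z" by blast
  then obtain u where u: "\<And>l. approx_pattern p N P k l (u l) Z" by metis
  have "\<And>l c. c < p \<Longrightarrow> \<bar>u l c\<bar> \<le> 2" using u unfolding approx_pattern_def by blast
  then have "\<exists>(r :: nat \<Rightarrow> nat) v. strict_mono r \<and> (\<forall>c<p. (\<lambda>l. u (r l) c) \<longlonglongrightarrow> v c)"
    by (rule bounded_finite_coords_convergent_subseq)
  then obtain r v where r: "strict_mono (r :: nat \<Rightarrow> nat)"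
    and lim: "\<And>c. c < p \<Longrightarrow> (\<lambda>l. u (r l) c) \<longlonglongrightarrow> v c" by blast
  have z: "(\<lambda>l. 1 / real (Suc (r l))) \<longlonglongrightarrow> 0"
    using LIMSEQ_subseq_LIMSEQ[OF LIMSEQ_inverse_real_of_nat r] by (simp add: o_def inverse_eq_divide)
  have L: "(\<lambda>l. proj_diff p Z (u (r l)) i j) \<longlonglongrightarrow> proj_diff p Z v i j" for i j by (rule proj_diff_tendsto(1)) (rule lim)
  define v' where "v' = restrict v {..<p}"
  have ipv: "ip p v' x = ip p v x" for x unfolding ip_def v'_def by simp
  have "(\<Sum>c<p. (v c)\<^sup>2) = 1"
  proof -
    have "(\<lambda>l. \<bar>(\<Sum>c<p. (u (r l) c)\<^sup>2) - 1\<bar>) \<longlonglongrightarrow> \<bar>(\<Sum>c<p. (v c)\<^sup>2) - 1\<bar>"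
      by (intro tendsto_rabs tendsto_diff proj_diff_tendsto(2) lim tendsto_const)
    then have "\<bar>(\<Sum>c<p. (v c)\<^sup>2) - 1\<bar> \<le> 0"
      by (rule LIMSEQ_le[OF _ z]) (use u in \<open>auto simp: approx_pattern_def\<close>)
    then show ?thesis by simp
  qed
  then have "v' \<in> unit_sphere p" unfolding unit_sphere_def v'_def by auto
  moreover have "order_pattern p N Z v' = P"
  proof -
    have "proj_diff p Z v i j \<le> 0 \<longleftrightarrow> (i, j) \<in> P" if ij: "i < N" "j < N" for i j
    proof (cases "(i, j) \<in> P")
      case True
      have "proj_diff p Z v i j \<le> 0" by (rule LIMSEQ_le[OF L z]) (use u ij True in \<open>auto simp: approx_pattern_def\<close>)
      then show ?thesis using True by simp
    next
      case False
      have "(\<lambda>l. 1 / real (Suc k) - 1 / real (Suc (r l))) \<longlonglongrightarrow> 1 / real (Suc k) - 0" by (intro tendsto_diff z tendsto_const)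
      then have "1 / real (Suc k) - 0 \<le> proj_diff p Z v i j"
        by (rule LIMSEQ_le[OF _ L]) (use u ij False in \<open>auto simp: approx_pattern_def\<close>)
      moreover have "0 < 1 / real (Suc k)" by simp
      ultimately show ?thesis using False by linarith
    qed
    then show ?thesis using PN unfolding order_pattern_def ipv by (auto simp: proj_diff_def)
  qed
  ultimately show "P \<in> order_pattern p N Z ` unit_sphere p" by blast
qed

text \<open>Layout of the pool: the first m positions hold the second sample, the next n the first
  sample. After a permutation \<pi> the second sample thus consists of the images of the first m
  positions.\<close>

definition rejects :: "nat \<Rightarrow> nat \<Rightarrow> nat \<Rightarrow> nat \<Rightarrow> (nat \<Rightarrow> real \<Rightarrow> real) \<Rightarrow> real \<Rightarrow> (nat \<Rightarrow> nat \<Rightarrow> real) \<Rightarrow> bool" where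
  "rejects n m p d psi \<alpha> Z \<longleftrightarrow> Psi_max n m p d psi (\<lambda>i. Z (m + i)) Z \<ge> c_MB n p d psi (\<lambda>i. Z (m + i)) \<alpha>"

text \<open>The test as a function of the set of realised order patterns alone. This set takes
  finitely many values, so the rejection event is a finite union of measurable events, and suprema
  and quantiles need no separate measurability argument.\<close>

definition rejects_pattern :: "nat \<Rightarrow> nat \<Rightarrow> nat \<Rightarrow> (nat \<Rightarrow> real \<Rightarrow> real) \<Rightarrow> real \<Rightarrow> (nat \<times> nat) set set \<Rightarrow> bool" where
  "rejects_pattern n m d psi \<alpha> Os \<longleftrightarrow>
     sqrt (real n * real m / (real n + real m)) *
       Sup {\<bar>(\<Sum>j<m. psi k (real (card {i. i < n \<and> (m + i, j) \<in> P}) / real n)) / real m\<bar> | P k. P \<in> Os \<and> k \<in> {1..d}}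
     \<ge> Inf {t. measure (gauss_mult n) {e \<in> space (gauss_mult n).
          Sup {\<bar>(\<Sum>i'<n. e i' * psi k (real (card {i. i < n \<and> (m + i, m + i') \<in> P}) / real n)) / sqrt (real n)\<bar> | P k. P \<in> Os \<and> k \<in> {1..d}} > t} \<le> \<alpha>}"

lemma rejects_iff_rejects_pattern: "rejects n m p d psi \<alpha> Z \<longleftrightarrow> rejects_pattern n m d psi \<alpha> (order_pattern p (n + m) Z ` unit_sphere p)"
proof -
  let ?O = "order_pattern p (n + m) Z ` unit_sphere p"
  have e1: "ecdf_u n p (\<lambda>i. Z (m + i)) u (ip p u (Z j)) = real (card {i. i < n \<and> (m + i, j) \<in> order_pattern p (n + m) Z u}) / real n" if "j < n + m" for u j
  proof -
    have "{i. i < n \<and> ip p u (Z (m + i)) \<le> ip p u (Z j)} = {i. i < n \<and> (m + i, j) \<in> order_pattern p (n + m) Z u}"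
      using that unfolding order_pattern_def by auto
    then show ?thesis unfolding ecdf_u_def by simp
  qed
  have s1: "{\<bar>(\<Sum>j<m. psi k (ecdf_u n p (\<lambda>i. Z (m + i)) u (ip p u (Z j)))) / real m\<bar> | u k. u \<in> unit_sphere p \<and> k \<in> {1..d}}
     = {\<bar>(\<Sum>j<m. psi k (real (card {i. i < n \<and> (m + i, j) \<in> P}) / real n)) / real m\<bar> | P k. P \<in> ?O \<and> k \<in> {1..d}}"
  proof -
    have "(\<Sum>j<m. psi k (ecdf_u n p (\<lambda>i. Z (m + i)) u (ip p u (Z j)))) = (\<Sum>j<m. psi k (real (card {i. i < n \<and> (m + i, j) \<in> order_pattern p (n + m) Z u}) / real n))" for u k
      by (intro sum.cong refl) (simp add: e1)
    then show ?thesis by (simp only:) blast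
  qed
  have s2: "{\<bar>(\<Sum>i'<n. e i' * psi k (ecdf_u n p (\<lambda>i. Z (m + i)) u (ip p u (Z (m + i'))))) / sqrt (real n)\<bar> | u k. u \<in> unit_sphere p \<and> k \<in> {1..d}}
     = {\<bar>(\<Sum>i'<n. e i' * psi k (real (card {i. i < n \<and> (m + i, m + i') \<in> P}) / real n)) / sqrt (real n)\<bar> | P k. P \<in> ?O \<and> k \<in> {1..d}}" for e
  proof -
    have "(\<Sum>i'<n. e i' * psi k (ecdf_u n p (\<lambda>i. Z (m + i)) u (ip p u (Z (m + i'))))) = (\<Sum>i'<n. e i' * psi k (real (card {i. i < n \<and> (m + i, m + i') \<in> order_pattern p (n + m) Z u}) / real n))" for u k
      by (intro sum.cong refl) (simp add: e1)
    then show ?thesis by (simp only:) blast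
  qed
  show ?thesis unfolding rejects_def rejects_pattern_def Psi_max_def c_MB_def Psi_MB_def s1 s2 ..
qed

lemma order_pattern_cong: assumes "\<And>i. i < N \<Longrightarrow> Z i = Z' i" shows "order_pattern p N Z = order_pattern p N Z'"
  by (rule ext) (auto simp: order_pattern_def assms)

lemma rejects_cong: assumes "\<And>i. i < n + m \<Longrightarrow> Z i = Z' i" shows "rejects n m p d psi \<alpha> Z \<longleftrightarrow> rejects n m p d psi \<alpha> Z'"
proof -
  have "order_pattern p (n + m) Z = order_pattern p (n + m) Z'" using assms by (rule order_pattern_cong)
  then show ?thesis unfolding rejects_iff_rejects_pattern by simp
qed

context ac_law begin

lemma order_pattern_set_measurable:
  "{Z \<in> space (PiM {..<N} (\<lambda>_. F)). P \<in> order_pattern p N Z ` unit_sphere p} \<in> sets (PiM {..<N} (\<lambda>_. F))"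
proof (cases "P \<subseteq> {..<N} \<times> {..<N}")
  case False
  then have "{Z \<in> space (PiM {..<N} (\<lambda>_. F)). P \<in> order_pattern p N Z ` unit_sphere p} = {}" unfolding order_pattern_iff_approx by blast
  then show ?thesis by (simp only: sets.empty_sets)
next
  case True
  let ?Q = "PiM {..<N} (\<lambda>_. F)"
  let ?R = "{..<p} \<rightarrow>\<^sub>E (\<rat> :: real set)"
  have cR: "countable ?R" by (intro countable_PiE) (auto simp: countable_rat)
  have dm: "(\<lambda>Z. proj_diff p Z u i j) \<in> borel_measurable ?Q" if "i < N" "j < N" for u i j
  proof -
    have "(\<lambda>Z. Z i c) \<in> borel_measurable ?Q" "(\<lambda>Z. Z j c) \<in> borel_measurable ?Q" if "c \<in> {..<p}" for c
      using coord2_measurable[of _ "{..<N}" c] that \<open>i < N\<close> \<open>j < N\<close> by auto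
    then show ?thesis unfolding proj_diff_def ip_def by (intro borel_measurable_diff borel_measurable_sum borel_measurable_times borel_measurable_const) auto
  qed
  have am: "{Z \<in> space ?Q. approx_pattern p N P k l u Z} \<in> sets ?Q" for k l u
  proof -
    have i: "{Z \<in> space ?Q. ((i, j) \<in> P \<longrightarrow> proj_diff p Z u i j \<le> 1 / real (Suc l)) \<and> ((i, j) \<notin> P \<longrightarrow> proj_diff p Z u i j \<ge> 1 / real (Suc k) - 1 / real (Suc l))} \<in> sets ?Q"
      if "i \<in> {..<N}" "j \<in> {..<N}" for i j
    proof -
      have [measurable]: "(\<lambda>Z. proj_diff p Z u i j) \<in> borel_measurable ?Q" using dm that by simp
      show ?thesis by measurable
    qed
    have "{Z \<in> space ?Q. \<forall>i\<in>{..<N}. \<forall>j\<in>{..<N}. ((i, j) \<in> P \<longrightarrow> proj_diff p Z u i j \<le> 1 / real (Suc l)) \<and> ((i, j) \<notin> P \<longrightarrow> proj_diff p Z u i j \<ge> 1 / real (Suc k) - 1 / real (Suc l))} \<in> sets ?Q"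
      by (intro sets.sets_Collect_finite_All i finite_lessThan)
    then show ?thesis unfolding approx_pattern_def by (intro sets.sets_Collect_conj sets.sets_Collect_const)
  qed
  have "{Z \<in> space ?Q. P \<in> order_pattern p N Z ` unit_sphere p} = (\<Union>k. (\<Inter>l. (\<Union>u\<in>?R. {Z \<in> space ?Q. approx_pattern p N P k l u Z})))"
  proof (rule set_eqI)
    fix Z
    show "Z \<in> {Z \<in> space ?Q. P \<in> order_pattern p N Z ` unit_sphere p} \<longleftrightarrow> Z \<in> (\<Union>k. (\<Inter>l. (\<Union>u\<in>?R. {Z \<in> space ?Q. approx_pattern p N P k l u Z})))"
      unfolding mem_Collect_eq order_pattern_iff_approx Union_iff INT_iff UN_iff using True by simp
  qed
  also have "\<dots> \<in> sets ?Q"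
    by (intro sets.countable_UN sets.countable_INT image_subsetI sets.countable_UN' cR am) auto
  finally show ?thesis .
qed

lemma rejects_measurable: "{Z \<in> space (PiM {..<n + m} (\<lambda>_. F)). rejects n m p d psi \<alpha> Z} \<in> sets (PiM {..<n + m} (\<lambda>_. F))"
proof -
  let ?N = "n + m"
  let ?Q = "PiM {..<?N} (\<lambda>_. F)"
  let ?PP = "Pow ({..<?N} \<times> {..<?N})"
  let ?O = "\<lambda>Z. order_pattern p ?N Z ` unit_sphere p"
  have fin: "finite ?PP" by simp
  have sub: "?O Z \<subseteq> ?PP" for Z unfolding order_pattern_def by auto
  have eq: "{Z \<in> space ?Q. ?O Z = S} \<in> sets ?Q" if S: "S \<subseteq> ?PP" for S
  proof -
    have "?O Z = S \<longleftrightarrow> (\<forall>P\<in>?PP. P \<in> ?O Z \<longleftrightarrow> P \<in> S)" for Z using sub[of Z] S by blast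
    then have "{Z \<in> space ?Q. ?O Z = S} = {Z \<in> space ?Q. \<forall>P\<in>?PP. P \<in> ?O Z \<longleftrightarrow> P \<in> S}" by simp
    also have "\<dots> \<in> sets ?Q"
    proof (rule sets.sets_Collect_finite_All'[OF _ fin])
      fix P
      have A: "{Z \<in> space ?Q. P \<in> ?O Z} \<in> sets ?Q" by (rule order_pattern_set_measurable)
      show "{Z \<in> space ?Q. P \<in> ?O Z \<longleftrightarrow> P \<in> S} \<in> sets ?Q"
      proof (cases "P \<in> S")
        case True then show ?thesis using A by simp
      next
        case False
        have "{Z \<in> space ?Q. P \<in> ?O Z \<longleftrightarrow> P \<in> S} = space ?Q - {Z \<in> space ?Q. P \<in> ?O Z}" using False by auto
        then show ?thesis using A by simp
      qed
    qed auto
    finally show ?thesis .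
  qed
  have "{Z \<in> space ?Q. rejects n m p d psi \<alpha> Z} = (\<Union>S\<in>{S \<in> Pow ?PP. rejects_pattern n m d psi \<alpha> S}. {Z \<in> space ?Q. ?O Z = S})"
    unfolding rejects_iff_rejects_pattern using sub by blast
  also have "\<dots> \<in> sets ?Q" using eq fin by (intro sets.finite_UN) auto
  finally show ?thesis .
qed

section \<open>Exchangeability of the pooled sample\<close>

definition glue :: "nat \<Rightarrow> nat \<Rightarrow> (nat \<Rightarrow> nat \<Rightarrow> real) \<times> (nat \<Rightarrow> nat \<Rightarrow> real) \<Rightarrow> nat \<Rightarrow> nat \<Rightarrow> real" where
  "glue n m XY = (\<lambda>i\<in>{..<n + m}. if i < m then snd XY i else fst XY (i - m))"

lemma glue_measurable: "glue n m \<in> measurable (PiM {..<n} (\<lambda>_. F) \<Otimes>\<^sub>M PiM {..<m} (\<lambda>_. F)) (PiM {..<n + m} (\<lambda>_. F))"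
  unfolding glue_def
proof (rule measurable_restrict)
  fix i assume i: "i \<in> {..<n + m}"
  show "(\<lambda>XY. if i < m then snd XY i else fst XY (i - m)) \<in> measurable (PiM {..<n} (\<lambda>_. F) \<Otimes>\<^sub>M PiM {..<m} (\<lambda>_. F)) F"
  proof (cases "i < m")
    case True
    then have "(\<lambda>Y. Y i) \<in> measurable (PiM {..<m} (\<lambda>_. F)) F" by (intro measurable_component_singleton) simp
    from measurable_compose[OF measurable_snd this] True show ?thesis by simp
  next
    case False
    then have "(\<lambda>X. X (i - m)) \<in> measurable (PiM {..<n} (\<lambda>_. F)) F" using i by (intro measurable_component_singleton) auto
    from measurable_compose[OF measurable_fst this] False show ?thesis by simp
  qed
qed

lemma distr_glue:
  "distr (PiM {..<n} (\<lambda>_. F) \<Otimes>\<^sub>M PiM {..<m} (\<lambda>_. F)) (PiM {..<n + m} (\<lambda>_. F)) (glue n m) = PiM {..<n + m} (\<lambda>_. F)"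
proof -
  interpret P: product_sigma_finite "\<lambda>_. F" by (rule product_sigma_finite_F)
  let ?X = "PiM {..<n} (\<lambda>_. F)" and ?Y = "PiM {..<m} (\<lambda>_. F)" and ?Q = "PiM {..<n + m} (\<lambda>_. F)"
  interpret Y: prob_space ?Y by (intro prob_space_PiM prob_space_axioms)
  show ?thesis
  proof (rule P.PiM_eqI)
    fix A assume A: "\<And>i. i \<in> {..<n + m} \<Longrightarrow> A i \<in> sets F"
    let ?A1 = "PiE {..<n} (\<lambda>i. A (m + i))" and ?A2 = "PiE {..<m} A"
    have A1: "?A1 \<in> sets ?X" using A by (intro sets_PiM_I_finite) auto
    have A2: "?A2 \<in> sets ?Y" using A by (intro sets_PiM_I_finite) auto
    have "emeasure (distr (?X \<Otimes>\<^sub>M ?Y) ?Q (glue n m)) (PiE {..<n + m} A) = emeasure (?X \<Otimes>\<^sub>M ?Y) (glue n m -` PiE {..<n + m} A \<inter> space (?X \<Otimes>\<^sub>M ?Y))"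
      using A by (intro emeasure_distr glue_measurable sets_PiM_I_finite) auto
    also have "glue n m -` PiE {..<n + m} A \<inter> space (?X \<Otimes>\<^sub>M ?Y) = ?A1 \<times> ?A2"
    proof (intro equalityI subsetI)
      fix z assume z: "z \<in> glue n m -` PiE {..<n + m} A \<inter> space (?X \<Otimes>\<^sub>M ?Y)"
      obtain x y where xy: "z = (x, y)" by (cases z)
      have g: "glue n m (x, y) i \<in> A i" if "i < n + m" for i using z xy that by (auto simp: PiE_iff)
      have ext: "x \<in> extensional {..<n}" "y \<in> extensional {..<m}" using z xy by (auto simp: space_pair_measure space_PiM PiE_iff)
      have "x i \<in> A (m + i)" if "i < n" for i using g[of "m + i"] that by (simp add: glue_def)
      moreover have "y i \<in> A i" if "i < m" for i using g[of i] that by (simp add: glue_def)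
      ultimately show "z \<in> ?A1 \<times> ?A2" using ext xy by (auto simp: PiE_iff)
    next
      fix z assume z: "z \<in> ?A1 \<times> ?A2"
      obtain x y where xy: "z = (x, y)" by (cases z)
      have s: "z \<in> space (?X \<Otimes>\<^sub>M ?Y)"
        using z sets.sets_into_space[OF A1] sets.sets_into_space[OF A2] by (auto simp: space_pair_measure)
      have "glue n m (x, y) i \<in> A i" if "i < n + m" for i
      proof (cases "i < m")
        case True then show ?thesis using z xy by (auto simp: glue_def PiE_iff)
      next
        case False
        have h: "\<forall>k\<in>{..<n}. x k \<in> A (m + k)" using z xy by (auto simp: PiE_iff)
        have "i - m \<in> {..<n}" using False that by auto
        from bspec[OF h this] show ?thesis using False that by (simp add: glue_def)
      qed
      then show "z \<in> glue n m -` PiE {..<n + m} A \<inter> space (?X \<Otimes>\<^sub>M ?Y)" using s xy by (auto simp: PiE_iff glue_def)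
    qed
    also have "emeasure (?X \<Otimes>\<^sub>M ?Y) (?A1 \<times> ?A2) = emeasure ?X ?A1 * emeasure ?Y ?A2"
      using A1 A2 by (rule Y.emeasure_pair_measure_Times)
    also have "emeasure ?X ?A1 = (\<Prod>i<n. emeasure F (A (m + i)))" using A by (intro P.emeasure_PiM) auto
    also have "emeasure ?Y ?A2 = (\<Prod>i<m. emeasure F (A i))" using A by (intro P.emeasure_PiM) auto
    also have "(\<Prod>i<n. emeasure F (A (m + i))) * (\<Prod>i<m. emeasure F (A i)) = (\<Prod>i<n + m. emeasure F (A i))"
    proof -
      have "(\<Prod>i<n. emeasure F (A (m + i))) = (\<Prod>i\<in>{m..<n + m}. emeasure F (A i))"
        by (rule prod.reindex_bij_witness[of _ "\<lambda>i. i - m" "\<lambda>i. m + i"]) auto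
      moreover have "{..<n + m} = {m..<n + m} \<union> {..<m}" by auto
      moreover have "(\<Prod>i\<in>{m..<n + m} \<union> {..<m}. emeasure F (A i)) = (\<Prod>i\<in>{m..<n + m}. emeasure F (A i)) * (\<Prod>i<m. emeasure F (A i))"
        by (rule prod.union_disjoint) auto
      ultimately show ?thesis by simp
    qed
    finally show "emeasure (distr (?X \<Otimes>\<^sub>M ?Y) ?Q (glue n m)) (PiE {..<n + m} A) = (\<Prod>i<n + m. emeasure F (A i))" .
  qed auto
qed

lemma reject_prob_eq: "reject_prob F F n m p d psi \<alpha> = measure (PiM {..<n + m} (\<lambda>_. F)) {Z \<in> space (PiM {..<n + m} (\<lambda>_. F)). rejects n m p d psi \<alpha> Z}"
proof -
  let ?M = "PiM {..<n} (\<lambda>_. F) \<Otimes>\<^sub>M PiM {..<m} (\<lambda>_. F)" and ?Q = "PiM {..<n + m} (\<lambda>_. F)"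
  let ?S = "{Z \<in> space ?Q. rejects n m p d psi \<alpha> Z}"
  have iff: "rejects n m p d psi \<alpha> (glue n m XY) \<longleftrightarrow> Psi_max n m p d psi (fst XY) (snd XY) \<ge> c_MB n p d psi (fst XY) \<alpha>" for XY
  proof -
    have "{i. i < n \<and> ip p u (glue n m XY (m + i)) \<le> t} = {i. i < n \<and> ip p u (fst XY i) \<le> t}" for u t
      by (auto simp: glue_def)
    then have ec: "ecdf_u n p (\<lambda>i. glue n m XY (m + i)) u t = ecdf_u n p (fst XY) u t" for u t unfolding ecdf_u_def by simp
    have 1: "(\<Sum>j<m. psi k (ecdf_u n p (fst XY) u (ip p u (glue n m XY j)))) = (\<Sum>j<m. psi k (ecdf_u n p (fst XY) u (ip p u (snd XY j))))" for u k
      by (intro sum.cong refl) (simp add: glue_def)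
    have 2: "(\<Sum>i<n. e i * psi k (ecdf_u n p (fst XY) u (ip p u (glue n m XY (m + i))))) = (\<Sum>i<n. e i * psi k (ecdf_u n p (fst XY) u (ip p u (fst XY i))))" for e u k
      by (intro sum.cong refl) (simp add: glue_def)
    show ?thesis unfolding rejects_def Psi_max_def c_MB_def Psi_MB_def ec 1 2 ..
  qed
  have "measure ?Q ?S = measure (distr ?M ?Q (glue n m)) ?S" unfolding distr_glue ..
  also have "\<dots> = measure ?M (glue n m -` ?S \<inter> space ?M)" by (rule measure_distr[OF glue_measurable rejects_measurable])
  also have "glue n m -` ?S \<inter> space ?M = {XY \<in> space ?M. Psi_max n m p d psi (fst XY) (snd XY) \<ge> c_MB n p d psi (fst XY) \<alpha>}"
    using measurable_space[OF glue_measurable] iff by auto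
  finally show ?thesis unfolding reject_prob_def Let_def by simp
qed

text \<open>The pool has independent, identically distributed entries, so permuting it does not
  change the rejection probability. This probability is therefore the mean of the permutation
  average, which the assumption controls for almost every pool.\<close>

lemma exchangeable_average:
  assumes b: "\<And>Z. ties_ok p (n + m) Z \<Longrightarrow> \<bar>EP (n + m) (\<lambda>\<pi>. of_bool (rejects n m p d psi \<alpha> (\<lambda>i. Z (\<pi> i)))) - \<alpha>\<bar> \<le> b"
  shows "\<bar>reject_prob F F n m p d psi \<alpha> - \<alpha>\<bar> \<le> b"
proof -
  let ?N = "n + m"
  let ?Q = "PiM {..<?N} (\<lambda>_. F)"
  interpret Q: prob_space ?Q by (intro prob_space_PiM prob_space_axioms)
  let ?R = "rejects n m p d psi \<alpha>"
  let ?S = "\<lambda>\<pi>. {Z \<in> space ?Q. ?R (\<lambda>i. Z (\<pi> i))}"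
  have per: "?S \<pi> \<in> sets ?Q" "measure ?Q (?S \<pi>) = reject_prob F F n m p d psi \<alpha>" if pi: "\<pi> permutes {..<?N}" for \<pi>
  proof -
    let ?f = "\<lambda>Z. \<lambda>i\<in>{..<?N}. Z (\<pi> i)"
    have im: "\<pi> i \<in> {..<?N}" if "i \<in> {..<?N}" for i using permutes_in_image[OF pi] that by simp
    have fm: "?f \<in> measurable ?Q ?Q" using im by (intro measurable_restrict measurable_component_singleton) auto
    have d: "distr ?Q ?Q ?f = ?Q"
      using distr_PiM_reindex[of "{..<?N}" "\<lambda>_. F" \<pi> "{..<?N}"] prob_space_axioms permutes_inj_on[OF pi] im by (simp add: Pi_iff)
    have eq: "?f -` {Z \<in> space ?Q. ?R Z} \<inter> space ?Q = ?S \<pi>"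
    proof -
      have "?R (?f Z) \<longleftrightarrow> ?R (\<lambda>i. Z (\<pi> i))" for Z by (rule rejects_cong) simp
      then show ?thesis using measurable_space[OF fm] by auto
    qed
    show "?S \<pi> \<in> sets ?Q"
      using measurable_sets[OF fm rejects_measurable[where d=d and psi=psi and \<alpha>=\<alpha>]] unfolding eq .
    have "reject_prob F F n m p d psi \<alpha> = measure (distr ?Q ?Q ?f) {Z \<in> space ?Q. ?R Z}" unfolding reject_prob_eq d ..
    also have "\<dots> = measure ?Q (?S \<pi>)" unfolding measure_distr[OF fm rejects_measurable] eq ..
    finally show "measure ?Q (?S \<pi>) = reject_prob F F n m p d psi \<alpha>" ..
  qed
  have ind: "integrable ?Q (indicator (?S \<pi>) :: _ \<Rightarrow> real)" if "\<pi> permutes {..<?N}" for \<pi>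
    using per(1)[OF that] by (simp add: Q.emeasure_eq_measure)
  let ?g = "\<lambda>Z. (\<Sum>\<pi> | \<pi> permutes {..<?N}. indicator (?S \<pi>) Z) / fact ?N :: real"
  have ig: "integrable ?Q ?g" unfolding divide_inverse using ind by (intro integrable_mult_left Bochner_Integration.integrable_sum) simp
  have "(\<integral>Z. ?g Z \<partial>?Q) = (\<Sum>\<pi> | \<pi> permutes {..<?N}. measure ?Q (?S \<pi>)) / fact ?N"
    using ind per(1) by (simp add: Bochner_Integration.integral_sum)
  also have "\<dots> = reject_prob F F n m p d psi \<alpha>"
    using per(2) by (simp add: card_permutations[OF refl finite_lessThan])
  finally have int: "(\<integral>Z. ?g Z \<partial>?Q) = reject_prob F F n m p d psi \<alpha>" .
  have AE: "AE Z in ?Q. \<bar>?g Z - \<alpha>\<bar> \<le> b"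
    using AE_ties_ok[of ?N] AE_space
  proof eventually_elim
    case (elim Z)
    have "?g Z = EP ?N (\<lambda>\<pi>. of_bool (?R (\<lambda>i. Z (\<pi> i))))"
      unfolding EP_def using elim(2) by (simp add: indicator_def of_bool_def)
    then show ?case using b[OF elim(1)] by simp
  qed
  have "\<bar>reject_prob F F n m p d psi \<alpha> - \<alpha>\<bar> = \<bar>\<integral>Z. ?g Z - \<alpha> \<partial>?Q\<bar>"
    unfolding int[symmetric] using ig by (simp add: Q.prob_space)
  also have "\<dots> \<le> (\<integral>Z. \<bar>?g Z - \<alpha>\<bar> \<partial>?Q)" by (rule integral_abs_bound)
  also have "\<dots> \<le> (\<integral>Z. b \<partial>?Q)" using ig AE by (intro integral_mono_AE integrable_abs Bochner_Integration.integrable_diff) auto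
  finally show ?thesis by (simp add: Q.prob_space)
qed

end

section \<open>Rates\<close>

text \<open>On each of the M cells the left endpoint rule errs by at most L / M^2. The sum is not
  normalised, so the total error L / M is multiplied by M.\<close>

lemma lipschitz_riemann_sum:
  fixes f :: "real \<Rightarrow> real"
  assumes lip: "\<And>x y. x \<in> {0..1} \<Longrightarrow> y \<in> {0..1} \<Longrightarrow> \<bar>f x - f y\<bar> \<le> L * \<bar>x - y\<bar>" and L: "L \<ge> 0" and M: "M > 0"
  shows "\<bar>(\<Sum>i<M. f (real i / real M)) - real M * integral {0..1} f\<bar> \<le> L"
proof -
  have "L-lipschitz_on {0..1} f" using lip L by (auto simp: lipschitz_on_def dist_real_def)
  then have cont: "continuous_on {0..1} f" by (rule lipschitz_on_continuous_on)
  have int: "f integrable_on {a..b}" if "0 \<le> a" "b \<le> 1" for a b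
    using that by (intro integrable_continuous_real continuous_on_subset[OF cont]) auto
  have "\<bar>(\<Sum>i<k. f (real i / real M) / real M) - integral {0..real k / real M} f\<bar> \<le> real k * L / (real M)\<^sup>2" if "k \<le> M" for k
    using that
  proof (induction k)
    case 0 then show ?case by simp
  next
    case (Suc k)
    let ?a = "real k / real M" and ?b = "real (Suc k) / real M"
    have b1: "?b \<le> 1" using Suc.prems M by simp
    have a0: "0 \<le> ?a" by simp
    have ab: "?a \<le> ?b" by (simp add: divide_right_mono)
    have w: "?b - ?a = 1 / real M" by (simp add: diff_divide_distrib[symmetric])
    have "integral {0..?b} f = integral {0..?a} f + integral {?a..?b} f"
      using Henstock_Kurzweil_Integration.integral_combine[OF a0 ab int[OF order_refl b1]] by simp
    moreover have "\<bar>f ?a / real M - integral {?a..?b} f\<bar> \<le> L / (real M)\<^sup>2"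
    proof -
      have "integral {?a..?b} (\<lambda>x. f ?a - f x) = f ?a / real M - integral {?a..?b} f"
        using ab w b1 a0 by (subst integral_diff) (auto intro!: int)
      moreover have "norm (integral {?a..?b} (\<lambda>x. f ?a - f x)) \<le> integral {?a..?b} (\<lambda>x. L / real M)"
      proof (rule integral_norm_bound_integral)
        show "(\<lambda>x. f ?a - f x) integrable_on {?a..?b}" by (intro integrable_diff int a0 b1) auto
        fix x assume x: "x \<in> {?a..?b}"
        have "\<bar>f ?a - f x\<bar> \<le> L * \<bar>?a - x\<bar>" using x b1 a0 ab order_trans[of 0 ?a x] order_trans[of x ?b 1] by (intro lip) auto
        also have "\<dots> \<le> L * (1 / real M)" using x w L by (intro mult_left_mono) auto
        finally show "norm (f ?a - f x) \<le> L / real M" by simp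
      qed auto
      ultimately show ?thesis using ab w by (simp add: power2_eq_square)
    qed
    moreover have "real (Suc k) * L / (real M)\<^sup>2 = real k * L / (real M)\<^sup>2 + L / (real M)\<^sup>2"
      by (simp add: add_divide_distrib algebra_simps)
    ultimately show ?case using Suc.IH Suc.prems by simp
  qed
  from this[of M] have "\<bar>(\<Sum>i<M. f (real i / real M)) / real M - integral {0..1} f\<bar> \<le> L / real M"
    using M by (simp add: sum_divide_distrib power2_eq_square)
  then have "real M * \<bar>(\<Sum>i<M. f (real i / real M)) / real M - integral {0..1} f\<bar> \<le> real M * (L / real M)"
    by (rule mult_left_mono) simp
  also have "real M * \<bar>(\<Sum>i<M. f (real i / real M)) / real M - integral {0..1} f\<bar> = \<bar>real M * ((\<Sum>i<M. f (real i / real M)) / real M - integral {0..1} f)\<bar>"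
    by (simp add: abs_mult)
  finally show ?thesis using M by (simp add: right_diff_distrib)
qed

text \<open>The derivative bound controls everything else: a function of mean zero on the unit
  interval is bounded by its oscillation, hence by B, and its unit second moment then forces B >= 1.
  The mean vanishes by orthogonality to the constant function.\<close>

lemma orthonormal_element_bounds:
  fixes f f' :: "real \<Rightarrow> real"
  assumes der: "\<And>z. z \<in> {0..1} \<Longrightarrow> (f has_real_derivative f' z) (at z within {0..1})"
    and bd: "\<And>z. z \<in> {0..1} \<Longrightarrow> \<bar>f' z\<bar> \<le> B"
    and mean: "integral {0..1} f = 0" and var: "integral {0..1} (\<lambda>z. (f z)\<^sup>2) = 1"
  shows "\<And>x y. x \<in> {0..1} \<Longrightarrow> y \<in> {0..1} \<Longrightarrow> \<bar>f x - f y\<bar> \<le> B * \<bar>x - y\<bar>"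
    and "\<And>x. x \<in> {0..1} \<Longrightarrow> \<bar>f x\<bar> \<le> B"
    and "B \<ge> 1"
    and "\<And>M. M > 0 \<Longrightarrow> \<bar>\<Sum>i<M. f (real i / real M)\<bar> \<le> B"
    and "\<And>M. M > 0 \<Longrightarrow> \<bar>(\<Sum>i<M. (f (real i / real M))\<^sup>2) / real M - 1\<bar> \<le> 2 * B\<^sup>2 / real M"
proof -
  show lip: "\<bar>f x - f y\<bar> \<le> B * \<bar>x - y\<bar>" if "x \<in> {0..1}" "y \<in> {0..1}" for x y
    using field_differentiable_bound[of "{0..1}" f f' B x y] der bd that by simp
  have B0: "B \<ge> 0" using bd[of 0] by simp
  have cont: "continuous_on {0..1} f" using der by (rule DERIV_continuous_on)
  then have int: "f integrable_on {0..1}" by (rule integrable_continuous_real)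
  show bnd: "\<bar>f x\<bar> \<le> B" if x: "x \<in> {0..1}" for x
  proof -
    have "integral {0..1} (\<lambda>y. f x - f y) = f x" using mean by (subst integral_diff) (auto intro!: int)
    moreover have "norm (integral {0..1} (\<lambda>y. f x - f y)) \<le> integral {0..1} (\<lambda>y::real. B)"
    proof (rule integral_norm_bound_integral)
      show "(\<lambda>y. f x - f y) integrable_on {0..1}" by (intro integrable_diff int) auto
      fix y :: real assume y: "y \<in> {0..1}"
      have "\<bar>f x - f y\<bar> \<le> B * \<bar>x - y\<bar>" using x y by (rule lip)
      also have "\<dots> \<le> B * 1" using x y B0 by (intro mult_left_mono) auto
      finally show "norm (f x - f y) \<le> B" by simp
    qed auto
    ultimately show ?thesis by simp
  qed
  have "integral {0..1} (\<lambda>z. (f z)\<^sup>2) \<le> integral {0..1} (\<lambda>z::real. B\<^sup>2)"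
  proof (rule integral_le)
    show "(\<lambda>z. (f z)\<^sup>2) integrable_on {0..1}" by (intro integrable_continuous_real continuous_intros cont)
    fix z :: real assume "z \<in> {0..1}"
    from bnd[OF this] show "(f z)\<^sup>2 \<le> B\<^sup>2" using B0 by (simp add: abs_le_square_iff[symmetric])
  qed auto
  then have "1\<^sup>2 \<le> B\<^sup>2" using var by simp
  then show "B \<ge> 1" using B0 by (rule power2_le_imp_le)
  show "\<bar>\<Sum>i<M. f (real i / real M)\<bar> \<le> B" if "M > 0" for M
    using lipschitz_riemann_sum[of f B M] lip B0 that mean by simp
  show "\<bar>(\<Sum>i<M. (f (real i / real M))\<^sup>2) / real M - 1\<bar> \<le> 2 * B\<^sup>2 / real M" if M: "M > 0" for M
  proof -
    have "\<bar>(\<Sum>i<M. (f (real i / real M))\<^sup>2) - real M * integral {0..1} (\<lambda>z. (f z)\<^sup>2)\<bar> \<le> 2 * B\<^sup>2"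
    proof (rule lipschitz_riemann_sum)
      fix x y :: real assume xy: "x \<in> {0..1}" "y \<in> {0..1}"
      have "\<bar>(f x)\<^sup>2 - (f y)\<^sup>2\<bar> = \<bar>f x - f y\<bar> * \<bar>f x + f y\<bar>" unfolding abs_mult[symmetric] by (simp add: power2_eq_square algebra_simps)
      also have "\<dots> \<le> (B * \<bar>x - y\<bar>) * (2 * B)" using lip[OF xy] bnd[OF xy(1)] bnd[OF xy(2)] B0 by (intro mult_mono) auto
      finally show "\<bar>(f x)\<^sup>2 - (f y)\<^sup>2\<bar> \<le> 2 * B\<^sup>2 * \<bar>x - y\<bar>" by (simp add: power2_eq_square algebra_simps)
    qed (use M in auto)
    then have "\<bar>(\<Sum>i<M. (f (real i / real M))\<^sup>2) - real M\<bar> / real M \<le> 2 * B\<^sup>2 / real M"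
      unfolding var using M by (intro divide_right_mono) auto
    also have "\<bar>(\<Sum>i<M. (f (real i / real M))\<^sup>2) - real M\<bar> / real M = \<bar>((\<Sum>i<M. (f (real i / real M))\<^sup>2) - real M) / real M\<bar>" by simp
    finally show ?thesis using M by (simp add: diff_divide_distrib)
  qed
qed

text \<open>Here \<open>r\<close> stands for \<open>sqrt p\<close> and \<open>h\<close> for a bound on \<open>p\<close> to the power \<open>7/2\<close> times \<open>B / sqrt N\<close>.\<close>

lemma err_le:
  assumes n: "3 \<le> n" and m: "m \<le> n" "c0 * real n \<le> real m" and c0: "0 < c0"
    and B: "1 \<le> B" and r: "1 \<le> r" and h: "r ^ 7 * B \<le> h * sqrt (real (n + m))" and C: "0 \<le> C" and c: "0 < c"
  defines "l \<equiv> ln (real (n + m))"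
  shows "err n m B (10 * r\<^sup>2 * l) (1 / (r * l ^ 3)) (10 * r ^ 3 * l ^ 4) C c
    \<le> 288 * (1200 / sqrt c0 * l\<^sup>2 * h + 80 / sqrt c0 * l\<^sup>2 * sqrt h + 20 / l) + 72 / real n
      + 2526 * (C / c) * l ^ 12 * h + 64512 * l ^ 8 * h"
proof -
  define N where "N = real (n + m)"
  define s where "s = sqrt (N / (real n * real m))"
  have N3: "N \<ge> 3" using n unfolding N_def by simp
  have "exp 1 \<le> N" using exp_le N3 by linarith
  then have l1: "1 \<le> l" using N3 unfolding l_def N_def[symmetric] by (simp add: ln_ge_iff)
  have r0: "0 < r" and l0: "0 < l" and B0: "0 < B" using r l1 B by auto
  have rp: "r ^ a \<le> r ^ b" if "a \<le> b" for a b :: nat using r that by (rule power_increasing[rotated])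
  have lp: "l ^ a \<le> l ^ b" if "a \<le> b" for a b :: nat using l1 that by (rule power_increasing[rotated])
  have sN: "sqrt N > 0" using N3 by simp
  define H where "H = B / sqrt N"
  have H0: "0 < H" using B0 sN unfolding H_def by simp
  have rH: "r ^ 7 * H \<le> h" using h sN unfolding H_def N_def by (simp add: field_simps)
  have rkH: "r ^ k * H \<le> h" if "k \<le> 7" for k
    using mult_right_mono[OF rp[OF that], of H] H0 rH by linarith
  have h0: "0 < h" using rH H0 r0 by (meson less_le_trans mult_pos_pos zero_less_power)
  have m0: "0 < real m" using m(2) c0 n by (metis less_le_trans mult_pos_pos of_nat_0_less_iff gr0I not_numeral_le_zero)
  have s: "s \<le> 2 / sqrt c0 / sqrt N"
  proof -
    have "N / (real n * real m) \<le> 4 / (c0 * N)"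
    proof -
      have "N * (c0 * N) \<le> 4 * (real n * real m)"
      proof -
        have "N \<le> 2 * real n" using m(1) unfolding N_def by simp
        moreover have "c0 * N \<le> 2 * real m"
        proof -
          have "c0 * N \<le> c0 * (2 * real n)" using \<open>N \<le> 2 * real n\<close> c0 by simp
          then show ?thesis using m(2) by simp
        qed
        ultimately have "N * (c0 * N) \<le> (2 * real n) * (2 * real m)" by (rule mult_mono) (use c0 N3 in auto)
        then show ?thesis by simp
      qed
      moreover have "real n * real m > 0" using n m0 by simp
      moreover have "c0 * N > 0" using c0 N3 by simp
      ultimately show ?thesis by (simp add: divide_simps mult.commute)
    qed
    then have "s \<le> sqrt (4 / (c0 * N))" unfolding s_def by simp
    also have "\<dots> = 2 / sqrt c0 / sqrt N" by (simp add: real_sqrt_divide real_sqrt_mult)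
    finally show ?thesis .
  qed
  have s0: "0 \<le> s" using N3 unfolding s_def by simp
  have s10: "sqrt 10 \<le> 4" by (rule real_le_lsqrt) auto
  have sl: "sqrt l \<le> l" using l1 by (simp add: real_le_lsqrt power2_eq_square)
  have sL: "sqrt (10 * r\<^sup>2 * l) \<le> 4 * r * l"
  proof -
    have "sqrt (10 * r\<^sup>2 * l) = sqrt 10 * r * sqrt l" using r0 by (simp add: real_sqrt_mult)
    also have "\<dots> \<le> 4 * r * l" using s10 sl r0 l0 by (intro mult_mono) auto
    finally show ?thesis .
  qed
  have sL0: "0 \<le> sqrt (10 * r\<^sup>2 * l)" using l0 by simp
  have T1: "s * (15 * (10 * r\<^sup>2 * l) * B) * sqrt (10 * r\<^sup>2 * l) \<le> 1200 / sqrt c0 * l\<^sup>2 * h"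
  proof -
    have "s * (15 * (10 * r\<^sup>2 * l) * B) * sqrt (10 * r\<^sup>2 * l) \<le> (2 / sqrt c0 / sqrt N) * (15 * (10 * r\<^sup>2 * l) * B) * (4 * r * l)"
      using s s0 sL sL0 r0 l0 B0 c0 sN by (intro mult_mono) auto
    also have "\<dots> = 1200 / sqrt c0 * l\<^sup>2 * (r ^ 3 * H)" unfolding H_def by (simp add: power2_eq_square power3_eq_cube)
    also have "\<dots> \<le> 1200 / sqrt c0 * l\<^sup>2 * h" using rkH[of 3] c0 by (intro mult_left_mono) auto
    finally show ?thesis .
  qed
  have T2: "s * (4 * sqrt (sqrt N * l * (10 * r\<^sup>2 * l))) * sqrt (10 * r\<^sup>2 * l) \<le> 80 / sqrt c0 * l\<^sup>2 * sqrt h"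
  proof -
    have q: "r\<^sup>2 \<le> sqrt h * sqrt (sqrt N)"
    proof -
      have "r ^ 4 * 1 \<le> r ^ 7 * B" using rp[of 4 7] B r0 by (intro mult_mono) auto
      also have "\<dots> \<le> h * sqrt N" using h unfolding N_def .
      finally have "(r\<^sup>2)\<^sup>2 \<le> h * sqrt N" by (simp add: power_mult[symmetric])
      then have "r\<^sup>2 \<le> sqrt (h * sqrt N)" by (rule real_le_rsqrt)
      then show ?thesis by (simp add: real_sqrt_mult)
    qed
    have e: "sqrt (sqrt N * l * L) * sqrt L = sqrt (sqrt N) * sqrt l * L" if "0 \<le> L" for L
    proof -
      have "sqrt (sqrt N * l * L) * sqrt L = sqrt (sqrt N * l) * (sqrt L * sqrt L)" by (simp add: real_sqrt_mult)
      then show ?thesis using that by (simp add: real_sqrt_mult)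
    qed
    have "s * (4 * sqrt (sqrt N * l * (10 * r\<^sup>2 * l))) * sqrt (10 * r\<^sup>2 * l) = s * (4 * (sqrt (sqrt N) * sqrt l * (10 * r\<^sup>2 * l)))"
      using e[of "10 * r\<^sup>2 * l"] l0 by (simp add: mult.assoc)
    also have "\<dots> \<le> (2 / sqrt c0 / sqrt N) * (4 * (sqrt (sqrt N) * l * (10 * (sqrt h * sqrt (sqrt N)) * l)))"
      using s s0 sl q l0 N3 h0 c0 by (intro mult_mono order_refl) auto
    also have "\<dots> = 80 / sqrt c0 * l\<^sup>2 * sqrt h * (sqrt (sqrt N) * sqrt (sqrt N) / sqrt N)" by (simp add: power2_eq_square)
    also have "\<dots> = 80 / sqrt c0 * l\<^sup>2 * sqrt h" using sN N3 by simp
    finally show ?thesis .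
  qed
  have T3: "(2 * (1 / (r * l ^ 3) * (l + 1)) + 1 / (r * l ^ 3)) * sqrt (10 * r\<^sup>2 * l) \<le> 20 / l"
  proof -
    have "(2 * (1 / (r * l ^ 3) * (l + 1)) + 1 / (r * l ^ 3)) = (2 * l + 3) / (r * l ^ 3)" by (simp add: add_divide_distrib[symmetric])
    also have "\<dots> \<le> (5 * l) / (r * l ^ 3)" using l1 r0 by (intro divide_right_mono) auto
    finally have "(2 * (1 / (r * l ^ 3) * (l + 1)) + 1 / (r * l ^ 3)) * sqrt (10 * r\<^sup>2 * l) \<le> (5 * l) / (r * l ^ 3) * (4 * r * l)"
      using sL sL0 r0 l0 by (intro mult_mono) auto
    also have "\<dots> = 20 / l" using r0 l0 by (simp add: power3_eq_cube field_simps)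
    finally show ?thesis .
  qed
  have hm: "harm (n + m) \<le> 2 * l"
  proof -
    have "harm (n + m) - ln (real (n + m)) \<le> harm 1 - ln (real 1)" using n by (intro euler_mascheroni_sequence_decreasing) auto
    then have "harm (n + m) \<le> 1 + l" unfolding l_def by (simp add: harm_def)
    then show ?thesis using l1 by simp
  qed
  \<comment> \<open>The decisive term: \<beta>^2 / \<epsilon> is 100 r^7 l^11, and r^7 B / sqrt N is
    at most h. The other two summands have lower powers of r and l; together the coefficients are 1
    + 30 + 600 = 631.\<close>
  have T4: "(1 / (1 / (r * l ^ 3))^3 + 3 * (10 * r ^ 3 * l ^ 4) / (1 / (r * l ^ 3))\<^sup>2 + 6 * (10 * r ^ 3 * l ^ 4)\<^sup>2 / (1 / (r * l ^ 3))) * H * C / (3 * c) * 2 * harm (n + m)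
     \<le> 842 * (C / c) * l ^ 12 * h"
  proof -
    have "(1 / (1 / (r * l ^ 3))^3 + 3 * (10 * r ^ 3 * l ^ 4) / (1 / (r * l ^ 3))\<^sup>2 + 6 * (10 * r ^ 3 * l ^ 4)\<^sup>2 / (1 / (r * l ^ 3)))
      = r ^ 3 * l ^ 9 + 30 * (r ^ 5 * l ^ 10) + 600 * (r ^ 7 * l ^ 11)"
      using r0 l0 by (simp add: power_mult_distrib power_divide power_mult[symmetric] power_add[symmetric] mult_ac) (simp add: eval_nat_numeral)
    also have "\<dots> \<le> r ^ 7 * l ^ 11 + 30 * (r ^ 7 * l ^ 11) + 600 * (r ^ 7 * l ^ 11)"
      using r0 l0 by (intro add_mono mult_mono rp lp mult_left_mono order_refl) auto
    also have "\<dots> = 631 * (r ^ 7 * l ^ 11)" by simp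
    finally have "(1 / (1 / (r * l ^ 3))^3 + 3 * (10 * r ^ 3 * l ^ 4) / (1 / (r * l ^ 3))\<^sup>2 + 6 * (10 * r ^ 3 * l ^ 4)\<^sup>2 / (1 / (r * l ^ 3))) * H * C / (3 * c) * 2 * harm (n + m)
      \<le> 631 * (r ^ 7 * l ^ 11) * H * C / (3 * c) * 2 * (2 * l)"
      using hm H0 C c l0 r0 by (intro mult_mono divide_right_mono mult_right_mono) (auto simp: harm_nonneg)
    also have "\<dots> = (2524 / 3) * (C / c) * l ^ 12 * (r ^ 7 * H)" by (simp add: eval_nat_numeral)
    also have "\<dots> \<le> 842 * (C / c) * l ^ 12 * h" using rH H0 C c l0 r0 by (intro mult_mono) auto
    finally show ?thesis .
  qed
  have T5: "128 * B * sqrt (10 * r\<^sup>2 * l / N) * (1 / (1 / (r * l ^ 3))\<^sup>2 + 2 * (10 * r ^ 3 * l ^ 4) / (1 / (r * l ^ 3))) \<le> 10752 * l ^ 8 * h"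
  proof -
    have "(1 / (1 / (r * l ^ 3))\<^sup>2 + 2 * (10 * r ^ 3 * l ^ 4) / (1 / (r * l ^ 3))) = r ^ 2 * l ^ 6 + 20 * (r ^ 4 * l ^ 7)"
      using r0 l0 by (simp add: power_mult_distrib power_divide power_mult[symmetric] power_add[symmetric] mult_ac) (simp add: eval_nat_numeral)
    also have "\<dots> \<le> r ^ 4 * l ^ 7 + 20 * (r ^ 4 * l ^ 7)"
      using r0 l0 by (intro add_mono mult_mono rp lp mult_left_mono order_refl) auto
    also have "\<dots> = 21 * (r ^ 4 * l ^ 7)" by simp
    finally have u: "(1 / (1 / (r * l ^ 3))\<^sup>2 + 2 * (10 * r ^ 3 * l ^ 4) / (1 / (r * l ^ 3))) \<le> 21 * (r ^ 4 * l ^ 7)" .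
    have "128 * B * sqrt (10 * r\<^sup>2 * l / N) * (1 / (1 / (r * l ^ 3))\<^sup>2 + 2 * (10 * r ^ 3 * l ^ 4) / (1 / (r * l ^ 3)))
      = 128 * H * sqrt (10 * r\<^sup>2 * l) * (1 / (1 / (r * l ^ 3))\<^sup>2 + 2 * (10 * r ^ 3 * l ^ 4) / (1 / (r * l ^ 3)))"
      unfolding H_def by (simp add: real_sqrt_divide)
    also have "\<dots> \<le> 128 * H * (4 * r * l) * (21 * (r ^ 4 * l ^ 7))"
      using u sL sL0 H0 r0 l0 by (intro mult_mono order_refl) auto
    also have "\<dots> = 10752 * l ^ 8 * (r ^ 5 * H)" by (simp add: eval_nat_numeral)
    also have "\<dots> \<le> 10752 * l ^ 8 * h" using rkH[of 5] l0 by (intro mult_left_mono) auto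
    finally show ?thesis .
  qed
  have T6: "24 / N \<le> 24 / real n" using n unfolding N_def by (intro divide_left_mono) auto
  define \<Lambda> \<epsilon> \<beta> where "\<Lambda> = 10 * r\<^sup>2 * l" and "\<epsilon> = 1 / (r * l ^ 3)" and "\<beta> = 10 * r ^ 3 * l ^ 4"
  have "err n m B \<Lambda> \<epsilon> \<beta> C c =
     288 * (s * (15 * \<Lambda> * B) * sqrt \<Lambda> + s * (4 * sqrt (sqrt N * l * \<Lambda>)) * sqrt \<Lambda> + (2 * (\<epsilon> * (l + 1)) + \<epsilon>) * sqrt \<Lambda>)
     + 3 * (24 / N) + 3 * ((1 / \<epsilon>^3 + 3 * \<beta> / \<epsilon>\<^sup>2 + 6 * \<beta>\<^sup>2 / \<epsilon>) * H * C / (3 * c) * 2 * harm (n + m))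
     + 6 * (128 * B * sqrt (\<Lambda> / N) * (1 / \<epsilon>\<^sup>2 + 2 * \<beta> / \<epsilon>))"
    unfolding err_def Let_def l_def N_def[symmetric] s_def[symmetric] H_def[symmetric]
    by (simp only: distrib_left distrib_right)
  also have "\<dots> \<le> 288 * (1200 / sqrt c0 * l\<^sup>2 * h + 80 / sqrt c0 * l\<^sup>2 * sqrt h + 20 / l)
     + 3 * (24 / real n) + 3 * (842 * (C / c) * l ^ 12 * h) + 6 * (10752 * l ^ 8 * h)"
    unfolding \<Lambda>_def \<epsilon>_def \<beta>_def by (intro add_mono mult_left_mono T1 T2 T3 T4 T5 T6) auto
  finally show ?thesis unfolding \<Lambda>_def \<epsilon>_def \<beta>_def by (simp add: algebra_simps)
qed

text \<open>With l = ln N the parameters are \<Lambda> = 10 p l, \<epsilon> = 1 / (sqrt p l^3) and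
  \<beta> = \<Lambda> / \<epsilon>. Then exp (\<Lambda> / 2) = N^(5 p), of which N^(3 p) covers the
  order patterns and N^(2 p) the d scores. The product \<epsilon> sqrt \<Lambda> is small even after
  multiplication by l, as the smoothing shift \<open>w\<close> demands. The assumption
  \<open>small\<close> keeps 2 \<beta> B / sqrt N at most 1.\<close>

lemma (in ac_law) reject_prob_error:
  fixes psi psi1 :: "nat \<Rightarrow> real \<Rightarrow> real"
  assumes n: "3 \<le> n" and m: "m \<le> n" "c0 * real n \<le> real m" and c0: "0 < c0"
    and p: "1 \<le> p" and d: "1 \<le> d" "d \<le> n"
    and der: "\<And>k z. k \<in> {1..d} \<Longrightarrow> z \<in> {0..1} \<Longrightarrow> (psi k has_real_derivative psi1 k z) (at z within {0..1})"
    and bd: "\<And>k z. k \<in> {1..d} \<Longrightarrow> z \<in> {0..1} \<Longrightarrow> \<bar>psi1 k z\<bar> \<le> B"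
    and mean: "\<And>k. k \<in> {1..d} \<Longrightarrow> integral {0..1} (psi k) = 0"
    and var: "\<And>k. k \<in> {1..d} \<Longrightarrow> integral {0..1} (\<lambda>z. (psi k z)\<^sup>2) = 1"
    and h: "sqrt (real p) ^ 7 * B \<le> h * sqrt (real (n + m))" and c: "0 < c" and C: "0 \<le> C"
    and ul1: "unit_law (two_point (real m / real (n + m))) C c" and ul2: "unit_law std_normal_distribution C c"
    and \<alpha>: "0 < \<alpha>" "\<alpha> < 1"
  defines "l \<equiv> ln (real (n + m))"
  assumes small: "20 * l ^ 4 * h \<le> 1"
  shows "\<bar>reject_prob F F n m p d psi \<alpha> - \<alpha>\<bar> \<le>
    288 * (1200 / sqrt c0 * l\<^sup>2 * h + 80 / sqrt c0 * l\<^sup>2 * sqrt h + 20 / l) + 72 / real n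
      + 2526 * (C / c) * l ^ 12 * h + 64512 * l ^ 8 * h"
proof -
  define N where "N = n + m"
  define r where "r = sqrt (real p)"
  have r1: "1 \<le> r" using p unfolding r_def by simp
  have r2: "r\<^sup>2 = real p" unfolding r_def by simp
  have N3: "real N \<ge> 3" using n unfolding N_def by simp
  have lN: "l = ln (real N)" unfolding l_def N_def ..
  have "exp 1 \<le> real N" using exp_le N3 by linarith
  then have l1: "1 \<le> l" using N3 unfolding lN by (simp add: ln_ge_iff)
  have r0: "0 < r" and l0: "0 < l" using r1 l1 by auto
  note ob = orthonormal_element_bounds[OF der bd mean var]
  have d1: "1 \<in> {1..d}" using d by simp
  have B1: "B \<ge> 1" by (rule ob(3)[OF d1 _ d1 _ d1 d1])
  have m0: "0 < m" using m(2) c0 n by (metis less_le_trans mult_pos_pos of_nat_0_less_iff gr0I not_numeral_le_zero)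
  have sN: "sqrt (real N) > 0" using N3 by simp
  define H where "H = B / sqrt (real N)"
  have H0: "0 < H" using B1 sN unfolding H_def by simp
  have rH: "r ^ 7 * H \<le> h" using h sN unfolding H_def N_def r_def by (simp add: field_simps)
  have rkH: "r ^ k * H \<le> h" if "k \<le> 7" for k
    using mult_right_mono[OF power_increasing[OF that r1], of H] H0 rH by linarith
  have lp: "l ^ a \<le> l ^ b" if "a \<le> b" for a b :: nat using l1 that by (rule power_increasing[rotated])
  have h0: "0 < h" using rH H0 r0 by (meson less_le_trans mult_pos_pos zero_less_power)
  have lh: "20 * (l * h) \<le> 1" "20 * h \<le> 1"
  proof -
    have "20 * (l ^ 1 * h) \<le> 20 * (l ^ 4 * h)" "20 * (l ^ 0 * h) \<le> 20 * (l ^ 4 * h)"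
      using h0 by (intro mult_left_mono mult_right_mono lp; simp)+
    then show "20 * (l * h) \<le> 1" "20 * h \<le> 1" using small by auto
  qed
  let ?L = "10 * r\<^sup>2 * l" and ?e = "1 / (r * l ^ 3)" and ?b = "10 * r ^ 3 * l ^ 4"
  have s10: "sqrt 10 \<le> 4" by (rule real_le_lsqrt) auto
  have sl: "sqrt l \<le> l" using l1 by (simp add: real_le_lsqrt power2_eq_square)
  have BL: "B * sqrt (?L / real N) \<le> 1"
  proof -
    have "B * sqrt (?L / real N) = H * (sqrt 10 * r * sqrt l)" using r0 unfolding H_def by (simp add: real_sqrt_mult real_sqrt_divide)
    also have "\<dots> \<le> H * (4 * r * l)" using s10 sl r0 l0 H0 by (intro mult_left_mono mult_mono) auto
    also have "\<dots> = 4 * l * (r ^ 1 * H)" by simp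
    also have "\<dots> \<le> 4 * l * h" using rkH[of 1] l0 by (intro mult_left_mono) auto
    also have "\<dots> \<le> 1" using lh l0 h0 by simp
    finally show ?thesis .
  qed
  have LN: "?L \<le> real N"
  proof -
    have "1 * sqrt (?L / real N) \<le> B * sqrt (?L / real N)" using B1 l0 by (intro mult_right_mono) auto
    then have "sqrt (?L / real N) \<le> 1" using BL by linarith
    then show ?thesis using N3 by simp
  qed
  have expL: "exp (?L / 2) = real N ^ (5 * p)"
  proof -
    have "?L / 2 = real (5 * p) * ln (real N)" unfolding r2 lN by simp
    then show ?thesis using N3 by (simp only: exp_of_nat_mult) simp
  qed
  have cnt: "real ((N * N + 1) ^ p) * real d \<le> exp (?L / 2)"
  proof -
    have "real N * real N + 1 \<le> real N ^ 3"
    proof -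
      have "3 * (real N * real N) \<le> real N * (real N * real N)" using N3 by (intro mult_right_mono) auto
      moreover have "1 \<le> real N * real N" using mult_mono[of 1 "real N" 1 "real N"] N3 by simp
      ultimately show ?thesis by (simp add: power3_eq_cube mult.assoc)
    qed
    then have "(real N * real N + 1) ^ p \<le> (real N ^ 3) ^ p" by (intro power_mono) auto
    moreover have "real d \<le> real N ^ (2 * p)"
    proof -
      have "real d \<le> real N ^ 1" using d unfolding N_def by simp
      also have "\<dots> \<le> real N ^ (2 * p)" using N3 p by (intro power_increasing) auto
      finally show ?thesis .
    qed
    ultimately have "(real N * real N + 1) ^ p * real d \<le> (real N ^ 3) ^ p * real N ^ (2 * p)" by (intro mult_mono) auto
    also have "\<dots> = real N ^ (5 * p)" by (simp add: power_mult[symmetric] power_add[symmetric])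
    finally show ?thesis unfolding expL by (simp add: algebra_simps)
  qed
  have expm: "exp (- ?L / 2) \<le> 1 / real N ^ 5"
  proof -
    have "exp (- ?L / 2) = 1 / exp (?L / 2)" unfolding minus_divide_left[symmetric] exp_minus by (rule inverse_eq_divide)
    also have "\<dots> \<le> 1 / real N ^ 5" unfolding expL using N3 p by (intro divide_left_mono power_increasing) auto
    finally show ?thesis .
  qed
  have pL: "real p + 1 \<le> ?L"
  proof -
    have "real p * 1 \<le> real p * l" using l1 by (intro mult_left_mono) auto
    moreover have "1 \<le> real p" using p by simp
    ultimately have "real p + 1 \<le> 10 * (real p * l)" by linarith
    then show ?thesis unfolding r2 by simp
  qed
  have r3: "r ^ 3 = r * r\<^sup>2" and l4: "l ^ 4 = l ^ 3 * l" by (simp_all add: eval_nat_numeral)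
  have eb: "?e * ?b = ?L" unfolding r3 l4 using r0 l0 by simp
  have ebL: "?L / ?b = ?e" unfolding r3 l4 using r0 l0 by simp
  have bc: "2 * ?b * (B / sqrt (real N)) \<le> 1"
  proof -
    have "2 * ?b * (B / sqrt (real N)) = 20 * l ^ 4 * (r ^ 3 * H)" unfolding H_def by simp
    also have "\<dots> \<le> 20 * l ^ 4 * h" using rkH[of 3] l0 by (intro mult_left_mono) auto
    finally show ?thesis using small by linarith
  qed
  have rie2: "\<bar>(\<Sum>i<N. (psi k (real i / real N))\<^sup>2) / real N - 1\<bar> \<le> 1 / 2" if k: "k \<in> {1..d}" for k
  proof -
    have "\<bar>(\<Sum>i<N. (psi k (real i / real N))\<^sup>2) / real N - 1\<bar> \<le> 2 * B\<^sup>2 / real N"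
      using ob(5)[OF k _ k _ k k, of N] N3 by simp
    also have "\<dots> = 2 * H\<^sup>2" unfolding H_def using N3 by (simp add: power_divide)
    also have "\<dots> \<le> 2 * (1 / 20)\<^sup>2" using rkH[of 0] lh H0 by (intro mult_left_mono power_mono) auto
    also have "\<dots> \<le> 1 / 2" by (simp add: power2_eq_square)
    finally show ?thesis .
  qed
  have "\<bar>reject_prob F F n m p d psi \<alpha> - \<alpha>\<bar> \<le> err n m B ?L ?e ?b C c"
  proof (rule exchangeable_average)
    fix Z assume t: "ties_ok p (n + m) Z"
    show "\<bar>EP (n + m) (\<lambda>\<pi>. of_bool (rejects n m p d psi \<alpha> (\<lambda>i. Z (\<pi> i)))) - \<alpha>\<bar> \<le> err n m B ?L ?e ?b C c"
      unfolding rejects_def N_def[symmetric]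
    proof (rule permutation_size_error)
      show "\<bar>psi k x - psi k y\<bar> \<le> B * \<bar>x - y\<bar>" if "k \<in> {1..d}" "x \<in> {0..1}" "y \<in> {0..1}" for k x y
        using ob(1)[OF that(1) _ that(1) _ that(1) that(1)] that by blast
      show "\<bar>psi k x\<bar> \<le> B" if "k \<in> {1..d}" "x \<in> {0..1}" for k x
        using ob(2)[OF that(1) _ that(1) _ that(1) that(1)] that by blast
      show "\<bar>\<Sum>i<M. psi k (real i / real M)\<bar> \<le> B" if "k \<in> {1..d}" "M > 0" for k M
        using ob(4)[OF that(1) _ that(1) _ that(1) that(1)] that by blast
      show "?e * ?b \<ge> 1" unfolding eb using pL by simp
      show "?L / ?b \<le> ?e" unfolding ebL ..
      show "ties_ok p N Z" using t unfolding N_def .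
      show "unit_law (two_point (real m / real N)) C c" using ul1 unfolding N_def .
    qed (use N_def m m0 p d B1 rie2 pL LN cnt expm BL r0 l0 c ul2 bc \<alpha> in auto)
  qed
  also have "\<dots> \<le> 288 * (1200 / sqrt c0 * l\<^sup>2 * h + 80 / sqrt c0 * l\<^sup>2 * sqrt h + 20 / l) + 72 / real n
      + 2526 * (C / c) * l ^ 12 * h + 64512 * l ^ 8 * h"
    unfolding l_def using h by (intro err_le n m c0 B1 r1 C c) (simp add: r_def)
  finally show ?thesis .
qed

text \<open>Every term but those in 1 / ln n and 1 / n is a power of a logarithm times n^(-c1/2), or
  n^(-c1/4) under the square root, so the polynomial factor wins.\<close>

lemma error_bound_tendsto:
  fixes c1 K1 K2 K3 :: real
  assumes "c1 > 0"
  shows "(\<lambda>n. 288 * (K1 * (ln (2 * real n))\<^sup>2 * (K3 * real n powr (- c1 / 2)) + K2 * (ln (2 * real n))\<^sup>2 * sqrt (K3 * real n powr (- c1 / 2)) + 20 / ln (real n)) + 72 / real n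
      + K4 * (ln (2 * real n)) ^ 12 * (K3 * real n powr (- c1 / 2)) + 64512 * (ln (2 * real n)) ^ 8 * (K3 * real n powr (- c1 / 2))) \<longlonglongrightarrow> 0" (is "?f \<longlonglongrightarrow> 0")
proof -
  have a: "(\<lambda>n. (ln (2 * real n)) ^ k * real n powr (- c)) \<longlonglongrightarrow> 0" if "c > 0" for k c
    using that by real_asymp
  have b: "(\<lambda>n. 20 / ln (real n)) \<longlonglongrightarrow> 0" by real_asymp
  have e: "(\<lambda>n. 72 / real n) \<longlonglongrightarrow> 0" by real_asymp
  have s: "sqrt (K3 * real n powr (- c1 / 2)) = sqrt K3 * real n powr (- (c1 / 4))" for n
    by (simp add: real_sqrt_mult powr_half_sqrt[symmetric] powr_powr)
  have f: "?f = (\<lambda>n. 288 * (K1 * K3 * ((ln (2 * real n))\<^sup>2 * real n powr (- (c1 / 2))) + K2 * sqrt K3 * ((ln (2 * real n))\<^sup>2 * real n powr (- (c1 / 4))) + 20 / ln (real n)) + 72 / real n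
      + K4 * K3 * ((ln (2 * real n)) ^ 12 * real n powr (- (c1 / 2))) + 64512 * K3 * ((ln (2 * real n)) ^ 8 * real n powr (- (c1 / 2))))"
    unfolding s by (simp add: mult_ac)
  have "?f \<longlonglongrightarrow> 288 * (K1 * K3 * 0 + K2 * sqrt K3 * 0 + 0) + 0 + K4 * K3 * 0 + 64512 * K3 * 0"
    unfolding f using assms by (intro tendsto_intros a b e) auto
  then show ?thesis by simp
qed

theorem theorem3:
  fixes p m d :: "nat \<Rightarrow> nat"
    and F :: "nat \<Rightarrow> (nat \<Rightarrow> real) measure"
    and psi psi1 psi2 :: "nat \<Rightarrow> nat \<Rightarrow> real \<Rightarrow> real"
    and c0 C0 C1 c1 :: real
  assumes c0: "0 < c0" "c0 \<le> 1"
    and constants: "C0 > 0" "C1 > 0" "0 < c1" "c1 < 1"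
    and p_pos: "\<And>n. n \<ge> 1 \<Longrightarrow> p n \<ge> 1"
    and m_bounds: "\<And>n. n \<ge> 1 \<Longrightarrow> c0 * real n \<le> real (m n)" "\<And>n. n \<ge> 1 \<Longrightarrow> m n \<le> n"
    and F_sets: "\<And>n. n \<ge> 1 \<Longrightarrow> sets (F n) = sets (lebesgue_Rp (p n))"
    and F_prob: "\<And>n. n \<ge> 1 \<Longrightarrow> prob_space (F n)"
    and F_ac: "\<And>n. n \<ge> 1 \<Longrightarrow> absolutely_continuous (lebesgue_Rp (p n)) (F n)"
    and d_pos: "\<And>n. n \<ge> 1 \<Longrightarrow> d n \<ge> 1"
    and d_le: "\<And>n. n \<ge> 1 \<Longrightarrow> real (d n) \<le> min (real n) (min (real (m n)) (exp (C0 * real (p n))))"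
    and psi0: "\<And>n z. n \<ge> 1 \<Longrightarrow> z \<in> {0..1} \<Longrightarrow> psi n 0 z = 1"
    and psi_deriv1: "\<And>n k z. n \<ge> 1 \<Longrightarrow> k \<le> d n \<Longrightarrow> z \<in> {0..1} \<Longrightarrow>
          (psi n k has_real_derivative psi1 n k z) (at z within {0..1})"
    and psi_deriv2: "\<And>n k z. n \<ge> 1 \<Longrightarrow> k \<le> d n \<Longrightarrow> z \<in> {0..1} \<Longrightarrow>
          (psi1 n k has_real_derivative psi2 n k z) (at z within {0..1})"
    and psi_orthonormal: "\<And>n j k. n \<ge> 1 \<Longrightarrow> j \<le> d n \<Longrightarrow> k \<le> d n \<Longrightarrow>
          integral {0..1} (\<lambda>z. psi n j z * psi n k z) = (if j = k then 1 else 0)"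
    and B1_bound: "\<And>n k z. n \<ge> 1 \<Longrightarrow> k \<in> {1..d n} \<Longrightarrow> z \<in> {0..1} \<Longrightarrow>
          real (p n) ^ 7 * (psi1 n k z)\<^sup>2 \<le> C1 * real n powr (1 - c1)"
    and B2_bound: "\<And>n k z. n \<ge> 1 \<Longrightarrow> k \<in> {1..d n} \<Longrightarrow> z \<in> {0..1} \<Longrightarrow>
          real (p n) * (psi2 n k z)\<^sup>2 \<le> C1 * real n powr (1 - c1)"
  shows "(\<lambda>n. SUP \<alpha>\<in>{0<..<1::real}.
            \<bar>reject_prob (F n) (F n) n (m n) (p n) (d n) (psi n) \<alpha> - \<alpha>\<bar>) \<longlonglongrightarrow> 0"
proof -
  \<comment> \<open>The sampling fraction q lies in [c0 / 2, 1/2], so q (1 - q) >= c0 / 4 and the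
    standardised Bernoulli variable is bounded by 2 / sqrt c0. The maximum with 1 makes exp (- R)
    admissible for the Gaussian law too.\<close>
  define R where "R = max 1 (2 / sqrt c0)"
  obtain C' where C': "\<And>C c. C' \<le> C \<Longrightarrow> c \<le> exp (-1) \<Longrightarrow> unit_law std_normal_distribution C c"
    using unit_law_std_normal by blast
  define C where "C = max (R ^ 3 * exp R) C'"
  define c where "c = exp (- R)"
  have cpos: "c > 0" unfolding c_def by simp
  have C0: "C \<ge> 0" unfolding C_def R_def by (intro max.coboundedI1) auto
  have ul2: "unit_law std_normal_distribution C c" unfolding C_def c_def R_def by (intro C') auto
  \<comment> \<open>Bound for p^(7/2) B / sqrt N: the numerator will be sqrt (C1 n^(1 - c1)), and N
    >= n.\<close>
  define h where "h = (\<lambda>n. sqrt C1 * real n powr (- c1 / 2))"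
  \<comment> \<open>Dominates ln N because N = n + m is at most 2 n.\<close>
  define L where "L = (\<lambda>n. ln (2 * real n))"
  define g where "g = (\<lambda>n. 288 * (1200 / sqrt c0 * (L n)\<^sup>2 * h n + 80 / sqrt c0 * (L n)\<^sup>2 * sqrt (h n) + 20 / ln (real n)) + 72 / real n
      + 2526 * (C / c) * (L n) ^ 12 * h n + 64512 * (L n) ^ 8 * h n)"
  have g0: "g \<longlonglongrightarrow> 0" unfolding g_def h_def L_def using error_bound_tendsto[OF constants(3)] .
  have "(\<lambda>n. 20 * sqrt C1 * ((L n) ^ 4 * real n powr (- c1 / 2))) \<longlonglongrightarrow> 20 * sqrt C1 * 0"
    unfolding L_def using constants(3) by (intro tendsto_mult_left) real_asymp
  then have "(\<lambda>n. 20 * (L n) ^ 4 * h n) \<longlonglongrightarrow> 0" unfolding h_def by (simp add: mult_ac)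
  then have "eventually (\<lambda>n. 20 * (L n) ^ 4 * h n < 1) sequentially" by (rule order_tendstoD) simp
  then have ev: "eventually (\<lambda>n. 20 * (L n) ^ 4 * h n < 1 \<and> 3 \<le> n) sequentially"
    using eventually_ge_at_top[of 3] by (rule eventually_conj)
  have bnd: "\<bar>reject_prob (F n) (F n) n (m n) (p n) (d n) (psi n) \<alpha> - \<alpha>\<bar> \<le> g n"
    if sml: "20 * (L n) ^ 4 * h n < 1" and n: "3 \<le> n" and \<alpha>: "\<alpha> \<in> {0<..<1}" for n \<alpha>
  proof -
    have n1: "n \<ge> 1" using n by simp
    interpret ac_law "F n" "p n"
      using F_prob[OF n1] F_sets[OF n1] F_ac[OF n1] by (intro ac_law.intro ac_law_axioms.intro)
    define N where "N = real (n + m n)"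
    have Nn: "real n \<le> N" "N \<le> 2 * real n" using m_bounds(2)[OF n1] unfolding N_def by auto
    have n3: "3 \<le> real n" using n by simp
    have N0: "N > 0" using Nn n3 by linarith
    have m0: "0 < real (m n)" using m_bounds(1)[OF n1] c0 n3 by (meson less_le_trans mult_pos_pos zero_less_numeral)
    let ?q = "real (m n) / N"
    have ul1: "unit_law (two_point ?q) C c"
    proof (rule unit_law_two_point)
      show "0 < ?q" using m0 N0 by simp
      show "?q < 1" using n3 N0 unfolding N_def by simp
      have q1: "c0 / 2 \<le> ?q"
      proof -
        have "c0 * N \<le> c0 * (2 * real n)" using Nn c0 by (intro mult_left_mono) auto
        then have "c0 * N \<le> 2 * real (m n)" using m_bounds(1)[OF n1] by simp
        then show ?thesis using N0 by (simp add: field_simps)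
      qed
      have q2: "1 / 2 \<le> 1 - ?q"
      proof -
        have "2 * real (m n) \<le> N" using m_bounds(2)[OF n1] unfolding N_def by simp
        then show ?thesis using N0 by (simp add: field_simps)
      qed
      have "c0 / 2 * (1 / 2) \<le> ?q * (1 - ?q)" using q1 q2 c0 m0 N0 by (intro mult_mono) auto
      then have "sqrt (c0 / 4) \<le> sqrt (?q * (1 - ?q))" by simp
      moreover have "0 < sqrt (c0 / 4)" using c0 by simp
      ultimately have "1 / sqrt (?q * (1 - ?q)) \<le> 1 / sqrt (c0 / 4)" by (intro divide_left_mono mult_pos_pos) linarith+
      also have "\<dots> = 2 / sqrt c0" by (simp add: real_sqrt_divide)
      finally show "1 / sqrt (?q * (1 - ?q)) \<le> R" unfolding R_def by simp
    qed (auto simp: C_def c_def)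
    \<comment> \<open>Derivative bound extracted from \<open>B1_bound\<close>. Taking it in place of
      the supremum of the derivatives makes p^7 B^2 equal to C1 n^(1 - c1).\<close>
    define B where "B = sqrt (C1 * real n powr (1 - c1) / real (p n) ^ 7)"
    have pp: "real (p n) ^ 7 > 0" using p_pos[OF n1] by simp
    have bd: "\<bar>psi1 n k z\<bar> \<le> B" if "k \<in> {1..d n}" "z \<in> {0..1}" for k z
    proof -
      have "(psi1 n k z)\<^sup>2 \<le> C1 * real n powr (1 - c1) / real (p n) ^ 7"
        using B1_bound[OF n1 that] pp by (simp add: pos_le_divide_eq mult.commute)
      then show ?thesis unfolding B_def by (intro real_le_rsqrt) simp
    qed
    have hB: "sqrt (real (p n)) ^ 7 * B \<le> h n * sqrt N"
    proof -
      have "sqrt (real (p n)) ^ 7 * B = sqrt (real (p n) ^ 7 * (C1 * real n powr (1 - c1) / real (p n) ^ 7))"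
        unfolding B_def real_sqrt_mult real_sqrt_power[symmetric] ..
      also have "\<dots> = sqrt C1 * sqrt (real n powr (1 - c1))" using pp by (simp add: real_sqrt_mult)
      also have "sqrt (real n powr (1 - c1)) = real n powr (- c1 / 2) * sqrt (real n)"
      proof -
        have "sqrt (real n powr (1 - c1)) = real n powr ((1 - c1) / 2)" by (simp add: powr_half_sqrt[symmetric] powr_powr)
        also have "(1 - c1) / 2 = - c1 / 2 + 1 / 2" by (simp add: field_simps)
        finally show ?thesis unfolding powr_add using n3 by (simp add: powr_half_sqrt)
      qed
      also have "sqrt C1 * (real n powr (- c1 / 2) * sqrt (real n)) \<le> h n * sqrt N"
        unfolding h_def using Nn constants by (simp add: mult.assoc mult_left_mono)
      finally show ?thesis .
    qed
    have h0: "h n > 0" unfolding h_def using constants n3 by simp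
    have ln1: "1 \<le> ln (real n)" using exp_le n3 by (simp add: ln_ge_iff)
    have lnN: "ln (real n) \<le> ln N" "ln N \<le> L n" unfolding L_def using Nn n3 N0 by auto
    have l0: "0 \<le> ln N" using ln1 lnN by linarith
    have mean: "integral {0..1} (psi n k) = 0" if k: "k \<in> {1..d n}" for k
    proof -
      have "integral {0..1} (psi n k) = integral {0..1} (\<lambda>z. psi n 0 z * psi n k z)"
        using psi0[OF n1] by (intro integral_cong) simp
      also have "\<dots> = 0" using psi_orthonormal[OF n1, of 0 k] k by simp
      finally show ?thesis .
    qed
    have var: "integral {0..1} (\<lambda>z. (psi n k z)\<^sup>2) = 1" if k: "k \<in> {1..d n}" for k
      using psi_orthonormal[OF n1, of k k] k by (simp add: power2_eq_square)
    have small: "20 * ln N ^ 4 * h n \<le> 1"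
    proof -
      have "20 * ln N ^ 4 * h n \<le> 20 * (L n) ^ 4 * h n" using lnN l0 h0 by (intro mult_right_mono mult_left_mono power_mono) auto
      then show ?thesis using sml by linarith
    qed
    have "\<bar>reject_prob (F n) (F n) n (m n) (p n) (d n) (psi n) \<alpha> - \<alpha>\<bar> \<le>
      288 * (1200 / sqrt c0 * (ln N)\<^sup>2 * h n + 80 / sqrt c0 * (ln N)\<^sup>2 * sqrt (h n) + 20 / ln N) + 72 / real n
      + 2526 * (C / c) * (ln N) ^ 12 * h n + 64512 * (ln N) ^ 8 * h n"
      unfolding N_def
    proof (rule reject_prob_error)
      show "(psi n k has_real_derivative psi1 n k z) (at z within {0..1})" if "k \<in> {1..d n}" "z \<in> {0..1}" for k z
        using psi_deriv1[OF n1] that by simp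
      show "d n \<le> n" using d_le[OF n1] by simp
      show "unit_law (two_point (real (m n) / real (n + m n))) C c" using ul1 unfolding N_def .
      show "sqrt (real (p n)) ^ 7 * B \<le> h n * sqrt (real (n + m n))" using hB unfolding N_def .
      show "20 * ln (real (n + m n)) ^ 4 * h n \<le> 1" using small unfolding N_def .
    qed (use n m_bounds[OF n1] c0 p_pos[OF n1] d_pos[OF n1] bd mean var cpos C0 ul2 \<alpha> in auto)
    also have "\<dots> \<le> g n"
      unfolding g_def using lnN l0 h0 ln1 c0 C0 cpos
      by (intro add_mono mult_left_mono mult_right_mono power_mono divide_left_mono mult_pos_pos order_refl) auto
    finally show ?thesis .
  qed
  show ?thesis
  proof (rule tendsto_sandwich[OF _ _ tendsto_const g0])
    show "eventually (\<lambda>n. 0 \<le> (SUP \<alpha>\<in>{0<..<1::real}. \<bar>reject_prob (F n) (F n) n (m n) (p n) (d n) (psi n) \<alpha> - \<alpha>\<bar>)) sequentially"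
      using ev
    proof eventually_elim
      case (elim n)
      \<comment> \<open>A supremum of reals carries information only over a bounded set;
        \<open>bnd\<close> supplies the bound for large n.\<close>
      have "bdd_above ((\<lambda>\<alpha>. \<bar>reject_prob (F n) (F n) n (m n) (p n) (d n) (psi n) \<alpha> - \<alpha>\<bar>) ` {0<..<1::real})"
        using bnd elim by (intro bdd_aboveI2[where M="g n"]) auto
      then show ?case by (rule cSUP_upper2[where x="1/2"]) auto
    qed
    show "eventually (\<lambda>n. (SUP \<alpha>\<in>{0<..<1::real}. \<bar>reject_prob (F n) (F n) n (m n) (p n) (d n) (psi n) \<alpha> - \<alpha>\<bar>) \<le> g n) sequentially"
      using ev by eventually_elim (rule cSUP_least, use bnd in auto)
  qed
qed

end
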